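(* Let $K$ be a number field of degree $n$ over $\mathbb{Q}$, let $B=\{\omega_1,\ldots,\omega_n\}$ be an integral basis for $K$, and let $\tau>1$ be a real number. Then the set $$E(K,B,\tau)=\{x\in\mathbb{R}^n : |x-r/q|\le |q|^{-(\tau+1)} \text{ for infinitely many } (q,r)\in\mathbb{Z}^n\times\mathbb{Z}^n \text{ with } q\neq 0\}$$ is a Salem set of dimension $2n/(1+\tau)$; that is, $\dim_F(E(K,B,\tau))=\dim_H(E(K,B,\tau))=2n/(1+\tau)$.
   Context: For $x\in\mathbb{R}^n$, $|x|=\max_{1\le i\le n}|x_i|$ is the max-norm. An integral basis of $K$ is a $\mathbb{Q}$-basis of $K$ that is also a $\mathbb{Z}$-basis of the ring of integers $\mathbb{Z}_K$. Using $B$, one identifies $q=(q_1,\ldots,q_n)\in\mathbb{Q}^n$ with $q=\sum_{i=1}^n q_i\omega_i\in K$; this identifies $\mathbb{Z}^n$ with $\mathbb{Z}_K$. For $q,r\in\mathbb{Z}^n$, $q\ne 0$, the quotient $r/q$ is computed in the field $K$ and then regarded as an element of $\mathbb{Q}^n\subseteq\mathbb{R}^n$; $|q|$ is the max-norm of the coordinate vector. For a finite Borel measure $\mu$ on $\mathbb{R}^n$, $\widehat{\mu}(\xi)=\int_{\mathbb{R}^n}e^{-2\pi i x\cdot\xi}\,d\mu(x)$. $\dim_H$ denotes Hausdorff dimension. The Fourier dimension $\dim_F(E)$ of a Borel set $E\subseteq\mathbb{R}^n$ is the supremum of those $s\in[0,n]$ for which there is a Borel probability measure $\mu$ supported on $E$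 (i.e. $\mu(\mathbb{R}^n\setminus E)=0$) with $|\widehat{\mu}(\xi)|^2|\xi|^{s}\to 0$ as $|\xi|\to\infty$. A set $E$ is a Salem set if $\dim_F(E)=\dim_H(E)$. *)

theory Defs
  imports "HOL-Analysis.Analysis" "HOL-Probability.Probability"
    "HOL-Computational_Algebra.Computational_Algebra"
begin

section \<open>Number fields and integral bases\<close>

interpretation rat_vs: vector_space "\<lambda>(c::rat) (x::'k::field_char_0). of_rat c * x"
  by unfold_locales (auto simp: algebra_simps of_rat_add of_rat_mult)

interpretation int_mod: module "\<lambda>(c::int) (x::'k::field_char_0). of_int c * x"
  by unfold_locales (auto simp: algebra_simps)

text \<open>A number field is a subfield of an arbitrary field of characteristic 0 (possibly the whole
  field, possibly the complex numbers) which has finite dimension over the rationals.\<close>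

definition subfield_of_type :: "'k::field set \<Rightarrow> bool" where
  "subfield_of_type K \<longleftrightarrow> 0 \<in> K \<and> 1 \<in> K \<and>
     (\<forall>x\<in>K. \<forall>y\<in>K. x + y \<in> K \<and> x * y \<in> K) \<and> (\<forall>x\<in>K. - x \<in> K \<and> inverse x \<in> K)"

definition number_field :: "'k::field_char_0 set \<Rightarrow> bool" where
  "number_field K \<longleftrightarrow> subfield_of_type K \<and> (\<exists>b. finite b \<and> rat_vs.span b = K)"

definition degree_over_rat :: "'k::field_char_0 set \<Rightarrow> nat" where
  "degree_over_rat K = rat_vs.dim K"

definition ring_of_integers :: "'k::field_char_0 set \<Rightarrow> 'k set" where
  "ring_of_integers K = {x \<in> K. algebraic_int x}"

definition integral_basis :: "'k::field_char_0 set \<Rightarrow> ('n::finite \<Rightarrow> 'k) \<Rightarrow> bool" where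
  "integral_basis K \<omega> \<longleftrightarrow> inj \<omega> \<and>
     rat_vs.independent (range \<omega>) \<and> rat_vs.span (range \<omega>) = K \<and>
     int_mod.independent (range \<omega>) \<and> int_mod.span (range \<omega>) = ring_of_integers K"

definition from_coords :: "('n::finite \<Rightarrow> 'k::field_char_0) \<Rightarrow> rat ^ 'n \<Rightarrow> 'k" where
  "from_coords \<omega> c = (\<Sum>i\<in>UNIV. of_rat (c $ i) * \<omega> i)"

definition to_coords :: "('n::finite \<Rightarrow> 'k::field_char_0) \<Rightarrow> 'k \<Rightarrow> rat ^ 'n" where
  "to_coords \<omega> x = (THE c. from_coords \<omega> c = x)"

definition int_to_rat_vec :: "int ^ 'n \<Rightarrow> rat ^ 'n::finite" where
  "int_to_rat_vec q = (\<chi> i. of_int (q $ i))"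

definition rat_to_real_vec :: "rat ^ 'n \<Rightarrow> real ^ 'n::finite" where
  "rat_to_real_vec c = (\<chi> i. of_rat (c $ i))"

definition quot_vec :: "('n::finite \<Rightarrow> 'k::field_char_0) \<Rightarrow> int ^ 'n \<Rightarrow> int ^ 'n \<Rightarrow> real ^ 'n" where
  "quot_vec \<omega> r q = rat_to_real_vec
     (to_coords \<omega> (from_coords \<omega> (int_to_rat_vec r) / from_coords \<omega> (int_to_rat_vec q)))"

text \<open>On \<open>real ^ 'n\<close> the library's \<^const>\<open>infnorm\<close> is the max-norm. The set depends on the
  number field only through its basis.\<close>

definition nf_approx_set :: "('n::finite \<Rightarrow> 'k::field_char_0) \<Rightarrow> real \<Rightarrow> (real ^ 'n) set" where
  "nf_approx_set \<omega> \<tau> = {x. infinite {(q :: int ^ 'n, r :: int ^ 'n). q \<noteq> 0 \<and>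
     infnorm (x - quot_vec \<omega> r q)
       \<le> infnorm (rat_to_real_vec (int_to_rat_vec q)) powr (- (\<tau> + 1))}}"


section \<open>Hausdorff dimension\<close>

text \<open>The case \<open>s = 0\<close> is separate because \<open>0 powr 0 = 0\<close>.\<close>

definition diam_powr :: "real \<Rightarrow> 'a::metric_space set \<Rightarrow> ennreal" where
  "diam_powr s U = (if U = {} then 0 else if s = 0 then 1 else ennreal (diameter U powr s))"

text \<open>Boundedness of the covering sets is required explicitly, as \<^const>\<open>diameter\<close> is
  meaningless on unbounded sets.\<close>

definition hausdorff_premeasure :: "real \<Rightarrow> real \<Rightarrow> 'a::metric_space set \<Rightarrow> ennreal" where
  "hausdorff_premeasure s \<delta> E =
     (INF U \<in> {U :: nat \<Rightarrow> 'a set. (\<forall>i. bounded (U i) \<and> diameter (U i) \<le> \<delta>) \<and> E \<subseteq> (\<Union>i. U i)}.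
        \<Sum>i. diam_powr s (U i))"

definition hausdorff_outer_measure :: "real \<Rightarrow> 'a::metric_space set \<Rightarrow> ennreal" where
  "hausdorff_outer_measure s E = (SUP \<delta> \<in> {0<..}. hausdorff_premeasure s \<delta> E)"

definition hausdorff_dim :: "'a::metric_space set \<Rightarrow> ennreal" where
  "hausdorff_dim E = (INF s \<in> {s. 0 \<le> s \<and> hausdorff_outer_measure s E = 0}. ennreal s)"


section \<open>Fourier dimension and Salem sets\<close>

definition fourier_transform :: "(real ^ 'n::finite) measure \<Rightarrow> real ^ 'n \<Rightarrow> complex" where
  "fourier_transform \<mu> \<xi> = (LINT x|\<mu>. exp (- 2 * of_real pi * \<i> * of_real (x \<bullet> \<xi>)))"

text \<open>Membership in \<^const>\<open>null_sets\<close> includes measurability of the complement; the bare equation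
  \<open>emeasure \<mu> (UNIV - E) = 0\<close> would hold trivially for non-measurable sets. The supremum over the
  empty set is 0.\<close>

definition fourier_dim :: "(real ^ 'n::finite) set \<Rightarrow> ennreal" where
  "fourier_dim E =
     (SUP s \<in> {s. 0 \<le> s \<and> s \<le> real CARD('n) \<and>
         (\<exists>\<mu>. prob_space \<mu> \<and> sets \<mu> = sets borel \<and> UNIV - E \<in> null_sets \<mu> \<and>
            ((\<lambda>\<xi>. (cmod (fourier_transform \<mu> \<xi>))\<^sup>2 * infnorm \<xi> powr s) \<longlongrightarrow> 0) at_infinity)}.
        ennreal s)"

definition salem_set :: "(real ^ 'n::finite) set \<Rightarrow> bool" where
  "salem_set E \<longleftrightarrow> fourier_dim E = hausdorff_dim E"

end

theory Submission
  imports Defs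
begin

text \<open>The upper bound on the Hausdorff dimension comes from covering by the balls around \<open>r / q\<close>:
  \<open>O(|q| ^ n)\<close> of them meet the unit cube, and \<open>\<Sum>q. |q| powr (n - s (\<tau> + 1))\<close> converges for
  \<open>s > 2 n / (1 + \<tau>)\<close>.

  For the lower bound on the Fourier dimension (Kaufman's method), average over about \<open>M ^ n\<close>
  denominators \<open>q\<close> of size about \<open>M\<close> a kernel concentrated near the points \<open>r / q\<close>, at scale
  slightly below \<open>M powr (- (\<tau> + 1))\<close>. The Fourier coefficient at \<open>m \<noteq> 0\<close> of this trigonometric
  polynomial \<open>F M\<close> is at most the proportion of those \<open>q\<close> for which \<open>y \<mapsto> m \<bullet> y\<close> is integral on the
  lattice of all \<open>r / q\<close>. By duality such \<open>q\<close> divide a fixed nonzero algebraic integer \<open>h m\<close>, so the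
  divisor bound for ideals makes the coefficient \<open>O(M powr (- n) |m| powr \<delta>)\<close>. Riesz-type products of the
  \<open>F M\<close> along a rapidly growing sequence of \<open>M\<close> therefore keep Fourier decay of every order
  \<open>a < n / (1 + \<tau>)\<close>, and a weak limit of them lives on the approximation set.

  Finally, decay of \<open>|\<mu>^ \<xi>|^2\<close> of order \<open>s\<close> bounds the \<open>t\<close>-energy of \<open>\<mu>\<close> for \<open>t < s\<close>, so Fourier
  dimension never exceeds Hausdorff dimension.\<close>

text \<open>The exponent comes from one balance. \<open>F M\<close> has frequencies up to a constant
  times \<open>M powr \<sigma>\<close>, with \<open>\<sigma>\<close> slightly above
  \<open>1 + \<tau>\<close>, and nonconstant coefficients of size \<open>M powr (- n)\<close> up to
  a small power of the frequency. Weighted by \<open>|m| powr a\<close> they still tend to 0 as soon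
  as \<open>a < n / (1 + \<tau>)\<close>, and squaring the transform doubles \<open>a\<close>. A
  trigonometric polynomial cannot vanish on an open set, so \<open>F M\<close> is not supported near
  the quotients; it is merely tiny elsewhere, and the set \<open>{F M > \<theta> M}\<close> with
  \<open>\<theta> M\<close> tending to 0 plays the part of the neighbourhood. In return every finite
  product is again a combination of finitely many characters, so that each new factor can be chosen
  against all earlier ones at once. On the algebraic side, elements of the ring of integers need not
  factor uniquely and may have infinitely many associates. Divisors are therefore counted as ideals,
  and the denominators are selected so that distinct ones generate distinct ideals.\<close>

no_notation fps_nth (infixl "$" 75)

section \<open>Algebraic integers\<close>

lemma of_int_poly_mult:
  "map_poly (of_int :: int \<Rightarrow> 'a::field_char_0) (p * q) = map_poly of_int p * map_poly of_int q"
  by (rule poly_eqI) (simp add: coeff_map_poly coeff_mult)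

lemma of_int_poly_diff:
  "map_poly (of_int :: int \<Rightarrow> 'a::field_char_0) (p - q) = map_poly of_int p - map_poly of_int q"
  by (rule poly_eqI) (simp add: coeff_map_poly)

text \<open>Fraction-free elimination: eliminating \<open>g m\<close> preserves the property that the
  diagonal entries are monic and dominate the off-diagonal ones in degree.\<close>

lemma algebraic_int_of_linear_system:
  fixes x :: "'a::field_char_0" and A :: "'i \<Rightarrow> 'i \<Rightarrow> int poly"
  assumes "finite I" and "i0 \<in> I" and "g i0 \<noteq> 0"
    and "\<And>i. i \<in> I \<Longrightarrow> lead_coeff (A i i) = 1 \<and> degree (A i i) = D"
    and "\<And>i j. i \<in> I \<Longrightarrow> j \<in> I \<Longrightarrow> i \<noteq> j \<Longrightarrow> degree (A i j) < D"
    and "\<And>i. i \<in> I \<Longrightarrow> (\<Sum>j\<in>I. poly (map_poly of_int (A i j)) x * g j) = 0"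
  shows "algebraic_int x"
  using assms
proof (induction I arbitrary: A D i0 rule: finite_induct)
  case empty
  then show ?case by simp
next
  case (insert m I)
  let ?e = "\<lambda>p. poly (map_poly of_int p) x"
  have e_mult: "?e (p * q) = ?e p * ?e q" and e_diff: "?e (p - q) = ?e p - ?e q" for p q
    by (simp_all add: of_int_poly_mult of_int_poly_diff)
  show ?case
  proof (cases "\<exists>i1\<in>I. g i1 \<noteq> 0")
    \<comment> \<open>If \<open>g m\<close> is the only nonzero entry, row \<open>m\<close> alone is
      a monic equation for \<open>x\<close>.\<close>
    case False
    then have "g m \<noteq> 0" "\<And>i. i \<in> I \<Longrightarrow> g i = 0" using insert.prems by auto
    with insert.prems(5)[of m] insert.hyps have "?e (A m m) = 0" by simp
    then show ?thesis using insert.prems(3)[of m]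
      unfolding algebraic_int_altdef_ipoly by auto
  next
    case True
    then obtain i1 where i1: "i1 \<in> I" "g i1 \<noteq> 0" by blast
    define A' where "A' i j = A m m * A i j - A i m * A m j" for i j
    have D: "0 < D" using insert.prems(4)[of i1 m] i1 insert.hyps by fastforce
    have dm: "lead_coeff (A m m) = 1" "degree (A m m) = D" using insert.prems(3) by auto
    have off: "degree (A i m * A m j) < 2 * D" if "i \<in> I" "j \<in> I" for i j
    proof -
      have "degree (A i m * A m j) \<le> degree (A i m) + degree (A m j)" by (rule degree_mult_le)
      also have "\<dots> < D + D" using insert.prems(4)[of i m] insert.prems(4)[of m j] that insert.hyps
        by (intro add_strict_mono) auto
      finally show ?thesis by simp
    qed
    show ?thesis
    proof (rule insert.IH[OF i1, of A' "2 * D"])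
      fix i assume i: "i \<in> I"
      have di: "lead_coeff (A i i) = 1" "degree (A i i) = D" using insert.prems(3) i by auto
      have nz: "A m m \<noteq> 0" "A i i \<noteq> 0" using dm di by auto
      have dd: "degree (A m m * A i i) = 2 * D" using nz dm di by (simp add: degree_mult_eq)
      have "coeff (A' i i) (2 * D) = coeff (A m m * A i i) (2 * D)"
        using off[OF i i] by (simp add: A'_def coeff_eq_0)
      also have "\<dots> = lead_coeff (A m m * A i i)" using dd by simp
      also have "\<dots> = 1" using dm di by (simp add: lead_coeff_mult)
      finally have c: "coeff (A' i i) (2 * D) = 1" .
      have "degree (A' i i) \<le> 2 * D" unfolding A'_def
        using off[OF i i] dd by (intro degree_diff_le) auto
      moreover have "2 * D \<le> degree (A' i i)" by (rule le_degree) (use c in auto)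
      ultimately show "lead_coeff (A' i i) = 1 \<and> degree (A' i i) = 2 * D" using c by auto
    next
      fix i j assume ij: "i \<in> I" "j \<in> I" "i \<noteq> j"
      have "degree (A m m * A i j) \<le> degree (A m m) + degree (A i j)" by (rule degree_mult_le)
      also have "\<dots> < 2 * D" using dm insert.prems(4)[of i j] ij by auto
      finally show "degree (A' i j) < 2 * D" unfolding A'_def
        using off[of i j] ij by (intro degree_diff_less) auto
    next
      fix i assume i: "i \<in> I"
      have eqi: "?e (A i m) * g m + (\<Sum>j\<in>I. ?e (A i j) * g j) = 0"
        using insert.prems(5)[of i] i insert.hyps by simp
      have eqm: "?e (A m m) * g m + (\<Sum>j\<in>I. ?e (A m j) * g j) = 0"
        using insert.prems(5)[of m] insert.hyps by simp
      have "(\<Sum>j\<in>I. ?e (A' i j) * g j) =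
          ?e (A m m) * (\<Sum>j\<in>I. ?e (A i j) * g j) - ?e (A i m) * (\<Sum>j\<in>I. ?e (A m j) * g j)"
        by (simp add: A'_def e_mult e_diff sum_distrib_left sum_subtractf algebra_simps)
      also have "\<dots> = ?e (A m m) * (- ?e (A i m) * g m) - ?e (A i m) * (- ?e (A m m) * g m)"
        using eqi eqm by (simp add: add_eq_0_iff)
      finally show "(\<Sum>j\<in>I. ?e (A' i j) * g j) = 0" by simp
    qed
  qed
qed

text \<open>The determinant trick: the polynomial matrix with entries \<open>X - a i i\<close> on
  the diagonal and \<open>- a i j\<close> off it, evaluated at \<open>x\<close>, kills the nonzero
  vector \<open>g\<close>. The diagonal has degree 1 and the rest degree 0, hence
  \<open>D = 1\<close>.\<close>

lemma algebraic_int_of_stable_module: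
  fixes x :: "'a::field_char_0" and a :: "'i \<Rightarrow> 'i \<Rightarrow> int"
  assumes "finite I" and "i0 \<in> I" and "g i0 \<noteq> 0"
    and eq: "\<And>i. i \<in> I \<Longrightarrow> x * g i = (\<Sum>j\<in>I. of_int (a i j) * g j)"
  shows "algebraic_int x"
proof (rule algebraic_int_of_linear_system[where g = g and D = 1 and
      A = "\<lambda>i j. (if i = j then [:- a i j, 1:] else [:- a i j:])", OF assms(1-3)])
  fix i assume i: "i \<in> I"
  have "(\<Sum>j\<in>I. poly (map_poly of_int (if i = j then [:- a i j, 1:] else [:- a i j:])) x * g j)
      = (\<Sum>j\<in>I. (if i = j then x * g j else 0) - of_int (a i j) * g j)"
    by (intro sum.cong) (auto simp: map_poly_pCons algebra_simps)
  also have "\<dots> = 0"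
    using i assms(1) by (simp add: sum_subtractf eq)
  finally show "(\<Sum>j\<in>I. poly (map_poly of_int (if i = j then [:- a i j, 1:] else [:- a i j:])) x * g j) = 0" .
qed auto

lemma algebraic_int_power_expand:
  fixes x :: "'a::field_char_0"
  assumes "algebraic_int x"
  obtains d a where "d > 0" "x ^ d = (\<Sum>i<d. of_int (a i) * x ^ i)"
proof -
  obtain p where p: "poly (map_poly of_int p) x = 0" "lead_coeff (p :: int poly) = 1"
    using assms unfolding algebraic_int_altdef_ipoly by auto
  have d0: "degree p \<noteq> 0"
  proof
    assume "degree p = 0"
    then obtain c where "p = [:c:]" by (meson degree_eq_zeroE)
    then show False using p by (simp add: map_poly_pCons split: if_splits)
  qed
  have "0 = (\<Sum>i\<le>degree p. of_int (coeff p i) * x ^ i)"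
    using p by (simp add: poly_altdef coeff_map_poly degree_map_poly)
  also have "\<dots> = x ^ degree p + (\<Sum>i<degree p. of_int (coeff p i) * x ^ i)"
    using p by (simp add: lessThan_Suc_atMost[symmetric])
  finally have "x ^ degree p = (\<Sum>i<degree p. of_int (- coeff p i) * x ^ i)"
    by (simp add: sum_negf eq_neg_iff_add_eq_0)
  then show thesis using that[of "degree p" "\<lambda>i. - coeff p i"] d0 by simp
qed

text \<open>The monomials \<open>x ^ i * y ^ j\<close> generate a finite module containing 1, so
  every multiplier that preserves it is integral. Both \<open>x * y\<close> and \<open>x + y\<close>
  will be such multipliers.\<close>

lemma algebraic_int_pair_system:
  fixes x y z :: "'a::field_char_0"
  assumes d: "d > 0" and e: "e > 0"
    and z: "\<And>i j. i < d \<Longrightarrow> j < e \<Longrightarrow> \<exists>c. z * (x ^ i * y ^ j) =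
      (\<Sum>k<d. \<Sum>l<e. of_int (c k l) * (x ^ k * y ^ l))"
  shows "algebraic_int z"
proof -
  let ?I = "{..<d} \<times> {..<e}"
  define c where "c i j = (SOME c. z * (x ^ i * y ^ j) =
      (\<Sum>k<d. \<Sum>l<e. of_int (c k l) * (x ^ k * y ^ l)))" for i j
  have c: "z * (x ^ i * y ^ j) = (\<Sum>k<d. \<Sum>l<e. of_int (c i j k l) * (x ^ k * y ^ l))"
    if "i < d" "j < e" for i j
    using someI_ex[OF z[OF that]] unfolding c_def .
  show ?thesis
  proof (rule algebraic_int_of_stable_module[of ?I "(0, 0)" "\<lambda>p. x ^ fst p * y ^ snd p" _
          "\<lambda>p q. c (fst p) (snd p) (fst q) (snd q)"])
    fix p assume "p \<in> ?I"
    then have "z * (x ^ fst p * y ^ snd p) =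
      (\<Sum>k<d. \<Sum>l<e. of_int (c (fst p) (snd p) k l) * (x ^ k * y ^ l))" by (intro c) auto
    also have "\<dots> = (\<Sum>q\<in>?I. of_int (c (fst p) (snd p) (fst q) (snd q)) * (x ^ fst q * y ^ snd q))"
      by (simp add: sum.cartesian_product case_prod_unfold)
    finally show "z * (x ^ fst p * y ^ snd p) =
      (\<Sum>q\<in>?I. of_int (c (fst p) (snd p) (fst q) (snd q)) * (x ^ fst q * y ^ snd q))" .
  qed (use d e in auto)
qed

lemma int_span_shift:
  fixes x :: "'a::field_char_0"
  assumes x: "x ^ d = (\<Sum>i<d. of_int (a i) * x ^ i)" "d > 0" and "i < d"
  shows "\<exists>c. x * x ^ i = (\<Sum>k<d. of_int (c k) * x ^ k)"
proof (cases "Suc i < d")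
  case True
  have "(\<Sum>k<d. of_int (if k = Suc i then 1 else 0) * x ^ k) = (\<Sum>k<d. if k = Suc i then x ^ k else 0)"
    by (intro sum.cong) auto
  also have "\<dots> = x * x ^ i" using True by simp
  finally show ?thesis by metis
next
  case False
  then have "Suc i = d" using assms by simp
  then have "x * x ^ i = x ^ d" by auto
  then show ?thesis using x by metis
qed

lemma
  fixes x y :: "'a::field_char_0"
  assumes "algebraic_int x" "algebraic_int y"
  shows algebraic_int_times: "algebraic_int (x * y)" and algebraic_int_plus: "algebraic_int (x + y)"
proof -
  obtain d a where d: "d > 0" and x: "x ^ d = (\<Sum>i<d. of_int (a i) * x ^ i)"
    using algebraic_int_power_expand[OF assms(1)] by blast
  obtain e b where e: "e > 0" and y: "y ^ e = (\<Sum>i<e. of_int (b i) * y ^ i)"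
    using algebraic_int_power_expand[OF assms(2)] by blast
  have "\<exists>c. \<forall>i<d. x * x ^ i = (\<Sum>k<d. of_int (c i k) * x ^ k)"
    using int_span_shift[OF x d] by metis
  then obtain p where p: "\<And>i. i < d \<Longrightarrow> x * x ^ i = (\<Sum>k<d. of_int (p i k) * x ^ k)" by blast
  have "\<exists>c. \<forall>i<e. y * y ^ i = (\<Sum>k<e. of_int (c i k) * y ^ k)"
    using int_span_shift[OF y e] by metis
  then obtain q where q: "\<And>i. i < e \<Longrightarrow> y * y ^ i = (\<Sum>k<e. of_int (q i k) * y ^ k)" by blast
  show "algebraic_int (x * y)"
  proof (rule algebraic_int_pair_system[OF d e, where x = x and y = y])
    fix i j assume ij: "i < d" "j < e"
    have "(x * y) * (x ^ i * y ^ j) = (x * x ^ i) * (y * y ^ j)" by (simp only: mult_ac)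
    also have "\<dots> = (\<Sum>k<d. \<Sum>l<e. of_int (p i k * q j l) * (x ^ k * y ^ l))"
      unfolding p[OF ij(1)] q[OF ij(2)] sum_product by (intro sum.cong refl) (simp add: mult_ac)
    finally show "\<exists>c. (x * y) * (x ^ i * y ^ j) = (\<Sum>k<d. \<Sum>l<e. of_int (c k l) * (x ^ k * y ^ l))"
      by (intro exI)
  qed
  show "algebraic_int (x + y)"
  proof (rule algebraic_int_pair_system[OF d e, where x = x and y = y])
    fix i j assume ij: "i < d" "j < e"
    \<comment> \<open>The power that is not shifted is also expanded, by a Kronecker delta, so that
      both summands become double sums over the same monomials.\<close>
    have 1: "x ^ i = (\<Sum>k<d. of_int (if k = i then 1 else 0) * x ^ k)"
      using ij by (simp add: if_distrib[where f = "\<lambda>t. of_int t * _"] cong: if_cong)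
    have 2: "y ^ j = (\<Sum>k<e. of_int (if k = j then 1 else 0) * y ^ k)"
      using ij by (simp add: if_distrib[where f = "\<lambda>t. of_int t * _"] cong: if_cong)
    have "(x + y) * (x ^ i * y ^ j) = (x * x ^ i) * y ^ j + x ^ i * (y * y ^ j)"
      by (simp only: distrib_right mult_ac)
    also have "\<dots> = (\<Sum>k<d. \<Sum>l<e. of_int (p i k) * x ^ k * (of_int (if l = j then 1 else 0) * y ^ l))
       + (\<Sum>k<d. \<Sum>l<e. of_int (if k = i then 1 else 0) * x ^ k * (of_int (q j l) * y ^ l))"
      unfolding p[OF ij(1)] q[OF ij(2)] by (subst 1, subst 2) (simp only: sum_product)
    also have "\<dots> = (\<Sum>k<d. \<Sum>l<e. of_int (p i k * (if l = j then 1 else 0)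
         + (if k = i then 1 else 0) * q j l) * (x ^ k * y ^ l))"
      unfolding sum.distrib[symmetric] by (intro sum.cong refl) (simp add: algebra_simps)
    finally show "\<exists>c. (x + y) * (x ^ i * y ^ j) = (\<Sum>k<d. \<Sum>l<e. of_int (c k l) * (x ^ k * y ^ l))"
      by (intro exI)
  qed
qed

section \<open>Ideals of an integrally closed order\<close>

text \<open>The last two assumptions make \<open>R\<close> a Dedekind domain with finite residue rings; \<open>x\<close> ranges over
  the ambient field, so no field of fractions is needed.\<close>

locale integrally_closed_order =
  fixes R :: "'a::field_char_0 set"
  assumes zero_in: "0 \<in> R" and one_in: "1 \<in> R"
    and add_in: "x \<in> R \<Longrightarrow> y \<in> R \<Longrightarrow> x + y \<in> R"
    and mult_in: "x \<in> R \<Longrightarrow> y \<in> R \<Longrightarrow> x * y \<in> R"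
    and uminus_in: "x \<in> R \<Longrightarrow> - x \<in> R"
    and finite_quot_principal: "a \<in> R \<Longrightarrow> a \<noteq> 0 \<Longrightarrow> finite ((\<lambda>x. {y \<in> R. y - x \<in> (*) a ` R}) ` R)"
    and integrally_closed: "\<lbrakk>N \<subseteq> R; \<exists>n\<in>N. n \<noteq> 0; \<And>m n. m \<in> N \<Longrightarrow> n \<in> N \<Longrightarrow> m + n \<in> N;
      \<And>r n. r \<in> R \<Longrightarrow> n \<in> N \<Longrightarrow> r * n \<in> N; \<And>n. n \<in> N \<Longrightarrow> x * n \<in> N\<rbrakk> \<Longrightarrow> x \<in> R"
begin

text \<open>Submodules of the ambient field rather than of \<open>R\<close>, so that products with
  \<open>invset P\<close>, which leaves \<open>R\<close>, are covered by the same calculus.\<close>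

definition submod :: "'a set \<Rightarrow> bool" where
  "submod N \<longleftrightarrow> 0 \<in> N \<and> (\<forall>x\<in>N. \<forall>y\<in>N. x + y \<in> N) \<and> (\<forall>r\<in>R. \<forall>x\<in>N. r * x \<in> N)"

definition prodset :: "'a set \<Rightarrow> 'a set \<Rightarrow> 'a set" where
  "prodset A B = submod hull {a * b |a b. a \<in> A \<and> b \<in> B}"

definition nzideal :: "'a set \<Rightarrow> bool" where
  "nzideal I \<longleftrightarrow> submod I \<and> I \<subseteq> R \<and> (\<exists>x\<in>I. x \<noteq> 0)"

definition maxideal :: "'a set \<Rightarrow> bool" where
  "maxideal P \<longleftrightarrow> nzideal P \<and> P \<noteq> R \<and> (\<forall>J. submod J \<longrightarrow> P \<subseteq> J \<longrightarrow> J \<subseteq> R \<longrightarrow> J = P \<or> J = R)"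

definition coset :: "'a set \<Rightarrow> 'a \<Rightarrow> 'a set" where
  "coset I x = {y \<in> R. y - x \<in> I}"

text \<open>The ideal norm, that is the order of \<open>R / I\<close>.\<close>

definition idx :: "'a set \<Rightarrow> nat" where
  "idx I = card (coset I ` R)"

section \<open>Submodules and their products\<close>

lemma submodD:
  assumes "submod N"
  shows "0 \<in> N" "x \<in> N \<Longrightarrow> y \<in> N \<Longrightarrow> x + y \<in> N" "r \<in> R \<Longrightarrow> x \<in> N \<Longrightarrow> r * x \<in> N"
    "x \<in> N \<Longrightarrow> - x \<in> N" "x \<in> N \<Longrightarrow> y \<in> N \<Longrightarrow> x - y \<in> N"
proof -
  show *: "0 \<in> N" "x \<in> N \<Longrightarrow> y \<in> N \<Longrightarrow> x + y \<in> N" "r \<in> R \<Longrightarrow> x \<in> N \<Longrightarrow> r * x \<in> N" for x y r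
    using assms unfolding submod_def by auto
  have n: "x \<in> N \<Longrightarrow> - x \<in> N" for x
    using *(3)[of "-1" x] uminus_in[OF one_in] by simp
  show "x \<in> N \<Longrightarrow> - x \<in> N" by (rule n)
  show "x \<in> N \<Longrightarrow> y \<in> N \<Longrightarrow> x - y \<in> N" using *(2)[of x "- y"] n[of y] by simp
qed

lemma submodI:
  assumes "0 \<in> N" "\<And>x y. x \<in> N \<Longrightarrow> y \<in> N \<Longrightarrow> x + y \<in> N" "\<And>r x. r \<in> R \<Longrightarrow> x \<in> N \<Longrightarrow> r * x \<in> N"
  shows "submod N"
  using assms unfolding submod_def by auto

lemma submod_R: "submod R"
  by (intro submodI zero_in add_in mult_in)

lemma nzideal_R: "nzideal R"
  unfolding nzideal_def using submod_R one_in by (auto intro: bexI[of _ 1])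

lemma submod_hull: "submod (submod hull X)"
  by (rule hull_in) (auto simp: submod_def)

lemma submod_prodset: "submod (prodset A B)"
  unfolding prodset_def by (rule submod_hull)

lemma in_prodset: "a \<in> A \<Longrightarrow> b \<in> B \<Longrightarrow> a * b \<in> prodset A B"
  unfolding prodset_def by (rule hull_inc) blast

lemma prodset_least: "submod N \<Longrightarrow> (\<And>a b. a \<in> A \<Longrightarrow> b \<in> B \<Longrightarrow> a * b \<in> N) \<Longrightarrow> prodset A B \<subseteq> N"
  unfolding prodset_def by (rule hull_minimal) auto

lemma prodset_comm: "prodset A B = prodset B A"
proof -
  have "{a * b |a b. a \<in> A \<and> b \<in> B} = {a * b |a b. a \<in> B \<and> b \<in> A}"
    by (metis (no_types, lifting) mult.commute)
  then show ?thesis unfolding prodset_def by simp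
qed

lemma submod_colon: "submod N \<Longrightarrow> submod {x. a * x \<in> N}"
  using submodD(1-3)[of N] by (intro submodI) (auto simp: distrib_left mult.left_commute[of a])

text \<open>For fixed \<open>a\<close> the elements that \<open>a\<close> multiplies into a
  submodule form a submodule again, so only the generators \<open>b * c\<close> have to be tested.
  The inclusion is proved for all \<open>A\<close> and \<open>B\<close>, and the converse is the
  same with the two exchanged. This law is what products over multisets rest on.\<close>

lemma prodset_left_commute: "prodset A (prodset B C) = prodset B (prodset A C)"
proof -
  have "prodset A (prodset B C) \<subseteq> prodset B (prodset A C)" for A B
  proof (rule prodset_least[OF submod_prodset])
    fix a x assume a: "a \<in> A" and x: "x \<in> prodset B C"
    have "prodset B C \<subseteq> {x. a * x \<in> prodset B (prodset A C)}"
    proof (rule prodset_least[OF submod_colon[OF submod_prodset]])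
      fix b c assume "b \<in> B" "c \<in> C"
      then have "b * (a * c) \<in> prodset B (prodset A C)" using a by (intro in_prodset)
      then show "b * c \<in> {x. a * x \<in> prodset B (prodset A C)}" by (simp add: mult.left_commute)
    qed
    then show "a * x \<in> prodset B (prodset A C)" using x by auto
  qed
  then show ?thesis by (intro equalityI)
qed

lemma prodset_assoc: "prodset (prodset A B) C = prodset A (prodset B C)"
proof -
  have "prodset (prodset A B) C = prodset C (prodset A B)" by (rule prodset_comm)
  also have "\<dots> = prodset A (prodset C B)" by (rule prodset_left_commute)
  also have "\<dots> = prodset A (prodset B C)" by (rule arg_cong[OF prodset_comm])
  finally show ?thesis .
qed

lemma prodset_R: "submod I \<Longrightarrow> prodset R I = I"
proof
  assume I: "submod I"
  show "prodset R I \<subseteq> I" using I by (intro prodset_least submodD(3)[OF I]) auto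
  show "I \<subseteq> prodset R I" using in_prodset[OF one_in] by fastforce
qed

lemma prodset_mono: "A \<subseteq> A' \<Longrightarrow> B \<subseteq> B' \<Longrightarrow> prodset A B \<subseteq> prodset A' B'"
  by (intro prodset_least submod_prodset in_prodset) auto

lemma prodset_subset_right: "submod J \<Longrightarrow> P \<subseteq> R \<Longrightarrow> prodset P J \<subseteq> J"
  using submodD(3)[of J] by (intro prodset_least) auto

lemma nzideal_prodset:
  assumes "nzideal I" "nzideal J" shows "nzideal (prodset I J)"
proof -
  obtain x y where "x \<in> I" "x \<noteq> 0" "y \<in> J" "y \<noteq> 0" using assms unfolding nzideal_def by blast
  then have "x * y \<in> prodset I J" "x * y \<noteq> 0" by (auto intro: in_prodset)
  moreover have "prodset I J \<subseteq> R"
    using prodset_subset_right[of J I] assms unfolding nzideal_def by blast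
  ultimately show ?thesis unfolding nzideal_def using submod_prodset by blast
qed

lemma nzideal_mono: "nzideal I \<Longrightarrow> submod J \<Longrightarrow> I \<subseteq> J \<Longrightarrow> J \<subseteq> R \<Longrightarrow> nzideal J"
  unfolding nzideal_def by blast

lemma mem_R: "nzideal I \<Longrightarrow> x \<in> I \<Longrightarrow> x \<in> R" and nz_submod: "nzideal I \<Longrightarrow> submod I"
  unfolding nzideal_def by auto

section \<open>Cosets, finite quotients and induction on overideals\<close>

lemma coset_eq_iff: "submod I \<Longrightarrow> x \<in> R \<Longrightarrow> y \<in> R \<Longrightarrow> coset I x = coset I y \<longleftrightarrow> x - y \<in> I"
proof
  assume I: "submod I" and R: "x \<in> R" "y \<in> R"
  { assume "coset I x = coset I y"
    moreover have "x \<in> coset I x" using R submodD[OF I] by (simp add: coset_def)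
    ultimately show "x - y \<in> I" by (simp add: coset_def) }
  { assume xy: "x - y \<in> I"
    have "z - x \<in> I \<longleftrightarrow> z - y \<in> I" for z
      using submodD(2)[OF I _ xy, of "z - x"] submodD(5)[OF I _ xy, of "z - y"] by auto
    then show "coset I x = coset I y" by (auto simp: coset_def) }
qed

text \<open>A nonzero \<open>a\<close> in \<open>I\<close> makes each coset of \<open>I\<close> a
  function of a coset of the principal ideal of \<open>a\<close>, and there are finitely many of
  those.\<close>

lemma finite_quot: assumes "nzideal I" shows "finite (coset I ` R)"
proof -
  obtain a where a: "a \<in> I" "a \<noteq> 0" using assms unfolding nzideal_def by blast
  have aR: "a \<in> R" using a mem_R assms by blast
  let ?c = "\<lambda>x. {y \<in> R. y - x \<in> (*) a ` R}"
  have I: "submod I" using assms nz_submod by blast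
  have sub: "(*) a ` R \<subseteq> I" using submodD(3)[OF I] a by (auto simp: mult.commute)
  have "coset I x = {y \<in> R. \<exists>z\<in>?c x. y - z \<in> I}" if "x \<in> R" for x
  proof (intro set_eqI iffI)
    fix y assume "y \<in> coset I x"
    moreover have "x \<in> ?c x" using that zero_in by (auto intro!: image_eqI[of _ _ 0])
    ultimately show "y \<in> {y \<in> R. \<exists>z\<in>?c x. y - z \<in> I}" unfolding coset_def by blast
  next
    fix y assume "y \<in> {y \<in> R. \<exists>z\<in>?c x. y - z \<in> I}"
    then obtain z where z: "y \<in> R" "y - z \<in> I" "z - x \<in> I" using sub by blast
    then have "(y - z) + (z - x) \<in> I" using submodD(2)[OF I] by blast
    then show "y \<in> coset I x" using z by (simp add: coset_def)
  qed
  then have "coset I ` R = (\<lambda>X. {y \<in> R. \<exists>z\<in>X. y - z \<in> I}) ` (?c ` R)"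
    by (auto simp: image_image)
  then show ?thesis using finite_quot_principal[OF aR a(2)] by simp
qed

text \<open>An ideal above \<open>I\<close> is a union of cosets of \<open>I\<close>, hence
  determined by a subset of the finite quotient.\<close>

lemma finite_overideals: assumes "nzideal I" shows "finite {J. nzideal J \<and> I \<subseteq> J}"
proof (rule inj_on_finite)
  have I: "submod I" using assms nz_submod by blast
  show "inj_on (\<lambda>J. coset I ` J) {J. nzideal J \<and> I \<subseteq> J}"
  proof (rule inj_onI)
    have *: "J \<subseteq> J'" if J: "nzideal J" "I \<subseteq> J" "nzideal J'" "I \<subseteq> J'" "coset I ` J = coset I ` J'" for J J'
    proof
      fix x assume x: "x \<in> J"
      then obtain y where y: "y \<in> J'" "coset I x = coset I y" using J(5) by blast
      then have "x - y \<in> I" using coset_eq_iff[OF I, of x y] mem_R[OF J(1) x] mem_R[OF J(3) y(1)] by simp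
      then have "x - y \<in> J'" using J(4) by auto
      then have "(x - y) + y \<in> J'" using submodD(2)[OF nz_submod[OF J(3)]] y by blast
      then show "x \<in> J'" by simp
    qed
    fix J J' assume "J \<in> {J. nzideal J \<and> I \<subseteq> J}" "J' \<in> {J. nzideal J \<and> I \<subseteq> J}" "coset I ` J = coset I ` J'"
    then show "J = J'" using *[of J J'] *[of J' J] by auto
  qed
  show "(\<lambda>J. coset I ` J) ` {J. nzideal J \<and> I \<subseteq> J} \<subseteq> Pow (coset I ` R)"
    using mem_R by blast
  show "finite (Pow (coset I ` R))" using finite_quot[OF assms] by simp
qed

lemma overideals_psubset:
  "nzideal I \<Longrightarrow> nzideal J \<Longrightarrow> I \<subset> J \<Longrightarrow>
    card {N. nzideal N \<and> J \<subseteq> N} < card {N. nzideal N \<and> I \<subseteq> N}"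
  by (rule psubset_card_mono[OF finite_overideals]) auto

text \<open>This plays the part of Noetherian induction; the measure is the finite number of ideals
  above \<open>I\<close>.\<close>

lemma overideal_induct [consumes 1, case_names less]:
  assumes "nzideal I" "\<And>I. nzideal I \<Longrightarrow> (\<And>J. nzideal J \<Longrightarrow> I \<subset> J \<Longrightarrow> Q J) \<Longrightarrow> Q I"
  shows "Q I"
  using assms(1)
proof (induction "card {N. nzideal N \<and> I \<subseteq> N}" arbitrary: I rule: less_induct)
  case less
  show ?case by (rule assms(2)[OF less.prems]) (use less overideals_psubset in blast)
qed

lemma submod_sum: assumes "submod I" "submod J" shows "submod {x + y |x y. x \<in> I \<and> y \<in> J}"
proof (rule submodI)
  show "0 \<in> {x + y |x y. x \<in> I \<and> y \<in> J}" using assms submodD(1) by force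
next
  fix x y assume "x \<in> {x + y |x y. x \<in> I \<and> y \<in> J}" "y \<in> {x + y |x y. x \<in> I \<and> y \<in> J}"
  then obtain a b c d where "x = a + b" "y = c + d" "a \<in> I" "c \<in> I" "b \<in> J" "d \<in> J" by blast
  moreover from this have "a + c \<in> I" "b + d \<in> J" using submodD(2) assms by blast+
  ultimately show "x + y \<in> {x + y |x y. x \<in> I \<and> y \<in> J}"
    by (intro CollectI exI[of _ "a + c"] exI[of _ "b + d"]) simp
next
  fix r x assume "r \<in> R" "x \<in> {x + y |x y. x \<in> I \<and> y \<in> J}"
  then obtain a b where "x = a + b" "a \<in> I" "b \<in> J" by blast
  moreover from this have "r * a \<in> I" "r * b \<in> J" using submodD(3) assms \<open>r \<in> R\<close> by blast+
  ultimately show "r * x \<in> {x + y |x y. x \<in> I \<and> y \<in> J}" by (auto simp: distrib_left)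
qed

lemma submod_principal: "submod ((*) a ` R)"
proof (rule submodI)
  show "0 \<in> (*) a ` R" using zero_in by (auto intro!: image_eqI[of _ _ 0])
  show "x + y \<in> (*) a ` R" if "x \<in> (*) a ` R" "y \<in> (*) a ` R" for x y
  proof -
    obtain r s where "x = a * r" "y = a * s" "r \<in> R" "s \<in> R" using \<open>x \<in> _\<close> \<open>y \<in> _\<close> by auto
    then show ?thesis by (intro image_eqI[of _ _ "r + s"]) (auto simp: distrib_left add_in)
  qed
  show "r * x \<in> (*) a ` R" if "r \<in> R" "x \<in> (*) a ` R" for r x
  proof -
    obtain s where "x = a * s" "s \<in> R" using \<open>x \<in> _\<close> by auto
    then show ?thesis using \<open>r \<in> R\<close> by (intro image_eqI[of _ _ "r * s"]) (auto simp: mult_in)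
  qed
qed

section \<open>Maximal ideals and their products\<close>

lemma maxideal_comax:
  assumes P: "maxideal P" and J: "submod J" "J \<subseteq> R" "\<not> J \<subseteq> P"
  obtains p j where "p \<in> P" "j \<in> J" "p + j = 1"
proof -
  have sP: "submod P" "P \<subseteq> R" using P unfolding maxideal_def nzideal_def by auto
  let ?S = "{x + y |x y. x \<in> P \<and> y \<in> J}"
  have "P \<subseteq> ?S" using submodD(1)[OF J(1)] by force
  moreover have JS: "J \<subseteq> ?S" using submodD(1)[OF sP(1)] by force
  moreover have "?S \<subseteq> R" using sP(2) J(2) by (auto intro!: add_in)
  ultimately have "?S = P \<or> ?S = R"
    using P submod_sum[OF sP(1) J(1)] unfolding maxideal_def by blast
  then have "1 \<in> ?S" using JS J(3) one_in by blast
  then show thesis using that by auto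
qed

text \<open>If \<open>A\<close> is not inside \<open>P\<close>, then \<open>p + a = 1\<close> for
  some \<open>p\<close> and \<open>a\<close>, and every \<open>b\<close> in \<open>B\<close> equals
  \<open>b * p + a * b\<close>, whose two terms lie in \<open>P\<close>.\<close>

lemma maxideal_prime:
  assumes P: "maxideal P" and AB: "submod A" "A \<subseteq> R" "B \<subseteq> R" "prodset A B \<subseteq> P"
  shows "A \<subseteq> P \<or> B \<subseteq> P"
proof (rule disjCI)
  assume B: "\<not> B \<subseteq> P"
  show "A \<subseteq> P"
  proof (rule ccontr)
    assume A: "\<not> A \<subseteq> P"
    obtain p a where pa: "p \<in> P" "a \<in> A" "p + a = 1" using maxideal_comax[OF P AB(1,2) A] by blast
    have sP: "submod P" using P unfolding maxideal_def nzideal_def by auto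
    have "b \<in> P" if "b \<in> B" for b
    proof -
      have "a * b \<in> P" using in_prodset[of a A b B] pa that AB(4) by blast
      moreover have "b * p \<in> P" using submodD(3)[OF sP] pa that AB(3) by blast
      ultimately have "b * p + a * b \<in> P" using submodD(2)[OF sP] by blast
      moreover have "b * p + a * b = b * (p + a)" by (simp add: algebra_simps)
      ultimately show ?thesis using pa by simp
    qed
    then show False using B by blast
  qed
qed

lemma ex_maxideal: assumes "nzideal I" "I \<noteq> R" obtains P where "maxideal P" "I \<subseteq> P"
proof -
  let ?S = "{J. nzideal J \<and> I \<subseteq> J} - {R}"
  have "finite ?S" using finite_overideals[OF assms(1)] by simp
  moreover have "I \<in> ?S" using assms by auto
  ultimately obtain P where P: "P \<in> ?S" "I \<subseteq> P" "\<And>J. J \<in> ?S \<Longrightarrow> P \<subseteq> J \<Longrightarrow> P = J"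
    by (rule finite_has_maximal2[THEN bexE, of ?S I]) (auto dest: sym)
  have "maxideal P" unfolding maxideal_def
  proof (intro conjI allI impI)
    show "nzideal P" "P \<noteq> R" using P(1) by auto
    fix J assume J: "submod J" "P \<subseteq> J" "J \<subseteq> R"
    then have "nzideal J" using nzideal_mono[of P J] P(1) by auto
    then show "J = P \<or> J = R" using P(3)[of J] J P(2) by auto
  qed
  then show thesis using that P(2) by auto
qed

sublocale prodset_commute: comp_fun_commute prodset
  by unfold_locales (auto simp: fun_eq_iff prodset_left_commute)

definition prodm :: "'a set multiset \<Rightarrow> 'a set" where
  "prodm M = fold_mset prodset R M"

lemma prodm_empty [simp]: "prodm {#} = R"
  by (simp add: prodm_def)

lemma prodm_add [simp]: "prodm (add_mset P M) = prodset P (prodm M)"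
  by (simp add: prodm_def)

lemma submod_prodm: "submod (prodm M)"
  by (cases M) (auto simp: submod_R submod_prodset)

lemma prodm_union: "prodm (M + N) = prodset (prodm M) (prodm N)"
  by (induction M) (auto simp: prodset_R submod_prodm prodset_assoc)

lemma nzideal_prodm: "(\<And>P. P \<in># M \<Longrightarrow> maxideal P) \<Longrightarrow> nzideal (prodm M)"
  by (induction M) (auto simp: nzideal_R maxideal_def intro!: nzideal_prodset)

text \<open>By primality some factor lies in \<open>P\<close>, and an inclusion between maximal
  ideals is an equality.\<close>

lemma maxideal_prodm:
  assumes "maxideal P" "\<And>Q. Q \<in># M \<Longrightarrow> maxideal Q" "prodm M \<subseteq> P"
  shows "P \<in># M"
  using assms(2,3)
proof (induction M)
  case empty
  then show ?case using assms(1) unfolding maxideal_def nzideal_def by auto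
next
  case (add Q M)
  have Q: "submod Q" "Q \<subseteq> R" "maxideal Q" using add.prems(1)[of Q] unfolding maxideal_def nzideal_def by auto
  have "prodm M \<subseteq> R" using nzideal_prodm add.prems(1) unfolding nzideal_def by simp
  then have "Q \<subseteq> P \<or> prodm M \<subseteq> P"
    using maxideal_prime[OF assms(1) Q(1,2)] add.prems(2) by simp
  then show ?case
  proof
    assume "Q \<subseteq> P"
    then have "P = Q" using Q(3) assms(1) unfolding maxideal_def nzideal_def by blast
    then show ?thesis by simp
  qed (use add in auto)
qed

text \<open>If \<open>I\<close> is not maximal and \<open>a \<in> J - I\<close>, then \<open>I + aR\<close> and \<open>(I : a)\<close> are both strictly
  larger than \<open>I\<close>: otherwise \<open>a\<close> would act injectively, hence surjectively, on the finite
  quotient \<open>R / I\<close>.\<close>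

lemma prodm_subset_ideal:
  assumes "nzideal I" shows "\<exists>M. (\<forall>P\<in>#M. maxideal P) \<and> prodm M \<subseteq> I"
  using assms
proof (induction rule: overideal_induct)
  case (less I)
  have I: "submod I" "I \<subseteq> R" using less.hyps unfolding nzideal_def by auto
  show ?case
  proof (cases "I = R \<or> maxideal I")
    case True
    then show ?thesis
    proof
      assume "I = R" then show ?thesis by (intro exI[of _ "{#}"]) auto
    next
      assume "maxideal I"
      then show ?thesis using prodset_R[OF I(1)] prodset_comm[of I R] by (intro exI[of _ "{#I#}"]) auto
    qed
  next
    case False
    then obtain J where J: "submod J" "I \<subseteq> J" "J \<subseteq> R" "J \<noteq> I" "J \<noteq> R"
      using less.hyps unfolding maxideal_def by auto
    then obtain a where a: "a \<in> J" "a \<notin> I" by blast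
    have aR: "a \<in> R" using a J by blast
    define A where "A = {x + y |x y. x \<in> I \<and> y \<in> (*) a ` R}"
    define B where "B = {r \<in> R. a * r \<in> I}"
    have saR: "submod ((*) a ` R)" by (rule submod_principal)
    have sA: "submod A" unfolding A_def by (rule submod_sum[OF I(1) saR])
    have AJ: "A \<subseteq> J" unfolding A_def
      using J a submodD(2,3)[OF J(1)] by (auto simp: mult.commute[of a] intro!: submodD(2)[OF J(1)])
    have IA: "I \<subseteq> A" unfolding A_def using submodD(1)[OF saR] by force
    have aA: "a \<in> A" unfolding A_def using submodD(1)[OF I(1)] one_in by (force intro: image_eqI[of _ _ 1])
    have nA: "nzideal A" using nzideal_mono[OF less.hyps sA IA] AJ J by blast
    have IA': "I \<subset> A" using IA aA a by blast
    have sB: "submod B" unfolding B_def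
      using submodD[OF I(1)] zero_in add_in mult_in
      by (intro submodI) (auto simp: distrib_left mult.left_commute[of a])
    have IB: "I \<subseteq> B" unfolding B_def using I aR submodD(3)[OF I(1) aR] by blast
    have nB: "nzideal B" using nzideal_mono[OF less.hyps sB IB] unfolding B_def by blast
    have IB': "I \<noteq> B"
    proof
      assume eq: "I = B"
      \<comment> \<open>Multiplication by \<open>a\<close> on the quotient \<open>R / I\<close>,
        through chosen representatives.\<close>
      define f where "f X = coset I (a * (SOME x. x \<in> R \<and> X = coset I x))" for X
      have f: "f (coset I x) = coset I (a * x)" if "x \<in> R" for x
      proof -
        let ?y = "SOME y. y \<in> R \<and> coset I x = coset I y"
        have y: "?y \<in> R \<and> coset I x = coset I ?y" by (rule someI[of _ x]) (use that in auto)
        then have "x - ?y \<in> I" using coset_eq_iff[OF I(1)] that by blast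
        then have "a * (x - ?y) \<in> I" using submodD(3)[OF I(1) aR] by blast
        then have "a * x - a * ?y \<in> I" by (simp add: right_diff_distrib)
        then show ?thesis unfolding f_def
          using coset_eq_iff[OF I(1), of "a * x" "a * ?y"] y that aR mult_in by auto
      qed
      have "inj_on f (coset I ` R)"
      proof (rule inj_onI)
        fix X Y assume "X \<in> coset I ` R" "Y \<in> coset I ` R" and ff: "f X = f Y"
        then obtain x y where xy: "X = coset I x" "Y = coset I y" "x \<in> R" "y \<in> R" by blast
        then have "a * x - a * y \<in> I" using ff coset_eq_iff[OF I(1)] aR mult_in f by auto
        moreover have "x - y \<in> R" using xy submodD(5)[OF submod_R] by blast
        ultimately have "x - y \<in> B" unfolding B_def by (simp add: right_diff_distrib)
        then show "X = Y" using xy eq coset_eq_iff[OF I(1)] by simp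
      qed
      moreover have "f ` (coset I ` R) \<subseteq> coset I ` R" using f aR mult_in by auto
      ultimately have "f ` (coset I ` R) = coset I ` R"
        using endo_inj_surj[OF finite_quot[OF less.hyps]] by simp
      \<comment> \<open>Surjectivity inverts \<open>a\<close> modulo \<open>I\<close>; as
        \<open>a\<close> and \<open>I\<close> both lie in \<open>J\<close>, this puts 1 into
        \<open>J\<close>.\<close>
      then have "coset I 1 \<in> f ` (coset I ` R)" using one_in by auto
      then obtain x where "x \<in> R" "coset I 1 = f (coset I x)" by auto
      then have x: "x \<in> R" "coset I 1 = coset I (a * x)" using f by auto
      then have "1 - a * x \<in> I" using coset_eq_iff[OF I(1)] one_in aR mult_in by auto
      then have "(1 - a * x) + x * a \<in> J" using J a x by (intro submodD(2,3)[OF J(1)]) auto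
      then have "1 \<in> J" by (simp add: mult.commute)
      then have "r \<in> J" if "r \<in> R" for r using submodD(3)[OF J(1) that] by fastforce
      then show False using J by blast
    qed
    obtain M where M: "\<forall>P\<in>#M. maxideal P" "prodm M \<subseteq> A" using less.IH[OF nA IA'] by blast
    obtain N where N: "\<forall>P\<in>#N. maxideal P" "prodm N \<subseteq> B" using less.IH[OF nB] IB IB' by blast
    have "prodset A B \<subseteq> I"
    proof (rule prodset_least[OF I(1)])
      fix x y assume x: "x \<in> A" and y: "y \<in> B"
      then obtain i r where ir: "x = i + a * r" "i \<in> I" "r \<in> R" unfolding A_def by blast
      have "y * i \<in> I" "r * (a * y) \<in> I" using submodD(3)[OF I(1)] y ir unfolding B_def by auto
      then have "y * i + r * (a * y) \<in> I" using submodD(2)[OF I(1)] by blast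
      then show "x * y \<in> I" using ir by (simp add: algebra_simps)
    qed
    then have "prodm (M + N) \<subseteq> I" using prodset_mono[OF M(2) N(2)] by (simp add: prodm_union)
    then show ?thesis using M N by (intro exI[of _ "M + N"]) auto
  qed
qed

text \<open>For a nonzero \<open>c\<close> in \<open>P\<close>, take a shortest product of maximal
  ideals inside the principal ideal of \<open>c\<close>. Then \<open>P\<close> is one of the
  factors, and without it the product is no longer contained in that ideal. An element
  \<open>b\<close> witnessing this satisfies \<open>b * p\<close> in the ideal of \<open>c\<close>
  for every \<open>p\<close> in \<open>P\<close>, so \<open>b / c\<close> has the required
  properties.\<close>

lemma maxideal_inverse_proper:
  assumes P: "maxideal P" obtains x where "x \<notin> R" "\<And>p. p \<in> P \<Longrightarrow> x * p \<in> R"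
proof -
  have nP: "nzideal P" using P unfolding maxideal_def by blast
  obtain c where c: "c \<in> P" "c \<noteq> 0" using nP unfolding nzideal_def by blast
  have cR: "c \<in> R" using c nP mem_R by blast
  define I where "I = (*) c ` R"
  have sI: "submod I" unfolding I_def by (rule submod_principal)
  have nI: "nzideal I" unfolding nzideal_def
    using sI c cR mult_in one_in unfolding I_def by (auto intro!: bexI[of _ 1])
  have IP: "I \<subseteq> P" unfolding I_def using submodD(3)[OF nz_submod[OF nP]] c by (auto simp: mult.commute[of c])
  let ?Q = "\<lambda>M. (\<forall>P\<in>#M. maxideal P) \<and> prodm M \<subseteq> I"
  obtain M0 where "?Q M0" using prodm_subset_ideal[OF nI] by auto
  then have "?Q (arg_min size ?Q)" and least: "\<And>N. ?Q N \<Longrightarrow> size (arg_min size ?Q) \<le> size N"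
    using arg_min_natI[of ?Q M0 size] arg_min_nat_le[of ?Q _ size] by blast+
  then obtain M where M: "?Q M" "\<And>N. size N < size M \<Longrightarrow> \<not> ?Q N" using leD by blast
  have "P \<in># M" using maxideal_prodm[OF P] M(1) IP by blast
  then obtain N where N: "M = add_mset P N" by (meson multi_member_split)
  then have "\<not> prodm N \<subseteq> I" using M(2)[of N] M(1) by auto
  then obtain b where b: "b \<in> prodm N" "b \<notin> I" by blast
  show thesis
  proof (rule that[of "b / c"])
    show "b / c \<notin> R"
    proof
      assume "b / c \<in> R"
      then have "c * (b / c) \<in> I" unfolding I_def by blast
      then show False using b c by simp
    qed
    fix p assume "p \<in> P"
    then have "p * b \<in> I" using in_prodset[of p P b "prodm N"] b M(1) N by auto
    then obtain r where "r \<in> R" "p * b = c * r" unfolding I_def by blast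
    then show "b / c * p \<in> R" using c by (simp add: mult.commute)
  qed
qed

section \<open>Inverses of maximal ideals and factorization\<close>

definition invset :: "'a set \<Rightarrow> 'a set" where
  "invset P = {x. \<forall>p\<in>P. x * p \<in> R}"

lemma stable_nzideal: "nzideal N \<Longrightarrow> (\<And>n. n \<in> N \<Longrightarrow> x * n \<in> N) \<Longrightarrow> x \<in> R"
  using integrally_closed[of N x] submodD(2,3)[of N] unfolding nzideal_def by blast

text \<open>The product lies between \<open>P\<close> and \<open>R\<close>. Were it equal to
  \<open>P\<close>, an element of \<open>invset P\<close> outside \<open>R\<close> would map the
  nonzero ideal \<open>P\<close> into itself, against integral closedness.\<close>

lemma prodset_invset: assumes P: "maxideal P" shows "prodset P (invset P) = R"
proof -
  have nP: "nzideal P" using P unfolding maxideal_def by blast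
  have sub: "prodset P (invset P) \<subseteq> R"
    by (rule prodset_least[OF submod_R]) (auto simp: invset_def mult.commute)
  have one: "1 \<in> invset P" using mem_R[OF nP] unfolding invset_def by auto
  have "P \<subseteq> prodset P (invset P)" using in_prodset[OF _ one, of _ P] by fastforce
  then have "prodset P (invset P) = P \<or> prodset P (invset P) = R"
    using P sub submod_prodset unfolding maxideal_def by blast
  moreover have "prodset P (invset P) \<noteq> P"
  proof
    assume eq: "prodset P (invset P) = P"
    obtain x where x: "x \<notin> R" "\<And>p. p \<in> P \<Longrightarrow> x * p \<in> R" using maxideal_inverse_proper[OF P] by blast
    then have "x \<in> invset P" unfolding invset_def by auto
    then have "x * p \<in> P" if "p \<in> P" for p using in_prodset[OF that, of x "invset P"] eq by (simp add: mult.commute)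
    then show False using stable_nzideal[OF nP] x by blast
  qed
  ultimately show ?thesis by blast
qed

lemma invset_cancel: "maxideal P \<Longrightarrow> submod X \<Longrightarrow> prodset (invset P) (prodset P X) = X"
  using prodset_assoc[of P "invset P" X] prodset_left_commute[of "invset P" P X]
    prodset_invset[of P] prodset_R[of X] by simp

text \<open>\<open>J\<close> is the quotient of \<open>I\<close> by \<open>P\<close>. It is strictly
  larger than \<open>I\<close>, since otherwise an element of \<open>invset P\<close> outside
  \<open>R\<close> would stabilise \<open>I\<close>. The strict growth drives the induction that
  yields the factorization.\<close>

lemma maxideal_divides:
  assumes P: "maxideal P" and I: "nzideal I" "I \<subseteq> P"
  obtains J where "nzideal J" "I \<subset> J" "prodset P J = I"
proof -
  define J where "J = prodset (invset P) I"
  have nP: "nzideal P" using P unfolding maxideal_def by blast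
  have sI: "submod I" using I nz_submod by blast
  have one: "1 \<in> invset P" using mem_R[OF nP] unfolding invset_def by auto
  have IJ: "I \<subseteq> J" unfolding J_def using in_prodset[OF one] by fastforce
  have JR: "J \<subseteq> R" unfolding J_def
    by (rule prodset_least[OF submod_R]) (use I in \<open>auto simp: invset_def\<close>)
  have nJ: "nzideal J" using nzideal_mono[OF I(1) _ IJ JR] submod_prodset unfolding J_def by blast
  have PJ: "prodset P J = I"
    unfolding J_def prodset_assoc[symmetric] prodset_invset[OF P] by (rule prodset_R[OF sI])
  have "I \<noteq> J"
  proof
    assume eq: "I = J"
    obtain x where x: "x \<notin> R" "\<And>p. p \<in> P \<Longrightarrow> x * p \<in> R" using maxideal_inverse_proper[OF P] by blast
    then have "x \<in> invset P" unfolding invset_def by auto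
    then have "x * n \<in> I" if "n \<in> I" for n
      using in_prodset[OF _ that, of x "invset P"] unfolding J_def[symmetric] eq[symmetric] by blast
    then show False using stable_nzideal[OF I(1)] x by blast
  qed
  then show thesis using that[OF nJ _ PJ] IJ by blast
qed

lemma ideal_factorization:
  assumes "nzideal I" shows "\<exists>M. (\<forall>P\<in>#M. maxideal P) \<and> I = prodm M"
  using assms
proof (induction rule: overideal_induct)
  case (less I)
  show ?case
  proof (cases "I = R")
    case True then show ?thesis by (intro exI[of _ "{#}"]) auto
  next
    case False
    then obtain P where P: "maxideal P" "I \<subseteq> P" using ex_maxideal[OF less.hyps] by blast
    then obtain J where J: "nzideal J" "I \<subset> J" "prodset P J = I" using maxideal_divides[OF P(1) less.hyps] by blast
    then obtain M where "\<forall>P\<in>#M. maxideal P" "J = prodm M" using less.IH by blast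
    then show ?thesis using P J by (intro exI[of _ "add_mset P M"]) auto
  qed
qed

text \<open>To contain is to divide. If \<open>J\<close> lies in the factor \<open>P\<close>, then
  \<open>P\<close> is cancelled from both sides. Otherwise \<open>p + j = 1\<close>, and
  \<open>x = p * x + x * j\<close> shows that \<open>J\<close> already contains the product without
  \<open>P\<close>.\<close>

lemma overideal_submultiset:
  assumes "\<And>P. P \<in># M \<Longrightarrow> maxideal P" "nzideal J" "prodm M \<subseteq> J"
  shows "\<exists>N. N \<subseteq># M \<and> J = prodm N"
  using assms
proof (induction M arbitrary: J)
  case empty
  then show ?case unfolding nzideal_def by auto
next
  case (add P M)
  have P: "maxideal P" using add.prems by simp
  have sJ: "submod J" "J \<subseteq> R" using add.prems unfolding nzideal_def by auto
  show ?case
  proof (cases "J \<subseteq> P")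
    case True
    then obtain J' where J': "nzideal J'" "J \<subset> J'" "prodset P J' = J"
      using maxideal_divides[OF P add.prems(2)] by blast
    have "prodset (invset P) (prodset P (prodm M)) \<subseteq> prodset (invset P) (prodset P J')"
      by (rule prodset_mono[OF order_refl]) (use add.prems(3) J'(3) in auto)
    then have "prodm M \<subseteq> J'"
      using invset_cancel[OF P submod_prodm] invset_cancel[OF P nz_submod[OF J'(1)]] by simp
    then obtain N where "N \<subseteq># M" "J' = prodm N" using add.IH[OF _ J'(1)] add.prems(1) by auto
    then show ?thesis using J' by (intro exI[of _ "add_mset P N"]) auto
  next
    case False
    obtain p j where pj: "p \<in> P" "j \<in> J" "p + j = 1" using maxideal_comax[OF P sJ False] by blast
    have "prodm M \<subseteq> J"
    proof
      fix x assume x: "x \<in> prodm M"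
      then have xR: "x \<in> R" using nzideal_prodm[of M] add.prems(1) mem_R by auto
      have "p * x \<in> J" using in_prodset[OF pj(1) x] add.prems(3) by auto
      moreover have "x * j \<in> J" using submodD(3)[OF sJ(1) xR pj(2)] .
      ultimately have "p * x + x * j \<in> J" using submodD(2)[OF sJ(1)] by blast
      moreover have "p * x + x * j = (p + j) * x" by (simp add: algebra_simps)
      ultimately show "x \<in> J" using pj by simp
    qed
    then obtain N where "N \<subseteq># M" "J = prodm N" using add.IH[OF _ add.prems(2)] add.prems(1) by auto
    then show ?thesis by (intro exI[of _ N]) (auto intro: subset_mset.order_trans)
  qed
qed

text \<open>Choose \<open>x\<close> in \<open>J\<close> outside the product ideal. By maximality
  \<open>x * r\<close> falls into the product only for \<open>r\<close> in \<open>P\<close>, so the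
  elements \<open>x * r + s\<close>, with \<open>r\<close> and \<open>s\<close> running over
  representatives modulo \<open>P\<close> and modulo \<open>J\<close>, are pairwise incongruent:
  reduction modulo \<open>J\<close> recovers \<open>s\<close>, and then \<open>r\<close> is
  determined modulo \<open>P\<close>.\<close>

lemma idx_prodset:
  assumes P: "maxideal P" and J: "nzideal J"
  shows "idx P * idx J \<le> idx (prodset P J)"
proof -
  have nP: "nzideal P" using P unfolding maxideal_def by blast
  have sP: "submod P" "P \<subseteq> R" and sJ: "submod J" "J \<subseteq> R" using nP J unfolding nzideal_def by auto
  let ?I = "prodset P J"
  have nI: "nzideal ?I" by (rule nzideal_prodset[OF nP J])
  have sI: "submod ?I" by (rule submod_prodset)
  have IJ: "?I \<subseteq> J" by (rule prodset_subset_right[OF sJ(1) sP(2)])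
  have "?I \<noteq> J"
  proof
    assume eq: "?I = J"
    have "prodset (invset P) ?I = J" by (rule invset_cancel[OF P sJ(1)])
    then have st: "prodset (invset P) J = J" using eq by simp
    obtain x where x: "x \<notin> R" "\<And>p. p \<in> P \<Longrightarrow> x * p \<in> R" using maxideal_inverse_proper[OF P] by blast
    then have "x \<in> invset P" unfolding invset_def by auto
    then have "x * n \<in> J" if "n \<in> J" for n using in_prodset[OF _ that, of x "invset P"] st by simp
    then show False using stable_nzideal[OF J] x by blast
  qed
  then obtain x where x: "x \<in> J" "x \<notin> ?I" using IJ by blast
  have xR: "x \<in> R" using x sJ by blast
  have xP: "r \<in> P" if r: "r \<in> R" "x * r \<in> ?I" for r
  proof (rule ccontr)
    assume nr: "r \<notin> P"
    let ?B = "{r. x * r \<in> ?I} \<inter> R"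
    have B: "submod ?B" using submod_colon[OF sI, of x] submod_R unfolding submod_def by blast
    obtain p j where pj: "p \<in> P" "j \<in> ?B" "p + j = 1"
      using maxideal_comax[OF P B] nr r by blast
    have "p * x + x * j \<in> ?I" using in_prodset[OF pj(1) x(1)] pj(2) submodD(2)[OF sI] by auto
    moreover have "p * x + x * j = (p + j) * x" by (simp add: algebra_simps)
    ultimately show False using pj x by simp
  qed
  define rp where "rp I X = (SOME y. y \<in> R \<and> X = coset I y)" for I X
  have rp: "rp I X \<in> R \<and> X = coset I (rp I X)" if "X \<in> coset I ` R" for I X
    unfolding rp_def by (rule someI_ex) (use that in blast)
  define f where "f = (\<lambda>(X, Y). coset ?I (x * rp P X + rp J Y))"
  have "inj_on f (coset P ` R \<times> coset J ` R)"
  proof (rule inj_onI, clarsimp simp: f_def, goal_cases)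
    case (1 a b c d)
    let ?a = "rp P (coset P a)" and ?c = "rp P (coset P c)"
    let ?b = "rp J (coset J b)" and ?d = "rp J (coset J d)"
    have R: "?a \<in> R" "?b \<in> R" "?c \<in> R" "?d \<in> R" using rp 1 by blast+
    have cs: "coset P a = coset P ?a" "coset J b = coset J ?b" "coset P c = coset P ?c" "coset J d = coset J ?d"
      using rp 1 by blast+
    have mem: "(x * ?a + ?b) - (x * ?c + ?d) \<in> ?I"
      using 1 coset_eq_iff[OF sI] R xR add_in mult_in by auto
    have "x * (?c - ?a) \<in> J"
      using submodD(3)[OF sJ(1) _ x(1), of "?c - ?a"] submodD(5)[OF submod_R R(3,1)] by (simp add: mult.commute)
    then have "((x * ?a + ?b) - (x * ?c + ?d)) + x * (?c - ?a) \<in> J"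
      using mem IJ submodD(2)[OF sJ(1)] by blast
    then have "?b - ?d \<in> J" by (simp add: algebra_simps)
    then have bd: "coset J b = coset J d" using cs coset_eq_iff[OF sJ(1)] R by metis
    then have "x * (?a - ?c) \<in> ?I" using mem by (simp add: algebra_simps)
    then have "?a - ?c \<in> P" using xP submodD(5)[OF submod_R R(1,3)] by blast
    then have "coset P a = coset P c" using cs coset_eq_iff[OF sP(1)] R by metis
    then show ?case using bd by blast
  qed
  moreover have "f ` (coset P ` R \<times> coset J ` R) \<subseteq> coset ?I ` R"
    unfolding f_def using rp xR add_in mult_in by auto
  ultimately have "card (coset P ` R \<times> coset J ` R) \<le> card (coset ?I ` R)"
    using finite_quot[OF nI] card_inj_on_le by blast
  then show ?thesis by (simp add: idx_def card_cartesian_product)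
qed

lemma idx_R: "idx R \<ge> 1"
proof -
  have "coset R ` R \<noteq> {}" using zero_in by blast
  then show ?thesis unfolding idx_def using finite_quot[OF nzideal_R] by (simp add: Suc_le_eq card_gt_0_iff)
qed

lemma idx_prodm:
  "(\<And>P. P \<in># M \<Longrightarrow> maxideal P) \<Longrightarrow> (\<Prod>P\<in>#M. idx P) \<le> idx (prodm M)"
proof (induction M)
  case empty then show ?case using idx_R by simp
next
  case (add P M)
  have "(\<Prod>P\<in>#add_mset P M. idx P) \<le> idx P * idx (prodm M)" using add by (simp add: mult_left_mono)
  also have "\<dots> \<le> idx (prodset P (prodm M))" using add.prems by (intro idx_prodset nzideal_prodm) auto
  finally show ?case by simp
qed

lemma maxideal_idx_ge_2: assumes P: "maxideal P" shows "idx P \<ge> 2"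
proof -
  have nP: "nzideal P" and sP: "submod P" "P \<subseteq> R" "P \<noteq> R"
    using P unfolding maxideal_def nzideal_def by auto
  have "1 \<notin> P" using sP submodD(3)[OF sP(1), of _ 1] by force
  then have "coset P 1 \<noteq> coset P 0" using coset_eq_iff[OF sP(1) one_in zero_in] by simp
  then have "card {coset P 1, coset P 0} = 2" by simp
  moreover have "card {coset P 1, coset P 0} \<le> card (coset P ` R)"
    by (rule card_mono[OF finite_quot[OF nP]]) (use one_in zero_in in auto)
  ultimately show ?thesis by (simp add: idx_def)
qed

lemma of_nat_in: "of_nat k \<in> R"
  by (induction k) (auto simp: zero_in one_in add_in)

text \<open>Two of the \<open>k + 1\<close> integers from 0 to \<open>k\<close> are congruent modulo
  \<open>I\<close>, and their difference divides \<open>fact k\<close>.\<close>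

lemma of_nat_fact_in:
  assumes "nzideal I" "idx I \<le> k" shows "of_nat (fact k) \<in> I"
proof -
  have sI: "submod I" using assms nz_submod by blast
  have "card ((\<lambda>i. coset I (of_nat i)) ` {0..k}) \<le> card (coset I ` R)"
    by (rule card_mono[OF finite_quot[OF assms(1)]]) (use of_nat_in in auto)
  also have "\<dots> < card {0..k}" using assms(2) by (simp add: idx_def)
  finally have "\<not> inj_on (\<lambda>i. coset I (of_nat i)) {0..k}" by (rule pigeonhole)
  then obtain i j where ij: "i \<le> k" "j \<le> k" "i < j" "coset I (of_nat i) = coset I (of_nat j)"
    unfolding inj_on_def by (metis atLeastAtMost_iff linorder_neqE_nat)
  then have "of_nat j - of_nat i \<in> I" using coset_eq_iff[OF sI] of_nat_in by metis
  then have m: "of_nat (j - i) \<in> I" using ij by (simp add: of_nat_diff)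
  have "j - i dvd fact k" using ij by (intro dvd_fact) auto
  then obtain q where "fact k = q * (j - i)" by (metis dvd_def mult.commute)
  then have "of_nat (fact k) = of_nat q * (of_nat (j - i) :: 'a)" by (metis of_nat_mult)
  then show ?thesis using submodD(3)[OF sI of_nat_in m] by metis
qed

text \<open>All these ideals contain the one generated by \<open>fact k\<close>, which has only
  finitely many ideals above it.\<close>

lemma finite_small_ideals: "finite {I. nzideal I \<and> idx I \<le> k}"
proof -
  let ?c = "of_nat (fact k) :: 'a"
  define I where "I = submod hull {?c}"
  have c: "?c \<in> I" unfolding I_def by (rule hull_inc) simp
  have IR: "I \<subseteq> R" unfolding I_def by (rule hull_minimal) (use of_nat_in[of "fact k"] submod_R in simp_all)
  have "nzideal I" unfolding nzideal_def using submod_hull[of "{?c}"] IR c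
    by (auto simp: I_def[symmetric] simp del: of_nat_fact intro!: bexI[of _ ?c])
  moreover have "{J. nzideal J \<and> idx J \<le> k} \<subseteq> {J. nzideal J \<and> I \<subseteq> J}"
  proof (rule subsetI)
    fix J assume "J \<in> {J. nzideal J \<and> idx J \<le> k}"
    then have J: "nzideal J" "idx J \<le> k" by auto
    have "I \<subseteq> J" unfolding I_def
      by (rule hull_minimal) (use of_nat_fact_in[OF J] nz_submod[OF J(1)] in simp_all)
    then show "J \<in> {J. nzideal J \<and> I \<subseteq> J}" using J by simp
  qed
  ultimately show ?thesis using finite_overideals finite_subset by blast
qed

section \<open>Counting the divisors of an ideal\<close>

lemma
  shows finite_submultisets: "finite {N. N \<subseteq># M}"
    and card_submultisets_le: "card {N. N \<subseteq># M} \<le> (\<Prod>P\<in>set_mset M. count M P + 1)"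
proof -
  let ?S = "PiE (set_mset M) (\<lambda>P. {..count M P})"
  have inj: "inj_on (\<lambda>N. restrict (count N) (set_mset M)) {N. N \<subseteq># M}"
    proof (rule inj_onI)
      fix N N' assume *: "N \<in> {N. N \<subseteq># M}" "N' \<in> {N. N \<subseteq># M}"
        "restrict (count N) (set_mset M) = restrict (count N') (set_mset M)"
      show "N = N'"
      proof (rule multiset_eqI)
        fix P
        show "count N P = count N' P"
        proof (cases "P \<in># M")
          case True then show ?thesis using fun_cong[OF *(3), of P] by simp
        next
          case False
          then have "P \<notin># N" "P \<notin># N'" using *(1,2) mset_subset_eqD[of N M P] mset_subset_eqD[of N' M P] by auto
          then show ?thesis by (simp add: not_in_iff)
        qed
      qed
    qed
  have sub: "(\<lambda>N. restrict (count N) (set_mset M)) ` {N. N \<subseteq># M} \<subseteq> ?S"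
    by (auto simp: mset_subset_eq_count)
  have fin: "finite ?S" by (intro finite_PiE) auto
  show "finite {N. N \<subseteq># M}" by (rule inj_on_finite[OF inj sub fin])
  show "card {N. N \<subseteq># M} \<le> (\<Prod>P\<in>set_mset M. count M P + 1)"
    using card_inj_on_le[OF inj sub fin] by (simp add: card_PiE)
qed

text \<open>The divisor bound \<open>d(I) \<le> C N(I) powr \<delta>\<close>: a maximal ideal of index at least \<open>2 powr (1/\<delta>)\<close>
  contributes a factor \<open>e + 1 \<le> 2 ^ e\<close>, and there are finitely many others.\<close>

theorem overideals_bound:
  assumes "\<delta> > 0"
  obtains C where "C > 0"
    "\<And>I. nzideal I \<Longrightarrow> real (card {J. nzideal J \<and> I \<subseteq> J}) \<le> C * real (idx I) powr \<delta>"
proof -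
  define k where "k = nat \<lceil>2 powr (1 / \<delta>)\<rceil>"
  define S where "S = {I. nzideal I \<and> idx I \<le> k}"
  have finS: "finite S" unfolding S_def by (rule finite_small_ideals)
  \<comment> \<open>Chosen so that \<open>e + 1 \<le> c * 2 powr (\<delta> * e)\<close> for every
    \<open>e\<close>, by \<open>1 + u \<le> exp u\<close> with
    \<open>u = e * \<delta> * ln 2\<close>.\<close>
  define c where "c = 1 + 1 / (\<delta> * ln 2)"
  have c1: "c \<ge> 1" unfolding c_def using assms by simp
  have small: "real (e + 1) \<le> c * 2 powr (\<delta> * e)" for e :: nat
  proof -
    have "1 + real e * (\<delta> * ln 2) \<le> exp (real e * (\<delta> * ln 2))" by (rule exp_ge_add_one_self)
    also have "\<dots> = 2 powr (\<delta> * e)" by (simp add: powr_def mult_ac)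
    finally have *: "1 + real e * (\<delta> * ln 2) \<le> 2 powr (\<delta> * e)" .
    have "real (e + 1) \<le> c * (1 + real e * (\<delta> * ln 2))"
      unfolding c_def using assms by (simp add: field_simps)
    also have "\<dots> \<le> c * 2 powr (\<delta> * e)" using * c1 by (intro mult_left_mono) auto
    finally show ?thesis .
  qed
  show thesis
  proof (rule that[of "c ^ card S"])
    show "c ^ card S > 0" using c1 by simp
    fix I assume I: "nzideal I"
    obtain M where M: "\<And>P. P \<in># M \<Longrightarrow> maxideal P" "I = prodm M" using ideal_factorization[OF I] by blast
    let ?e = "count M"
    have each: "real (?e P + 1) \<le> (if P \<in> S then c else 1) * real (idx P) powr (\<delta> * ?e P)" if "P \<in># M" for P
    proof (cases "P \<in> S")
      case True
      have "2 powr (\<delta> * ?e P) \<le> real (idx P) powr (\<delta> * ?e P)"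
        using maxideal_idx_ge_2[OF M(1)[OF that]] assms by (intro powr_mono2) auto
      then have "c * 2 powr (\<delta> * ?e P) \<le> c * real (idx P) powr (\<delta> * ?e P)" using c1 by simp
      then show ?thesis using small[of "?e P"] True by simp
    next
      case False
      then have "idx P > k" using M(1)[OF that] unfolding S_def maxideal_def by auto
      then have "2 powr (1 / \<delta>) \<le> real (idx P)" unfolding k_def by linarith
      then have "(2 powr (1 / \<delta>)) powr (\<delta> * ?e P) \<le> real (idx P) powr (\<delta> * ?e P)"
        using assms by (intro powr_mono2) auto
      then have "2 ^ ?e P \<le> real (idx P) powr (\<delta> * ?e P)"
        using assms by (simp add: powr_powr powr_realpow)
      moreover have "?e P + 1 \<le> 2 ^ ?e P" using less_exp[of "?e P"] by linarith
      then have "real (?e P + 1) \<le> 2 ^ ?e P" by (metis of_nat_le_iff of_nat_numeral of_nat_power)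
      ultimately show ?thesis using False by simp
    qed
    have "{J. nzideal J \<and> I \<subseteq> J} \<subseteq> prodm ` {N. N \<subseteq># M}"
      using overideal_submultiset[OF M(1)] M(2) by blast
    moreover have fin: "finite {N. N \<subseteq># M}" by (rule finite_submultisets)
    ultimately have "card {J. nzideal J \<and> I \<subseteq> J} \<le> card {N. N \<subseteq># M}"
      by (meson card_image_le card_mono finite_imageI le_trans)
    also have "\<dots> \<le> (\<Prod>P\<in>set_mset M. ?e P + 1)" by (rule card_submultisets_le)
    finally have "real (card {J. nzideal J \<and> I \<subseteq> J}) \<le> (\<Prod>P\<in>set_mset M. real (?e P + 1))"
      by (metis of_nat_le_iff of_nat_prod)
    also have "\<dots> \<le> (\<Prod>P\<in>set_mset M. (if P \<in> S then c else 1) * real (idx P) powr (\<delta> * ?e P))"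
      using each by (intro prod_mono) auto
    also have "\<dots> = (\<Prod>P\<in>set_mset M. if P \<in> S then c else 1) * (\<Prod>P\<in>set_mset M. real (idx P) powr (\<delta> * ?e P))"
      by (rule prod.distrib)
    also have "\<dots> \<le> c ^ card S * real (idx I) powr \<delta>"
    proof (rule mult_mono)
      have "(\<Prod>P\<in>set_mset M. if P \<in> S then c else 1) = c ^ card (set_mset M \<inter> S)"
        by (simp add: prod.inter_restrict[symmetric])
      also have "\<dots> \<le> c ^ card S" using c1 finS by (intro power_increasing card_mono) auto
      finally show "(\<Prod>P\<in>set_mset M. if P \<in> S then c else 1) \<le> c ^ card S" .
      have "(\<Prod>P\<in>set_mset M. real (idx P) powr (\<delta> * ?e P)) = (\<Prod>P\<in>set_mset M. (real (idx P) ^ ?e P) powr \<delta>)"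
      proof (rule prod.cong[OF refl])
        fix P assume "P \<in> set_mset M"
        then have "real (idx P) > 0" using maxideal_idx_ge_2[OF M(1), of P] by simp
        then show "real (idx P) powr (\<delta> * ?e P) = (real (idx P) ^ ?e P) powr \<delta>"
          by (simp add: powr_powr powr_realpow[symmetric] mult.commute)
      qed
      also have "\<dots> = (\<Prod>P\<in>set_mset M. real (idx P) ^ ?e P) powr \<delta>"
        by (simp add: prod_powr_distrib)
      also have "(\<Prod>P\<in>set_mset M. real (idx P) ^ ?e P) = real (\<Prod>P\<in>#M. idx P)"
        by (simp add: image_prod_mset_multiplicity)
      also have "real (\<Prod>P\<in>#M. idx P) powr \<delta> \<le> real (idx I) powr \<delta>"
        using idx_prodm[OF M(1)] M(2) assms by (intro powr_mono2) auto
      finally show "(\<Prod>P\<in>set_mset M. real (idx P) powr (\<delta> * ?e P)) \<le> real (idx I) powr \<delta>" .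
    qed (use c1 in \<open>auto intro: prod_nonneg\<close>)
    finally show "real (card {J. nzideal J \<and> I \<subseteq> J}) \<le> c ^ card S * real (idx I) powr \<delta>" .
  qed
qed

end

section \<open>Coordinates with respect to an integral basis\<close>

lemma infnorm_le_iff:
  fixes x :: "real ^ 'n"
  shows "infnorm x \<le> B \<longleftrightarrow> (\<forall>i. \<bar>x $ i\<bar> \<le> B)"
proof
  show "infnorm x \<le> B \<Longrightarrow> \<forall>i. \<bar>x $ i\<bar> \<le> B"
    using component_le_infnorm_cart order_trans by blast
  show "\<forall>i. \<bar>x $ i\<bar> \<le> B \<Longrightarrow> infnorm x \<le> B"
    unfolding infnorm_cart by (intro cSup_least) auto
qed

definition ivec :: "int ^ 'n \<Rightarrow> real ^ 'n::finite" where
  "ivec m = (\<chi> i. real_of_int (m $ i))"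

lemma ivec_nth [simp]: "ivec m $ i = real_of_int (m $ i)"
  by (simp add: ivec_def)

lemma card_int_box:
  fixes t :: int assumes "t \<ge> 0"
  shows "card {z :: int ^ 'n. \<forall>i. \<bar>z $ i\<bar> \<le> t} = nat (2 * t + 1) ^ CARD('n)"
    and "finite {z :: int ^ 'n. \<forall>i. \<bar>z $ i\<bar> \<le> t}"
proof -
  let ?P = "PiE (UNIV::'n set) (\<lambda>_. {-t..t})"
  have eq: "{z :: int ^ 'n. \<forall>i. \<bar>z $ i\<bar> \<le> t} = (\<lambda>f. \<chi> i. f i) ` ?P"
  proof (intro set_eqI iffI)
    fix z :: "int ^ 'n" assume "z \<in> {z. \<forall>i. \<bar>z $ i\<bar> \<le> t}"
    then show "z \<in> (\<lambda>f. \<chi> i. f i) ` ?P"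
      by (intro image_eqI[of _ _ "\<lambda>i. z $ i"]) (auto simp: abs_le_iff minus_le_iff)
  qed (auto simp: PiE_iff abs_le_iff minus_le_iff)
  have "inj_on (\<lambda>f. (\<chi> i. f i) :: int ^ 'n) ?P" by (auto simp: inj_on_def vec_eq_iff)
  then show "card {z :: int ^ 'n. \<forall>i. \<bar>z $ i\<bar> \<le> t} = nat (2 * t + 1) ^ CARD('n)"
    unfolding eq using assms by (simp add: card_image card_PiE)
  show "finite {z :: int ^ 'n. \<forall>i. \<bar>z $ i\<bar> \<le> t}"
    unfolding eq by (intro finite_imageI finite_PiE) auto
qed

lemma infnorm_ivec_ge_1: "m \<noteq> 0 \<Longrightarrow> infnorm (ivec m) \<ge> 1"
proof -
  assume "m \<noteq> 0"
  then obtain i where "m $ i \<noteq> 0" by (auto simp: vec_eq_iff)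
  then have "1 \<le> \<bar>ivec m $ i\<bar>" by simp
  then show ?thesis using component_le_infnorm_cart order_trans by blast
qed

locale integral_basis_field =
  fixes K :: "'k::field_char_0 set" and \<omega> :: "'n::finite \<Rightarrow> 'k"
  assumes nfK: "number_field K" and basis: "integral_basis K \<omega>"
begin

abbreviation (input) ZK :: "'k set" where "ZK \<equiv> ring_of_integers K"

abbreviation (input) fc :: "rat ^ 'n \<Rightarrow> 'k" where "fc \<equiv> from_coords \<omega>"

abbreviation (input) co :: "'k \<Rightarrow> rat ^ 'n" where "co \<equiv> to_coords \<omega>"

text \<open>The coordinate max-norm carried over to \<open>K\<close>. It is submultiplicative up to
  the factor \<open>Cm\<close>.\<close>

definition nrm :: "'k \<Rightarrow> real" where
  "nrm x = infnorm (rat_to_real_vec (co x))"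

lemma K_closed:
  "0 \<in> K" "1 \<in> K" "x \<in> K \<Longrightarrow> y \<in> K \<Longrightarrow> x + y \<in> K" "x \<in> K \<Longrightarrow> y \<in> K \<Longrightarrow> x * y \<in> K"
  "x \<in> K \<Longrightarrow> - x \<in> K" "x \<in> K \<Longrightarrow> inverse x \<in> K"
  "x \<in> K \<Longrightarrow> y \<in> K \<Longrightarrow> x - y \<in> K" "x \<in> K \<Longrightarrow> y \<in> K \<Longrightarrow> x / y \<in> K"
proof -
  show *: "0 \<in> K" "1 \<in> K" "x \<in> K \<Longrightarrow> y \<in> K \<Longrightarrow> x + y \<in> K" "x \<in> K \<Longrightarrow> y \<in> K \<Longrightarrow> x * y \<in> K"
    "x \<in> K \<Longrightarrow> - x \<in> K" "x \<in> K \<Longrightarrow> inverse x \<in> K" for x y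
    using nfK unfolding number_field_def subfield_of_type_def by auto
  show "x \<in> K \<Longrightarrow> y \<in> K \<Longrightarrow> x - y \<in> K" using *(3)[of x "- y"] *(5)[of y] by simp
  show "x \<in> K \<Longrightarrow> y \<in> K \<Longrightarrow> x / y \<in> K" using *(4)[of x "inverse y"] *(6)[of y] by (simp add: divide_inverse)
qed

lemma ZK_subset: "x \<in> ZK \<Longrightarrow> x \<in> K"
  by (simp add: ring_of_integers_def)

lemma ZK_closed:
  "0 \<in> ZK" "1 \<in> ZK" "x \<in> ZK \<Longrightarrow> y \<in> ZK \<Longrightarrow> x + y \<in> ZK" "x \<in> ZK \<Longrightarrow> y \<in> ZK \<Longrightarrow> x * y \<in> ZK"
  "x \<in> ZK \<Longrightarrow> - x \<in> ZK" "x \<in> ZK \<Longrightarrow> y \<in> ZK \<Longrightarrow> x - y \<in> ZK"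
proof -
  show *: "0 \<in> ZK" "1 \<in> ZK" "x \<in> ZK \<Longrightarrow> y \<in> ZK \<Longrightarrow> x + y \<in> ZK" "x \<in> ZK \<Longrightarrow> y \<in> ZK \<Longrightarrow> x * y \<in> ZK"
    "x \<in> ZK \<Longrightarrow> - x \<in> ZK" for x y
    by (auto simp: ring_of_integers_def K_closed algebraic_int_plus algebraic_int_times)
  show "x \<in> ZK \<Longrightarrow> y \<in> ZK \<Longrightarrow> x - y \<in> ZK" using *(3)[of x "- y"] *(5)[of y] by simp
qed

lemma ZK_of_int: "of_int k \<in> ZK"
proof -
  have "of_nat m \<in> K" for m by (induction m) (auto simp: K_closed)
  then have "of_int k \<in> K" using K_closed(5) by (cases k rule: int_cases2) auto
  then show ?thesis by (simp add: ring_of_integers_def)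
qed

lemma ZK_of_nat: "of_nat k \<in> ZK"
  using ZK_of_int[of "int k"] by simp

lemma fc_add: "fc (a + b) = fc a + fc b"
  and fc_scale: "fc (c *s a) = of_rat c * fc a"
  and fc_0: "fc 0 = 0"
proof -
  show "fc (a + b) = fc a + fc b"
    unfolding from_coords_def sum.distrib[symmetric]
    by (intro sum.cong refl) (simp add: of_rat_add distrib_right)
  show "fc (c *s a) = of_rat c * fc a"
    unfolding from_coords_def sum_distrib_left
    by (intro sum.cong refl) (simp only: vector_smult_component of_rat_mult mult.assoc)
  show "fc 0 = 0" unfolding from_coords_def by simp
qed

lemma inj_omega: "inj \<omega>"
  using basis by (simp add: integral_basis_def)

lemma fc_eq_0: assumes "fc a = 0" shows "a = 0"
proof (rule ccontr)
  assume "a \<noteq> 0"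
  then obtain i where i: "a $ i \<noteq> 0" by (auto simp: vec_eq_iff)
  have "(\<Sum>v\<in>range \<omega>. of_rat (a $ (inv \<omega> v)) * v) = fc a"
    unfolding from_coords_def by (subst sum.reindex[OF inj_omega]) (simp add: inv_f_f[OF inj_omega])
  then have "rat_vs.dependent (range \<omega>)"
    using assms i rat_vs.dependent_finite[of "range \<omega>"]
    by (auto simp: inv_f_f[OF inj_omega] intro!: exI[of _ "\<lambda>v. a $ (inv \<omega> v)"] bexI[of _ "\<omega> i"])
  then show False using basis by (simp add: integral_basis_def)
qed

lemma fc_inj: "fc a = fc b \<Longrightarrow> a = b"
proof -
  assume "fc a = fc b"
  then have "fc (a + (- 1) *s b) = 0" by (simp only: fc_add fc_scale) simp
  then have "a + (- 1) *s b = 0" by (rule fc_eq_0)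
  then show "a = b" by (simp add: vec_eq_iff)
qed

lemma co_fc [simp]: "co (fc a) = a"
  unfolding to_coords_def using fc_inj by blast

lemma fc_in_K: "fc a \<in> K" and ex_fc: "x \<in> K \<Longrightarrow> \<exists>a. x = fc a"
proof -
  have K: "K = range (\<lambda>u. \<Sum>v\<in>range \<omega>. of_rat (u v) * v)"
    using basis rat_vs.span_finite[of "range \<omega>"] by (simp add: integral_basis_def)
  have eq: "(\<Sum>v\<in>range \<omega>. of_rat (u v) * v) = fc (\<chi> i. u (\<omega> i))" for u
    unfolding from_coords_def by (subst sum.reindex[OF inj_omega]) simp
  show "x \<in> K \<Longrightarrow> \<exists>a. x = fc a" using K eq by auto
  have "fc a = (\<Sum>v\<in>range \<omega>. of_rat (a $ inv \<omega> v) * v)"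
    unfolding from_coords_def by (subst sum.reindex[OF inj_omega]) (simp add: inv_f_f[OF inj_omega])
  then show "fc a \<in> K" by (subst K) (auto intro!: exI[of _ "\<lambda>v. a $ inv \<omega> v"])
qed

lemma fc_co: "x \<in> K \<Longrightarrow> fc (co x) = x"
  using ex_fc by fastforce

lemma fc_int_in_ZK: "fc (int_to_rat_vec z) \<in> ZK" and ex_fc_int: "x \<in> ZK \<Longrightarrow> \<exists>z. x = fc (int_to_rat_vec z)"
proof -
  have ZK: "ZK = range (\<lambda>u. \<Sum>v\<in>range \<omega>. of_int (u v) * v)"
    using basis int_mod.span_finite[of "range \<omega>"] by (simp add: integral_basis_def)
  have eq: "(\<Sum>v\<in>range \<omega>. of_int (u v) * v) = fc (int_to_rat_vec (\<chi> i. u (\<omega> i)))" for u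
    unfolding from_coords_def int_to_rat_vec_def by (subst sum.reindex[OF inj_omega]) simp
  show "x \<in> ZK \<Longrightarrow> \<exists>z. x = fc (int_to_rat_vec z)" using ZK eq by auto
  have "fc (int_to_rat_vec z) = (\<Sum>v\<in>range \<omega>. of_int (z $ inv \<omega> v) * v)"
    unfolding from_coords_def int_to_rat_vec_def by (subst sum.reindex[OF inj_omega]) (simp add: inv_f_f[OF inj_omega])
  then show "fc (int_to_rat_vec z) \<in> ZK" by (subst ZK) (auto intro!: exI[of _ "\<lambda>v. z $ inv \<omega> v"])
qed

lemma co_add: "x \<in> K \<Longrightarrow> y \<in> K \<Longrightarrow> co (x + y) = co x + co y"
  by (metis co_fc fc_add fc_co)

lemma co_scale: "x \<in> K \<Longrightarrow> co (of_rat c * x) = c *s co x"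
  by (metis co_fc fc_scale fc_co)

lemma co_scale_int: "x \<in> K \<Longrightarrow> co (of_int c * x) = of_int c *s co x"
  using co_scale[of x "of_int c"] by simp

lemma co_0: "co 0 = 0"
  by (metis co_fc fc_0)

lemma K_sum: "(\<And>i. i \<in> S \<Longrightarrow> f i \<in> K) \<Longrightarrow> sum f S \<in> K"
  by (induction S rule: infinite_finite_induct) (auto simp: K_closed)

lemma co_sum: "(\<And>i. i \<in> S \<Longrightarrow> f i \<in> K) \<Longrightarrow> co (sum f S) = (\<Sum>i\<in>S. co (f i))"
  by (induction S rule: infinite_finite_induct) (auto simp: co_0 co_add K_sum)

lemma ZK_iff: "x \<in> K \<Longrightarrow> x \<in> ZK \<longleftrightarrow> (\<forall>i. co x $ i \<in> \<int>)"
proof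
  assume x: "x \<in> K"
  { assume "x \<in> ZK"
    then obtain z where "x = fc (int_to_rat_vec z)" using ex_fc_int by blast
    then show "\<forall>i. co x $ i \<in> \<int>" by (simp add: int_to_rat_vec_def) }
  { assume "\<forall>i. co x $ i \<in> \<int>"
    then have "co x = int_to_rat_vec (\<chi> i. \<lfloor>co x $ i\<rfloor>)" by (simp add: vec_eq_iff int_to_rat_vec_def)
    then show "x \<in> ZK" using fc_co[OF x] fc_int_in_ZK by metis }
qed

lemma omega_fc: "\<omega> i = fc (int_to_rat_vec (axis i 1))"
proof -
  have "fc (int_to_rat_vec (axis i 1)) = (\<Sum>j\<in>UNIV. if j = i then \<omega> j else 0)"
    unfolding from_coords_def int_to_rat_vec_def axis_def by (intro sum.cong) auto
  then show ?thesis by simp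
qed

lemma omega_ZK: "\<omega> i \<in> ZK" and omega_K: "\<omega> i \<in> K"
  using omega_fc fc_int_in_ZK ZK_subset by metis+

lemma expand: "x \<in> K \<Longrightarrow> x = (\<Sum>i\<in>UNIV. of_rat (co x $ i) * \<omega> i)"
  using fc_co[of x] by (simp add: from_coords_def)

lemma K_of_rat: "of_rat c \<in> K"
proof -
  obtain a b where "quotient_of c = (a, b)" by (cases "quotient_of c")
  then have "c = of_int a / of_int b" by (rule quotient_of_div)
  then have "of_rat c = (of_int a / of_int b :: 'k)" by (simp add: of_rat_divide)
  then show ?thesis using K_closed(8) ZK_subset[OF ZK_of_int] by simp
qed

lemma rat_to_real_vec_linear:
  "rat_to_real_vec (a + b) = rat_to_real_vec a + rat_to_real_vec b"
  "rat_to_real_vec (c *s a) = real_of_rat c *\<^sub>R rat_to_real_vec a"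
  "rat_to_real_vec 0 = 0"
  by (simp_all add: rat_to_real_vec_def vec_eq_iff of_rat_add of_rat_mult)

lemma nrm_add: "x \<in> K \<Longrightarrow> y \<in> K \<Longrightarrow> nrm (x + y) \<le> nrm x + nrm y"
  by (simp add: nrm_def co_add rat_to_real_vec_linear infnorm_triangle)

lemma nrm_scale: "x \<in> K \<Longrightarrow> nrm (of_rat c * x) = \<bar>real_of_rat c\<bar> * nrm x"
  by (simp add: nrm_def co_scale rat_to_real_vec_linear infnorm_mul)

lemma nrm_scale_int: "x \<in> K \<Longrightarrow> nrm (of_int c * x) = \<bar>real_of_int c\<bar> * nrm x"
  using nrm_scale[of x "of_int c"] by simp

lemma nrm_minus: "x \<in> K \<Longrightarrow> nrm (- x) = nrm x"
  using nrm_scale_int[of x "-1"] by simp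

lemma nrm_diff: "x \<in> K \<Longrightarrow> y \<in> K \<Longrightarrow> nrm (x - y) \<le> nrm x + nrm y"
  using nrm_add[of x "- y"] nrm_minus[of y] K_closed(5) by simp

lemma nrm_nonneg: "nrm x \<ge> 0"
  by (simp add: nrm_def infnorm_pos_le)

lemma nrm_0: "nrm 0 = 0"
  by (simp add: nrm_def co_0 rat_to_real_vec_linear infnorm_0)

lemma nrm_sum: "(\<And>i. i \<in> S \<Longrightarrow> f i \<in> K) \<Longrightarrow> nrm (sum f S) \<le> (\<Sum>i\<in>S. nrm (f i))"
proof (induction S rule: infinite_finite_induct)
  case (insert x F)
  then have "nrm (f x + sum f F) \<le> nrm (f x) + nrm (sum f F)" by (intro nrm_add K_sum) auto
  then show ?case using insert by auto
qed (auto simp: nrm_0)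

lemma coord_le_nrm: "\<bar>real_of_rat (co x $ i)\<bar> \<le> nrm x"
  using component_le_infnorm_cart[of "rat_to_real_vec (co x)" i]
  by (simp add: nrm_def rat_to_real_vec_def)

lemma nrm_le_iff: "nrm x \<le> B \<longleftrightarrow> (\<forall>i. \<bar>real_of_rat (co x $ i)\<bar> \<le> B)"
  by (simp add: nrm_def infnorm_le_iff rat_to_real_vec_def)

lemma nrm_ZK_less_1: assumes "x \<in> ZK" "nrm x < 1" shows "x = 0"
proof -
  have K: "x \<in> K" using assms ZK_subset by blast
  have "co x $ i = 0" for i
  proof -
    obtain k where k: "co x $ i = of_int k" using ZK_iff[OF K] assms(1) Ints_cases by blast
    have "\<bar>real_of_rat (co x $ i)\<bar> < 1" by (rule order_le_less_trans[OF coord_le_nrm assms(2)])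
    then have "\<bar>real_of_int k\<bar> < 1" unfolding k by (simp only: of_rat_of_int_eq)
    then have "\<bar>k\<bar> < 1" by (metis of_int_abs of_int_less_1_iff)
    then have "k = 0" by simp
    then show ?thesis using k by simp
  qed
  then have "co x = 0" by (simp add: vec_eq_iff)
  then show ?thesis using fc_co[OF K] fc_0 by metis
qed

definition Cm :: real where
  "Cm = 1 + (\<Sum>i\<in>UNIV. \<Sum>j\<in>UNIV. nrm (\<omega> i * \<omega> j))"

lemma Cm_ge_1: "Cm \<ge> 1"
  by (auto simp: Cm_def intro!: sum_nonneg nrm_nonneg)

lemma nrm_mult: assumes "x \<in> K" "y \<in> K" shows "nrm (x * y) \<le> Cm * nrm x * nrm y"
proof -
  let ?x = "\<lambda>i. co x $ i" and ?y = "\<lambda>i. co y $ i"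
  have K: "of_rat c * (\<omega> i * \<omega> j) \<in> K" for c i j by (intro K_closed K_of_rat omega_K)
  have "x * y = (\<Sum>i\<in>UNIV. of_rat (?x i) * \<omega> i) * (\<Sum>j\<in>UNIV. of_rat (?y j) * \<omega> j)"
    using expand[OF assms(1)] expand[OF assms(2)] by simp
  also have "\<dots> = (\<Sum>i\<in>UNIV. \<Sum>j\<in>UNIV. of_rat (?x i * ?y j) * (\<omega> i * \<omega> j))"
    by (simp add: sum_product of_rat_mult mult_ac)
  finally have eq: "x * y = \<dots>" .
  have "nrm (x * y) \<le> (\<Sum>i\<in>UNIV. \<Sum>j\<in>UNIV. nrm (of_rat (?x i * ?y j) * (\<omega> i * \<omega> j)))"
    unfolding eq by (rule order_trans[OF nrm_sum]) (auto intro!: sum_mono nrm_sum K_sum K)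
  also have "\<dots> \<le> (\<Sum>i\<in>UNIV. \<Sum>j\<in>UNIV. (nrm x * nrm y) * nrm (\<omega> i * \<omega> j))"
  proof (intro sum_mono)
    fix i j
    have "nrm (of_rat (?x i * ?y j) * (\<omega> i * \<omega> j)) = \<bar>real_of_rat (?x i)\<bar> * \<bar>real_of_rat (?y j)\<bar> * nrm (\<omega> i * \<omega> j)"
      by (subst nrm_scale) (auto simp: of_rat_mult abs_mult intro!: K_closed omega_K)
    also have "\<dots> \<le> (nrm x * nrm y) * nrm (\<omega> i * \<omega> j)"
      by (intro mult_mono mult_right_mono coord_le_nrm nrm_nonneg) (auto intro!: mult_nonneg_nonneg nrm_nonneg)
    finally show "nrm (of_rat (?x i * ?y j) * (\<omega> i * \<omega> j)) \<le> (nrm x * nrm y) * nrm (\<omega> i * \<omega> j)" .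
  qed
  also have "\<dots> \<le> Cm * nrm x * nrm y"
    by (simp add: Cm_def sum_distrib_left[symmetric] algebra_simps nrm_nonneg)
  finally show ?thesis .
qed

lemma finite_ZK_bounded: "finite {x \<in> ZK. nrm x \<le> B}"
proof -
  let ?S = "(\<lambda>f. \<chi> i. f i) ` (PiE UNIV (\<lambda>_::'n. {- \<lceil>B\<rceil>..\<lceil>B\<rceil>})) :: (int ^ 'n) set"
  have "finite ?S" by (intro finite_imageI finite_PiE) auto
  moreover have "{x \<in> ZK. nrm x \<le> B} \<subseteq> (\<lambda>z. fc (int_to_rat_vec z)) ` ?S"
  proof
    fix x assume x: "x \<in> {x \<in> ZK. nrm x \<le> B}"
    then obtain z where z: "x = fc (int_to_rat_vec z)" using ex_fc_int by blast
    have "\<bar>real_of_int (z $ i)\<bar> \<le> B" for i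
      using x nrm_le_iff[of x B] by (simp add: z int_to_rat_vec_def)
    then have "z $ i \<in> {- \<lceil>B\<rceil>..\<lceil>B\<rceil>}" for i
      by (simp add: abs_le_iff) (metis ceiling_mono ceiling_of_int le_ceiling_iff minus_le_iff of_int_minus)
    then have "z \<in> ?S" by (intro image_eqI[of _ _ "\<lambda>i. z $ i"]) auto
    then show "x \<in> (\<lambda>z. fc (int_to_rat_vec z)) ` ?S" using z by blast
  qed
  ultimately show ?thesis using finite_surj by blast
qed

end

section \<open>Divisors and denominators\<close>

lemma rat_to_real_int_to_rat: "rat_to_real_vec (int_to_rat_vec m) = ivec m"
  by (simp add: rat_to_real_vec_def int_to_rat_vec_def vec_eq_iff)

lemma rat_to_real_vec_nth [simp]: "rat_to_real_vec c $ i = of_rat (c $ i)"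
  and int_to_rat_vec_nth [simp]: "int_to_rat_vec q $ i = of_int (q $ i)"
  by (simp_all add: rat_to_real_vec_def int_to_rat_vec_def)

lemma of_rat_in_Ints_iff: "real_of_rat x \<in> \<int> \<longleftrightarrow> x \<in> \<int>"
proof
  assume "real_of_rat x \<in> \<int>"
  then obtain k where "real_of_rat x = of_int k" using Ints_cases by blast
  then have "real_of_rat x = real_of_rat (of_int k)" by simp
  then have "x = of_int k" by (simp only: of_rat_eq_iff)
  then show "x \<in> \<int>" by simp
next
  assume "x \<in> \<int>"
  then obtain k where "x = of_int k" using Ints_cases by blast
  then show "real_of_rat x \<in> \<int>" by simp
qed

lemma abs_det_le:
  fixes A :: "rat ^ 'n ^ 'n"
  assumes "\<And>i j. \<bar>real_of_rat (A $ i $ j)\<bar> \<le> B"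
  shows "\<bar>real_of_rat (det A)\<bar> \<le> fact CARD('n) * B ^ CARD('n)"
proof -
  have "real_of_rat (det A) =
      (\<Sum>p | p permutes UNIV. real_of_int (sign p) * (\<Prod>i\<in>UNIV. real_of_rat (A $ i $ p i)))"
    unfolding det_def by (simp add: of_rat_sum of_rat_mult of_rat_prod)
  also have "\<bar>\<dots>\<bar> \<le> (\<Sum>p\<in>{p. p permutes (UNIV::'n set)}. B ^ CARD('n))"
  proof (rule order_trans[OF sum_abs], rule sum_mono)
    fix p :: "'n \<Rightarrow> 'n"
    have "\<bar>real_of_int (sign p) * (\<Prod>i\<in>UNIV. real_of_rat (A $ i $ p i))\<bar> = (\<Prod>i\<in>UNIV. \<bar>real_of_rat (A $ i $ p i)\<bar>)"
      by (simp add: abs_mult sign_def abs_prod)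
    also have "\<dots> \<le> (\<Prod>i\<in>(UNIV::'n set). B)" using assms by (intro prod_mono) auto
    finally show "\<bar>real_of_int (sign p) * (\<Prod>i\<in>UNIV. real_of_rat (A $ i $ p i))\<bar> \<le> B ^ CARD('n)" by simp
  qed
  also have "\<dots> = fact CARD('n) * B ^ CARD('n)"
    by (simp add: card_permutations)
  finally show ?thesis .
qed

lemma det_in_Ints:
  fixes A :: "rat ^ 'n ^ 'n"
  assumes "\<And>i j. A $ i $ j \<in> \<int>" shows "det A \<in> \<int>"
  unfolding det_def using assms by (intro Ints_sum Ints_mult Ints_prod) auto

lemma common_denominator:
  fixes F :: "rat set"
  assumes "finite F" shows "\<exists>D::nat. D > 0 \<and> (\<forall>x\<in>F. of_nat D * x \<in> \<int>)"
  using assms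
proof (induction F)
  case (insert x F)
  then obtain D where D: "D > 0" "\<forall>x\<in>F. of_nat D * x \<in> \<int>" by blast
  obtain a b where ab: "quotient_of x = (a, b)" by (cases "quotient_of x")
  then have b: "b > 0" and x: "x = of_int a / of_int b" using quotient_of_denom_pos quotient_of_div by auto
  have "of_nat (D * nat b) * y \<in> \<int>" if "y \<in> F" for y
  proof -
    have "of_nat (D * nat b) * y = of_int b * (of_nat D * y)" using b by simp
    then show ?thesis using D that by (metis Ints_mult Ints_of_int)
  qed
  moreover have "of_nat (D * nat b) * x \<in> \<int>"
  proof -
    have "of_nat (D * nat b) * x = of_nat D * of_int a" using b by (subst x) simp
    then show ?thesis by (simp only: Ints_mult Ints_of_nat Ints_of_int)
  qed
  ultimately show ?case using D(1) b by (intro exI[of _ "D * nat b"]) auto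
qed (auto intro: exI[of _ 1])

lemma common_denominator_matrix:
  fixes f :: "'a::finite \<Rightarrow> 'b::finite \<Rightarrow> rat"
  obtains D :: nat where "D > 0" "\<And>i j. of_nat D * f i j \<in> \<int>"
proof -
  obtain D :: nat where D: "D > 0 \<and> (\<forall>x\<in>range (\<lambda>p. f (fst p) (snd p)). of_nat D * x \<in> \<int>)"
    using common_denominator[of "range (\<lambda>p. f (fst p) (snd p))"] by auto
  have "of_nat D * f i j \<in> \<int>" for i j
    using conjunct2[OF D] by (rule bspec) (auto intro: range_eqI[of _ _ "(i, j)"])
  then show thesis using that D by blast
qed

context integral_basis_field
begin

text \<open>The integer is the absolute norm of \<open>a\<close>, as the determinant of
  multiplication by \<open>a\<close> in the basis. Cramer's rule shows that it clears the
  denominators of \<open>1 / a\<close>, and the Leibniz formula bounds it by the \<open>n\<close>-th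
  power of the entries.\<close>

lemma norm_multiple:
  obtains B where "B > 0" "\<And>a. a \<in> ZK \<Longrightarrow> a \<noteq> 0 \<Longrightarrow>
    \<exists>c::nat. c > 0 \<and> real c \<le> B * nrm a ^ CARD('n) \<and> of_nat c / a \<in> ZK"
proof -
  define W where "W = 1 + (\<Sum>j\<in>UNIV. nrm (\<omega> j))"
  have W: "W \<ge> 1" "nrm (\<omega> j) \<le> W" for j
    using member_le_sum[of j UNIV "\<lambda>j. nrm (\<omega> j)"] by (auto simp: W_def nrm_nonneg sum_nonneg)
  define B where "B = fact CARD('n) * (Cm * W) ^ CARD('n)"
  have B: "B > 0" unfolding B_def using Cm_ge_1 W(1) by simp
  show thesis
  proof (rule that[OF B])
    fix a assume a: "a \<in> ZK" "a \<noteq> 0"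
    then have aK: "a \<in> K" using ZK_subset by blast
    define A :: "rat ^ 'n ^ 'n" where "A = (\<chi> i j. co (a * \<omega> j) $ i)"
    have Av: "A *v co x = co (a * x)" if x: "x \<in> K" for x
    proof -
      have "a * x = (\<Sum>j\<in>UNIV. of_rat (co x $ j) * (a * \<omega> j))"
        by (subst (1) expand[OF x]) (simp only: sum_distrib_left mult.left_commute)
      then have "co (a * x) = (\<Sum>j\<in>UNIV. co x $ j *s co (a * \<omega> j))"
        using aK omega_K by (simp only: co_sum co_scale K_closed K_of_rat)
      then show ?thesis by (simp add: vec_eq_iff matrix_vector_mult_def A_def mult.commute)
    qed
    have "v = 0" if "A *v v = 0" for v
    proof -
      have "co (a * fc v) = 0" using Av[OF fc_in_K, of v] that by simp
      then have "a * fc v = 0" using fc_co[of "a * fc v"] K_closed(4)[OF aK fc_in_K] fc_0 by metis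
      then show ?thesis using a fc_eq_0 by simp
    qed
    then have d0: "det A \<noteq> 0"
      using invertible_det_nz invertible_left_inverse matrix_left_invertible_ker by metis
    have Aint: "A $ i $ j \<in> \<int>" for i j
      using ZK_iff[of "a * \<omega> j"] ZK_closed(4)[OF a(1) omega_ZK[of j]] ZK_subset by (simp add: A_def)
    have one: "co 1 $ i \<in> \<int>" for i using ZK_iff[OF K_closed(2)] ZK_closed(2) by blast
    have inv: "co (1 / a) $ k = det (\<chi> i j. if j = k then co 1 $ i else A $ i $ j) / det A" for k
    proof -
      have "A *v co (1 / a) = co 1" using Av[of "1 / a"] a aK K_closed by simp
      then show ?thesis using cramer[OF d0, of "co (1 / a)" "co 1"] by (metis (no_types, lifting) vec_lambda_beta)
    qed
    obtain d where d: "det A = of_int d" using det_in_Ints[of A] Aint Ints_cases by blast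
    have "of_int d * co (1 / a) $ k \<in> \<int>" for k
      unfolding inv d[symmetric] using d0 one Aint by (auto intro!: det_in_Ints)
    then have "of_int d * (1 / a) \<in> ZK"
      using ZK_iff[of "of_int d * (1 / a)"] co_scale_int[of "1 / a" d] K_closed aK ZK_subset[OF ZK_of_int] by simp
    then have dz: "of_int \<bar>d\<bar> * (1 / a) \<in> ZK" using ZK_closed(5) by (cases "d \<ge> 0") (auto simp: abs_if)
    have "\<bar>real_of_rat (A $ i $ j)\<bar> \<le> Cm * W * nrm a" for i j
    proof -
      have "\<bar>real_of_rat (A $ i $ j)\<bar> \<le> nrm (a * \<omega> j)" unfolding A_def using coord_le_nrm by simp
      also have "\<dots> \<le> Cm * nrm a * nrm (\<omega> j)" by (rule nrm_mult[OF aK omega_K])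
      also have "\<dots> \<le> Cm * nrm a * W" using W Cm_ge_1 nrm_nonneg by (intro mult_left_mono) auto
      finally show ?thesis by (simp add: mult_ac)
    qed
    then have "\<bar>real_of_rat (det A)\<bar> \<le> fact CARD('n) * (Cm * W * nrm a) ^ CARD('n)" by (rule abs_det_le)
    then have "real (nat \<bar>d\<bar>) \<le> B * nrm a ^ CARD('n)" by (simp add: d B_def power_mult_distrib)
    moreover have "nat \<bar>d\<bar> > 0" using d d0 by auto
    moreover have "of_nat (nat \<bar>d\<bar>) / a \<in> ZK" using dz by simp
    ultimately show "\<exists>c::nat. c > 0 \<and> real c \<le> B * nrm a ^ CARD('n) \<and> of_nat c / a \<in> ZK" by blast
  qed
qed

text \<open>Representatives of \<open>ZK\<close> modulo the integer \<open>c\<close>.\<close>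

definition Box :: "nat \<Rightarrow> 'k set" where
  "Box c = (\<lambda>f. fc (int_to_rat_vec (\<chi> i. int (f i)))) ` PiE UNIV (\<lambda>_. {..<c})"

lemma Box: "finite (Box c)" "card (Box c) \<le> c ^ CARD('n)" "Box c \<subseteq> ZK"
proof -
  have f: "finite (PiE (UNIV::'n set) (\<lambda>_. {..<c}))" by (intro finite_PiE) auto
  show "finite (Box c)" unfolding Box_def using f by simp
  show "card (Box c) \<le> c ^ CARD('n)"
    unfolding Box_def using card_image_le[OF f] by (rule order_trans) (simp add: card_PiE)
  show "Box c \<subseteq> ZK" unfolding Box_def using fc_int_in_ZK by auto
qed

lemma Box_reduce:
  assumes "x \<in> ZK" "c > 0"
  shows "\<exists>b\<in>Box c. \<exists>w. x = b + of_nat c * fc (int_to_rat_vec w)"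
proof -
  obtain z where z: "x = fc (int_to_rat_vec z)" using ex_fc_int assms by blast
  define f where "f i = nat (z $ i mod int c)" for i
  have "f \<in> PiE UNIV (\<lambda>_. {..<c})" using assms by (auto simp: f_def nat_less_iff)
  then have "fc (int_to_rat_vec (\<chi> i. int (f i))) \<in> Box c" unfolding Box_def by blast
  moreover have "int_to_rat_vec z = int_to_rat_vec (\<chi> i. int (f i)) + of_nat c *s int_to_rat_vec (\<chi> i. z $ i div int c)"
  proof (simp add: vec_eq_iff, intro allI)
    fix i
    have "z $ i = int (f i) + int c * (z $ i div int c)" using assms by (simp add: f_def)
    then show "rat_of_int (z $ i) = of_nat (f i) + of_nat c * of_int (z $ i div int c)"
      by (metis of_int_add of_int_mult of_int_of_nat_eq)
  qed
  then have "x = fc (int_to_rat_vec (\<chi> i. int (f i))) + of_nat c * fc (int_to_rat_vec (\<chi> i. z $ i div int c))"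
    unfolding z by (simp only: fc_add fc_scale of_rat_of_nat_eq)
  ultimately show ?thesis by blast
qed

text \<open>Both axioms are reduced to rational integers. A nonzero \<open>a\<close> divides some
  integer \<open>c\<close>, so \<open>Box c\<close> meets all classes modulo \<open>a\<close>. A
  nonzero ideal \<open>N\<close> contains some integer \<open>c\<close>, which makes it finitely
  generated over the integers, and the determinant trick applies to any \<open>x\<close> that
  stabilises it.\<close>

lemma order_ZK: "integrally_closed_order ZK"
proof
  fix a assume a: "a \<in> ZK" "a \<noteq> 0"
  obtain c :: nat where c: "c > 0" "of_nat c / a \<in> ZK" using norm_multiple a by metis
  let ?cls = "\<lambda>x. {y \<in> ZK. y - x \<in> (*) a ` ZK}"
  have "?cls ` ZK \<subseteq> ?cls ` Box c"
  proof
    fix X assume "X \<in> ?cls ` ZK"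
    then obtain x where x: "x \<in> ZK" "X = ?cls x" by blast
    obtain b w where b: "b \<in> Box c" "x = b + of_nat c * fc (int_to_rat_vec w)" using Box_reduce[OF x(1) c(1)] by blast
    define v where "v = of_nat c / a * fc (int_to_rat_vec w)"
    have v: "v \<in> ZK" "x = b + a * v" unfolding v_def using b(2) a(2) ZK_closed(4)[OF c(2) fc_int_in_ZK] by simp_all
    have "y - x \<in> (*) a ` ZK \<longleftrightarrow> y - b \<in> (*) a ` ZK" for y
    proof
      assume "y - x \<in> (*) a ` ZK"
      then obtain u where "y - x = a * u" "u \<in> ZK" by blast
      then have "y - b = a * (u + v)" "u + v \<in> ZK" using v ZK_closed(3) by (auto simp: algebra_simps)
      then show "y - b \<in> (*) a ` ZK" by blast
    next
      assume "y - b \<in> (*) a ` ZK"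
      then obtain u where "y - b = a * u" "u \<in> ZK" by blast
      then have "y - x = a * (u - v)" "u - v \<in> ZK" using v ZK_closed(6) by (auto simp: algebra_simps)
      then show "y - x \<in> (*) a ` ZK" by blast
    qed
    then have "X = ?cls b" using x by simp
    then show "X \<in> ?cls ` Box c" using b by blast
  qed
  then show "finite (?cls ` ZK)" by (rule finite_subset) (intro finite_imageI Box(1))
next
  fix N x
  assume N: "N \<subseteq> ZK" "\<exists>n\<in>N. n \<noteq> 0" "\<And>m n. m \<in> N \<Longrightarrow> n \<in> N \<Longrightarrow> m + n \<in> N"
    "\<And>r n. r \<in> ZK \<Longrightarrow> n \<in> N \<Longrightarrow> r * n \<in> N" "\<And>n. n \<in> N \<Longrightarrow> x * n \<in> N"
  obtain n where n: "n \<in> N" "n \<noteq> 0" using N by blast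
  have nK: "n \<in> K" "x * n \<in> K" using ZK_subset N(1) n(1) N(5)[OF n(1)] by auto
  have xK: "x \<in> K" using K_closed(8)[OF nK(2,1)] n by simp
  have nZ: "n \<in> ZK" using n(1) N(1) by auto
  obtain c :: nat where c: "c > 0" "of_nat c / n \<in> ZK" using norm_multiple nZ n(2) by metis
  have cN: "of_nat c \<in> N" using N(4)[OF c(2) n(1)] n by simp
  \<comment> \<open>Generators of \<open>N\<close> over the integers: reducing an element of
    \<open>N\<close> modulo \<open>c\<close> leaves a remainder that lies both in
    \<open>Box c\<close> and in \<open>N\<close>.\<close>
  define G where "G = (Box c \<inter> N) \<union> range (\<lambda>i. of_nat c * \<omega> i)"
  have finG: "finite G" unfolding G_def using Box(1) by simp
  have cw: "of_nat c * w \<in> N" if "w \<in> ZK" for w using N(4)[OF that cN] by (simp add: mult.commute)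
  have GN: "G \<subseteq> N" unfolding G_def using cw[OF omega_ZK] by auto
  have span: "m \<in> int_mod.span G" if m: "m \<in> N" for m
  proof -
    obtain b w where b: "b \<in> Box c" "m = b + of_nat c * fc (int_to_rat_vec w)" using Box_reduce[OF _ c(1), of m] m N by blast
    have cwN: "of_nat c * fc (int_to_rat_vec w) \<in> N" using cw fc_int_in_ZK by blast
    have "- 1 * (of_nat c * fc (int_to_rat_vec w)) \<in> N" using N(4)[OF ZK_closed(5)[OF ZK_closed(2)] cwN] by simp
    then have "m + - 1 * (of_nat c * fc (int_to_rat_vec w)) \<in> N" using N(3)[OF m] by blast
    then have bG: "b \<in> G" using b unfolding G_def by simp
    have "of_nat c * fc (int_to_rat_vec w) = (\<Sum>i\<in>UNIV. of_int (w $ i) * (of_nat c * \<omega> i))"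
      unfolding from_coords_def by (simp add: sum_distrib_left mult.left_commute)
    also have "\<dots> \<in> int_mod.span G"
      by (intro int_mod.span_sum int_mod.span_scale int_mod.span_base) (auto simp: G_def)
    finally show ?thesis using b int_mod.span_add[OF int_mod.span_base[OF bG]] by simp
  qed
  have "\<exists>a. x * g = (\<Sum>h\<in>G. of_int (a h) * h)" if "g \<in> G" for g
    using span[OF N(5)] that GN int_mod.span_finite[OF finG] by blast
  then obtain a where a: "\<And>g. g \<in> G \<Longrightarrow> x * g = (\<Sum>h\<in>G. of_int (a g h) * h)" by metis
  have om: "\<omega> i \<noteq> 0" for i
  proof
    assume "\<omega> i = 0"
    then have "int_to_rat_vec (axis i 1) = (0 :: rat ^ 'n)" using omega_fc fc_eq_0 by metis
    then have "int_to_rat_vec (axis i 1) $ i = (0 :: rat ^ 'n) $ i" by simp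
    then show False by (simp add: axis_def)
  qed
  have "algebraic_int x"
    by (rule algebraic_int_of_stable_module[of G "of_nat c * \<omega> undefined" "\<lambda>g. g" x a])
      (use finG om c a in \<open>auto simp: G_def\<close>)
  then show "x \<in> ZK" using xK by (simp add: ring_of_integers_def)
qed (use ZK_closed in auto)

text \<open>Each \<open>q\<close> becomes a principal ideal above that of \<open>c\<close>. No
  element of \<open>Q\<close> divides another one, so in particular no two are associated and
  distinct \<open>q\<close> give distinct ideals.\<close>

lemma divisor_count:
  assumes "\<delta> > 0"
  shows "\<exists>C>0. \<forall>c Q. c > (0::nat) \<longrightarrow> (\<forall>q\<in>Q. q \<in> ZK \<and> q \<noteq> 0 \<and> of_nat c / q \<in> ZK) \<longrightarrow>
    (\<forall>q\<in>Q. \<forall>q'\<in>Q. q / q' \<in> ZK \<longrightarrow> q = q') \<longrightarrow> real (card Q) \<le> C * real c powr \<delta>"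
proof -
  interpret integrally_closed_order ZK by (rule order_ZK)
  \<comment> \<open>The ideal of \<open>c\<close> has index at most \<open>c ^ n\<close>, so the
    exponent is divided by \<open>n\<close> in advance.\<close>
  have d: "\<delta> / CARD('n) > 0" using assms by simp
  obtain C where C: "C > 0"
    "\<And>I. nzideal I \<Longrightarrow> real (card {J. nzideal J \<and> I \<subseteq> J}) \<le> C * real (idx I) powr (\<delta> / CARD('n))"
    using overideals_bound[OF d] by blast
  show ?thesis
  proof (intro exI[of _ C] conjI allI impI C(1))
    fix c :: nat and Q
    assume c: "c > 0" and Q': "\<forall>q\<in>Q. q \<in> ZK \<and> q \<noteq> 0 \<and> of_nat c / q \<in> ZK"
      and na: "\<forall>q\<in>Q. \<forall>q'\<in>Q. q / q' \<in> ZK \<longrightarrow> q = q'"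
    have Q: "q \<in> ZK \<and> q \<noteq> 0 \<and> of_nat c / q \<in> ZK" if "q \<in> Q" for q using Q' that by blast
    have nz: "nzideal ((*) q ` ZK)" if "q \<in> ZK" "q \<noteq> 0" for q
      unfolding nzideal_def using submod_principal[of q] that ZK_closed(2,4) by (auto intro!: bexI[of _ 1])
    let ?I = "(*) (of_nat c) ` ZK"
    have I: "nzideal ?I" using nz[OF ZK_of_nat] c by simp
    have "card Q \<le> card {J. nzideal J \<and> ?I \<subseteq> J}"
    proof (rule card_inj_on_le)
      show "inj_on (\<lambda>q. (*) q ` ZK) Q"
      proof (rule inj_onI)
        fix q q' assume q: "q \<in> Q" "q' \<in> Q" "(*) q ` ZK = (*) q' ` ZK"
        then have "q * 1 \<in> (*) q' ` ZK" using ZK_closed(2) by blast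
        then obtain r where "r \<in> ZK" "q = q' * r" by auto
        then have "q / q' \<in> ZK" using Q q by simp
        then show "q = q'" using na q by blast
      qed
      show "(\<lambda>q. (*) q ` ZK) ` Q \<subseteq> {J. nzideal J \<and> ?I \<subseteq> J}"
      proof (clarsimp, intro conjI subsetI)
        fix q assume q: "q \<in> Q"
        then show "nzideal ((*) q ` ZK)" using Q nz by blast
        fix x assume "x \<in> ?I"
        then obtain r where r: "r \<in> ZK" "x = of_nat c * r" by blast
        then have "x = q * (of_nat c / q * r)" "of_nat c / q * r \<in> ZK" using Q[OF q] ZK_closed(4)[OF _ r(1), of "of_nat c / q"] by simp_all
        then show "x \<in> (*) q ` ZK" by blast
      qed
      show "finite {J. nzideal J \<and> ?I \<subseteq> J}" by (rule finite_overideals[OF I])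
    qed
    then have "real (card Q) \<le> C * real (idx ?I) powr (\<delta> / CARD('n))"
      using C(2)[OF I] by linarith
    also have "\<dots> \<le> C * real (c ^ CARD('n)) powr (\<delta> / CARD('n))"
    proof -
      have "coset ?I ` ZK \<subseteq> coset ?I ` Box c"
      proof
        fix X assume "X \<in> coset ?I ` ZK"
        then obtain x where x: "x \<in> ZK" "X = coset ?I x" by blast
        obtain b w where b: "b \<in> Box c" "x = b + of_nat c * fc (int_to_rat_vec w)" using Box_reduce[OF x(1) c] by blast
        have "x - b \<in> ?I" using b fc_int_in_ZK by auto
        then have "X = coset ?I b" using coset_eq_iff[OF submod_principal x(1), of b] Box(3) b x by blast
        then show "X \<in> coset ?I ` Box c" using b by blast
      qed
      then have "idx ?I \<le> card (Box c)" unfolding idx_def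
        by (meson Box(1) card_image_le card_mono finite_imageI le_trans)
      then have "idx ?I \<le> c ^ CARD('n)" using Box(2) le_trans by blast
      then have "real (idx ?I) \<le> real (c ^ CARD('n))" by (simp only: of_nat_le_iff)
      then show ?thesis using C(1) d by (intro mult_left_mono powr_mono2) auto
    qed
    also have "real (c ^ CARD('n)) powr (\<delta> / CARD('n)) = real c powr \<delta>"
      using c by (simp add: powr_realpow[symmetric] powr_powr)
    finally show "real (card Q) \<le> C * real c powr \<delta>" .
  qed
qed

text \<open>Every rational functional on \<open>K\<close> is \<open>y \<mapsto> \<pi> (\<kappa> y)\<close> for a unique \<open>\<kappa>\<close>, where \<open>\<pi>\<close> is one fixed
  coordinate; up to a common denominator, \<open>h m\<close> is this \<open>\<kappa>\<close> for the functional \<open>y \<mapsto> m \<bullet> y\<close>.\<close>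

lemma dual_element:
  obtains C h where "C > 0" "\<And>m. m \<noteq> 0 \<Longrightarrow> h m \<in> ZK \<and> h m \<noteq> 0 \<and> nrm (h m) \<le> C * infnorm (ivec m)"
    "\<And>m q. q \<in> K \<Longrightarrow> q \<noteq> 0 \<Longrightarrow> (\<And>i. (\<Sum>j\<in>UNIV. of_int (m $ j) * co (\<omega> i / q) $ j) \<in> \<int>) \<Longrightarrow> h m / q \<in> ZK"
proof -
  define i0 :: 'n where "i0 = undefined"
  define T :: "rat ^ 'n ^ 'n" where "T = (\<chi> j i. co (\<omega> i * \<omega> j) $ i0)"
  have pair: "co (x * y) $ i0 = (\<Sum>j\<in>UNIV. co y $ j * co (x * \<omega> j) $ i0)" if "x \<in> K" "y \<in> K" for x y
  proof -
    have "x * y = (\<Sum>j\<in>UNIV. of_rat (co y $ j) * (x * \<omega> j))"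
      by (subst (1) expand[OF that(2)]) (simp only: sum_distrib_left mult.left_commute)
    then have "co (x * y) = (\<Sum>j\<in>UNIV. co y $ j *s co (x * \<omega> j))"
      using that omega_K by (simp only: co_sum co_scale K_closed K_of_rat)
    then show ?thesis by simp
  qed
  have Tv: "(T *v v) $ j = co (fc v * \<omega> j) $ i0" for v j
    using pair[OF omega_K[of j] fc_in_K[of v]]
    by (simp add: matrix_vector_mult_def T_def mult.commute)
  \<comment> \<open>The form sending \<open>(x, y)\<close> to the coordinate \<open>i0\<close> of
    \<open>x * y\<close> is nondegenerate: for \<open>fc v \<noteq> 0\<close> the choice
    \<open>y = \<omega> i0 / fc v\<close> gives the value 1.\<close>
  have "v = 0" if v: "T *v v = 0" for v
  proof (rule ccontr)
    assume "v \<noteq> 0"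
    then have f0: "fc v \<noteq> 0" using fc_eq_0 by blast
    have z: "co (fc v * y) $ i0 = 0" if "y \<in> K" for y
      using pair[OF fc_in_K that, of v] Tv[of v] v by simp
    have "co (fc v * (\<omega> i0 / fc v)) $ i0 = 0" by (intro z K_closed omega_K fc_in_K)
    moreover have "fc v * (\<omega> i0 / fc v) = \<omega> i0" using f0 by simp
    ultimately show False by (simp add: omega_fc axis_def)
  qed
  then obtain S where ST: "S ** T = mat 1" using matrix_left_invertible_ker[of T] by auto
  then have TS: "T ** S = mat 1" by (simp add: matrix_left_right_inverse)
  obtain D :: nat where D: "D > 0" "\<And>i j. of_nat D * S $ i $ j \<in> \<int>"
    using common_denominator_matrix[of "\<lambda>i j. S $ i $ j"] by blast
  define h where "h m = fc (of_nat D *s (S *v int_to_rat_vec m))" for m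
  have Sint: "of_nat D * (S *v int_to_rat_vec m) $ i \<in> \<int>" for m i
  proof -
    have "of_nat D * (S *v int_to_rat_vec m) $ i = (\<Sum>j\<in>UNIV. (of_nat D * S $ i $ j) * of_int (m $ j))"
      by (simp add: matrix_vector_mult_def sum_distrib_left mult.assoc)
    also have "\<dots> \<in> \<int>" by (intro Ints_sum Ints_mult[OF D(2)]) simp
    finally show ?thesis .
  qed
  have hZ: "h m \<in> ZK" for m using ZK_iff[OF fc_in_K] Sint by (simp add: h_def)
  define C where "C = 1 + (\<Sum>i\<in>UNIV. \<Sum>j\<in>UNIV. \<bar>real_of_rat (of_nat D * S $ i $ j)\<bar>)"
  have C: "C > 0" unfolding C_def by (intro add_pos_nonneg sum_nonneg) auto
  show thesis
  proof (rule that[OF C, of h])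
    fix m :: "int ^ 'n" assume m: "m \<noteq> 0"
    have "h m \<noteq> 0"
    proof
      assume "h m = 0"
      then have "of_nat D *s (S *v int_to_rat_vec m) = 0" unfolding h_def by (rule fc_eq_0)
      then have "S *v int_to_rat_vec m = 0" using D(1) by (simp add: vec_eq_iff)
      then have "T *v (S *v int_to_rat_vec m) = 0" by simp
      then have "int_to_rat_vec m = 0" by (simp add: matrix_vector_mul_assoc TS)
      then show False using m by (simp add: vec_eq_iff int_to_rat_vec_def)
    qed
    moreover have "nrm (h m) \<le> C * infnorm (ivec m)"
    proof (unfold nrm_le_iff, intro allI)
      fix i
      have "real_of_rat (co (h m) $ i) = (\<Sum>j\<in>UNIV. real_of_rat (of_nat D * S $ i $ j) * real_of_int (m $ j))"
        by (simp add: h_def matrix_vector_mult_def sum_distrib_left mult.assoc of_rat_sum of_rat_mult)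
      also have "\<bar>\<dots>\<bar> \<le> (\<Sum>j\<in>UNIV. \<bar>real_of_rat (of_nat D * S $ i $ j)\<bar> * infnorm (ivec m))"
        using component_le_infnorm_cart[of "ivec m"]
        by (intro order_trans[OF sum_abs] sum_mono) (auto simp: abs_mult intro!: mult_left_mono)
      also have "\<dots> = (\<Sum>j\<in>UNIV. \<bar>real_of_rat (of_nat D * S $ i $ j)\<bar>) * infnorm (ivec m)"
        by (simp add: sum_distrib_right)
      also have "\<dots> \<le> C * infnorm (ivec m)"
        using member_le_sum[of i UNIV "\<lambda>i. \<Sum>j\<in>UNIV. \<bar>real_of_rat (of_nat D * S $ i $ j)\<bar>"]
        by (intro mult_right_mono infnorm_pos_le) (auto simp: C_def sum_nonneg)
      finally show "\<bar>real_of_rat (co (h m) $ i)\<bar> \<le> C * infnorm (ivec m)" .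
    qed
    ultimately show "h m \<in> ZK \<and> h m \<noteq> 0 \<and> nrm (h m) \<le> C * infnorm (ivec m)" using hZ by blast
  next
    fix m :: "int ^ 'n" and q
    assume q: "q \<in> K" "q \<noteq> 0" and int: "\<And>i. (\<Sum>j\<in>UNIV. of_int (m $ j) * co (\<omega> i / q) $ j) \<in> \<int>"
    define v where "v = S *v int_to_rat_vec m"
    have Tm: "T *v v = int_to_rat_vec m" unfolding v_def by (simp add: matrix_vector_mul_assoc TS)
    have kq: "fc v / q \<in> K" by (intro K_closed fc_in_K q)
    \<comment> \<open>The functional of \<open>m\<close>, composed with division by
      \<open>q\<close>, takes integer values on the basis and is thus the functional of an integer
      vector. Its dual element is that of \<open>m\<close> divided by \<open>q\<close>, so clearing
      the fixed denominator \<open>D\<close> makes it integral.\<close>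
    define m' :: "int ^ 'n" where "m' = (\<chi> i. \<lfloor>\<Sum>j\<in>UNIV. of_int (m $ j) * co (\<omega> i / q) $ j\<rfloor>)"
    have "T *v co (fc v / q) = int_to_rat_vec m'"
    proof (simp only: vec_eq_iff, intro allI)
      fix i
      have "(T *v co (fc v / q)) $ i = co (fc v / q * \<omega> i) $ i0" using Tv[of "co (fc v / q)"] fc_co[OF kq] by simp
      also have "fc v / q * \<omega> i = fc v * (\<omega> i / q)" by simp
      also have "co (fc v * (\<omega> i / q)) $ i0 = (\<Sum>j\<in>UNIV. co (\<omega> i / q) $ j * co (fc v * \<omega> j) $ i0)"
        by (intro pair K_closed omega_K q fc_in_K)
      also have "\<dots> = (\<Sum>j\<in>UNIV. of_int (m $ j) * co (\<omega> i / q) $ j)"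
        using Tv[of v] Tm by (simp add: mult.commute flip: Tv)
      also have "\<dots> = of_int (m' $ i)" using int[of i] by (simp add: m'_def)
      finally show "(T *v co (fc v / q)) $ i = int_to_rat_vec m' $ i" by simp
    qed
    then have "S *v (T *v co (fc v / q)) = S *v int_to_rat_vec m'" by simp
    then have "co (fc v / q) = S *v int_to_rat_vec m'" by (simp add: matrix_vector_mul_assoc ST)
    then have "fc v / q = fc (S *v int_to_rat_vec m')" using fc_co[OF kq] by simp
    then have "of_nat D * (fc v / q) = h m'" unfolding h_def by (simp only: fc_scale of_rat_of_nat_eq)
    moreover have "h m / q = of_nat D * (fc v / q)" unfolding h_def v_def by (simp only: fc_scale of_rat_of_nat_eq times_divide_eq_right)
    ultimately show "h m / q \<in> ZK" using hZ by simp
  qed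
qed

section \<open>Quotients of integer vectors in coordinates\<close>

lemma inj_fc_int: "inj_on (\<lambda>q. fc (int_to_rat_vec q)) S"
proof (rule inj_onI)
  fix q q' :: "int ^ 'n" assume "fc (int_to_rat_vec q) = fc (int_to_rat_vec q')"
  then have "int_to_rat_vec q = (int_to_rat_vec q' :: rat ^ 'n)" by (rule fc_inj)
  then show "q = q'" by (simp add: vec_eq_iff)
qed

lemma nrm_fc_int: "nrm (fc (int_to_rat_vec q)) = infnorm (ivec q)"
  by (simp add: nrm_def rat_to_real_int_to_rat)

lemma quot_vec_co: "quot_vec \<omega> r q = rat_to_real_vec (co (fc (int_to_rat_vec r) / fc (int_to_rat_vec q)))"
  by (simp add: quot_vec_def)

lemma fc_int_eq_0_iff: "fc (int_to_rat_vec q) = 0 \<longleftrightarrow> q = 0"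
proof
  assume "fc (int_to_rat_vec q) = 0"
  then have "int_to_rat_vec q = 0" by (rule fc_eq_0)
  then show "q = 0" by (simp add: vec_eq_iff int_to_rat_vec_def)
next
  assume "q = 0"
  then have "int_to_rat_vec q = 0" by (simp add: vec_eq_iff)
  then show "fc (int_to_rat_vec q) = 0" by (simp add: fc_0)
qed

lemma quot_vec_expand:
  "quot_vec \<omega> r q = (\<Sum>i\<in>UNIV. real_of_int (r $ i) *\<^sub>R quot_vec \<omega> (axis i 1) q)"
proof -
  let ?q = "fc (int_to_rat_vec q)"
  have K: "\<omega> i / ?q \<in> K" for i by (intro K_closed omega_K fc_in_K)
  have "fc (int_to_rat_vec r) / ?q = (\<Sum>i\<in>UNIV. of_rat (of_int (r $ i)) * (\<omega> i / ?q))"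
    unfolding from_coords_def[of \<omega> "int_to_rat_vec r"] by (simp add: sum_divide_distrib)
  also have "co \<dots> = (\<Sum>i\<in>UNIV. of_int (r $ i) *s co (\<omega> i / ?q))"
    by (simp only: co_sum co_scale K K_closed K_of_rat)
  finally show ?thesis
    by (simp add: quot_vec_co omega_fc[symmetric] vec_eq_iff of_rat_sum of_rat_mult)
qed

text \<open>The quotients with a fixed denominator are invariant under integer translations. This is
  why a periodic kernel can detect them.\<close>

lemma quot_vec_shift:
  assumes "q \<noteq> 0" obtains r' where "quot_vec \<omega> r' q = quot_vec \<omega> r q + ivec z"
proof -
  let ?f = "\<lambda>z. fc (int_to_rat_vec z)"
  have "?f r + ?f q * ?f z \<in> ZK" by (intro ZK_closed fc_int_in_ZK)
  then obtain r' where r': "?f r' = ?f r + ?f q * ?f z" using ex_fc_int by metis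
  have "?f q \<noteq> 0" using assms fc_int_eq_0_iff by blast
  then have "?f r' / ?f q = ?f r / ?f q + ?f z" unfolding r' by (simp add: add_divide_distrib)
  then have "co (?f r' / ?f q) = co (?f r / ?f q) + int_to_rat_vec z"
    by (simp add: co_add K_closed fc_in_K)
  then have "quot_vec \<omega> r' q = quot_vec \<omega> r q + ivec z"
    by (simp add: quot_vec_co rat_to_real_vec_linear rat_to_real_int_to_rat)
  then show thesis using that by blast
qed

text \<open>With such an \<open>N\<close>, the combinations of the vectors
  \<open>quot_vec \<omega> (axis i 1) q\<close> with coefficients below \<open>N\<close> represent
  all quotients \<open>r / q\<close> modulo integer vectors. Averages over the quotients thereby
  become finite character sums.\<close>

lemma quot_vec_denominator:
  obtains N :: nat where "N > 0" "\<And>i j. real N * quot_vec \<omega> (axis i 1) q $ j \<in> \<int>"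
proof -
  let ?x = "\<lambda>i. fc (int_to_rat_vec (axis i 1)) / fc (int_to_rat_vec q)"
  obtain N :: nat where N: "N > 0" "\<And>i j. of_nat N * co (?x i) $ j \<in> \<int>"
    using common_denominator_matrix[of "\<lambda>i j. co (?x i) $ j"] by blast
  have "real N * quot_vec \<omega> (axis i 1) q $ j \<in> \<int>" for i j
  proof -
    have "real_of_rat (of_nat N * co (?x i) $ j) \<in> \<int>" using N(2)[of i j] by (simp only: of_rat_in_Ints_iff)
    then show ?thesis by (simp add: quot_vec_co of_rat_mult)
  qed
  then show thesis using that N(1) by blast
qed

text \<open>This is \<open>r = q * (r / q)\<close>. It limits the numerators that a denominator can
  have in a bounded region, which serves both the covering count and the passage from infinitely
  many pairs to large denominators.\<close>

lemma infnorm_numerator_le: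
  assumes "q \<noteq> 0" shows "infnorm (ivec r) \<le> Cm * infnorm (ivec q) * infnorm (quot_vec \<omega> r q)"
proof -
  let ?f = "\<lambda>z. fc (int_to_rat_vec z)"
  have "?f q \<noteq> 0" using assms fc_int_eq_0_iff by blast
  then have "nrm (?f r) = nrm (?f q * (?f r / ?f q))" by simp
  also have "\<dots> \<le> Cm * nrm (?f q) * nrm (?f r / ?f q)" by (intro nrm_mult K_closed fc_in_K)
  finally show ?thesis by (simp only: nrm_fc_int) (simp add: nrm_def quot_vec_co)
qed

text \<open>The denominators are taken in a narrow cone around \<open>1\<close>: the quotient of two associated
  ones is then a unit at distance less than \<open>1\<close> from \<open>1\<close>, hence equal to \<open>1\<close>.\<close>

theorem denominator_family:
  obtains Q :: "nat \<Rightarrow> (int ^ 'n) set" and c C :: real where "c > 0" "C > 0"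
    "\<And>M. M \<ge> 1 \<Longrightarrow> finite (Q M) \<and> c * real M ^ CARD('n) \<le> real (card (Q M))"
    "\<And>M q. M \<ge> 1 \<Longrightarrow> q \<in> Q M \<Longrightarrow> real M / 2 \<le> infnorm (ivec q) \<and> infnorm (ivec q) \<le> C * real M"
    "\<And>\<delta>. \<delta> > 0 \<Longrightarrow> \<exists>B>0. \<forall>M\<ge>1. \<forall>m. m \<noteq> 0 \<longrightarrow>
      real (card {q \<in> Q M. \<forall>i. ivec m \<bullet> quot_vec \<omega> (axis i 1) q \<in> \<int>}) \<le> B * infnorm (ivec m) powr \<delta>"
proof -
  let ?f = "\<lambda>z. fc (int_to_rat_vec z)"
  have one: "(1::'k) \<in> K" "(1::'k) \<in> ZK" by (rule K_closed ZK_closed)+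
  have e1: "nrm 1 \<ge> 1" using nrm_ZK_less_1[OF one(2)] by force
  \<comment> \<open>The 8 makes the final estimate for \<open>q / q' - 1\<close> equal to
    \<open>2 * (Cm * g) * (2 * nrm 1) = 1 / 2\<close>; the factor \<open>Cm\<close> compensates for
    the lack of multiplicativity of \<open>nrm\<close>.\<close>
  define g where "g = 1 / (8 * Cm * nrm 1)"
  have g: "g > 0" "Cm * g * nrm 1 = 1 / 8" "Cm * g \<le> 1 / 8" "g \<le> 1 / 8"
  proof -
    show "g > 0" "Cm * g * nrm 1 = 1 / 8" using Cm_ge_1 e1 by (auto simp: g_def)
    have "8 * 1 * 1 \<le> 8 * Cm * nrm 1" using Cm_ge_1 e1 by (intro mult_mono) auto
    then show "g \<le> 1 / 8" unfolding g_def by (intro divide_left_mono) auto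
    have "Cm * g = 1 / (8 * nrm 1)" using Cm_ge_1 by (simp add: g_def)
    also have "\<dots> \<le> 1 / 8" using e1 by (intro divide_left_mono) auto
    finally show "Cm * g \<le> 1 / 8" .
  qed
  define Q where "Q M = {q. nrm (?f q - of_nat M) \<le> g * real M}" for M :: nat
  have MK: "of_nat M \<in> K" and nM: "nrm (of_nat M) = real M * nrm 1" for M :: nat
    using ZK_subset[OF ZK_of_nat] nrm_scale_int[OF one(1), of "int M"] by auto
  have size: "real M / 2 \<le> nrm (?f q) \<and> nrm (?f q) \<le> (nrm 1 + 1) * real M" if q: "q \<in> Q M" for q M
  proof -
    have d: "nrm (?f q - of_nat M) \<le> real M / 8"
      using q g(4) mult_right_mono[of g "1 / 8" "real M"] by (simp add: Q_def)
    have "nrm (?f q) \<le> nrm (of_nat M) + nrm (?f q - of_nat M)"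
      using nrm_add[OF MK K_closed(7)[OF fc_in_K MK], of M "int_to_rat_vec q" M] by simp
    moreover have "nrm (of_nat M) \<le> nrm (?f q) + nrm (?f q - of_nat M)"
      using nrm_diff[OF fc_in_K K_closed(7)[OF fc_in_K MK], of "int_to_rat_vec q" "int_to_rat_vec q" M] by simp
    moreover have "real M \<le> real M * nrm 1" using mult_left_mono[OF e1, of "real M"] by simp
    ultimately show ?thesis using d nM[of M] by (simp add: algebra_simps)
  qed
  have nonassoc: "q = q'" if q: "q \<in> Q M" "q' \<in> Q M" "M \<ge> 1" and u: "?f q / ?f q' \<in> ZK" for q q' M
  proof -
    let ?M = "of_nat M :: 'k"
    have M0: "real M > 0" using q by simp
    have nz: "?f q' \<noteq> 0" using size[OF q(2)] M0 nrm_0 by force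
    define y where "y = 1 / ?f q'"
    have yK: "y \<in> K" unfolding y_def by (intro K_closed fc_in_K)
    have vK: "?f q' - ?M \<in> K" "?f q - ?M \<in> K" by (intro K_closed fc_in_K MK)+
    \<comment> \<open>The norm of \<open>y = 1 / q'\<close> is bounded by absorption: it reappears
      on the right with the factor \<open>1 / 8\<close>.\<close>
    have "?M * y = 1 - (?f q' - ?M) * y" using nz by (simp add: y_def field_simps)
    then have "nrm (?M * y) \<le> nrm 1 + nrm ((?f q' - ?M) * y)"
      using nrm_diff[OF one(1) K_closed(4)[OF vK(1) yK]] by simp
    also have "\<dots> \<le> nrm 1 + Cm * (g * real M) * nrm y"
      using nrm_mult[OF vK(1) yK] q(2) Cm_ge_1 nrm_nonneg[of y]
      by (intro add_left_mono order_trans[OF nrm_mult[OF vK(1) yK]] mult_right_mono mult_left_mono) (auto simp: Q_def)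
    also have "\<dots> \<le> nrm 1 + 1 / 8 * (real M * nrm y)"
      using mult_right_mono[OF g(3), of "real M * nrm y"] nrm_nonneg[of y] by (simp add: mult_ac)
    finally have "real M * nrm y \<le> nrm 1 + 1 / 8 * (real M * nrm y)"
      using nrm_scale_int[OF yK, of "int M"] by simp
    then have My: "real M * nrm y \<le> 2 * nrm 1" using nrm_nonneg[of 1] by linarith
    have K1: "(?f q - ?M) - (?f q' - ?M) \<in> K" by (intro K_closed vK)
    have "?f q / ?f q' - 1 = ((?f q - ?M) - (?f q' - ?M)) * y" using nz by (simp add: y_def field_simps)
    then have "nrm (?f q / ?f q' - 1) \<le> Cm * nrm ((?f q - ?M) - (?f q' - ?M)) * nrm y"
      using nrm_mult[OF K1 yK] by simp
    also have "\<dots> \<le> Cm * (2 * (g * real M)) * nrm y"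
      using nrm_diff[OF vK(2,1)] q(1,2) Cm_ge_1 nrm_nonneg[of y]
      by (intro mult_right_mono mult_left_mono) (auto simp: Q_def)
    also have "\<dots> = 2 * (Cm * g) * (real M * nrm y)" by simp
    also have "\<dots> \<le> 2 * (Cm * g) * (2 * nrm 1)" using My g(1) Cm_ge_1 by (intro mult_left_mono) auto
    also have "\<dots> = 1 / 2" using g(2) by simp
    finally have "nrm (?f q / ?f q' - 1) < 1" by simp
    then have "?f q / ?f q' - 1 = 0" using nrm_ZK_less_1[OF ZK_closed(6)[OF u one(2)]] by blast
    then have "?f q = ?f q'" using nz by simp
    then have "int_to_rat_vec q = (int_to_rat_vec q' :: rat ^ 'n)" by (rule fc_inj)
    then show "q = q'" by (simp add: vec_eq_iff)
  qed
  have cardQ: "finite (Q M) \<and> g ^ CARD('n) * real M ^ CARD('n) \<le> real (card (Q M))" if M: "M \<ge> 1" for M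
  proof -
    obtain z1 where z1: "(1::'k) = ?f z1" using ex_fc_int[OF one(2)] by blast
    define t where "t = \<lfloor>g * real M\<rfloor>"
    have t0: "t \<ge> 0" using g(1) by (simp add: t_def)
    have "Q M \<subseteq> (\<lambda>q. ?f q) -` {x \<in> ZK. nrm x \<le> (nrm 1 + 1) * real M}"
      using size fc_int_in_ZK by auto
    then have fin: "finite (Q M)"
      using finite_vimageI[OF finite_ZK_bounded inj_fc_int] finite_subset by blast
    let ?Z = "{z :: int ^ 'n. \<forall>i. \<bar>z $ i\<bar> \<le> t}"
    have "card ?Z \<le> card (Q M)"
    proof (rule card_inj_on_le[OF _ _ fin])
      show "inj_on (\<lambda>z. z + int M *s z1) ?Z" by (simp add: inj_on_def)
      show "(\<lambda>z. z + int M *s z1) ` ?Z \<subseteq> Q M"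
      proof (clarsimp simp: Q_def)
        fix z :: "int ^ 'n" assume z: "\<forall>i. \<bar>z $ i\<bar> \<le> t"
        have "int_to_rat_vec (z + int M *s z1) = (int_to_rat_vec z + of_nat M *s int_to_rat_vec z1 :: rat ^ 'n)"
          by (simp add: vec_eq_iff)
        then have "?f (z + int M *s z1) = ?f z + of_nat M * ?f z1"
          by (simp only: fc_add fc_scale of_rat_of_nat_eq)
        then have "?f (z + int M *s z1) - of_nat M = ?f z" using z1 by simp
        moreover have "nrm (?f z) \<le> g * real M" unfolding nrm_fc_int infnorm_le_iff
        proof
          fix i
          have "real_of_int \<bar>z $ i\<bar> \<le> real_of_int t" using z by (simp only: of_int_le_iff)
          then show "\<bar>ivec z $ i\<bar> \<le> g * real M"
            by (intro order_trans[OF _ of_int_floor_le[of "g * real M"]]) (simp add: t_def)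
        qed
        ultimately show "nrm (?f (z + int M *s z1) - of_nat M) \<le> g * real M" by simp
      qed
    qed
    moreover have "(g * real M) ^ CARD('n) \<le> real (card ?Z)"
    proof -
      have "g * real M \<le> real (nat (2 * t + 1))" using t0 unfolding t_def by linarith
      then have "(g * real M) ^ CARD('n) \<le> real (nat (2 * t + 1)) ^ CARD('n)"
        using g(1) by (intro power_mono) auto
      then show ?thesis unfolding card_int_box(1)[OF t0] by simp
    qed
    ultimately show ?thesis using fin by (simp add: power_mult_distrib)
  qed
  show thesis
  proof (rule that[of "g ^ CARD('n)" "nrm 1 + 1" Q])
    show "g ^ CARD('n) > 0" "nrm 1 + 1 > 0" using g(1) nrm_nonneg[of 1] by auto
  next
    fix \<delta> :: real assume \<delta>: "\<delta> > 0"
    obtain B1 where B1: "B1 > 0" "\<And>a. a \<in> ZK \<Longrightarrow> a \<noteq> 0 \<Longrightarrow>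
      \<exists>c::nat. c > 0 \<and> real c \<le> B1 * nrm a ^ CARD('n) \<and> of_nat c / a \<in> ZK"
      using norm_multiple by blast
    obtain C2 h where h: "C2 > 0" "\<And>m. m \<noteq> 0 \<Longrightarrow> h m \<in> ZK \<and> h m \<noteq> 0 \<and> nrm (h m) \<le> C2 * infnorm (ivec m)"
      "\<And>m q. q \<in> K \<Longrightarrow> q \<noteq> 0 \<Longrightarrow> (\<And>i. (\<Sum>j\<in>UNIV. of_int (m $ j) * co (\<omega> i / q) $ j) \<in> \<int>) \<Longrightarrow> h m / q \<in> ZK"
      using dual_element by blast
    have d': "\<delta> / CARD('n) > 0" using \<delta> by simp
    obtain C3 where C3: "C3 > 0" and C3': "\<forall>c Q. c > (0::nat) \<longrightarrow> (\<forall>q\<in>Q. q \<in> ZK \<and> q \<noteq> 0 \<and> of_nat c / q \<in> ZK) \<longrightarrow>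
      (\<forall>q\<in>Q. \<forall>q'\<in>Q. q / q' \<in> ZK \<longrightarrow> q = q') \<longrightarrow> real (card Q) \<le> C3 * real c powr (\<delta> / CARD('n))"
      using divisor_count[OF d'] by blast
    \<comment> \<open>Three bounds are composed: \<open>q\<close> divides \<open>h m\<close>;
      \<open>h m\<close> divides an integer \<open>c\<close> of size \<open>O(|m| ^ n)\<close>; and
      \<open>c\<close> has \<open>O(c powr (\<delta> / n))\<close> divisors among the
      denominators.\<close>
    define B where "B = C3 * (B1 * C2 ^ CARD('n)) powr (\<delta> / CARD('n))"
    have "real (card {q \<in> Q M. \<forall>i. ivec m \<bullet> quot_vec \<omega> (axis i 1) q \<in> \<int>}) \<le> B * infnorm (ivec m) powr \<delta>"
      if M: "M \<ge> 1" and m: "m \<noteq> 0" for M m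
    proof -
      let ?S = "{q \<in> Q M. \<forall>i. ivec m \<bullet> quot_vec \<omega> (axis i 1) q \<in> \<int>}"
      obtain c :: nat where c: "c > 0" "real c \<le> B1 * nrm (h m) ^ CARD('n)" "of_nat c / h m \<in> ZK"
        using B1(2) h(2)[OF m] by blast
      have "real (card (?f ` ?S)) \<le> C3 * real c powr (\<delta> / CARD('n))"
      proof (rule C3'[rule_format, OF c(1)])
        fix x assume "x \<in> ?f ` ?S"
        then obtain q where q: "q \<in> ?S" "x = ?f q" by blast
        have x0: "x \<noteq> 0" using q size[of q M] M nrm_0 by force
        have "h m / x \<in> ZK"
        proof (rule h(3)[OF _ x0])
          show "x \<in> K" using q fc_in_K by blast
          fix i
          have "real_of_rat (\<Sum>j\<in>UNIV. of_int (m $ j) * co (\<omega> i / x) $ j) = ivec m \<bullet> quot_vec \<omega> (axis i 1) q"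
            by (simp add: inner_vec_def of_rat_sum of_rat_mult quot_vec_co q(2) omega_fc)
          then show "(\<Sum>j\<in>UNIV. of_int (m $ j) * co (\<omega> i / x) $ j) \<in> \<int>"
            using q(1) of_rat_in_Ints_iff by force
        qed
        then have "of_nat c / h m * (h m / x) \<in> ZK" using c(3) ZK_closed(4) by blast
        moreover have "of_nat c / h m * (h m / x) = of_nat c / x" using h(2)[OF m] by simp
        ultimately show "x \<in> ZK \<and> x \<noteq> 0 \<and> of_nat c / x \<in> ZK" using x0 q fc_int_in_ZK by simp
      next
        fix x x' assume "x \<in> ?f ` ?S" "x' \<in> ?f ` ?S" "x / x' \<in> ZK"
        then show "x = x'" using nonassoc M by blast
      qed
      moreover have "card (?f ` ?S) = card ?S"
        by (rule card_image[OF inj_fc_int])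
      moreover have "C3 * real c powr (\<delta> / CARD('n)) \<le> B * infnorm (ivec m) powr \<delta>"
      proof -
        have "real c \<le> B1 * (C2 * infnorm (ivec m)) ^ CARD('n)"
          by (rule order_trans[OF c(2)]) (use h(2)[OF m] B1(1) nrm_nonneg in \<open>auto intro!: mult_left_mono power_mono\<close>)
        also have "\<dots> = (B1 * C2 ^ CARD('n)) * infnorm (ivec m) ^ CARD('n)" by (simp add: power_mult_distrib)
        finally have "real c powr (\<delta> / CARD('n)) \<le> ((B1 * C2 ^ CARD('n)) * infnorm (ivec m) ^ CARD('n)) powr (\<delta> / CARD('n))"
          using d' by (intro powr_mono2) auto
        also have "\<dots> = (B1 * C2 ^ CARD('n)) powr (\<delta> / CARD('n)) * (infnorm (ivec m) ^ CARD('n)) powr (\<delta> / CARD('n))"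
          using B1(1) h(1) infnorm_pos_le by (intro powr_mult)
        also have "(infnorm (ivec m) ^ CARD('n)) powr (\<delta> / CARD('n)) = infnorm (ivec m) powr \<delta>"
        proof -
          have "ivec m \<noteq> 0" using m by (simp add: vec_eq_iff)
          then have "infnorm (ivec m) > 0" by (simp add: infnorm_pos_lt)
          then show ?thesis by (simp add: powr_realpow[symmetric] powr_powr)
        qed
        finally show ?thesis using C3 unfolding B_def by (simp add: mult.assoc)
      qed
      ultimately show ?thesis by simp
    qed
    moreover have "B > 0" unfolding B_def using C3 B1(1) h(1) by simp
    ultimately show "\<exists>B>0. \<forall>M\<ge>1. \<forall>m. m \<noteq> 0 \<longrightarrow>
      real (card {q \<in> Q M. \<forall>i. ivec m \<bullet> quot_vec \<omega> (axis i 1) q \<in> \<int>}) \<le> B * infnorm (ivec m) powr \<delta>" by blast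
  qed (use cardQ size in \<open>auto simp: nrm_fc_int\<close>)
qed

end

section \<open>Trigonometric polynomials\<close>

definition eexp :: "real \<Rightarrow> complex" where
  "eexp t = cis (2 * pi * t)"

lemma eexp_add: "eexp (s + t) = eexp s * eexp t"
  by (simp add: eexp_def cis_mult distrib_left)

lemma eexp_0 [simp]: "eexp 0 = 1"
  by (simp add: eexp_def)

lemma norm_eexp [simp]: "cmod (eexp t) = 1"
  by (simp add: eexp_def)

lemma cnj_eexp: "cnj (eexp t) = eexp (- t)"
  by (simp add: eexp_def cis_cnj)

lemma eexp_power: "eexp t ^ n = eexp (real n * t)"
  by (simp only: eexp_def Complex.DeMoivre) (simp add: mult_ac)

lemma eexp_sum: "eexp (\<Sum>i\<in>S. f i) = (\<Prod>i\<in>S. eexp (f i))"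
  by (induction S rule: infinite_finite_induct) (auto simp: eexp_add)

lemma eexp_eq_1_iff: "eexp t = 1 \<longleftrightarrow> t \<in> \<int>"
proof
  assume "eexp t = 1"
  then have "cos (2 * pi * t) = 1" by (simp add: eexp_def cis.ctr complex_eq_iff)
  then obtain k :: int where "2 * pi * t = real_of_int k * 2 * pi" using cos_one_2pi_int by auto
  then have "t = of_int k" by simp
  then show "t \<in> \<int>" by simp
next
  assume "t \<in> \<int>"
  then obtain k where "t = of_int k" using Ints_cases by blast
  then show "eexp t = 1" by (simp add: eexp_def cis_multiple_2pi)
qed

lemma continuous_on_eexp [continuous_intros]:
  "continuous_on S f \<Longrightarrow> continuous_on S (\<lambda>x. eexp (f x))"
  unfolding eexp_def by (intro continuous_intros)

text \<open>Generated by characters and sums, so that estimates additive in the polynomial need only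
  be proved for a single character.\<close>

inductive trigpoly :: "(real ^ 'n::finite \<Rightarrow> complex) \<Rightarrow> bool" where
  trigpoly_monom: "trigpoly (\<lambda>x. c * eexp (ivec m \<bullet> x))"
| trigpoly_add: "trigpoly f \<Longrightarrow> trigpoly g \<Longrightarrow> trigpoly (\<lambda>x. f x + g x)"

lemma ivec_add: "ivec (m + m') = ivec m + ivec m'" and ivec_0 [simp]: "ivec 0 = 0"
  by (simp_all add: vec_eq_iff)

lemma trigpoly_const: "trigpoly (\<lambda>x. c)"
  using trigpoly_monom[of c 0] by simp

lemma trigpoly_mult_monom: "trigpoly f \<Longrightarrow> trigpoly (\<lambda>x. c * eexp (ivec m \<bullet> x) * f x)"
proof (induction rule: trigpoly.induct)
  case (trigpoly_monom c' m')
  have "(\<lambda>x. c * eexp (ivec m \<bullet> x) * (c' * eexp (ivec m' \<bullet> x))) = (\<lambda>x. (c * c') * eexp (ivec (m + m') \<bullet> x))"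
    by (auto simp: ivec_add inner_add_left eexp_add)
  then show ?case using trigpoly.trigpoly_monom by metis
next
  case (trigpoly_add f g)
  then show ?case using trigpoly.trigpoly_add by (simp add: distrib_left)
qed

lemma trigpoly_mult: "trigpoly f \<Longrightarrow> trigpoly g \<Longrightarrow> trigpoly (\<lambda>x. f x * g x)"
proof (induction rule: trigpoly.induct)
  case (trigpoly_monom c m)
  then show ?case by (rule trigpoly_mult_monom)
next
  case (trigpoly_add f f')
  then show ?case using trigpoly.trigpoly_add by (simp add: distrib_right)
qed

lemma trigpoly_power: "trigpoly f \<Longrightarrow> trigpoly (\<lambda>x. f x ^ k)"
  by (induction k) (auto intro: trigpoly_const trigpoly_mult)

lemma trigpoly_sum: "(\<And>i. i \<in> S \<Longrightarrow> trigpoly (f i)) \<Longrightarrow> trigpoly (\<lambda>x. \<Sum>i\<in>S. f i x)"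
  by (induction S rule: infinite_finite_induct) (auto intro: trigpoly_const trigpoly_add)

lemma trigpoly_continuous: "trigpoly f \<Longrightarrow> continuous_on S f"
  by (induction rule: trigpoly.induct) (intro continuous_intros | assumption)+

lemma trigpoly_bounded: "trigpoly f \<Longrightarrow> \<exists>B. \<forall>x. cmod (f x) \<le> B"
proof (induction rule: trigpoly.induct)
  case (trigpoly_monom c m)
  then show ?case by (auto simp: norm_mult)
next
  case (trigpoly_add f g)
  then obtain A B where "\<forall>x. cmod (f x) \<le> A" "\<forall>x. cmod (g x) \<le> B" by blast
  then have "cmod (f x + g x) \<le> A + B" for x by (meson add_mono norm_triangle_le)
  then show ?case by blast
qed

text \<open>The geometric sum is at most \<open>2 / |eexp t - 1|\<close>. With \<open>s\<close> the
  signed distance from \<open>t\<close> to a nearest integer the denominator equals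
  \<open>2 |sin (pi s)|\<close>, and concavity of the sine gives
  \<open>|sin (pi s)| \<ge> 2 |s|\<close>.\<close>

lemma geometric_eexp_bound:
  assumes "\<And>k::int. \<bar>t - of_int k\<bar> \<ge> \<rho>" "\<rho> > 0"
  shows "cmod (\<Sum>j<L. eexp (real j * t)) \<le> 1 / (2 * \<rho>)"
proof -
  have tz: "t \<notin> \<int>" using assms by (auto elim!: Ints_cases) (metis diff_self abs_zero not_le)
  then have z: "eexp t \<noteq> 1" using eexp_eq_1_iff by blast
  have "(\<Sum>j<L. eexp (real j * t)) = (\<Sum>j<L. eexp t ^ j)" by (simp add: eexp_power)
  also have "\<dots> = (eexp t ^ L - 1) / (eexp t - 1)" by (rule geometric_sum[OF z])
  finally have "cmod (\<Sum>j<L. eexp (real j * t)) = cmod (eexp t ^ L - 1) / cmod (eexp t - 1)"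
    by (simp add: norm_divide)
  also have "\<dots> \<le> 2 / (4 * \<rho>)"
  proof (rule frac_le)
    show "cmod (eexp t ^ L - 1) \<le> 2" using norm_triangle_ineq4[of "eexp t ^ L" 1] by (simp add: eexp_power)
    define k where "k = \<lfloor>t + 1/2\<rfloor>"
    define s where "s = t - of_int k"
    have s: "\<bar>s\<bar> \<le> 1/2" unfolding s_def k_def by linarith
    have "eexp t = eexp s * eexp (of_int k)" by (simp add: s_def eexp_add[symmetric])
    also have "eexp (of_int k) = 1" by (simp add: eexp_eq_1_iff)
    finally have es: "eexp t = eexp s" by simp
    have "(cmod (eexp s - 1))\<^sup>2 = (cos (2 * pi * s) - 1)\<^sup>2 + (sin (2 * pi * s))\<^sup>2"
      by (simp add: eexp_def cmod_power2)
    also have "\<dots> = 2 - 2 * cos (2 * (pi * s))"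
      using sin_cos_squared_add[of "2 * pi * s"] by (simp add: power2_diff algebra_simps)
    also have "\<dots> = (2 * sin (pi * s))\<^sup>2"
      unfolding cos_double_sin by (simp add: power_mult_distrib)
    also have "\<dots> = (2 * \<bar>sin (pi * s)\<bar>)\<^sup>2" by (simp add: power_mult_distrib)
    finally have c: "cmod (eexp s - 1) = 2 * \<bar>sin (pi * s)\<bar>" by (rule power2_eq_imp_eq) simp_all
    have jordan: "2 * u \<le> sin (pi * u)" if "0 \<le> u" "u \<le> 1/2" for u :: real
    proof -
      have "concave_on {0..pi/2} (\<lambda>x. sin x :: real)"
      proof -
        have "convex_on {0..pi/2} (\<lambda>x. - sin x :: real)"
          by (rule f''_ge0_imp_convex[where f' = "\<lambda>x. - cos x" and f'' = "\<lambda>x. sin x"])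
            (auto intro!: derivative_eq_intros sin_ge_zero)
        then show ?thesis by (simp add: concave_on_def)
      qed
      then have "(1 - 2 * u) * sin 0 + (2 * u) * sin (pi / 2) \<le> sin ((1 - 2 * u) *\<^sub>R 0 + (2 * u) *\<^sub>R (pi / 2))"
        by (rule concave_onD) (use that in auto)
      then show ?thesis by (simp add: mult.commute)
    qed
    have "2 * \<bar>s\<bar> \<le> \<bar>sin (pi * s)\<bar>"
    proof (cases "s \<ge> 0")
      case True then show ?thesis using jordan[of s] s by auto
    next
      case False then show ?thesis using jordan[of "- s"] s by auto
    qed
    moreover have "\<bar>s\<bar> \<ge> \<rho>" using assms(1)[of k] by (simp add: s_def)
    ultimately show "4 * \<rho> \<le> cmod (eexp t - 1)" unfolding es c by linarith
  qed (use assms in auto)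
  finally show ?thesis by simp
qed

section \<open>Powers of the Fejer kernel and averages over lattices\<close>

lemma nonneg_coeff_power:
  fixes P :: "complex poly"
  assumes "\<And>i. coeff P i \<in> \<real>\<^sub>\<ge>\<^sub>0" shows "coeff (P ^ k) i \<in> \<real>\<^sub>\<ge>\<^sub>0"
proof (induction k arbitrary: i)
  case 0 then show ?case by (cases i) auto
next
  case (Suc k)
  have "sum f S \<in> \<real>\<^sub>\<ge>\<^sub>0" if "\<And>i. f i \<in> \<real>\<^sub>\<ge>\<^sub>0" for f :: "nat \<Rightarrow> complex" and S
    using that by (induction S rule: infinite_finite_induct) (auto intro: nonneg_Reals_add_I)
  then show ?case using Suc assms by (simp add: coeff_mult nonneg_Reals_mult_I)
qed

text \<open>The normalised \<open>p\<close>-th power of the Fejer kernel of order \<open>L\<close>.\<close>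

lemma jackson_kernel:
  fixes L p :: nat
  assumes L: "L \<ge> 1" and p: "p \<ge> 1"
  obtains J :: "real \<Rightarrow> real" and a :: "int \<Rightarrow> real" where
    "\<And>t. complex_of_real (J t) = (\<Sum>h\<in>{- int (p * L)..int (p * L)}. of_real (a h) * eexp (real_of_int h * t))"
    "a 0 = 1" "\<And>h. 0 \<le> a h" "\<And>h. a h \<le> 1"
    "\<And>t. 0 \<le> J t" "\<And>t. J t \<le> real p * real L"
    "\<And>t \<rho>. \<rho> > 0 \<Longrightarrow> (\<And>k::int. \<bar>t - of_int k\<bar> \<ge> \<rho>) \<Longrightarrow> J t \<le> real p * real L / (2 * \<rho> * real L) ^ (2 * p)"
proof -
  define P :: "complex poly" where "P = (\<Sum>j<L. monom 1 j)"
  define H where "H = p * L"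
  define w where "w s = Re (coeff (P ^ p) s)" for s
  have cP: "coeff P i \<in> \<real>\<^sub>\<ge>\<^sub>0" for i
    by (simp add: P_def coeff_sum)
  have w: "w s \<ge> 0" "coeff (P ^ p) s = of_real (w s)" for s
    using nonneg_coeff_power[OF cP, of p s] by (auto simp: w_def complex_nonneg_Reals_iff complex_eq_iff)
  have "degree P \<le> L - 1" unfolding P_def by (rule degree_sum_le) (auto simp: degree_monom_eq)
  then have "degree (P ^ p) \<le> (L - 1) * p" by (meson degree_power_le mult_le_mono1 order_trans)
  also have "(L - 1) * p < H" using L p by (simp add: H_def mult.commute)
  finally have deg: "degree (P ^ p) < H" .
  define W where "W t = (\<Sum>j<L. eexp (real j * t)) ^ p" for t
  have W: "W t = (\<Sum>s<H. of_real (w s) * eexp (real s * t))" for t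
  proof -
    have "poly P (eexp t) = (\<Sum>j<L. eexp (real j * t))" by (simp add: P_def poly_sum poly_monom eexp_power)
    then have "W t = poly (P ^ p) (eexp t)" by (simp add: W_def)
    also have "\<dots> = (\<Sum>s\<le>degree (P ^ p). of_real (w s) * eexp (real s * t))"
      by (simp add: poly_altdef w(2) eexp_power del: poly_power)
    also have "\<dots> = (\<Sum>s<H. of_real (w s) * eexp (real s * t))"
    proof (rule sum.mono_neutral_left)
      show "\<forall>i\<in>{..<H} - {..degree (P ^ p)}. of_real (w i) * eexp (real i * t) = 0"
        using w(2)[symmetric] by (auto simp: coeff_eq_0)
    qed (use deg in auto)
    finally show ?thesis .
  qed
  \<comment> \<open>The constant coefficient of \<open>|W|^2\<close>, by which the kernel is divided
    to get \<open>a 0 = 1\<close>. Cauchy-Schwarz over the \<open>H\<close> coefficients, whose sum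
    is \<open>L ^ p\<close>, bounds it from below.\<close>
  define A where "A = (\<Sum>s<H. (w s)\<^sup>2)"
  have sumw: "(\<Sum>s<H. w s) = real L ^ p"
  proof -
    have "complex_of_real (\<Sum>s<H. w s) = W 0" using W[of 0] by simp
    also have "\<dots> = of_real (real L ^ p)" by (simp add: W_def)
    finally show ?thesis by (simp only: of_real_eq_iff)
  qed
  have A_lower: "real L ^ (2 * p) \<le> real H * A"
  proof -
    have "(\<Sum>s<H. w s * 1)\<^sup>2 \<le> (\<Sum>s<H. (w s)\<^sup>2) * (\<Sum>s<H. 1\<^sup>2)" by (rule Cauchy_Schwarz_ineq_sum)
    then show ?thesis by (simp add: sumw A_def power_mult[symmetric] mult.commute)
  qed
  have HL: "real H = real p * real L" "real H > 0" "real L > 0" using L p by (auto simp: H_def)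
  have A0: "A > 0"
  proof (rule ccontr)
    assume "\<not> A > 0"
    then have "real H * A \<le> 0" using HL by (simp add: mult_le_0_iff)
    then show False using A_lower HL(3) by (smt (verit) zero_less_power)
  qed
  define J where "J t = (cmod (W t))\<^sup>2 / A" for t
  define a where "a h = (\<Sum>s<H. \<Sum>s'<H. if int s - int s' = h then w s * w s' else 0) / A" for h
  have J0: "J t \<ge> 0" for t using A0 by (simp add: J_def)
  have Jbound: "J t \<le> (c ^ p)\<^sup>2 / A" if "cmod (\<Sum>j<L. eexp (real j * t)) \<le> c" for t c
    unfolding J_def W_def norm_power using that A0 by (intro divide_right_mono power_mono) auto
  show thesis
  proof (rule that[of J a])
    fix t
    have e2: "eexp (real s * t) * eexp (- (real s' * t)) = eexp (real_of_int (int s - int s') * t)" for s s'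
      by (simp add: eexp_add[symmetric] left_diff_distrib)
    have "J t * A = (cmod (W t))\<^sup>2" using A0 by (simp add: J_def)
    then have "complex_of_real (J t * A) = W t * cnj (W t)" by (simp only: complex_norm_square)
    also have "\<dots> = (\<Sum>s<H. \<Sum>s'<H. of_real (w s * w s') * eexp (real_of_int (int s - int s') * t))"
      unfolding W cnj_sum sum_product
      by (intro sum.cong refl) (unfold e2[symmetric], simp add: cnj_eexp mult_ac)
    also have "\<dots> = (\<Sum>s<H. \<Sum>s'<H. \<Sum>h\<in>{- int H..int H}.
        of_real (if int s - int s' = h then w s * w s' else 0) * eexp (real_of_int h * t))"
    proof (intro sum.cong refl)
      fix s s' assume "s \<in> {..<H}" "s' \<in> {..<H}"
      then have "int s - int s' \<in> {- int H..int H}" by auto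
      moreover have "(\<Sum>h\<in>{- int H..int H}. of_real (if int s - int s' = h then w s * w s' else 0) * eexp (real_of_int h * t))
        = (\<Sum>h\<in>{- int H..int H}. if h = int s - int s' then of_real (w s * w s') * eexp (real_of_int h * t) else 0)"
        by (intro sum.cong) auto
      ultimately show "of_real (w s * w s') * eexp (real_of_int (int s - int s') * t) =
        (\<Sum>h\<in>{- int H..int H}. of_real (if int s - int s' = h then w s * w s' else 0) * eexp (real_of_int h * t))"
        by simp
    qed
    also have "\<dots> = (\<Sum>h\<in>{- int H..int H}. \<Sum>s<H. \<Sum>s'<H.
        of_real (if int s - int s' = h then w s * w s' else 0) * eexp (real_of_int h * t))"
      by (subst (2) sum.swap, subst sum.swap) simp
    also have "\<dots> = (\<Sum>h\<in>{- int H..int H}. of_real (a h * A) * eexp (real_of_int h * t))"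
    proof (intro sum.cong refl)
      fix h
      have "a h * A = (\<Sum>s<H. \<Sum>s'<H. if int s - int s' = h then w s * w s' else 0)"
        using A0 by (simp add: a_def)
      then show "(\<Sum>s<H. \<Sum>s'<H. of_real (if int s - int s' = h then w s * w s' else 0) * eexp (real_of_int h * t))
          = of_real (a h * A) * eexp (real_of_int h * t)"
        by (simp only: of_real_sum sum_distrib_right)
    qed
    also have "\<dots> = (\<Sum>h\<in>{- int H..int H}. of_real (a h) * eexp (real_of_int h * t)) * of_real A"
      unfolding sum_distrib_right by (intro sum.cong refl) (simp add: mult_ac)
    finally show "complex_of_real (J t) = (\<Sum>h\<in>{- int (p * L)..int (p * L)}. of_real (a h) * eexp (real_of_int h * t))"
      using A0 by (simp add: H_def)
  next
    show "a 0 = 1" using A0 by (simp add: a_def A_def power2_eq_square)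
    fix h
    \<comment> \<open>An autocorrelation is largest at 0: each product is split into two half
      squares, and for a given difference \<open>h\<close> every index occurs at most once on either
      side.\<close>
    have am: "w s * w s' \<le> (w s)\<^sup>2 / 2 + (w s')\<^sup>2 / 2" for s s'
      using sum_squares_bound[of "w s" "w s'"] by linarith
    show "a h \<ge> 0" unfolding a_def using A0 w(1) by (intro divide_nonneg_pos sum_nonneg) auto
    have "(\<Sum>s<H. \<Sum>s'<H. if int s - int s' = h then w s * w s' else 0)
        \<le> (\<Sum>s<H. \<Sum>s'<H. (if int s - int s' = h then (w s)\<^sup>2 / 2 else 0) + (if int s - int s' = h then (w s')\<^sup>2 / 2 else 0))"
      using am by (intro sum_mono) auto
    also have "\<dots> = (\<Sum>s<H. \<Sum>s'<H. (if int s - int s' = h then (w s)\<^sup>2 / 2 else 0))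
        + (\<Sum>s'<H. \<Sum>s<H. (if int s - int s' = h then (w s')\<^sup>2 / 2 else 0))"
      by (subst (3) sum.swap) (simp add: sum.distrib)
    also have "\<dots> \<le> (\<Sum>s<H. (w s)\<^sup>2 / 2) + (\<Sum>s'<H. (w s')\<^sup>2 / 2)"
    proof (intro add_mono sum_mono)
      fix s
      have "(\<Sum>s'<H. if int s - int s' = h then (w s)\<^sup>2 / 2 else 0) = (\<Sum>s'\<in>{s'\<in>{..<H}. int s - int s' = h}. (w s)\<^sup>2 / 2)"
        by (rule sum.inter_filter[symmetric]) simp
      also have "\<dots> \<le> (\<Sum>s'\<in>{nat (int s - h)}. (w s)\<^sup>2 / 2)" by (rule sum_mono2) auto
      finally show "(\<Sum>s'<H. if int s - int s' = h then (w s)\<^sup>2 / 2 else 0) \<le> (w s)\<^sup>2 / 2" by simp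
      have "(\<Sum>s'<H. if int s' - int s = h then (w s)\<^sup>2 / 2 else 0) = (\<Sum>s'\<in>{s'\<in>{..<H}. int s' - int s = h}. (w s)\<^sup>2 / 2)"
        by (rule sum.inter_filter[symmetric]) simp
      also have "\<dots> \<le> (\<Sum>s'\<in>{nat (int s + h)}. (w s)\<^sup>2 / 2)" by (rule sum_mono2) auto
      finally show "(\<Sum>s'<H. if int s' - int s = h then (w s)\<^sup>2 / 2 else 0) \<le> (w s)\<^sup>2 / 2" by simp
    qed
    also have "\<dots> = A" by (simp add: A_def sum_divide_distrib[symmetric])
    finally show "a h \<le> 1" using A0 by (simp add: a_def)
  next
    fix t
    show "J t \<ge> 0" by (rule J0)
    have "J t \<le> (real L ^ p)\<^sup>2 / A"
      by (rule Jbound) (use sum_norm_le[of "{..<L}" "\<lambda>j. eexp (real j * t)" "\<lambda>_. 1"] in simp)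
    also have "\<dots> \<le> real H" using A_lower A0 by (simp add: divide_le_eq power_mult[symmetric] mult.commute)
    finally show "J t \<le> real p * real L" by (simp add: HL)
  next
    fix t \<rho> :: real assume \<rho>: "\<rho> > 0" and dist: "\<And>k::int. \<bar>t - of_int k\<bar> \<ge> \<rho>"
    have "J t \<le> ((1 / (2 * \<rho>)) ^ p)\<^sup>2 / A" by (rule Jbound[OF geometric_eexp_bound[OF dist \<rho>]])
    also have "\<dots> = (1 / (2 * \<rho>)) ^ (2 * p) / A" by (simp add: power_mult[symmetric] mult.commute)
    also have "\<dots> \<le> (1 / (2 * \<rho>)) ^ (2 * p) * (real H / real L ^ (2 * p))"
    proof -
      have "1 / A \<le> real H / real L ^ (2 * p)" using A_lower A0 HL by (simp add: field_simps)
      then show ?thesis using \<rho> mult_left_mono[of "1 / A" "real H / real L ^ (2 * p)" "(1 / (2 * \<rho>)) ^ (2 * p)"] by simp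
    qed
    also have "\<dots> = real p * real L / (2 * \<rho> * real L) ^ (2 * p)"
      by (simp add: HL power_mult_distrib power_divide)
    finally show "J t \<le> real p * real L / (2 * \<rho> * real L) ^ (2 * p)" .
  qed
qed

lemma vec_sum_PiE:
  fixes f :: "int ^ 'n \<Rightarrow> 'a::comm_monoid_add"
  shows "(\<Sum>g\<in>PiE UNIV (\<lambda>_::'n. {- H..H}). f (\<chi> i. g i)) = (\<Sum>m\<in>{m. \<forall>i. \<bar>m $ i\<bar> \<le> H}. f m)"
proof (rule sum.reindex_bij_witness[of _ "\<lambda>m i. m $ i" "\<lambda>g. \<chi> i. g i"])
qed (auto simp: PiE_iff abs_le_iff minus_le_iff)

lemma kernel_product_expansion:
  fixes J :: "real \<Rightarrow> real" and y :: "real ^ 'n"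
  assumes J: "\<And>t. complex_of_real (J t) = (\<Sum>h\<in>{- H..H}. of_real (a h) * eexp (real_of_int h * t))"
  shows "complex_of_real (\<Prod>j\<in>UNIV. J (y $ j)) =
    (\<Sum>m\<in>{m :: int ^ 'n. \<forall>i. \<bar>m $ i\<bar> \<le> H}. of_real (\<Prod>j\<in>UNIV. a (m $ j)) * eexp (ivec m \<bullet> y))"
proof -
  have "complex_of_real (\<Prod>j\<in>UNIV. J (y $ j)) =
      (\<Prod>j\<in>UNIV. \<Sum>h\<in>{- H..H}. of_real (a h) * eexp (real_of_int h * y $ j))"
    by (simp add: J)
  also have "\<dots> = (\<Sum>g\<in>PiE UNIV (\<lambda>_. {- H..H}). \<Prod>j\<in>UNIV. of_real (a (g j)) * eexp (real_of_int (g j) * y $ j))"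
    by (rule prod_sum_PiE) auto
  also have "\<dots> = (\<Sum>g\<in>PiE UNIV (\<lambda>_. {- H..H}).
      (\<lambda>m. of_real (\<Prod>j\<in>UNIV. a (m $ j)) * eexp (ivec m \<bullet> y)) (\<chi> i. g i))"
    by (intro sum.cong refl) (simp add: prod.distrib eexp_sum inner_vec_def)
  also have "\<dots> = (\<Sum>m\<in>{m. \<forall>i. \<bar>m $ i\<bar> \<le> H}. of_real (\<Prod>j\<in>UNIV. a (m $ j)) * eexp (ivec m \<bullet> y))"
    by (rule vec_sum_PiE)
  finally show ?thesis .
qed

lemma character_sum:
  assumes "N > 0" "real N * t \<in> \<int>"
  shows "(\<Sum>k<N. eexp (- (real k * t))) = (if t \<in> \<int> then of_nat N else 0)"
proof -
  have e: "eexp (- (real k * t)) = eexp (- t) ^ k" for k by (simp add: eexp_power)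
  show ?thesis
  proof (cases "t \<in> \<int>")
    case True
    then have "eexp (- t) = 1" by (simp add: eexp_eq_1_iff)
    then show ?thesis using True by (simp add: e)
  next
    case False
    then have z: "eexp (- t) \<noteq> 1" by (simp add: eexp_eq_1_iff minus_in_Ints_iff)
    have "eexp (- t) ^ N = 1" using assms by (simp add: eexp_power eexp_eq_1_iff minus_in_Ints_iff)
    then show ?thesis using False geometric_sum[OF z, of N] by (simp add: e)
  qed
qed

lemma character_sum_vec:
  fixes t :: "'n::finite \<Rightarrow> real"
  assumes "N > 0" "\<And>i. real N * t i \<in> \<int>"
  shows "(\<Sum>f\<in>PiE UNIV (\<lambda>_::'n. {..<N}). eexp (- (\<Sum>i\<in>UNIV. real (f i) * t i)))
    = (if \<forall>i. t i \<in> \<int> then of_nat (N ^ CARD('n)) else 0)"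
proof -
  have "(\<Sum>f\<in>PiE UNIV (\<lambda>_::'n. {..<N}). eexp (- (\<Sum>i\<in>UNIV. real (f i) * t i)))
      = (\<Sum>f\<in>PiE UNIV (\<lambda>_::'n. {..<N}). \<Prod>i\<in>UNIV. eexp (- (real (f i) * t i)))"
    by (simp add: eexp_sum sum_negf[symmetric])
  also have "\<dots> = (\<Prod>i\<in>UNIV. \<Sum>k<N. eexp (- (real k * t i)))"
    by (rule prod_sum_PiE[symmetric]) auto
  also have "\<dots> = (\<Prod>i\<in>UNIV. if t i \<in> \<int> then of_nat N else 0)"
    using assms by (simp add: character_sum)
  also have "\<dots> = (if \<forall>i. t i \<in> \<int> then of_nat (N ^ CARD('n)) else 0)"
    by (auto intro!: prod_zero)
  finally show ?thesis .
qed

text \<open>The combinations of the \<open>v q i\<close> form a finite group modulo integer vectors.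
  Averaging a character over it leaves the character unchanged if it is trivial on the group and
  kills it otherwise, so the frequency \<open>m\<close> survives precisely for those
  \<open>q\<close> on whose lattice it is integral.\<close>

lemma averaged_kernel_expansion:
  fixes J :: "real \<Rightarrow> real" and v :: "'q \<Rightarrow> 'n::finite \<Rightarrow> real ^ 'n" and N :: "'q \<Rightarrow> nat"
  assumes Q: "finite Q" "Q \<noteq> {}" and N: "\<And>q. N q > 0" "\<And>q i j. real (N q) * v q i $ j \<in> \<int>"
    and J: "\<And>t. complex_of_real (J t) = (\<Sum>h\<in>{- H..H}. of_real (a h) * eexp (real_of_int h * t))"
  shows "complex_of_real ((\<Sum>q\<in>Q. (\<Sum>f\<in>PiE UNIV (\<lambda>_. {..<N q}).
      \<Prod>j\<in>UNIV. J ((x - (\<Sum>i\<in>UNIV. real (f i) *\<^sub>R v q i)) $ j)) / real (N q ^ CARD('n))) / real (card Q)) =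
    (\<Sum>m\<in>{m :: int ^ 'n. \<forall>i. \<bar>m $ i\<bar> \<le> H}.
      of_real ((\<Prod>j\<in>UNIV. a (m $ j)) * real (card {q \<in> Q. \<forall>i. ivec m \<bullet> v q i \<in> \<int>}) / real (card Q)) * eexp (ivec m \<bullet> x))"
    (is "complex_of_real (?S / _) = (\<Sum>m\<in>?B. _)")
proof -
  let ?A = "\<lambda>m. complex_of_real (\<Prod>j\<in>UNIV. a (m $ j))"
  let ?I = "\<lambda>m q. \<forall>i. ivec m \<bullet> v q i \<in> \<int>"
  have inner: "complex_of_real ((\<Sum>f\<in>PiE UNIV (\<lambda>_. {..<N q}).
      \<Prod>j\<in>UNIV. J ((x - (\<Sum>i\<in>UNIV. real (f i) *\<^sub>R v q i)) $ j)) / real (N q ^ CARD('n)))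
      = (\<Sum>m\<in>?B. ?A m * eexp (ivec m \<bullet> x) * (if ?I m q then 1 else 0))" for q
  proof -
    let ?P = "PiE UNIV (\<lambda>_::'n. {..<N q})"
    have Nt: "real (N q) * (ivec m \<bullet> v q i) \<in> \<int>" for m i
    proof -
      have "real (N q) * (ivec m \<bullet> v q i) = (\<Sum>j\<in>UNIV. real_of_int (m $ j) * (real (N q) * v q i $ j))"
        by (simp add: inner_vec_def sum_distrib_left mult.left_commute)
      then show ?thesis using N(2) by (simp only: Ints_sum Ints_mult Ints_of_int)
    qed
    have "complex_of_real (\<Sum>f\<in>?P. \<Prod>j\<in>UNIV. J ((x - (\<Sum>i\<in>UNIV. real (f i) *\<^sub>R v q i)) $ j))
        = (\<Sum>f\<in>?P. \<Sum>m\<in>?B. ?A m * eexp (ivec m \<bullet> (x - (\<Sum>i\<in>UNIV. real (f i) *\<^sub>R v q i))))"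
      unfolding of_real_sum kernel_product_expansion[OF J] ..
    also have "\<dots> = (\<Sum>m\<in>?B. \<Sum>f\<in>?P. ?A m * eexp (ivec m \<bullet> x) * eexp (- (\<Sum>i\<in>UNIV. real (f i) * (ivec m \<bullet> v q i))))"
      by (subst sum.swap) (simp add: inner_diff_right inner_sum_right mult.assoc eexp_add[symmetric])
    also have "\<dots> = (\<Sum>m\<in>?B. ?A m * eexp (ivec m \<bullet> x) * (if ?I m q then of_nat (N q ^ CARD('n)) else 0))"
      unfolding sum_distrib_left[symmetric] by (subst character_sum_vec[OF N(1) Nt]) simp
    also have "\<dots> = (\<Sum>m\<in>?B. ?A m * eexp (ivec m \<bullet> x) * (if ?I m q then 1 else 0)) * of_nat (N q ^ CARD('n))"
      unfolding sum_distrib_right by (intro sum.cong) auto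
    finally show ?thesis using N(1)[of q] by (simp add: field_simps)
  qed
  have "complex_of_real (?S / real (card Q)) = (\<Sum>q\<in>Q. \<Sum>m\<in>?B. ?A m * eexp (ivec m \<bullet> x) * (if ?I m q then 1 else 0)) / of_nat (card Q)"
    unfolding of_real_divide of_real_sum of_real_of_nat_eq by (simp only: inner[unfolded of_real_divide of_real_sum of_real_of_nat_eq])
  also have "(\<Sum>q\<in>Q. \<Sum>m\<in>?B. ?A m * eexp (ivec m \<bullet> x) * (if ?I m q then 1 else 0))
      = (\<Sum>m\<in>?B. ?A m * eexp (ivec m \<bullet> x) * of_nat (card {q \<in> Q. ?I m q}))"
  proof (subst sum.swap, intro sum.cong refl)
    fix m
    have "(\<Sum>q\<in>Q. if ?I m q then 1 else 0) = (of_nat (card {q \<in> Q. ?I m q}) :: complex)"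
      using Q(1) by (simp add: sum.If_cases Int_def conj_commute)
    then show "(\<Sum>q\<in>Q. ?A m * eexp (ivec m \<bullet> x) * (if ?I m q then 1 else 0)) = ?A m * eexp (ivec m \<bullet> x) * of_nat (card {q \<in> Q. ?I m q})"
      by (simp only: sum_distrib_left[symmetric])
  qed
  finally show ?thesis by (simp add: sum_divide_distrib mult_ac)
qed

section \<open>Trigonometric polynomials concentrated near the quotients\<close>

lemma int_near_vec:
  fixes y :: "real ^ 'n" assumes "\<And>j. \<exists>k::int. \<bar>y $ j - of_int k\<bar> < \<rho>"
  obtains z where "infnorm (y - ivec z) \<le> \<rho>"
proof -
  obtain k where k: "\<And>j. \<bar>y $ j - of_int (k j)\<bar> < \<rho>" using assms by metis
  have "infnorm (y - ivec (\<chi> j. k j)) \<le> \<rho>" unfolding infnorm_le_iff using k by (auto intro: less_imp_le)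
  then show thesis by (rule that)
qed

context integral_basis_field
begin

text \<open>The weighted coefficient bound \<open>\<eta> M\<close> feeds the perturbation argument.
  The last conclusion is the substitute for compact support: \<open>F M\<close> exceeds
  \<open>\<theta> M\<close> only close to quotients with large denominators.\<close>

theorem approximating_trigpolys:
  fixes \<tau> a :: real
  assumes \<tau>: "\<tau> > 0" and a: "0 \<le> a" "a < CARD('n) / (1 + \<tau>)"
  obtains F :: "nat \<Rightarrow> real ^ 'n \<Rightarrow> real" and \<theta> \<eta> :: "nat \<Rightarrow> real" and S :: "nat \<Rightarrow> (int ^ 'n) set"
    and f :: "nat \<Rightarrow> int ^ 'n \<Rightarrow> real" where
    "\<And>M x. 0 \<le> F M x"
    "\<And>M x. M \<ge> 1 \<Longrightarrow> complex_of_real (F M x) = 1 + (\<Sum>m\<in>S M. of_real (f M m) * eexp (ivec m \<bullet> x))"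
    "\<And>M. finite (S M)"
    "\<And>M m. M \<ge> 1 \<Longrightarrow> m \<in> S M \<Longrightarrow> \<bar>f M m\<bar> * (1 + infnorm (ivec m)) powr a \<le> \<eta> M"
    "\<eta> \<longlonglongrightarrow> 0" "\<theta> \<longlonglongrightarrow> 0" "\<And>M. M \<ge> 1 \<Longrightarrow> \<theta> M > 0"
    "\<And>M x. M \<ge> 1 \<Longrightarrow> F M x > \<theta> M \<Longrightarrow> \<exists>q r. real M / 2 \<le> infnorm (ivec q) \<and>
        infnorm (x - quot_vec \<omega> r q) \<le> infnorm (ivec q) powr (- (\<tau> + 1))"
proof -
  let ?n = "real CARD('n)"
  obtain Q :: "nat \<Rightarrow> (int ^ 'n) set" and c C :: real where c: "c > 0" and C: "C > 0"
    and Qcard: "\<And>M. M \<ge> 1 \<Longrightarrow> finite (Q M) \<and> c * real M ^ CARD('n) \<le> real (card (Q M))"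
    and Qsize: "\<And>M q. M \<ge> 1 \<Longrightarrow> q \<in> Q M \<Longrightarrow> real M / 2 \<le> infnorm (ivec q) \<and> infnorm (ivec q) \<le> C * real M"
    and Qdiv: "\<And>\<delta>. \<delta> > 0 \<Longrightarrow> \<exists>B>0. \<forall>M\<ge>1. \<forall>m. m \<noteq> 0 \<longrightarrow>
      real (card {q \<in> Q M. \<forall>i. ivec m \<bullet> quot_vec \<omega> (axis i 1) q \<in> \<int>}) \<le> B * infnorm (ivec m) powr \<delta>"
    by (rule denominator_family) blast
  \<comment> \<open>The slack in \<open>a * (1 + \<tau>) < n\<close>. A quarter of it goes to the
    divisor exponent \<open>\<delta>\<close> and a quarter to the excess \<open>s\<close> of the
    kernel degree, which gives
    \<open>(a + \<delta>) * \<sigma> = n - \<epsilon> / 2\<close>.\<close>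
  define \<epsilon> where "\<epsilon> = ?n - a * (1 + \<tau>)"
  have \<epsilon>: "\<epsilon> > 0" using a \<tau> by (simp add: \<epsilon>_def field_simps)
  define \<delta> where "\<delta> = \<epsilon> / (4 * (1 + \<tau>))"
  define s where "s = \<epsilon> / (4 * (a + \<delta>))"
  have \<delta>: "\<delta> > 0" using \<epsilon> \<tau> by (simp add: \<delta>_def)
  have s: "s > 0" using \<epsilon> \<delta> a by (simp add: s_def)
  define \<sigma> where "\<sigma> = 1 + \<tau> + s"
  have \<sigma>: "\<sigma> > 1 + \<tau>" "\<sigma> > 0" using s \<tau> by (auto simp: \<sigma>_def)
  have exp1: "(a + \<delta>) * \<sigma> < ?n"
  proof -
    have "a + \<delta> \<noteq> 0" using \<delta> a by linarith
    then have "(a + \<delta>) * s = \<epsilon> / 4"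
      unfolding s_def mult.commute[of 4] times_divide_eq_right by (rule mult_divide_mult_cancel_left)
    moreover have "1 + \<tau> \<noteq> 0" using \<tau> by linarith
    then have "(1 + \<tau>) * \<delta> = \<epsilon> / 4"
      unfolding \<delta>_def mult.commute[of 4] times_divide_eq_right by (rule mult_divide_mult_cancel_left)
    then have "\<delta> * (1 + \<tau>) = \<epsilon> / 4" by (simp only: mult.commute)
    moreover have "(a + \<delta>) * \<sigma> = a * (1 + \<tau>) + \<delta> * (1 + \<tau>) + (a + \<delta>) * s" by (simp add: \<sigma>_def algebra_simps)
    ultimately have "(a + \<delta>) * \<sigma> = a * (1 + \<tau>) + \<epsilon> / 4 + \<epsilon> / 4" by simp
    moreover have "a * (1 + \<tau>) = ?n - \<epsilon>" by (simp add: \<epsilon>_def)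
    ultimately have "(a + \<delta>) * \<sigma> = ?n - \<epsilon> / 2" by simp
    then show ?thesis using \<epsilon> by simp
  qed
  \<comment> \<open>Away from the quotients one factor of the kernel gains
    \<open>M powr (- 2 * p * s)\<close> against the trivial size
    \<open>M powr (n * \<sigma>)\<close> of the whole product; \<open>p\<close> is large enough for
    the gain to win.\<close>
  define p :: nat where "p = nat \<lceil>?n * \<sigma> / s\<rceil> + 1"
  have p1: "p \<ge> 1" by (simp add: p_def)
  have exp2: "?n * \<sigma> < real (2 * p) * s"
  proof -
    have "?n * \<sigma> / s < real p" unfolding p_def by linarith
    then have "?n * \<sigma> < real p * s" using s by (simp add: divide_less_eq)
    also have "\<dots> \<le> real (2 * p) * s" using s by simp
    finally show ?thesis .
  qed
  define L where "L M = nat \<lceil>real M powr \<sigma>\<rceil>" for M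
  have L: "real M powr \<sigma> \<le> real (L M)" "real (L M) \<le> 2 * real M powr \<sigma>" "L M \<ge> 1" if M: "M \<ge> 1" for M
  proof -
    have "real M powr \<sigma> \<ge> 1" using M \<sigma> ge_one_powr_ge_zero[of "real M" \<sigma>] by simp
    then show "real M powr \<sigma> \<le> real (L M)" "real (L M) \<le> 2 * real M powr \<sigma>" "L M \<ge> 1"
      unfolding L_def by linarith+
  qed
  \<comment> \<open>A radius that is admissible for every denominator in \<open>Q M\<close>, since
    these satisfy \<open>|q| \<le> C * M\<close>.\<close>
  define \<rho> where "\<rho> M = (C * real M) powr (- (\<tau> + 1))" for M
  \<comment> \<open>Kernel and coefficients are paired so that a single choice fixes both.\<close>
  define JP where "JP M Ja \<longleftrightarrow> (\<forall>t. complex_of_real (fst Ja t) = (\<Sum>h\<in>{- int (p * L M)..int (p * L M)}. of_real (snd Ja h) * eexp (real_of_int h * t)))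
    \<and> snd Ja 0 = 1 \<and> (\<forall>h. 0 \<le> snd Ja h \<and> snd Ja h \<le> 1) \<and> (\<forall>t. 0 \<le> fst Ja t \<and> fst Ja t \<le> real p * real (L M))
    \<and> (\<forall>t \<rho>. \<rho> > 0 \<longrightarrow> (\<forall>k::int. \<bar>t - of_int k\<bar> \<ge> \<rho>) \<longrightarrow> fst Ja t \<le> real p * real (L M) / (2 * \<rho> * real (L M)) ^ (2 * p))" for M and Ja :: "(real \<Rightarrow> real) \<times> (int \<Rightarrow> real)"
  define JA where "JA M = (SOME Ja. JP M Ja)" for M
  define J where "J M = fst (JA M)" for M
  define b where "b M = snd (JA M)" for M
  have JAp: "(\<forall>t. complex_of_real (J M t) = (\<Sum>h\<in>{- int (p * L M)..int (p * L M)}. of_real (b M h) * eexp (real_of_int h * t)))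
    \<and> b M 0 = 1 \<and> (\<forall>h. 0 \<le> b M h \<and> b M h \<le> 1) \<and> (\<forall>t. 0 \<le> J M t \<and> J M t \<le> real p * real (L M))
    \<and> (\<forall>t \<rho>. \<rho> > 0 \<longrightarrow> (\<forall>k::int. \<bar>t - of_int k\<bar> \<ge> \<rho>) \<longrightarrow> J M t \<le> real p * real (L M) / (2 * \<rho> * real (L M)) ^ (2 * p))"
    if M: "M \<ge> 1" for M
  proof -
    obtain J' a' where "\<And>t. complex_of_real (J' t) = (\<Sum>h\<in>{- int (p * L M)..int (p * L M)}. of_real (a' h) * eexp (real_of_int h * t))"
      "a' 0 = 1" "\<And>h. 0 \<le> a' h" "\<And>h. a' h \<le> 1"
      "\<And>t. 0 \<le> J' t" "\<And>t. J' t \<le> real p * real (L M)"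
      "\<And>t \<rho>. \<rho> > 0 \<Longrightarrow> (\<And>k::int. \<bar>t - of_int k\<bar> \<ge> \<rho>) \<Longrightarrow> J' t \<le> real p * real (L M) / (2 * \<rho> * real (L M)) ^ (2 * p)"
      by (rule jackson_kernel[OF L(3)[OF M] p1]) blast
    then have "JP M (J', a')" unfolding JP_def by simp
    then have "JP M (JA M)" unfolding JA_def by (rule someI)
    then show ?thesis unfolding J_def b_def JP_def .
  qed
  note Jexp = JAp[THEN conjunct1, rule_format] and b0 = JAp[THEN conjunct2, THEN conjunct1]
  have b01: "0 \<le> b M h" "b M h \<le> 1" if "M \<ge> 1" for M h using JAp[OF that] by auto
  have J0: "0 \<le> J M t" "J M t \<le> real p * real (L M)" if "M \<ge> 1" for M t using JAp[OF that] by auto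
  have Jfar: "J M t \<le> real p * real (L M) / (2 * \<rho> * real (L M)) ^ (2 * p)"
    if "M \<ge> 1" "\<rho> > 0" "\<And>k::int. \<bar>t - of_int k\<bar> \<ge> \<rho>" for M t \<rho> using JAp[OF that(1)] that(2,3) by blast
  define v where "v q i = quot_vec \<omega> (axis i 1) q" for q i
  define N where "N q = (SOME N::nat. N > 0 \<and> (\<forall>i j. real N * v q i $ j \<in> \<int>))" for q
  have N: "N q > 0 \<and> (\<forall>i j. real (N q) * v q i $ j \<in> \<int>)" for q
    unfolding N_def by (rule someI_ex, rule quot_vec_denominator[of q]) (auto simp: v_def)
  define G where "G M q x = (\<Sum>g\<in>PiE UNIV (\<lambda>_. {..<N q}).
      \<Prod>j\<in>UNIV. J M ((x - (\<Sum>i\<in>UNIV. real (g i) *\<^sub>R v q i)) $ j)) / real (N q ^ CARD('n))" for M q x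
  \<comment> \<open>Nonnegativity is claimed for every \<open>M\<close>, but nothing is known about
    \<open>J 0\<close>; hence the separate value at \<open>M = 0\<close>.\<close>
  define F where "F M x = (if M = 0 then 0 else (\<Sum>q\<in>Q M. G M q x) / real (card (Q M)))" for M x
  define Bx where "Bx M = {m :: int ^ 'n. \<forall>i. \<bar>m $ i\<bar> \<le> int (p * L M)}" for M
  define f where "f M m = (\<Prod>j\<in>UNIV. b M (m $ j)) * real (card {q \<in> Q M. \<forall>i. ivec m \<bullet> v q i \<in> \<int>}) / real (card (Q M))" for M m
  have Q0: "card (Q M) > 0" "finite (Q M)" "Q M \<noteq> {}" if M: "M \<ge> 1" for M
  proof -
    have "0 < c * real M ^ CARD('n)" using c M by simp
    then have "0 < real (card (Q M))" using Qcard[OF M] by linarith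
    then show "card (Q M) > 0" by simp
    then have "Q M \<noteq> {} \<and> finite (Q M)" unfolding card_gt_0_iff .
    then show "finite (Q M)" "Q M \<noteq> {}" by (rule conjunct2, rule conjunct1)
  qed
  have finB: "finite (Bx M)" for M unfolding Bx_def by (rule card_int_box(2)) simp
  have Fexp: "complex_of_real (F M x) = (\<Sum>m\<in>Bx M. of_real (f M m) * eexp (ivec m \<bullet> x))" if M: "M \<ge> 1" for M x
  proof -
    have "F M x = (\<Sum>q\<in>Q M. (\<Sum>g\<in>PiE UNIV (\<lambda>_. {..<N q}).
      \<Prod>j\<in>UNIV. J M ((x - (\<Sum>i\<in>UNIV. real (g i) *\<^sub>R v q i)) $ j)) / real (N q ^ CARD('n))) / real (card (Q M))"
      using M unfolding F_def G_def by (metis not_one_le_zero)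
    then show ?thesis unfolding Bx_def f_def
      using averaged_kernel_expansion[where Q = "Q M" and N = N and v = v and J = "J M" and a = "b M"
          and H = "int (p * L M)" and x = x] Q0(2,3)[OF M] N Jexp[OF M] by presburger
  qed
  have f0: "f M 0 = 1" if M: "M \<ge> 1" for M using b0[OF M] Q0[OF M] by (simp add: f_def)
  obtain B where B: "B > 0" "\<And>M m. M \<ge> 1 \<Longrightarrow> m \<noteq> 0 \<Longrightarrow>
      real (card {q \<in> Q M. \<forall>i. ivec m \<bullet> v q i \<in> \<int>}) \<le> B * infnorm (ivec m) powr \<delta>"
    using Qdiv[OF \<delta>] unfolding v_def by blast
  \<comment> \<open>The exponents of \<open>M\<close> in \<open>\<eta>\<close> and
    \<open>\<theta>\<close> are negative by \<open>exp1\<close> and \<open>exp2\<close>; the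
    remaining factors do not depend on \<open>M\<close>.\<close>
  define \<eta> where "\<eta> M = (B * 2 powr a * (2 * real p) powr (a + \<delta>) / c) * real M powr ((a + \<delta>) * \<sigma> - ?n)" for M
  define \<theta> where "\<theta> M = (2 * real p) ^ CARD('n) / (2 * C powr (- (\<tau> + 1))) ^ (2 * p) * real M powr (?n * \<sigma> - real (2 * p) * s)" for M
  show thesis
  proof (rule that[of F f "\<lambda>M. Bx M - {0}" \<eta> \<theta>])
    show "0 \<le> F M x" for M x
    proof (cases "M = 0")
      case False
      then have "M \<ge> 1" by simp
      then show ?thesis unfolding F_def G_def using J0(1) by (auto intro!: sum_nonneg divide_nonneg_nonneg prod_nonneg)
    qed (simp add: F_def)
    show "complex_of_real (F M x) = 1 + (\<Sum>m\<in>Bx M - {0}. of_real (f M m) * eexp (ivec m \<bullet> x))" if M: "M \<ge> 1" for M x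
      unfolding Fexp[OF M] using finB sum.remove[of "Bx M" 0 "\<lambda>m. of_real (f M m) * eexp (ivec m \<bullet> x)"] f0[OF M]
      by (simp add: Bx_def)
    show "finite (Bx M - {0})" for M using finB by simp
    show "\<bar>f M m\<bar> * (1 + infnorm (ivec m)) powr a \<le> \<eta> M" if M: "M \<ge> 1" and m: "m \<in> Bx M - {0}" for M m
    proof -
      let ?m = "infnorm (ivec m)"
      have m1: "?m \<ge> 1" by (rule infnorm_ivec_ge_1) (use m in simp)
      have mL: "?m \<le> 2 * real p * real M powr \<sigma>"
      proof -
        have "?m \<le> real p * real (L M)" unfolding infnorm_le_iff
        proof
          fix i
          have "real_of_int \<bar>m $ i\<bar> \<le> real_of_int (int (p * L M))" using m unfolding Bx_def by (simp only: of_int_le_iff) auto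
          then show "\<bar>ivec m $ i\<bar> \<le> real p * real (L M)" by simp
        qed
        also have "\<dots> \<le> real p * (2 * real M powr \<sigma>)" using L(2)[OF M] by (intro mult_left_mono) auto
        finally show ?thesis by simp
      qed
      have pr: "0 \<le> (\<Prod>j\<in>UNIV. b M (m $ j))" "(\<Prod>j\<in>UNIV. b M (m $ j)) \<le> 1"
        using b01[OF M] by (auto intro!: prod_nonneg prod_le_1)
      have "\<bar>f M m\<bar> \<le> 1 * (B * ?m powr \<delta>) / (c * real M ^ CARD('n))"
        unfolding f_def abs_divide abs_mult using pr B(2)[OF M, of m] m Qcard[OF M] c M Q0(1)[OF M]
        by (intro frac_le mult_mono) auto
      then have "\<bar>f M m\<bar> * (1 + ?m) powr a \<le> (B * ?m powr \<delta>) / (c * real M ^ CARD('n)) * (2 * ?m) powr a"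
        using m1 a(1) by (intro mult_mono powr_mono2) (auto simp: infnorm_pos_le intro!: divide_nonneg_nonneg mult_nonneg_nonneg less_imp_le[OF B(1)] less_imp_le[OF c])
      also have "\<dots> = (B * 2 powr a / c) * ?m powr (a + \<delta>) / real M ^ CARD('n)"
        using m1 by (simp add: powr_mult powr_add field_simps)
      also have "\<dots> \<le> (B * 2 powr a / c) * (2 * real p * real M powr \<sigma>) powr (a + \<delta>) / real M ^ CARD('n)"
        using m1 mL a(1) \<delta> B(1) c by (intro divide_right_mono mult_left_mono powr_mono2) auto
      also have "\<dots> = \<eta> M"
        using M p1 unfolding \<eta>_def by (simp add: powr_mult powr_powr powr_diff powr_realpow mult_ac)
      finally show ?thesis .
    qed
    have lim: "(\<lambda>M. K * real M powr e) \<longlonglongrightarrow> 0" if "e < 0" for K e :: real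
      using tendsto_mult_right_zero[OF tendsto_neg_powr[OF that filterlim_real_sequentially]] by simp
    show "\<eta> \<longlonglongrightarrow> 0" unfolding \<eta>_def using exp1 by (intro lim) simp
    show "\<theta> \<longlonglongrightarrow> 0" unfolding \<theta>_def using exp2 by (intro lim) simp
    show "\<theta> M > 0" if "M \<ge> 1" for M unfolding \<theta>_def using that p1 C by simp
    show "\<exists>q r. real M / 2 \<le> infnorm (ivec q) \<and> infnorm (x - quot_vec \<omega> r q) \<le> infnorm (ivec q) powr (- (\<tau> + 1))"
      if M: "M \<ge> 1" and big: "F M x > \<theta> M" for M x
    proof (rule ccontr)
      assume none: "\<not> ?thesis"
      have \<rho>0: "\<rho> M > 0" unfolding \<rho>_def using C M by simp
      have qpos: "infnorm (ivec q) > 0" if "q \<in> Q M" for q using Qsize[OF M that] M by linarith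
      \<comment> \<open>If every coordinate of \<open>x - r / q\<close> were within
        \<open>\<rho> M\<close> of an integer, moving the quotient by that integer vector would
        produce a forbidden approximation.\<close>
      have far: "\<exists>j. \<forall>k::int. \<rho> M \<le> \<bar>(x - quot_vec \<omega> r q) $ j - of_int k\<bar>" if q: "q \<in> Q M" for q r
      proof (rule ccontr)
        assume "\<nexists>j. \<forall>k::int. \<rho> M \<le> \<bar>(x - quot_vec \<omega> r q) $ j - of_int k\<bar>"
        then obtain z where z: "infnorm ((x - quot_vec \<omega> r q) - ivec z) \<le> \<rho> M"
          using int_near_vec[of "x - quot_vec \<omega> r q" "\<rho> M"] by (meson not_le)
        have "q \<noteq> 0" using qpos[OF q] by (auto simp: infnorm_0)
        then obtain r' where r': "quot_vec \<omega> r' q = quot_vec \<omega> r q + ivec z" using quot_vec_shift by blast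
        have "infnorm (x - quot_vec \<omega> r' q) \<le> \<rho> M" using z unfolding r' by (simp add: diff_diff_eq)
        also have "\<rho> M \<le> infnorm (ivec q) powr (- (\<tau> + 1))"
          unfolding \<rho>_def using Qsize[OF M q] qpos[OF q] \<tau> by (intro powr_mono2') auto
        finally show False using none Qsize[OF M q] by blast
      qed
      have Kb: "(\<Prod>j\<in>UNIV. J M ((x - quot_vec \<omega> r q) $ j)) \<le> \<theta> M" if q: "q \<in> Q M" for q r
      proof -
        let ?J = "\<lambda>j. J M ((x - quot_vec \<omega> r q) $ j)"
        let ?pL = "real p * real (L M)"
        obtain j where j: "\<And>k::int. \<rho> M \<le> \<bar>(x - quot_vec \<omega> r q) $ j - of_int k\<bar>" using far[OF q] by blast
        \<comment> \<open>One coordinate is far from the integers and receives the decay bound; the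
          others receive the trivial bound.\<close>
        have "(\<Prod>j\<in>UNIV. ?J j) = ?J j * (\<Prod>j\<in>UNIV - {j}. ?J j)" by (rule prod.remove) auto
        also have "\<dots> \<le> (?pL / (2 * \<rho> M * real (L M)) ^ (2 * p)) * (\<Prod>j\<in>UNIV - {j}. ?pL)"
          using J0[OF M] Jfar[OF M \<rho>0 j] \<rho>0 by (intro mult_mono prod_mono prod_nonneg) auto
        also have "\<dots> = ?pL ^ CARD('n) / (2 * \<rho> M * real (L M)) ^ (2 * p)"
        proof -
          have "?pL * ?pL ^ (CARD('n) - 1) = ?pL ^ CARD('n)" by (simp add: power_eq_if)
          then show ?thesis by (simp add: card_Diff_singleton)
        qed
        also have "\<dots> \<le> (2 * real p * real M powr \<sigma>) ^ CARD('n) / (2 * C powr (- (\<tau> + 1)) * real M powr s) ^ (2 * p)"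
        proof (rule frac_le)
          show "?pL ^ CARD('n) \<le> (2 * real p * real M powr \<sigma>) ^ CARD('n)"
            using mult_left_mono[OF L(2)[OF M], of "real p"] by (intro power_mono) auto
          have "real M powr s = real M powr (- (\<tau> + 1)) * real M powr \<sigma>"
            by (simp add: powr_add[symmetric] \<sigma>_def)
          then have "2 * C powr (- (\<tau> + 1)) * real M powr s = 2 * \<rho> M * real M powr \<sigma>"
            using C M by (simp add: \<rho>_def powr_mult)
          also have "\<dots> \<le> 2 * \<rho> M * real (L M)" using L(1)[OF M] \<rho>0 by (intro mult_left_mono) auto
          finally show "(2 * C powr (- (\<tau> + 1)) * real M powr s) ^ (2 * p) \<le> (2 * \<rho> M * real (L M)) ^ (2 * p)"
            by (intro power_mono) auto
          show "0 < (2 * C powr (- (\<tau> + 1)) * real M powr s) ^ (2 * p)" using C M by simp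
        qed auto
        also have "\<dots> = \<theta> M"
        proof -
          have e1: "(real M powr \<sigma>) ^ CARD('n) = real M powr (?n * \<sigma>)"
            using M by (simp add: powr_realpow[symmetric] powr_powr mult.commute)
          have e2: "(real M powr s) ^ (2 * p) = real M powr (real (2 * p) * s)"
            using M by (subst powr_realpow[symmetric]) (simp_all add: powr_powr mult.commute)
          show ?thesis unfolding \<theta>_def power_mult_distrib[of _ "real M powr _"] e1 e2 by (simp add: powr_diff)
        qed
        finally show ?thesis .
      qed
      have Gb: "G M q x \<le> \<theta> M" if q: "q \<in> Q M" for q
      proof -
        let ?P = "PiE UNIV (\<lambda>_::'n. {..<N q})"
        have "(\<Sum>g\<in>?P. \<Prod>j\<in>UNIV. J M ((x - (\<Sum>i\<in>UNIV. real (g i) *\<^sub>R v q i)) $ j)) \<le> (\<Sum>g\<in>?P. \<theta> M)"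
        proof (rule sum_mono)
          fix g :: "'n \<Rightarrow> nat"
          have "quot_vec \<omega> (\<chi> i. int (g i)) q = (\<Sum>i\<in>UNIV. real (g i) *\<^sub>R v q i)"
            by (simp add: quot_vec_expand[of "\<chi> i. int (g i)"] v_def)
          then show "(\<Prod>j\<in>UNIV. J M ((x - (\<Sum>i\<in>UNIV. real (g i) *\<^sub>R v q i)) $ j)) \<le> \<theta> M"
            using Kb[OF q, of "\<chi> i. int (g i)"] by simp
        qed
        also have "\<dots> = \<theta> M * real (N q ^ CARD('n))" by (simp add: card_PiE)
        finally show ?thesis unfolding G_def using N[of q] by (subst pos_divide_le_eq) auto
      qed
      have "(\<Sum>q\<in>Q M. G M q x) \<le> (\<Sum>q\<in>Q M. \<theta> M)" by (rule sum_mono[OF Gb])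
      then have "F M x \<le> \<theta> M" using M Q0[OF M] by (simp add: F_def divide_le_eq mult.commute)
      then show False using big by simp
    qed
  qed
qed

end

section \<open>Weighted Fourier decay\<close>

lemma fourier_transform_eexp:
  "fourier_transform \<mu> \<xi> = (LINT x|\<mu>. eexp (- (x \<bullet> \<xi>)))"
  unfolding fourier_transform_def eexp_def cis_conv_exp by (simp add: mult_ac)

lemma eexp_measurable [measurable]: "eexp \<in> borel_measurable borel"
  by (intro borel_measurable_continuous_onI continuous_on_eexp continuous_on_id)

lemma (in prob_space) integrable_eexp:
  "f \<in> borel_measurable M \<Longrightarrow> integrable M (\<lambda>x. eexp (f x))"
  by (rule integrable_const_bound[of _ 1]) auto

lemma norm_fourier_transform_le_1:
  assumes "prob_space \<mu>" shows "cmod (fourier_transform \<mu> \<xi>) \<le> 1"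
proof -
  interpret prob_space \<mu> by fact
  have "cmod (LINT x|\<mu>. eexp (- (x \<bullet> \<xi>))) \<le> (LINT x|\<mu>. cmod (eexp (- (x \<bullet> \<xi>))))" by (rule integral_norm_bound)
  then show ?thesis by (simp add: fourier_transform_eexp prob_space)
qed

section \<open>A base measure on the cube with fast Fourier decay\<close>

definition unif :: "real measure" where
  "unif = restrict_space lborel {0..1}"

lemma prob_space_unif: "prob_space unif"
  unfolding unif_def by (rule prob_spaceI) (simp add: emeasure_restrict_space space_restrict_space)

text \<open>For \<open>|t| \<le> 1\<close> the trivial bound 1 suffices; beyond that the primitive
  of the exponential gives \<open>1 / (pi |t|)\<close>.\<close>

lemma unif_fourier_bound:
  "cmod (LINT x|unif. eexp (- (x * t))) \<le> 2 / (1 + \<bar>t\<bar>)"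
proof (cases "\<bar>t\<bar> \<le> 1")
  case True
  interpret prob_space unif by (rule prob_space_unif)
  have "cmod (LINT x|unif. eexp (- (x * t))) \<le> (LINT x|unif. cmod (eexp (- (x * t))))" by (rule integral_norm_bound)
  also have "\<dots> = 1" by (simp add: prob_space)
  also have "1 \<le> 2 / (1 + \<bar>t\<bar>)" using True by (simp add: field_simps)
  finally show ?thesis .
next
  case False
  let ?c = "- (2 * complex_of_real pi * \<i> * complex_of_real t)"
  have c0: "?c \<noteq> 0" using False by auto
  have nc: "cmod ?c = 2 * pi * \<bar>t\<bar>" by (simp add: norm_mult)
  have e: "eexp (- (x * t)) = exp (?c * of_real x)" for x
    unfolding eexp_def cis_conv_exp by (simp add: mult_ac)
  have "(LINT x|unif. eexp (- (x * t))) = (LINT x|lborel. indicator {0..1} x *\<^sub>R exp (?c * of_real x))"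
    unfolding unif_def by (subst integral_restrict_space) (simp_all add: e)
  also have "\<dots> = exp (?c * of_real 1) / ?c - exp (?c * of_real 0) / ?c"
  proof (rule integral_FTC_atLeastAtMost)
    fix x :: real
    have "((\<lambda>z. exp (?c * z) / ?c) has_field_derivative exp (?c * of_real x)) (at (of_real x))"
      using c0 by (auto intro!: derivative_eq_intros)
    then show "((\<lambda>x. exp (?c * of_real x) / ?c) has_vector_derivative exp (?c * of_real x)) (at x within {0..1})"
      using has_vector_derivative_real_field[of "\<lambda>z. exp (?c * z) / ?c" "exp (?c * of_real x)" x "{0..1}"]
      by (simp add: o_def)
  qed (auto intro!: continuous_intros)
  finally have "cmod (LINT x|unif. eexp (- (x * t))) = cmod (eexp (- t) - 1) / (2 * pi * \<bar>t\<bar>)"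
    using e[of 1] by (simp add: diff_divide_distrib[symmetric] norm_divide nc norm_minus_commute norm_mult)
  also have "\<dots> \<le> 2 / (2 * pi * \<bar>t\<bar>)"
    using norm_triangle_ineq4[of "eexp (- t)" 1] False by (intro divide_right_mono) auto
  also have "\<dots> \<le> 2 / (1 + \<bar>t\<bar>)"
  proof (rule divide_left_mono)
    have "2 * 1 * \<bar>t\<bar> \<le> 2 * pi * \<bar>t\<bar>" using pi_ge_two by (intro mult_right_mono) auto
    then show "1 + \<bar>t\<bar> \<le> 2 * pi * \<bar>t\<bar>" using False by linarith
  qed (use False in auto)
  finally show ?thesis .
qed

text \<open>Uniformity in \<open>x\<close> comes from replacing \<open>x\<close> by its floor
  \<open>k\<close>, which changes \<open>1 + |x - h|\<close> by a factor of at most 2. On either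
  side of \<open>k\<close> the distances \<open>|h - k|\<close> are distinct naturals, so each side
  is dominated by one convergent series.\<close>

lemma sum_inverse_square_shift:
  obtains B where "B > 0" "\<And>(x::real) H. (\<Sum>h\<in>{- H..H::int}. 1 / (1 + \<bar>x - of_int h\<bar>) ^ 2) \<le> B"
proof -
  define g where "g n = 1 / (1 + real n) ^ 2" for n :: nat
  have sg: "summable g"
    using inverse_squares_sums unfolding g_def by (auto simp: sums_iff add.commute)
  have g0: "g n \<ge> 0" for n by (simp add: g_def)
  define B where "B = 8 * suminf g + 1"
  have B: "B > 0" unfolding B_def using suminf_nonneg[OF sg g0] by linarith
  show thesis
  proof (rule that[OF B])
    fix x :: real and H :: int
    define k where "k = \<lfloor>x\<rfloor>"
    have aux: "A \<le> C + 1 \<Longrightarrow> 0 \<le> C \<Longrightarrow> 1 + A \<le> 2 * (1 + C)" for A C :: real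
      by (simp add: distrib_left)
    have "(\<Sum>h\<in>{- H..H}. 1 / (1 + \<bar>x - of_int h\<bar>) ^ 2) \<le> (\<Sum>h\<in>{- H..H}. 4 * g (nat \<bar>h - k\<bar>))"
    proof (rule sum_mono)
      fix h :: int
      have "of_int k \<le> x" "x < of_int k + 1" unfolding k_def by linarith+
      then have "\<bar>real_of_int h - real_of_int k\<bar> \<le> \<bar>x - of_int h\<bar> + 1" by linarith
      then have "1 + \<bar>real_of_int h - real_of_int k\<bar> \<le> 2 * (1 + \<bar>x - of_int h\<bar>)"
        using abs_ge_zero[of "x - of_int h"] by (rule aux)
      then have "1 + real_of_int \<bar>h - k\<bar> \<le> 2 * (1 + \<bar>x - of_int h\<bar>)" by simp
      then have "(1 + real_of_int \<bar>h - k\<bar>) ^ 2 \<le> (2 * (1 + \<bar>x - of_int h\<bar>)) ^ 2" by (intro power_mono) auto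
      then have "4 / (2 * (1 + \<bar>x - of_int h\<bar>)) ^ 2 \<le> 4 / (1 + real_of_int \<bar>h - k\<bar>) ^ 2"
        by (rule divide_left_mono) (auto intro!: mult_pos_pos zero_less_power add_pos_nonneg)
      moreover have "4 / (2 * (1 + \<bar>x - of_int h\<bar>)) ^ 2 = 1 / (1 + \<bar>x - of_int h\<bar>) ^ 2"
        by (simp only: power_mult_distrib) simp
      ultimately have "1 / (1 + \<bar>x - of_int h\<bar>) ^ 2 \<le> 4 / (1 + real_of_int \<bar>h - k\<bar>) ^ 2" by (simp only:)
      then show "1 / (1 + \<bar>x - of_int h\<bar>) ^ 2 \<le> 4 * g (nat \<bar>h - k\<bar>)" by (simp add: g_def)
    qed
    also have "\<dots> = 4 * (\<Sum>h\<in>{- H..H}. g (nat \<bar>h - k\<bar>))" by (simp add: sum_distrib_left)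
    finally have main: "(\<Sum>h\<in>{- H..H}. 1 / (1 + \<bar>x - of_int h\<bar>) ^ 2) \<le> 4 * (\<Sum>h\<in>{- H..H}. g (nat \<bar>h - k\<bar>))" .
    have "(\<Sum>h\<in>{- H..H}. g (nat \<bar>h - k\<bar>)) \<le> (\<Sum>h\<in>{- H..H} \<inter> {k..}. g (nat \<bar>h - k\<bar>)) + (\<Sum>h\<in>{- H..H} \<inter> {..k}. g (nat \<bar>h - k\<bar>))"
    proof -
      let ?f = "\<lambda>h. g (nat \<bar>h - k\<bar>)"
      have "({- H..H} \<inter> {k..}) \<union> ({- H..H} \<inter> {..k}) = {- H..H}" by auto
      then have "sum ?f {- H..H} + sum ?f (({- H..H} \<inter> {k..}) \<inter> ({- H..H} \<inter> {..k}))
          = sum ?f ({- H..H} \<inter> {k..}) + sum ?f ({- H..H} \<inter> {..k})"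
        using sum.union_inter[of "{- H..H} \<inter> {k..}" "{- H..H} \<inter> {..k}" ?f] by simp
      moreover have "0 \<le> sum ?f (({- H..H} \<inter> {k..}) \<inter> ({- H..H} \<inter> {..k}))" by (intro sum_nonneg g0)
      ultimately show ?thesis by linarith
    qed
    also have "\<dots> \<le> suminf g + suminf g"
    proof (rule add_mono)
      have "(\<Sum>h\<in>{- H..H} \<inter> {k..}. g (nat \<bar>h - k\<bar>)) = sum g ((\<lambda>h. nat \<bar>h - k\<bar>) ` ({- H..H} \<inter> {k..}))"
        by (subst sum.reindex) (auto simp: inj_on_def)
      also have "\<dots> \<le> suminf g" by (rule sum_le_suminf[OF sg]) (auto simp: g0)
      finally show "(\<Sum>h\<in>{- H..H} \<inter> {k..}. g (nat \<bar>h - k\<bar>)) \<le> suminf g" .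
      have "(\<Sum>h\<in>{- H..H} \<inter> {..k}. g (nat \<bar>h - k\<bar>)) = sum g ((\<lambda>h. nat \<bar>h - k\<bar>) ` ({- H..H} \<inter> {..k}))"
        by (subst sum.reindex) (auto simp: inj_on_def)
      also have "\<dots> \<le> suminf g" by (rule sum_le_suminf[OF sg]) (auto simp: g0)
      finally show "(\<Sum>h\<in>{- H..H} \<inter> {..k}. g (nat \<bar>h - k\<bar>)) \<le> suminf g" .
    qed
    finally have "(\<Sum>h\<in>{- H..H}. g (nat \<bar>h - k\<bar>)) \<le> suminf g + suminf g" .
    with main show "(\<Sum>h\<in>{- H..H}. 1 / (1 + \<bar>x - of_int h\<bar>) ^ 2) \<le> B" unfolding B_def by linarith
  qed
qed

lemma sum_inverse_square_lattice:
  obtains B where "B > 0" "\<And>(\<xi>::real^'n) S. finite S \<Longrightarrow>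
    (\<Sum>m\<in>S. \<Prod>i\<in>UNIV. 1 / (1 + \<bar>(\<xi> - ivec m) $ i\<bar>) ^ 2) \<le> B"
proof -
  obtain B where B: "B > 0" "\<And>(x::real) H. (\<Sum>h\<in>{- H..H::int}. 1 / (1 + \<bar>x - of_int h\<bar>) ^ 2) \<le> B"
    by (rule sum_inverse_square_shift) blast
  show thesis
  proof (rule that[of "B ^ CARD('n)"])
    show "B ^ CARD('n) > 0" using B by simp
    fix \<xi> :: "real ^ 'n" and S :: "(int ^ 'n) set" assume S: "finite S"
    let ?g = "\<lambda>m::int^'n. \<Prod>i\<in>UNIV. 1 / (1 + \<bar>(\<xi> - ivec m) $ i\<bar>) ^ 2"
    define H where "H = (\<Sum>m\<in>S. \<Sum>i\<in>UNIV. \<bar>m $ i\<bar>)"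
    have "S \<subseteq> {m. \<forall>i. \<bar>m $ i\<bar> \<le> H}"
    proof (clarify)
      fix m i assume m: "m \<in> S"
      have "\<bar>m $ i\<bar> \<le> (\<Sum>i\<in>UNIV. \<bar>m $ i\<bar>)" by (rule member_le_sum) auto
      also have "\<dots> \<le> H" unfolding H_def using m S by (intro member_le_sum sum_nonneg) auto
      finally show "\<bar>m $ i\<bar> \<le> H" .
    qed
    moreover have H0: "H \<ge> 0" unfolding H_def by (intro sum_nonneg) auto
    ultimately have "sum ?g S \<le> sum ?g {m. \<forall>i. \<bar>m $ i\<bar> \<le> H}"
      using card_int_box(2)[OF H0, where 'n = 'n] by (intro sum_mono2) (auto intro!: prod_nonneg)
    also have "\<dots> = (\<Sum>f\<in>PiE UNIV (\<lambda>_. {- H..H}). \<Prod>i\<in>UNIV. 1 / (1 + \<bar>\<xi> $ i - of_int (f i)\<bar>) ^ 2)"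
      by (subst vec_sum_PiE[symmetric]) simp
    also have "\<dots> = (\<Prod>i\<in>UNIV. \<Sum>h\<in>{- H..H}. 1 / (1 + \<bar>\<xi> $ i - of_int h\<bar>) ^ 2)"
      by (rule prod_sum_PiE[symmetric]) auto
    also have "\<dots> \<le> (\<Prod>i\<in>(UNIV::'n set). B)"
      by (intro prod_mono conjI B sum_nonneg) auto
    finally show "sum ?g S \<le> B ^ CARD('n)" by simp
  qed
qed

lemma one_plus_infnorm_le_prod:
  "1 + infnorm (x::real^'n) \<le> (\<Prod>i\<in>UNIV. 1 + \<bar>x $ i\<bar>)"
proof -
  have "infnorm x \<le> (\<Prod>i\<in>UNIV. 1 + \<bar>x $ i\<bar>) - 1" unfolding infnorm_le_iff
  proof
    fix j
    have "(1 + \<bar>x $ j\<bar>) * 1 \<le> (1 + \<bar>x $ j\<bar>) * (\<Prod>i\<in>UNIV - {j}. 1 + \<bar>x $ i\<bar>)"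
      by (intro mult_left_mono prod_ge_1) auto
    also have "\<dots> = (\<Prod>i\<in>UNIV. 1 + \<bar>x $ i\<bar>)" by (rule prod.remove[symmetric]) auto
    finally show "\<bar>x $ j\<bar> \<le> (\<Prod>i\<in>UNIV. 1 + \<bar>x $ i\<bar>) - 1" by simp
  qed
  then show ?thesis by simp
qed

text \<open>The law of a vector of independent averages of \<open>N\<close> uniform variables.\<close>

theorem base_measure:
  fixes a :: real assumes a: "a \<ge> 0"
  obtains \<mu> :: "(real ^ 'n) measure" and B where "prob_space \<mu>" "sets \<mu> = sets borel"
    "AE x in \<mu>. \<forall>i. 0 \<le> x $ i \<and> x $ i < 1" "B > 0"
    "\<And>\<xi> S. finite S \<Longrightarrow> (\<Sum>m\<in>S. (1 + infnorm (\<xi> - ivec m)) powr a * cmod (fourier_transform \<mu> (\<xi> - ivec m))) \<le> B"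
proof -
  \<comment> \<open>\<open>N\<close> factors of decay \<open>1 / (1 + |\<xi> i|)\<close> in each
    coordinate leave an inverse square after the weight of order \<open>a\<close> is paid.\<close>
  define N where "N = nat \<lceil>a\<rceil> + 2"
  have N: "real N \<ge> a + 2" "N > 0" unfolding N_def by linarith simp
  let ?I = "(UNIV :: 'n set) \<times> {..<N}"
  interpret U: prob_space unif by (rule prob_space_unif)
  interpret P: product_prob_space "\<lambda>_. unif" ?I ..
  let ?P = "PiM ?I (\<lambda>_. unif)"
  have pp: "prob_space ?P" by (rule prob_space_PiM) (rule prob_space_unif)
  \<comment> \<open>Dividing by \<open>2 * N\<close> instead of \<open>N\<close> keeps the
    coordinates at most \<open>1 / 2\<close>, well inside the half-open cube.\<close>
  define T :: "('n \<times> nat \<Rightarrow> real) \<Rightarrow> real ^ 'n" where "T w = (\<chi> i. (\<Sum>j<N. w (i, j)) / (2 * real N))" for w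
  have mid: "(\<lambda>x. x) \<in> borel_measurable unif" by (simp add: unif_def measurable_restrict_space1)
  have mcomp: "(\<lambda>w. w p) \<in> borel_measurable ?P" if "p \<in> ?I" for p
    using measurable_compose[OF measurable_component_singleton[OF that] mid] .
  have T[measurable]: "T \<in> measurable ?P borel"
    unfolding borel_measurable_euclidean_space[where f = T] T_def
    by (auto simp: Basis_vec_def inner_axis intro!: borel_measurable_divide borel_measurable_sum mcomp)
  define \<mu> where "\<mu> = distr ?P borel T"
  have \<mu>: "prob_space \<mu>" "sets \<mu> = sets borel" unfolding \<mu>_def by (auto intro: prob_space.prob_space_distr[OF pp T])
  have sp: "w p \<in> {0..1}" if "w \<in> space ?P" "p \<in> ?I" for w p
  proof -
    have "w \<in> PiE ?I (\<lambda>_. space unif)" using that(1) by (simp only: space_PiM)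
    then have "w p \<in> space unif" using that(2) by (rule PiE_mem)
    then show ?thesis by (simp add: unif_def space_restrict_space)
  qed
  have "AE x in \<mu>. \<forall>i. 0 \<le> x $ i \<and> x $ i < 1" unfolding \<mu>_def
  proof (subst AE_distr_iff[OF T])
    show "{x \<in> space borel. \<forall>i. 0 \<le> x $ i \<and> x $ i < 1} \<in> sets (borel :: (real ^ 'n) measure)" by measurable
    show "AE w in ?P. \<forall>i. 0 \<le> T w $ i \<and> T w $ i < 1"
    proof (rule AE_I2, intro allI)
      fix w i assume w: "w \<in> space ?P"
      have "0 \<le> (\<Sum>j<N. w (i, j))" using sp[OF w] by (intro sum_nonneg) auto
      moreover have "(\<Sum>j<N. w (i, j)) \<le> (\<Sum>j<N. 1)" using sp[OF w] by (intro sum_mono) auto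
      ultimately show "0 \<le> T w $ i \<and> T w $ i < 1" using N(2) by (simp add: T_def field_simps)
    qed
  qed
  moreover have FT: "cmod (fourier_transform \<mu> \<xi>) \<le> (\<Prod>i\<in>UNIV. (4 * real N / (1 + \<bar>\<xi> $ i\<bar>)) ^ N)" for \<xi> :: "real ^ 'n"
  proof -
    let ?t = "\<lambda>p. \<xi> $ fst p / (2 * real N)"
    have "fourier_transform \<mu> \<xi> = (LINT w|?P. eexp (- (T w \<bullet> \<xi>)))"
      unfolding fourier_transform_eexp \<mu>_def by (rule integral_distr) auto
    also have "\<dots> = (LINT w|?P. (\<Prod>p\<in>?I. eexp (- (w p * ?t p))))"
    proof (rule Bochner_Integration.integral_cong[OF refl])
      fix w
      have "T w \<bullet> \<xi> = (\<Sum>i\<in>UNIV. \<Sum>j<N. w (i, j) * (\<xi> $ i / (2 * real N)))"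
        by (simp add: inner_vec_def T_def sum_divide_distrib sum_distrib_right)
      also have "\<dots> = (\<Sum>p\<in>?I. w p * ?t p)" by (simp add: sum.cartesian_product case_prod_unfold)
      finally show "eexp (- (T w \<bullet> \<xi>)) = (\<Prod>p\<in>?I. eexp (- (w p * ?t p)))"
        by (simp add: sum_negf[symmetric] eexp_sum)
    qed
    also have "\<dots> = (\<Prod>p\<in>?I. LINT x|unif. eexp (- (x * ?t p)))"
      by (intro P.product_integral_prod U.integrable_eexp borel_measurable_uminus borel_measurable_times
          mid borel_measurable_const) simp
    finally have "cmod (fourier_transform \<mu> \<xi>) = (\<Prod>p\<in>?I. cmod (LINT x|unif. eexp (- (x * ?t p))))"
      by (simp add: prod_norm)
    also have "\<dots> \<le> (\<Prod>p\<in>?I. 4 * real N / (1 + \<bar>\<xi> $ fst p\<bar>))"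
    proof (intro prod_mono conjI norm_ge_zero)
      fix p
      have "(1 + \<bar>\<xi> $ fst p\<bar>) / (2 * real N) \<le> 1 + \<bar>?t p\<bar>"
      proof -
        have "1 / (2 * real N) \<le> 1" using N(2) by simp
        then show ?thesis by (simp add: add_divide_distrib abs_divide)
      qed
      moreover have "(1 + \<bar>\<xi> $ fst p\<bar>) / (2 * real N) > 0" using N(2) by simp
      ultimately have "2 / (1 + \<bar>?t p\<bar>) \<le> 2 / ((1 + \<bar>\<xi> $ fst p\<bar>) / (2 * real N))"
      proof (intro divide_left_mono mult_pos_pos)
        show "0 < 1 + \<bar>?t p\<bar>" by (rule add_pos_nonneg) simp_all
      qed auto
      also have "\<dots> = 4 * real N / (1 + \<bar>\<xi> $ fst p\<bar>)" by simp
      finally show "cmod (LINT x|unif. eexp (- (x * ?t p))) \<le> 4 * real N / (1 + \<bar>\<xi> $ fst p\<bar>)"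
        using unif_fourier_bound[of "?t p"] by linarith
    qed
    also have "\<dots> = (\<Prod>i\<in>UNIV. \<Prod>j<N. 4 * real N / (1 + \<bar>\<xi> $ i\<bar>))"
      by (simp only: prod.cartesian_product case_prod_unfold)
    finally show ?thesis by simp
  qed
  obtain B0 where B0: "B0 > 0" "\<And>(\<xi>::real^'n) S. finite S \<Longrightarrow>
    (\<Sum>m\<in>S. \<Prod>i\<in>UNIV. 1 / (1 + \<bar>(\<xi> - ivec m) $ i\<bar>) ^ 2) \<le> B0"
    by (rule sum_inverse_square_lattice) blast
  define C where "C = (4 * real N) ^ (N * CARD('n))"
  have C: "C > 0" using N(2) by (simp add: C_def)
  have weight: "(1 + infnorm x) powr a * cmod (fourier_transform \<mu> x) \<le> C * (\<Prod>i\<in>UNIV. 1 / (1 + \<bar>x $ i\<bar>) ^ 2)" for x :: "real ^ 'n"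
  proof -
    have "(1 + infnorm x) powr a * cmod (fourier_transform \<mu> x)
        \<le> (\<Prod>i\<in>UNIV. 1 + \<bar>x $ i\<bar>) powr a * (\<Prod>i\<in>UNIV. (4 * real N / (1 + \<bar>x $ i\<bar>)) ^ N)"
      using one_plus_infnorm_le_prod[of x] FT[of x] a infnorm_pos_le[of x]
      by (intro mult_mono powr_mono2) auto
    also have "\<dots> = (\<Prod>i\<in>UNIV. (1 + \<bar>x $ i\<bar>) powr a * (4 * real N / (1 + \<bar>x $ i\<bar>)) ^ N)"
      by (simp add: prod_powr_distrib prod.distrib)
    also have "\<dots> \<le> (\<Prod>i\<in>UNIV. (4 * real N) ^ N * (1 / (1 + \<bar>x $ i\<bar>) ^ 2))"
    proof (intro prod_mono conjI)
      fix i
      let ?u = "1 + \<bar>x $ i\<bar>"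
      have "?u powr a * (4 * real N / ?u) ^ N = (4 * real N) ^ N * (?u powr a / ?u powr real N)"
        by (simp add: power_divide powr_realpow)
      also have "?u powr a / ?u powr real N = ?u powr (a - real N)" by (simp add: powr_diff)
      also have "(4 * real N) ^ N * ?u powr (a - real N) \<le> (4 * real N) ^ N * ?u powr (- 2)"
        using N(1) by (intro mult_left_mono powr_mono) auto
      also have "?u powr (- 2) = 1 / ?u ^ 2" by (simp only: powr_minus_divide) (subst powr_numeral, simp_all)
      finally show "?u powr a * (4 * real N / ?u) ^ N \<le> (4 * real N) ^ N * (1 / ?u ^ 2)" .
    qed auto
    also have "\<dots> = C * (\<Prod>i\<in>UNIV. 1 / (1 + \<bar>x $ i\<bar>) ^ 2)"
      unfolding prod.distrib by (simp add: C_def power_mult)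
    finally show ?thesis .
  qed
  have "(\<Sum>m\<in>S. (1 + infnorm (\<xi> - ivec m)) powr a * cmod (fourier_transform \<mu> (\<xi> - ivec m))) \<le> C * B0"
    if S: "finite S" for \<xi> :: "real ^ 'n" and S
  proof -
    have "(\<Sum>m\<in>S. (1 + infnorm (\<xi> - ivec m)) powr a * cmod (fourier_transform \<mu> (\<xi> - ivec m)))
        \<le> (\<Sum>m\<in>S. C * (\<Prod>i\<in>UNIV. 1 / (1 + \<bar>(\<xi> - ivec m) $ i\<bar>) ^ 2))" by (rule sum_mono[OF weight])
    also have "\<dots> \<le> C * B0" unfolding sum_distrib_left[symmetric] using B0(2)[OF S] C by (intro mult_left_mono) auto
    finally show ?thesis .
  qed
  moreover have "C * B0 > 0" using C B0 by simp
  ultimately show thesis using that[OF \<mu>] by blast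
qed

text \<open>Multiplying by a trigonometric polynomial whose nonconstant coefficients are small hardly
  changes the Fourier transform of \<open>P \<mu>\<close>, in the norm weighted by \<open>(1 + |\<xi>|) powr a\<close>.\<close>

lemma perturbation_small:
  fixes \<mu> :: "(real ^ 'n) measure"
  assumes \<mu>: "prob_space \<mu>" "sets \<mu> = sets borel" and a: "a \<ge> 0" and B: "B > 0"
    "\<And>\<xi> S. finite S \<Longrightarrow> (\<Sum>m\<in>S. (1 + infnorm (\<xi> - ivec m)) powr a * cmod (fourier_transform \<mu> (\<xi> - ivec m))) \<le> B"
    and F: "\<And>M x. M \<ge> (1::nat) \<Longrightarrow> complex_of_real (F M x) = 1 + (\<Sum>m\<in>S M. of_real (f M m) * eexp (ivec m \<bullet> x))"
    "\<And>M. finite (S M)"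
    "\<And>M m. M \<ge> 1 \<Longrightarrow> m \<in> S M \<Longrightarrow> \<bar>f M m\<bar> * (1 + infnorm (ivec m)) powr a \<le> \<eta> M" "\<eta> \<longlonglongrightarrow> 0"
    and P: "trigpoly P"
  shows "\<exists>e. e \<longlonglongrightarrow> 0 \<and> (\<forall>M\<ge>1. \<forall>\<xi>.
    cmod (LINT x|\<mu>. P x * (complex_of_real (F M x) - 1) * eexp (- (x \<bullet> \<xi>))) * (1 + infnorm \<xi>) powr a \<le> e M)"
  using P
proof (induction rule: trigpoly.induct)
  case (trigpoly_monom c m0)
  interpret prob_space \<mu> by fact
  note [measurable_cong] = \<mu>(2)
  define D where "D = cmod c * (1 + infnorm (ivec m0)) powr a * B"
  show ?case
  proof (intro exI[of _ "\<lambda>M. D * \<bar>\<eta> M\<bar>"] conjI allI impI)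
    show "(\<lambda>M. D * \<bar>\<eta> M\<bar>) \<longlonglongrightarrow> 0" using tendsto_mult_right_zero[OF tendsto_rabs_zero[OF F(4)]] .
    fix M \<xi> assume M: "M \<ge> (1::nat)"
    let ?\<xi> = "\<xi> - ivec m0"
    let ?w = "\<lambda>x::real^'n. (1 + infnorm x) powr a"
    have w0: "?w x \<ge> 0" for x by simp
    \<comment> \<open>The weight is submultiplicative. The weight at \<open>\<xi>\<close> thus
      splits among the fixed frequency \<open>m0\<close>, the frequency \<open>m\<close> of the
      coefficient and the argument of the transform of \<open>\<mu>\<close>.\<close>
    have wmult: "?w (x + y) \<le> ?w x * ?w y" for x y
    proof -
      have "1 + infnorm (x + y) \<le> (1 + infnorm x) * (1 + infnorm y)"
        using infnorm_triangle[of x y] mult_nonneg_nonneg[OF infnorm_pos_le infnorm_pos_le, of x y] by (simp add: algebra_simps)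
      then have "?w (x + y) \<le> ((1 + infnorm x) * (1 + infnorm y)) powr a"
        using a infnorm_pos_le[of "x + y"] by (intro powr_mono2) auto
      then show ?thesis using infnorm_pos_le[of x] infnorm_pos_le[of y] by (simp add: powr_mult)
    qed
    have "(LINT x|\<mu>. c * eexp (ivec m0 \<bullet> x) * (complex_of_real (F M x) - 1) * eexp (- (x \<bullet> \<xi>)))
        = (LINT x|\<mu>. (\<Sum>m\<in>S M. c * of_real (f M m) * eexp (- (x \<bullet> (?\<xi> - ivec m)))))"
    proof (rule Bochner_Integration.integral_cong[OF refl])
      fix x
      have "complex_of_real (F M x) - 1 = (\<Sum>m\<in>S M. of_real (f M m) * eexp (ivec m \<bullet> x))" using F(1)[OF M] by simp
      moreover have "- (x \<bullet> (?\<xi> - ivec m)) = ivec m0 \<bullet> x + ivec m \<bullet> x + - (x \<bullet> \<xi>)" for m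
        by (simp add: inner_diff_right inner_commute)
      then have "eexp (- (x \<bullet> (?\<xi> - ivec m))) = eexp (ivec m0 \<bullet> x) * eexp (ivec m \<bullet> x) * eexp (- (x \<bullet> \<xi>))" for m
        by (simp only: eexp_add)
      ultimately show "c * eexp (ivec m0 \<bullet> x) * (complex_of_real (F M x) - 1) * eexp (- (x \<bullet> \<xi>))
          = (\<Sum>m\<in>S M. c * of_real (f M m) * eexp (- (x \<bullet> (?\<xi> - ivec m))))"
        by (simp add: sum_distrib_left sum_distrib_right mult_ac)
    qed
    also have "\<dots> = (\<Sum>m\<in>S M. c * of_real (f M m) * fourier_transform \<mu> (?\<xi> - ivec m))"
      unfolding fourier_transform_eexp
      by (subst Bochner_Integration.integral_sum) (auto intro!: integrable_mult_right integrable_eexp)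
    also have "cmod \<dots> \<le> (\<Sum>m\<in>S M. cmod c * \<bar>f M m\<bar> * cmod (fourier_transform \<mu> (?\<xi> - ivec m)))"
      by (rule order_trans[OF norm_sum]) (simp add: norm_mult)
    finally have "cmod (LINT x|\<mu>. c * eexp (ivec m0 \<bullet> x) * (complex_of_real (F M x) - 1) * eexp (- (x \<bullet> \<xi>))) * ?w \<xi>
        \<le> (\<Sum>m\<in>S M. cmod c * \<bar>f M m\<bar> * cmod (fourier_transform \<mu> (?\<xi> - ivec m))) * ?w \<xi>"
      by (intro mult_right_mono w0)
    also have "\<dots> = (\<Sum>m\<in>S M. cmod c * \<bar>f M m\<bar> * cmod (fourier_transform \<mu> (?\<xi> - ivec m)) * ?w \<xi>)"
      by (rule sum_distrib_right)
    also have "\<dots> \<le> (\<Sum>m\<in>S M. (cmod c * ?w (ivec m0) * \<bar>\<eta> M\<bar>) * (?w (?\<xi> - ivec m) * cmod (fourier_transform \<mu> (?\<xi> - ivec m))))"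
    proof (rule sum_mono)
      fix m assume m: "m \<in> S M"
      let ?ft = "cmod (fourier_transform \<mu> (?\<xi> - ivec m))"
      have "?w \<xi> = ?w (ivec m0 + (ivec m + (?\<xi> - ivec m)))" by (simp add: algebra_simps)
      also have "\<dots> \<le> ?w (ivec m0) * (?w (ivec m) * ?w (?\<xi> - ivec m))"
        by (rule order_trans[OF wmult]) (intro mult_left_mono wmult w0)
      finally have "cmod c * \<bar>f M m\<bar> * ?ft * ?w \<xi> \<le> cmod c * \<bar>f M m\<bar> * ?ft * (?w (ivec m0) * (?w (ivec m) * ?w (?\<xi> - ivec m)))"
        by (intro mult_left_mono) auto
      also have "\<dots> = (\<bar>f M m\<bar> * ?w (ivec m)) * (cmod c * ?w (ivec m0) * ?w (?\<xi> - ivec m) * ?ft)" by (simp only: mult_ac)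
      also have "\<dots> \<le> \<bar>\<eta> M\<bar> * (cmod c * ?w (ivec m0) * ?w (?\<xi> - ivec m) * ?ft)"
        using F(3)[OF M m] by (intro mult_right_mono) auto
      finally show "cmod c * \<bar>f M m\<bar> * ?ft * ?w \<xi> \<le> (cmod c * ?w (ivec m0) * \<bar>\<eta> M\<bar>) * (?w (?\<xi> - ivec m) * ?ft)"
        by (simp only: mult_ac)
    qed
    also have "\<dots> = (cmod c * ?w (ivec m0) * \<bar>\<eta> M\<bar>) * (\<Sum>m\<in>S M. ?w (?\<xi> - ivec m) * cmod (fourier_transform \<mu> (?\<xi> - ivec m)))"
      by (rule sum_distrib_left[symmetric])
    also have "\<dots> \<le> D * \<bar>\<eta> M\<bar>"
    proof -
      have "(cmod c * ?w (ivec m0) * \<bar>\<eta> M\<bar>) * (\<Sum>m\<in>S M. ?w (?\<xi> - ivec m) * cmod (fourier_transform \<mu> (?\<xi> - ivec m)))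
          \<le> (cmod c * ?w (ivec m0) * \<bar>\<eta> M\<bar>) * B" by (intro mult_left_mono B F(2)) auto
      then show ?thesis by (simp add: D_def mult_ac)
    qed
    finally show "cmod (LINT x|\<mu>. c * eexp (ivec m0 \<bullet> x) * (complex_of_real (F M x) - 1) * eexp (- (x \<bullet> \<xi>))) * ?w \<xi> \<le> D * \<bar>\<eta> M\<bar>" .
  qed
next
  case (trigpoly_add f1 f2)
  then obtain e1 e2 where e: "e1 \<longlonglongrightarrow> 0" "e2 \<longlonglongrightarrow> 0"
    "\<And>M \<xi>. M \<ge> 1 \<Longrightarrow> cmod (LINT x|\<mu>. f1 x * (complex_of_real (F M x) - 1) * eexp (- (x \<bullet> \<xi>))) * (1 + infnorm \<xi>) powr a \<le> e1 M"
    "\<And>M \<xi>. M \<ge> 1 \<Longrightarrow> cmod (LINT x|\<mu>. f2 x * (complex_of_real (F M x) - 1) * eexp (- (x \<bullet> \<xi>))) * (1 + infnorm \<xi>) powr a \<le> e2 M"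
    by blast
  interpret prob_space \<mu> by fact
  note [measurable_cong] = \<mu>(2)
  show ?case
  proof (intro exI[of _ "\<lambda>M. e1 M + e2 M"] conjI allI impI)
    show "(\<lambda>M. e1 M + e2 M) \<longlonglongrightarrow> 0" using tendsto_add[OF e(1,2)] by simp
    fix M \<xi> assume M: "M \<ge> (1::nat)"
    have int: "integrable \<mu> (\<lambda>x. g x * (complex_of_real (F M x) - 1) * eexp (- (x \<bullet> \<xi>)))" if g: "trigpoly g" for g
    proof -
      have "trigpoly (\<lambda>x. g x * (\<Sum>m\<in>S M. of_real (f M m) * eexp (ivec m \<bullet> x)))"
        by (intro trigpoly_mult g trigpoly_sum trigpoly_monom)
      then have t: "trigpoly (\<lambda>x. g x * (complex_of_real (F M x) - 1))" unfolding F(1)[OF M] by simp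
      obtain K where K: "\<And>x. cmod (g x * (complex_of_real (F M x) - 1)) \<le> K" using trigpoly_bounded[OF t] by blast
      have [measurable]: "(\<lambda>x. g x * (complex_of_real (F M x) - 1)) \<in> borel_measurable borel"
        by (rule borel_measurable_continuous_onI[OF trigpoly_continuous[OF t]])
      show ?thesis by (rule integrable_const_bound[of _ K]) (use K in \<open>auto simp: norm_mult\<close>)
    qed
    have "(LINT x|\<mu>. (f1 x + f2 x) * (complex_of_real (F M x) - 1) * eexp (- (x \<bullet> \<xi>)))
      = (LINT x|\<mu>. f1 x * (complex_of_real (F M x) - 1) * eexp (- (x \<bullet> \<xi>)))
      + (LINT x|\<mu>. f2 x * (complex_of_real (F M x) - 1) * eexp (- (x \<bullet> \<xi>)))"
      unfolding distrib_right by (rule Bochner_Integration.integral_add) (intro int trigpoly_add.hyps)+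
    then have "cmod (LINT x|\<mu>. (f1 x + f2 x) * (complex_of_real (F M x) - 1) * eexp (- (x \<bullet> \<xi>))) * (1 + infnorm \<xi>) powr a
      \<le> (cmod (LINT x|\<mu>. f1 x * (complex_of_real (F M x) - 1) * eexp (- (x \<bullet> \<xi>)))
        + cmod (LINT x|\<mu>. f2 x * (complex_of_real (F M x) - 1) * eexp (- (x \<bullet> \<xi>)))) * (1 + infnorm \<xi>) powr a"
      by (intro mult_right_mono) (auto simp: norm_triangle_ineq)
    also have "\<dots> \<le> e1 M + e2 M" using e(3)[OF M, of \<xi>] e(4)[OF M, of \<xi>] by (simp only: distrib_right)
    finally show "cmod (LINT x|\<mu>. (f1 x + f2 x) * (complex_of_real (F M x) - 1) * eexp (- (x \<bullet> \<xi>))) * (1 + infnorm \<xi>) powr a \<le> e1 M + e2 M" .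
  qed
qed

section \<open>Weak compactness on the cube\<close>

text \<open>Base 4 with digits 0 and 1 leaves gaps: the first differing digit \<open>K0\<close>
  contributes \<open>(1/4) ^ K0\<close>, and the later ones at most a third of that. In base 2
  carries would destroy this.\<close>

lemma expansion_separation:
  fixes d d' :: "nat \<Rightarrow> int"
  assumes d: "\<And>k. d k \<in> {0, 1}" and d': "\<And>k. d' k \<in> {0, 1}" and ne: "d K \<noteq> d' K"
  shows "(1/4) ^ K / 2 < \<bar>(\<Sum>k. of_int (d k) * (1/4) ^ k) - (\<Sum>k. of_int (d' k) * (1/4) ^ k :: real)\<bar>"
proof -
  define K0 where "K0 = (LEAST k. d k \<noteq> d' k)"
  have K0: "d K0 \<noteq> d' K0" "\<And>k. k < K0 \<Longrightarrow> d k = d' k" "K0 \<le> K"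
    unfolding K0_def using LeastI[of "\<lambda>k. d k \<noteq> d' k", OF ne] not_less_Least Least_le[of "\<lambda>k. d k \<noteq> d' k", OF ne] by auto
  define u where "u k = of_int (d k - d' k) * (1/4 :: real) ^ k" for k
  have geo: "summable (\<lambda>k. (1/4 :: real) ^ k)" by (simp add: summable_geometric)
  have sm: "summable (\<lambda>k. of_int (e k) * (1/4 :: real) ^ k)" if "\<And>k. e k \<in> {0, 1::int}" for e
  proof (rule summable_comparison_test'[OF geo, of 0])
    fix k show "norm (of_int (e k) * (1/4 :: real) ^ k) \<le> (1/4) ^ k" using that[of k] by auto
  qed
  have su: "summable u" unfolding u_def of_int_diff left_diff_distrib
    by (intro summable_diff sm d d')
  have ub: "\<bar>u k\<bar> \<le> (1/4) ^ k" for k using d[of k] d'[of k] by (auto simp: u_def abs_mult)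
  have "(\<Sum>k. of_int (d k) * (1/4) ^ k) - (\<Sum>k. of_int (d' k) * (1/4) ^ k :: real) = suminf u"
    unfolding u_def of_int_diff left_diff_distrib by (rule suminf_diff) (intro sm d d')+
  also have "suminf u = (\<Sum>k. u (k + Suc K0)) + sum u {..<Suc K0}" by (rule suminf_split_initial_segment[OF su])
  also have "sum u {..<Suc K0} = u K0" using K0(2) by (simp add: u_def)
  finally have eq: "(\<Sum>k. of_int (d k) * (1/4) ^ k) - (\<Sum>k. of_int (d' k) * (1/4) ^ k :: real) = (\<Sum>k. u (k + Suc K0)) + u K0" .
  have "\<bar>\<Sum>k. u (k + Suc K0)\<bar> \<le> (\<Sum>k. (1/4) ^ Suc K0 * (1/4) ^ k)"
  proof -
    have s1: "summable (\<lambda>k. (1/4 :: real) ^ Suc K0 * (1/4) ^ k)" by (intro summable_mult geo)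
    have "norm (u (k + Suc K0)) \<le> (1/4) ^ Suc K0 * (1/4) ^ k" for k using ub[of "k + Suc K0"] by (simp add: power_add mult_ac)
    then have "norm (\<Sum>k. u (k + Suc K0)) \<le> (\<Sum>k. (1/4) ^ Suc K0 * (1/4) ^ k)" by (rule norm_suminf_le[OF _ s1])
    then show ?thesis by simp
  qed
  also have "\<dots> = (1/4) ^ K0 / 3" unfolding suminf_mult[OF geo] by (simp add: suminf_geometric)
  finally have "\<bar>\<Sum>k. u (k + Suc K0)\<bar> \<le> (1/4) ^ K0 / 3" .
  moreover have "\<bar>u K0\<bar> = (1/4) ^ K0" using d[of K0] d'[of K0] K0(1) by (auto simp: u_def abs_mult)
  moreover have "(1/4 :: real) ^ K \<le> (1/4) ^ K0" using K0(3) by (intro power_decreasing) auto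
  moreover have "(0::real) < (1/4) ^ K0" by simp
  ultimately show ?thesis unfolding eq by linarith
qed

lemma floor_double_bit:
  fixes t :: real shows "\<lfloor>2 * t\<rfloor> = 2 * \<lfloor>t\<rfloor> + \<lfloor>2 * t\<rfloor> mod 2"
proof -
  have "\<lfloor>2 * t\<rfloor> div 2 = \<lfloor>t\<rfloor>" using floor_divide_real_eq_div[of 2 "2 * t"] by simp
  then show ?thesis by presburger
qed

text \<open>The binary digits of all coordinates are interleaved into a single base 4 expansion with
  digits \<open>0\<close> and \<open>1\<close>; decoding is uniformly continuous, although encoding is not.\<close>

lemma cube_coding:
  obtains g :: "real ^ 'n \<Rightarrow> real" and h :: "real \<Rightarrow> real ^ 'n" where
    "g \<in> borel_measurable borel" "\<And>x. 0 \<le> g x \<and> g x \<le> 2" "continuous_on UNIV h"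
    "\<And>x. (\<forall>i. 0 \<le> x $ i \<and> x $ i < 1) \<Longrightarrow> h (g x) = x"
proof -
  let ?n = "CARD('n)"
  obtain e :: "nat \<Rightarrow> 'n" where e: "bij_betw e {..<?n} UNIV"
    using ex_bij_betw_nat_finite[of "UNIV :: 'n set"] by (auto simp: atLeast0LessThan)
  \<comment> \<open>Digit \<open>k\<close> is the binary digit in place \<open>k div n + 1\<close>
    after the point of the coordinate numbered \<open>k mod n\<close>.\<close>
  define dg :: "real ^ 'n \<Rightarrow> nat \<Rightarrow> int" where "dg x k = \<lfloor>2 ^ Suc (k div ?n) * x $ (e (k mod ?n))\<rfloor> mod 2" for x k
  have dg: "dg x k \<in> {0, 1}" for x k unfolding dg_def by auto
  have geo: "summable (\<lambda>k. (1/4 :: real) ^ k)" by (simp add: summable_geometric)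
  have dgb: "\<bar>of_int (dg x k) * (1/4 :: real) ^ k\<bar> \<le> (1/4) ^ k" for x k using dg[of x k] by auto
  have sm: "summable (\<lambda>k. of_int (dg x k) * (1/4 :: real) ^ k)" for x
    by (rule summable_comparison_test'[OF geo, of 0]) (use dgb in auto)
  define g where "g x = (\<Sum>k. of_int (dg x k) * (1/4 :: real) ^ k)" for x
  have gm: "g \<in> borel_measurable borel" unfolding g_def dg_def by measurable
  have gb: "0 \<le> g x \<and> g x \<le> 2" for x
  proof
    show "0 \<le> g x" unfolding g_def 
    proof (rule suminf_nonneg[OF sm])
      fix k show "0 \<le> of_int (dg x k) * (1/4 :: real) ^ k" using dg[of x k] by auto
    qed
    have "g x \<le> (\<Sum>k. (1/4) ^ k)" unfolding g_def by (rule suminf_le[OF _ sm geo]) (use dgb in \<open>auto simp: abs_le_iff\<close>)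
    then show "g x \<le> 2" by (simp add: suminf_geometric)
  qed
  let ?C = "{x :: real ^ 'n. \<forall>i. 0 \<le> x $ i \<and> x $ i < 1}"
  have close: "dist x y \<le> real ?n * (1/2) ^ m"
    if x: "x \<in> ?C" and y: "y \<in> ?C" and d: "\<bar>g x - g y\<bar> \<le> (1/4) ^ (?n * m) / 2" for x y m
  proof -
    have eqd: "dg x k = dg y k" if "k < ?n * m" for k
    proof (rule ccontr)
      assume "dg x k \<noteq> dg y k"
      then have "(1/4) ^ k / 2 < \<bar>g x - g y\<bar>" unfolding g_def by (rule expansion_separation[OF dg dg])
      moreover have "(1/4 :: real) ^ (?n * m) \<le> (1/4) ^ k" using that by (intro power_decreasing) auto
      ultimately show False using d by linarith
    qed
    have "dist x y \<le> (\<Sum>i\<in>UNIV. \<bar>(x - y) $ i\<bar>)" unfolding dist_norm by (rule norm_le_l1_cart)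
    also have "\<dots> \<le> (\<Sum>i\<in>(UNIV :: 'n set). (1/2) ^ m)"
    proof (rule sum_mono)
      fix i
      obtain l where l: "l < ?n" "e l = i" using e by (metis UNIV_I bij_betw_imp_surj_on imageE lessThan_iff)
      \<comment> \<open>The floors are rebuilt bit by bit, starting from
        \<open>\<lfloor>x $ i\<rfloor> = 0\<close>, which holds because the cube is
        half-open.\<close>
      have fl: "\<lfloor>2 ^ j * x $ i\<rfloor> = \<lfloor>2 ^ j * y $ i\<rfloor>" if "j \<le> m" for j
        using that
      proof (induction j)
        case 0
        have "\<lfloor>x $ i\<rfloor> = 0" "\<lfloor>y $ i\<rfloor> = 0" using x y by (auto simp: floor_eq_iff)
        then show ?case by simp
      next
        case (Suc j)
        have "?n * j + l < ?n * m"
        proof -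
          have "?n * j + l < ?n * Suc j" using l(1) by simp
          also have "\<dots> \<le> ?n * m" using Suc.prems by (intro mult_le_mono) auto
          finally show ?thesis .
        qed
        then have "dg x (?n * j + l) = dg y (?n * j + l)" by (rule eqd)
        then have "\<lfloor>2 * (2 ^ j * x $ i)\<rfloor> mod 2 = \<lfloor>2 * (2 ^ j * y $ i)\<rfloor> mod 2"
          using l by (simp add: dg_def mult.assoc)
        then have "\<lfloor>2 * (2 ^ j * x $ i)\<rfloor> = \<lfloor>2 * (2 ^ j * y $ i)\<rfloor>"
          using Suc floor_double_bit[of "2 ^ j * x $ i"] floor_double_bit[of "2 ^ j * y $ i"] by simp
        then show ?case by (simp add: mult.assoc)
      qed
      have "\<bar>2 ^ m * x $ i - 2 ^ m * y $ i\<bar> \<le> 1" using fl[of m] by linarith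
      then have "2 ^ m * \<bar>x $ i - y $ i\<bar> \<le> 1" by (simp add: right_diff_distrib[symmetric] abs_mult)
      then show "\<bar>(x - y) $ i\<bar> \<le> (1/2) ^ m" by (simp add: field_simps power_one_over)
    qed
    finally show ?thesis by simp
  qed
  have inj: "inj_on g ?C"
  proof (rule inj_onI)
    fix x y assume xy: "x \<in> ?C" "y \<in> ?C" "g x = g y"
    have "(\<lambda>m. real ?n * (1/2) ^ m) \<longlonglongrightarrow> real ?n * 0"
      by (intro tendsto_mult tendsto_const LIMSEQ_realpow_zero) auto
    moreover have "dist x y \<le> real ?n * (1/2) ^ m" for m using close[OF xy(1,2)] xy(3) by simp
    ultimately have "dist x y \<le> 0" using LIMSEQ_le_const[of "\<lambda>m. real ?n * (1/2) ^ m" 0 "dist x y"] by simp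
    then show "x = y" by simp
  qed
  define h0 where "h0 = inv_into ?C g"
  have h0: "h0 (g x) = x" if "x \<in> ?C" for x unfolding h0_def by (rule inv_into_f_f[OF inj that])
  have uc: "uniformly_continuous_on (g ` ?C) h0"
    unfolding uniformly_continuous_on_def
  proof (intro allI impI)
    fix \<epsilon> :: real assume \<epsilon>: "\<epsilon> > 0"
    have "(\<lambda>m. real ?n * (1/2) ^ m) \<longlonglongrightarrow> 0"
      by (rule tendsto_mult_right_zero[OF LIMSEQ_realpow_zero]) auto
    then have "eventually (\<lambda>m. real ?n * (1/2) ^ m < \<epsilon>) sequentially" using \<epsilon> by (rule order_tendstoD)
    then obtain m where m: "real ?n * (1/2) ^ m < \<epsilon>" by (auto simp: eventually_sequentially)
    show "\<exists>d>0. \<forall>x\<in>g ` ?C. \<forall>x'\<in>g ` ?C. dist x' x < d \<longrightarrow> dist (h0 x') (h0 x) < \<epsilon>"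
    proof (intro exI[of _ "(1/4) ^ (?n * m) / 2"] conjI ballI impI)
      fix u v assume "u \<in> g ` ?C" "v \<in> g ` ?C" and uv: "dist v u < (1/4) ^ (?n * m) / 2"
      then obtain x y where xy: "x \<in> ?C" "y \<in> ?C" "u = g x" "v = g y" by blast
      have "dist y x \<le> real ?n * (1/2) ^ m" using close[OF xy(2,1), of m] uv xy by (simp add: dist_real_def)
      then show "dist (h0 v) (h0 u) < \<epsilon>" unfolding xy(3,4) h0[OF xy(1)] h0[OF xy(2)] using m by linarith
    qed simp
  qed
  \<comment> \<open>Limits of codes may lie outside the image of the cube, so the decoder is
    extended to the closure by uniform continuity and then to the whole line by Tietze's
    theorem.\<close>
  obtain h1 where h1: "uniformly_continuous_on (closure (g ` ?C)) h1" "\<And>x. x \<in> g ` ?C \<Longrightarrow> h0 x = h1 x"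
    by (rule uniformly_continuous_on_extension_on_closure[OF uc]) (rule that, auto)
  then have "continuous_on (closure (g ` ?C)) h1" by (intro uniformly_continuous_imp_continuous)
  then obtain h where h: "continuous_on UNIV h" "\<And>x. x \<in> closure (g ` ?C) \<Longrightarrow> h x = h1 x"
    using Tietze_unbounded[of "closure (g ` ?C)" h1 UNIV] by auto
  have "h (g x) = x" if "\<forall>i. 0 \<le> x $ i \<and> x $ i < 1" for x
  proof -
    have x: "x \<in> ?C" using that by simp
    then have "h (g x) = h1 (g x)" using closure_subset[of "g ` ?C"] by (intro h) auto
    also have "\<dots> = h0 (g x)" using x by (intro h1(2)[symmetric]) auto
    finally show ?thesis using h0[OF x] by simp
  qed
  then show thesis using that[OF gm gb h(1)] by blast
qed

text \<open>The codes push the measures to distributions on a fixed interval of the line, a tight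
  sequence, and the continuous decoder \<open>h\<close> carries a weak limit back. Since
  \<open>h (g x) = x\<close> on the cube, integrals of continuous functions are unaffected by the
  detour, although \<open>g\<close> itself is only measurable.\<close>

theorem cube_weak_compactness:
  fixes \<mu> :: "nat \<Rightarrow> (real ^ 'n) measure"
  assumes prob: "\<And>k. prob_space (\<mu> k)" and sets: "\<And>k. sets (\<mu> k) = sets borel"
    and cube: "\<And>k. AE x in \<mu> k. \<forall>i. 0 \<le> x $ i \<and> x $ i < 1"
  obtains r and \<nu> :: "(real ^ 'n) measure" where "strict_mono (r :: nat \<Rightarrow> nat)" "prob_space \<nu>" "sets \<nu> = sets borel"
    "\<And>f B. continuous_on UNIV f \<Longrightarrow> (\<And>x. cmod (f x) \<le> B) \<Longrightarrow> (\<lambda>k. LINT x|\<mu> (r k). f x) \<longlonglongrightarrow> (LINT x|\<nu>. f x)"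
proof -
  obtain g :: "real ^ 'n \<Rightarrow> real" and h :: "real \<Rightarrow> real ^ 'n" where
    gm: "g \<in> borel_measurable borel" and gb: "\<And>x. 0 \<le> g x \<and> g x \<le> 2" and hc: "continuous_on UNIV h"
    and hg: "\<And>x. (\<forall>i. 0 \<le> x $ i \<and> x $ i < 1) \<Longrightarrow> h (g x) = x"
    using cube_coding by blast
  have hm: "h \<in> borel_measurable borel" by (rule borel_measurable_continuous_onI[OF hc])
  define D where "D k = distr (\<mu> k) borel g" for k
  have gmk: "g \<in> measurable (\<mu> k) borel" for k using gm by (simp add: measurable_cong_sets[OF sets refl])
  have rd: "real_distribution (D k)" for k
  proof -
    interpret prob_space "\<mu> k" by (rule prob)
    have "prob_space (D k)" unfolding D_def by (rule prob_space_distr[OF gmk])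
    then show ?thesis unfolding real_distribution_def real_distribution_axioms_def by (simp add: D_def)
  qed
  have "tight D" unfolding tight_def
  proof (intro conjI allI impI rd)
    fix \<epsilon> :: real assume "\<epsilon> > 0"
    have "measure (D k) {-1<..2} > 1 - \<epsilon>" for k
    proof -
      interpret prob_space "\<mu> k" by (rule prob)
      have "g -` {-1<..2} \<inter> space (\<mu> k) = space (\<mu> k)" 
      proof (intro equalityI subsetI)
        fix x assume "x \<in> space (\<mu> k)"
        moreover have "-1 < g x" "g x \<le> 2" using gb[of x] by auto
        ultimately show "x \<in> g -` {-1<..2} \<inter> space (\<mu> k)" by simp
      qed auto
      then have "measure (D k) {-1<..2} = 1" unfolding D_def by (subst measure_distr[OF gmk]) (auto simp: prob_space)
      then show ?thesis using \<open>\<epsilon> > 0\<close> by simp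
    qed
    then show "\<exists>a b. a < b \<and> (\<forall>n. 1 - \<epsilon> < measure (D n) {a<..b})"
      by (intro exI[of _ "-1"] exI[of _ 2]) simp
  qed
  then obtain r M where r: "strict_mono (r :: nat \<Rightarrow> nat)" and M: "real_distribution M" and wc: "weak_conv_m (D \<circ> id \<circ> r) M"
    using tight_imp_convergent_subsubsequence[of D id] strict_mono_id by blast
  interpret M: real_distribution M by (rule M)
  have hM: "h \<in> measurable M borel" using hm by (simp add: measurable_cong_sets[OF M.events_eq_borel refl])
  show thesis
  proof (rule that[OF r, of "distr M borel h"])
    show "prob_space (distr M borel h)" by (rule M.prob_space_distr[OF hM])
    show "sets (distr M borel h) = sets borel" by simp
    fix f :: "real ^ 'n \<Rightarrow> complex" and B assume f: "continuous_on UNIV f" "\<And>x. cmod (f x) \<le> B"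
    have fm: "f \<in> borel_measurable borel" by (rule borel_measurable_continuous_onI[OF f(1)])
    have fh: "continuous_on UNIV (\<lambda>t. f (h t))" by (rule continuous_on_compose2[OF f(1) hc]) auto
    have fhm: "(\<lambda>t. f (h t)) \<in> borel_measurable borel" by (rule borel_measurable_continuous_onI[OF fh])
    have "(\<lambda>k. LINT t|(D \<circ> id \<circ> r) k. f (h t)) \<longlonglongrightarrow> (LINT t|M. f (h t))"
    proof (rule weak_conv_imp_integral_bdd_continuous_conv[OF _ M wc])
      show "real_distribution ((D \<circ> id \<circ> r) n)" for n using rd by simp
      show "isCont (\<lambda>t. f (h t)) x" for x using fh by (simp add: continuous_on_eq_continuous_at)
      show "norm (f (h x)) \<le> B" for x using f(2) by simp
    qed
    moreover have "(LINT t|(D \<circ> id \<circ> r) k. f (h t)) = (LINT x|\<mu> (r k). f x)" for k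
    proof -
      have "(LINT t|(D \<circ> id \<circ> r) k. f (h t)) = (LINT x|\<mu> (r k). f (h (g x)))"
        unfolding o_def id_def D_def by (rule integral_distr[OF gmk fhm])
      also have "\<dots> = (LINT x|\<mu> (r k). f x)"
      proof (rule integral_cong_AE)
        show "AE x in \<mu> (r k). f (h (g x)) = f x" using cube[of "r k"] by eventually_elim (simp add: hg)
        show "(\<lambda>x. f (h (g x))) \<in> borel_measurable (\<mu> (r k))" by (rule measurable_compose[OF gmk fhm])
        show "f \<in> borel_measurable (\<mu> (r k))" using fm by (simp add: measurable_cong_sets[OF sets refl])
      qed
      finally show ?thesis .
    qed
    moreover have "(LINT t|M. f (h t)) = (LINT x|distr M borel h. f x)" by (rule integral_distr[OF hM fm, symmetric])
    ultimately show "(\<lambda>k. LINT x|\<mu> (r k). f x) \<longlonglongrightarrow> (LINT x|distr M borel h. f x)" by simp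
  qed
qed

section \<open>Limits of Riesz-type products\<close>

text \<open>A trigonometric polynomial majorising the indicator of \<open>{F \<le> \<theta>}\<close> whose product with \<open>F\<close> is
  small: a high power of \<open>1 - F / A\<close>, where \<open>A\<close> bounds \<open>F\<close>.\<close>

lemma test_function:
  fixes F :: "real ^ 'n \<Rightarrow> real"
  assumes F0: "\<And>x. 0 \<le> F x" and tF: "trigpoly (\<lambda>x. complex_of_real (F x))" and \<theta>: "\<theta> > 0"
  shows "\<exists>h. trigpoly (\<lambda>x. complex_of_real (h x)) \<and>
    (\<forall>x. 0 \<le> h x \<and> h x * F x \<le> 4 * \<theta> \<and> (F x \<le> \<theta> \<longrightarrow> 1 \<le> h x))"
proof -
  obtain B where B: "\<forall>x. cmod (complex_of_real (F x)) \<le> B" using trigpoly_bounded[OF tF] ..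
  define k where "k = nat \<lceil>B / (2 * \<theta>)\<rceil> + 1"
  define A where "A = 2 * \<theta> * real k"
  have k: "real k \<ge> 1" "B / (2 * \<theta>) \<le> real k" unfolding k_def by (simp_all, linarith)
  have A: "A > 0" "F x \<le> A" for x
  proof -
    show "A > 0" using \<theta> k by (simp add: A_def)
    have "F x \<le> B" using B[rule_format, of x] F0[of x] by simp
    also have "B \<le> A" using k(2) \<theta> by (simp add: A_def divide_le_eq mult_ac)
    finally show "F x \<le> A" .
  qed
  define h where "h x = 2 * (1 - F x / A) ^ k" for x
  have u: "0 \<le> F x / A" "F x / A \<le> 1" for x using A F0 by auto
  have "trigpoly (\<lambda>x. complex_of_real (h x))"
  proof -
    have "trigpoly (\<lambda>x. 2 * (1 + (- 1 / of_real A) * complex_of_real (F x)) ^ k)"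
      by (intro trigpoly_mult trigpoly_power trigpoly_add trigpoly_const tF)
    moreover have "2 * (1 + (- 1 / of_real A) * complex_of_real (F x)) ^ k = complex_of_real (h x)" for x
      by (simp add: h_def)
    ultimately show ?thesis by simp
  qed
  moreover have "0 \<le> h x" for x using u[of x] by (simp add: h_def)
  moreover have "h x * F x \<le> 4 * \<theta>" for x
  proof -
    let ?u = "F x / A"
    have "(1 - ?u) ^ k * (1 + real k * ?u) \<le> (1 - ?u) ^ k * (1 + ?u) ^ k"
      using u[of x] Bernoulli_inequality[of ?u k] by (intro mult_left_mono) auto
    also have "\<dots> = (1 - ?u * ?u) ^ k" by (simp add: power_mult_distrib[symmetric] algebra_simps)
    also have "\<dots> \<le> 1" using u[of x] mult_left_le[of ?u ?u] by (intro power_le_one) auto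
    finally have "(1 - ?u) ^ k * (1 + real k * ?u) \<le> 1" .
    moreover have "(1 - ?u) ^ k * (real k * ?u) \<le> (1 - ?u) ^ k * (1 + real k * ?u)"
      using u[of x] by (intro mult_left_mono) auto
    ultimately have "real k * (?u * (1 - ?u) ^ k) \<le> 1" by (simp add: mult_ac)
    then have "4 * \<theta> * (real k * (?u * (1 - ?u) ^ k)) \<le> 4 * \<theta> * 1" using \<theta> by (intro mult_left_mono) auto
    moreover have "h x * F x = 4 * \<theta> * (real k * (?u * (1 - ?u) ^ k))" using A(1) \<theta> k(1) by (simp add: h_def A_def)
    ultimately show ?thesis by simp
  qed
  moreover have "1 \<le> h x" if "F x \<le> \<theta>" for x
  proof -
    let ?u = "F x / A"
    have "real k * ?u \<le> real k * (\<theta> / A)" using that A(1) by (intro mult_left_mono divide_right_mono) auto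
    also have "\<dots> = 1 / 2" using \<theta> k(1) by (simp add: A_def)
    finally have "1 / 2 \<le> 1 + real k * (- ?u)" by simp
    also have "\<dots> \<le> (1 + - ?u) ^ k" using u[of x] by (intro Bernoulli_inequality) auto
    finally show ?thesis by (simp add: h_def)
  qed
  ultimately show ?thesis by blast
qed

lemma integrable_trigpoly:
  fixes f :: "real ^ 'n \<Rightarrow> complex"
  assumes "prob_space M" "sets M = sets borel" "trigpoly f"
  shows "integrable M (\<lambda>x. f x * eexp (- (x \<bullet> \<xi>)))" "integrable M f"
proof -
  interpret prob_space M by fact
  note [measurable_cong] = assms(2)
  obtain K where K: "\<And>x. cmod (f x) \<le> K" using trigpoly_bounded[OF assms(3)] by blast
  have [measurable]: "f \<in> borel_measurable borel"
    by (rule borel_measurable_continuous_onI[OF trigpoly_continuous[OF assms(3)]])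
  show "integrable M (\<lambda>x. f x * eexp (- (x \<bullet> \<xi>)))"
    by (rule integrable_const_bound[of _ K]) (use K in \<open>auto simp: norm_mult\<close>)
  show "integrable M f"
    by (rule integrable_const_bound[of _ K]) (use K in auto)
qed

text \<open>Each index is chosen after all earlier ones, so large that inserting its factor changes
  the weighted transforms of the current product, and of that product times each earlier test
  function \<open>H\<close>, by at most \<open>\<epsilon> j\<close>. The first kind of control
  carries decay and total mass to the limit. The second keeps the limit masses of the sets
  \<open>{F \<le> \<theta>}\<close> summable, and Borel-Cantelli concludes. Test functions replace
  indicators because the perturbation estimate treats trigonometric polynomials.\<close>

theorem measure_construction:
  fixes F :: "nat \<Rightarrow> real ^ 'n \<Rightarrow> real"
  assumes a: "0 \<le> a" and F0: "\<And>M x. 0 \<le> F M x"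
    and Fexp: "\<And>M x. M \<ge> 1 \<Longrightarrow> complex_of_real (F M x) = 1 + (\<Sum>m\<in>S M. of_real (f M m) * eexp (ivec m \<bullet> x))"
    and finS: "\<And>M. finite (S M)"
    and f: "\<And>M m. M \<ge> 1 \<Longrightarrow> m \<in> S M \<Longrightarrow> \<bar>f M m\<bar> * (1 + infnorm (ivec m)) powr a \<le> \<eta> M"
    and \<eta>: "\<eta> \<longlonglongrightarrow> 0" and \<theta>: "\<theta> \<longlonglongrightarrow> 0" "\<And>M. M \<ge> 1 \<Longrightarrow> \<theta> M > 0"
  obtains \<nu> :: "(real ^ 'n) measure" and C and Ms :: "nat \<Rightarrow> nat" where "strict_mono Ms" "Ms 0 \<ge> 1"
    "prob_space \<nu>" "sets \<nu> = sets borel"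
    "\<And>\<xi>. cmod (fourier_transform \<nu> \<xi>) * (1 + infnorm \<xi>) powr a \<le> C"
    "AE x in \<nu>. \<forall>\<^sub>F j in sequentially. \<theta> (Ms j) < F (Ms j) x"
proof -
  obtain \<mu> :: "(real ^ 'n) measure" and B where \<mu>: "prob_space \<mu>" "sets \<mu> = sets borel"
    and cube: "AE x in \<mu>. \<forall>i. 0 \<le> x $ i \<and> x $ i < 1" and B: "B > 0"
    "\<And>\<xi> S. finite S \<Longrightarrow> (\<Sum>m\<in>S. (1 + infnorm (\<xi> - ivec m)) powr a * cmod (fourier_transform \<mu> (\<xi> - ivec m))) \<le> B"
    by (rule base_measure[OF a]) blast
  interpret \<mu>: prob_space \<mu> by (rule \<mu>(1))
  note [measurable_cong] = \<mu>(2)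
  let ?w = "\<lambda>\<xi>::real^'n. (1 + infnorm \<xi>) powr a"
  have tF: "trigpoly (\<lambda>x. complex_of_real (F M x))" if "M \<ge> 1" for M
    unfolding Fexp[OF that] by (intro trigpoly_add trigpoly_const trigpoly_sum trigpoly_monom)
  define H where "H M = (SOME h. trigpoly (\<lambda>x. complex_of_real (h x)) \<and>
    (\<forall>x. 0 \<le> h x \<and> h x * F M x \<le> 4 * \<theta> M \<and> (F M x \<le> \<theta> M \<longrightarrow> 1 \<le> h x)))" for M
  have H: "trigpoly (\<lambda>x. complex_of_real (H M x)) \<and>
    (\<forall>x. 0 \<le> H M x \<and> H M x * F M x \<le> 4 * \<theta> M \<and> (F M x \<le> \<theta> M \<longrightarrow> 1 \<le> H M x))" if M: "M \<ge> 1" for M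
    unfolding H_def by (rule someI_ex[OF test_function[OF F0 tF[OF M] \<theta>(2)[OF M]]])
  define small where "small P \<epsilon> M \<longleftrightarrow> (\<forall>\<xi>. cmod (LINT x|\<mu>. P x * (complex_of_real (F M x) - 1) * eexp (- (x \<bullet> \<xi>))) * ?w \<xi> \<le> \<epsilon>)" for P \<epsilon> M
  have small: "eventually (small P \<epsilon>) sequentially" if P: "trigpoly P" and \<epsilon>: "\<epsilon> > 0" for P \<epsilon>
  proof -
    obtain e where e: "e \<longlonglongrightarrow> 0" "\<And>M \<xi>. M \<ge> 1 \<Longrightarrow>
      cmod (LINT x|\<mu>. P x * (complex_of_real (F M x) - 1) * eexp (- (x \<bullet> \<xi>))) * ?w \<xi> \<le> e M"
      using perturbation_small[OF \<mu> a B Fexp finS f \<eta> P] by blast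
    have "eventually (\<lambda>M. e M < \<epsilon>) sequentially" by (rule order_tendstoD(2)[OF e(1) \<epsilon>])
    then show ?thesis using eventually_ge_at_top[of 1]
    proof eventually_elim
      case (elim M)
      then show ?case unfolding small_def using e(2) by (meson less_imp_le order_trans)
    qed
  qed
  define PT where "PT Ml x = (\<Prod>M\<leftarrow>Ml. complex_of_real (F M x))" for Ml x
  have tPT: "trigpoly (PT Ml)" if "\<forall>M\<in>set Ml. M \<ge> 1" for Ml
    using that
  proof (induction Ml)
    case Nil then show ?case unfolding PT_def by (simp add: trigpoly_const)
  next
    case (Cons M Ml)
    then have "trigpoly (\<lambda>x. complex_of_real (F M x) * PT Ml x)" by (intro trigpoly_mult tF) auto
    then show ?case unfolding PT_def by simp
  qed
  \<comment> \<open>The total is \<open>1 / 2\<close>, so all masses \<open>m j\<close> stay between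
    \<open>1 / 2\<close> and \<open>3 / 2\<close>.\<close>
  define \<epsilon> where "\<epsilon> j = (1/4) * (1/2::real) ^ j" for j :: nat
  have \<epsilon>0: "\<epsilon> j > 0" for j by (simp add: \<epsilon>_def)
  have \<epsilon>sum: "(\<Sum>l=i..<j. \<epsilon> l) \<le> 2 * \<epsilon> i" for i j
  proof (cases "i \<le> j")
    case True
    have "(\<Sum>l=i..<j. \<epsilon> l) = 2 * \<epsilon> i - 2 * \<epsilon> j" using True
      by (induction j rule: dec_induct) (auto simp: \<epsilon>_def)
    then show ?thesis using \<epsilon>0[of j] by simp
  qed (use \<epsilon>0[of i] in simp)
  \<comment> \<open>The last clause protects the past: it keeps later factors from moving mass back
    to the sets where an earlier \<open>F\<close> was small.\<close>
  define good where "good Ml M \<longleftrightarrow> M \<ge> 1 \<and> (\<forall>m\<in>set Ml. m < M) \<and> \<theta> M < \<epsilon> (length Ml) \<and> small (PT Ml) (\<epsilon> (length Ml)) M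
    \<and> (\<forall>m\<in>set Ml. small (\<lambda>x. complex_of_real (H m x) * PT Ml x) (\<epsilon> (length Ml)) M)" for Ml M
  have ex_good: "\<exists>M. good Ml M" if Ml: "\<forall>M\<in>set Ml. M \<ge> 1" for Ml
  proof -
    have "eventually (\<lambda>M. \<forall>m\<in>set Ml. m < M) sequentially" by (intro eventually_ball_finite ballI eventually_gt_at_top) auto
    moreover have "eventually (\<lambda>M. \<theta> M < \<epsilon> (length Ml)) sequentially" by (rule order_tendstoD(2)[OF \<theta>(1) \<epsilon>0])
    moreover have "eventually (small (PT Ml) (\<epsilon> (length Ml))) sequentially" by (rule small[OF tPT[OF Ml] \<epsilon>0])
    moreover have "eventually (\<lambda>M. \<forall>m\<in>set Ml. small (\<lambda>x. complex_of_real (H m x) * PT Ml x) (\<epsilon> (length Ml)) M) sequentially"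
      using Ml H by (intro eventually_ball_finite ballI small trigpoly_mult tPT \<epsilon>0) auto
    ultimately have "eventually (good Ml) sequentially" using eventually_ge_at_top[of 1]
      by eventually_elim (simp add: good_def)
    then show ?thesis by (auto simp: eventually_sequentially)
  qed
  define nxt where "nxt Ml = (SOME M. good Ml M)" for Ml
  \<comment> \<open>The recursion carries the whole list of earlier choices, since the next one
    depends on all of them.\<close>
  define xs where "xs = rec_nat [] (\<lambda>_ Ml. Ml @ [nxt Ml])"
  define Ms where "Ms j = nxt (xs j)" for j
  have xs0: "xs 0 = []" and xsS: "xs (Suc j) = xs j @ [Ms j]" for j by (simp_all add: xs_def Ms_def)
  have len: "length (xs j) = j" for j by (induction j) (simp_all add: xs0 xsS)
  have set_xs: "set (xs j) = Ms ` {..<j}" for j by (induction j) (auto simp: xs0 xsS lessThan_Suc)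
  have xs1: "\<forall>M\<in>set (xs j). M \<ge> 1" for j
  proof (induction j)
    case (Suc j)
    have "good (xs j) (Ms j)" unfolding Ms_def nxt_def by (rule someI_ex[OF ex_good[OF Suc]])
    then show ?case using Suc by (simp add: xsS good_def)
  qed (simp add: xs0)
  have good: "good (xs j) (Ms j)" for j unfolding Ms_def nxt_def by (rule someI_ex[OF ex_good[OF xs1]])
  have Ms1: "Ms j \<ge> 1" for j using good[of j] by (simp add: good_def)
  have mono: "strict_mono Ms"
    unfolding strict_mono_Suc_iff
  proof
    fix j
    have "Ms j \<in> set (xs (Suc j))" by (simp add: xsS)
    then show "Ms j < Ms (Suc j)" using good[of "Suc j"] unfolding good_def by blast
  qed
  define P where "P j x = (\<Prod>i<j. F (Ms i) x)" for j x
  have PPT: "complex_of_real (P j x) = PT (xs j) x" for j x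
    by (induction j) (simp_all add: P_def PT_def xs0 xsS)
  have P0: "P j x \<ge> 0" for j x unfolding P_def by (intro prod_nonneg) (simp add: F0)
  have tP: "trigpoly (\<lambda>x. complex_of_real (P j x))" for j unfolding PPT by (rule tPT[OF xs1])
  have Pm [measurable]: "P j \<in> borel_measurable borel" for j
  proof -
    have "(\<lambda>x. Re (complex_of_real (P j x))) \<in> borel_measurable borel"
      by (rule borel_measurable_continuous_onI) (intro continuous_intros trigpoly_continuous[OF tP])
    then show ?thesis by simp
  qed
  define D where "D g j = (LINT x|\<mu>. g x * complex_of_real (P j x))" for g :: "real ^ 'n \<Rightarrow> complex" and j
  have D_step: "D g (Suc j) = D g j + (LINT x|\<mu>. g x * complex_of_real (P j x) * (complex_of_real (F (Ms j) x) - 1))"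
    if g: "continuous_on UNIV g" "\<And>x. cmod (g x) \<le> K" for g K j
  proof -
    have [measurable]: "g \<in> borel_measurable borel" by (rule borel_measurable_continuous_onI[OF g(1)])
    have int: "integrable \<mu> (\<lambda>x. g x * t x)" if t: "trigpoly t" for t
    proof -
      obtain L where L: "\<And>x. cmod (t x) \<le> L" using trigpoly_bounded[OF t] by blast
      have [measurable]: "t \<in> borel_measurable borel" by (rule borel_measurable_continuous_onI[OF trigpoly_continuous[OF t]])
      have "cmod (g x * t x) \<le> K * L" for x
        unfolding norm_mult by (intro mult_mono g(2) L) (auto intro: order_trans[OF norm_ge_zero g(2)])
      then show ?thesis by (intro \<mu>.integrable_const_bound[of _ "K * L"]) auto
    qed
    have "trigpoly (\<lambda>x. complex_of_real (P j x) * (complex_of_real (F (Ms j) x) + (- 1)))"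
      by (intro trigpoly_mult tP trigpoly_add tF Ms1 trigpoly_const)
    then have i2: "integrable \<mu> (\<lambda>x. g x * (complex_of_real (P j x) * (complex_of_real (F (Ms j) x) + (- 1))))" by (rule int)
    have "D g (Suc j) = (LINT x|\<mu>. g x * complex_of_real (P j x) + g x * (complex_of_real (P j x) * (complex_of_real (F (Ms j) x) + (- 1))))"
      unfolding D_def by (intro Bochner_Integration.integral_cong refl) (simp add: P_def algebra_simps)
    also have "\<dots> = D g j + (LINT x|\<mu>. g x * (complex_of_real (P j x) * (complex_of_real (F (Ms j) x) + (- 1))))"
      unfolding D_def by (rule Bochner_Integration.integral_add[OF int[OF tP] i2])
    finally show ?thesis by (simp add: mult.assoc)
  qed
  have tele: "cmod (D g j) * c \<le> cmod (D g i) * c + 2 * \<epsilon> i" if "i \<le> j" and g: "continuous_on UNIV g" "\<And>x. cmod (g x) \<le> K"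
    and c: "c \<ge> 0"
    and st: "\<And>l. i \<le> l \<Longrightarrow> cmod (LINT x|\<mu>. g x * complex_of_real (P l x) * (complex_of_real (F (Ms l) x) - 1)) * c \<le> \<epsilon> l"
    for g K i j c
  proof -
    have "cmod (D g j) * c \<le> cmod (D g i) * c + (\<Sum>l=i..<j. \<epsilon> l)" using \<open>i \<le> j\<close>
    proof (induction j rule: dec_induct)
      case (step l)
      have "cmod (D g (Suc l)) * c \<le> cmod (D g l) * c + cmod (LINT x|\<mu>. g x * complex_of_real (P l x) * (complex_of_real (F (Ms l) x) - 1)) * c"
        unfolding D_step[OF g] distrib_right[symmetric] using c
        by (intro mult_right_mono norm_triangle_ineq) auto
      then show ?case using step st[of l] by simp
    qed simp
    then show ?thesis using \<epsilon>sum[of i j] by linarith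
  qed
  define m where "m j = (LINT x|\<mu>. P j x)" for j
  have intP: "integrable \<mu> (P j)" for j
  proof -
    have "integrable \<mu> (\<lambda>x. Re (complex_of_real (P j x)))" by (intro integrable_Re integrable_trigpoly(2)[OF \<mu> tP])
    then show ?thesis by simp
  qed
  have Dm: "D (\<lambda>x. 1) j = of_real (m j)" for j unfolding D_def m_def by simp
  have m_bounds: "1 / 2 \<le> m j" "m j \<le> 3 / 2" for j
  proof -
    have st: "cmod (LINT x|\<mu>. 1 * complex_of_real (P l x) * (complex_of_real (F (Ms l) x) - 1)) \<le> \<epsilon> l" for l
    proof -
      have "small (PT (xs l)) (\<epsilon> l) (Ms l)" using good[of l] by (simp add: good_def len)
      then have "cmod (LINT x|\<mu>. PT (xs l) x * (complex_of_real (F (Ms l) x) - 1) * eexp (- (x \<bullet> 0))) * ?w 0 \<le> \<epsilon> l"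
        unfolding small_def by blast
      then show ?thesis by (simp add: PPT infnorm_0)
    qed
    have "cmod (D (\<lambda>x. 1) j - 1) \<le> (\<Sum>l<j. \<epsilon> l)"
    proof (induction j)
      case 0 then show ?case by (simp add: D_def P_def \<mu>.prob_space)
    next
      case (Suc j)
      have "D (\<lambda>x. 1) (Suc j) - 1 = (D (\<lambda>x. 1) j - 1) + (LINT x|\<mu>. 1 * complex_of_real (P j x) * (complex_of_real (F (Ms j) x) - 1))"
        using D_step[of "\<lambda>x. 1" 1 j] by simp
      then have "cmod (D (\<lambda>x. 1) (Suc j) - 1) \<le> cmod (D (\<lambda>x. 1) j - 1)
          + cmod (LINT x|\<mu>. 1 * complex_of_real (P j x) * (complex_of_real (F (Ms j) x) - 1))"
        by (simp only: norm_triangle_ineq)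
      then have "cmod (D (\<lambda>x. 1) (Suc j) - 1) \<le> cmod (D (\<lambda>x. 1) j - 1) + \<epsilon> j"
        using st[of j] by linarith
      then show ?case using Suc by simp
    qed
    also have "(\<Sum>l<j. \<epsilon> l) \<le> 1 / 2" using \<epsilon>sum[of 0 j] by (simp add: atLeast0LessThan \<epsilon>_def)
    finally have "cmod (of_real (m j - 1)) \<le> 1 / 2" by (simp add: Dm)
    then have "\<bar>m j - 1\<bar> \<le> 1 / 2" by (simp only: norm_of_real)
    then have "m j - 1 \<le> 1 / 2" "- (m j - 1) \<le> 1 / 2" by (rule abs_le_D1, rule abs_le_D2)
    then show "1 / 2 \<le> m j" "m j \<le> 3 / 2" by linarith+
  qed
  have mpos: "m j > 0" for j using m_bounds(1)[of j] by linarith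
  define \<nu>s where "\<nu>s j = density \<mu> (\<lambda>x. ennreal (P j x / m j))" for j
  have \<nu>int: "(LINT x|\<nu>s j. g x) = D g j / of_real (m j)" if "continuous_on UNIV g" for g :: "real ^ 'n \<Rightarrow> complex" and j
  proof -
    have [measurable]: "g \<in> borel_measurable borel" by (rule borel_measurable_continuous_onI[OF that])
    have "(LINT x|\<nu>s j. g x) = (LINT x|\<mu>. (P j x / m j) *\<^sub>R g x)"
      unfolding \<nu>s_def using P0 mpos[of j] by (intro integral_density) (auto intro!: AE_I2 divide_nonneg_pos)
    also have "\<dots> = (LINT x|\<mu>. (g x * complex_of_real (P j x)) / of_real (m j))"
      by (intro Bochner_Integration.integral_cong refl) (simp add: scaleR_conv_of_real mult_ac)
    finally show ?thesis by (simp add: D_def)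
  qed
  have \<nu>prob: "prob_space (\<nu>s j)" for j
  proof (rule prob_spaceI)
    have "emeasure (\<nu>s j) (space (\<nu>s j)) = (\<integral>\<^sup>+x. ennreal (P j x / m j) \<partial>\<mu>)"
      unfolding \<nu>s_def by (subst emeasure_density) (auto intro!: nn_integral_cong simp: indicator_def)
    also have "\<dots> = ennreal (LINT x|\<mu>. P j x / m j)"
      using intP[of j] P0 mpos[of j] by (intro nn_integral_eq_integral) (auto intro!: AE_I2 divide_nonneg_pos)
    also have "\<dots> = 1" using mpos[of j] by (simp add: m_def)
    finally show "emeasure (\<nu>s j) (space (\<nu>s j)) = 1" .
  qed
  have \<nu>sets: "sets (\<nu>s j) = sets borel" for j by (simp add: \<nu>s_def \<mu>(2))
  have \<nu>cube: "AE x in \<nu>s j. \<forall>i. 0 \<le> x $ i \<and> x $ i < 1" for j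
    unfolding \<nu>s_def using cube by (subst AE_density) auto
  obtain r \<nu> where r: "strict_mono (r :: nat \<Rightarrow> nat)" and \<nu>: "prob_space \<nu>" "sets \<nu> = sets (borel :: (real ^ 'n) measure)"
    and lim: "\<And>g K. continuous_on UNIV g \<Longrightarrow> (\<And>x. cmod (g x) \<le> K) \<Longrightarrow> (\<lambda>k. LINT x|\<nu>s (r k). g x) \<longlonglongrightarrow> (LINT x|\<nu>. g x)"
    by (rule cube_weak_compactness[where \<mu> = \<nu>s, OF \<nu>prob \<nu>sets \<nu>cube]) blast
  \<comment> \<open>The factor 2 pays for the normalisation by
    \<open>m j \<ge> 1 / 2\<close>.\<close>
  have lim_bound: "cmod (LINT x|\<nu>. g x) * c \<le> 2 * L"
    if g: "continuous_on UNIV g" "\<And>x. cmod (g x) \<le> K" and c: "c \<ge> 0" and L: "\<And>j. j \<ge> j0 \<Longrightarrow> cmod (D g j) * c \<le> L" for g K c L j0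
  proof (rule LIMSEQ_le_const2)
    show "(\<lambda>k. cmod (LINT x|\<nu>s (r k). g x) * c) \<longlonglongrightarrow> cmod (LINT x|\<nu>. g x) * c"
      by (intro tendsto_mult tendsto_norm lim[OF g] tendsto_const)
    show "\<exists>N. \<forall>k\<ge>N. cmod (LINT x|\<nu>s (r k). g x) * c \<le> 2 * L"
    proof (intro exI[of _ j0] allI impI)
      fix k assume "j0 \<le> k"
      then have j: "r k \<ge> j0" using seq_suble[OF r, of k] by simp
      have "cmod (LINT x|\<nu>s (r k). g x) * c = (cmod (D g (r k)) * c) / m (r k)"
        using mpos[of "r k"] by (simp add: \<nu>int[OF g(1)] norm_divide)
      also have "\<dots> \<le> (cmod (D g (r k)) * c) / (1 / 2)"
        using m_bounds(1)[of "r k"] c by (intro divide_left_mono) auto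
      finally show "cmod (LINT x|\<nu>s (r k). g x) * c \<le> 2 * L" using L[OF j] by simp
    qed
  qed
  interpret \<nu>: prob_space \<nu> by (rule \<nu>(1))
  note [measurable_cong] = \<nu>(2)
  show thesis
  proof (rule that[OF mono Ms1 \<nu>])
    fix \<xi> :: "real ^ 'n"
    have cont: "continuous_on UNIV (\<lambda>x::real^'n. eexp (- (x \<bullet> \<xi>)))" by (intro continuous_intros)
    have "cmod (D (\<lambda>x. eexp (- (x \<bullet> \<xi>))) j) * ?w \<xi> \<le> B + 1" for j
    proof -
      have "cmod (D (\<lambda>x. eexp (- (x \<bullet> \<xi>))) j) * ?w \<xi> \<le> cmod (D (\<lambda>x. eexp (- (x \<bullet> \<xi>))) 0) * ?w \<xi> + 2 * \<epsilon> 0"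
      proof (rule tele[OF _ cont])
        show "cmod (eexp (- (x \<bullet> \<xi>))) \<le> 1" for x by simp
        fix l
        have "small (PT (xs l)) (\<epsilon> l) (Ms l)" using good[of l] by (simp add: good_def len)
        then show "cmod (LINT x|\<mu>. eexp (- (x \<bullet> \<xi>)) * complex_of_real (P l x) * (complex_of_real (F (Ms l) x) - 1)) * ?w \<xi> \<le> \<epsilon> l"
          unfolding small_def PPT by (simp add: mult_ac)
      qed auto
      moreover have "D (\<lambda>x. eexp (- (x \<bullet> \<xi>))) 0 = fourier_transform \<mu> \<xi>" by (simp add: D_def P_def fourier_transform_eexp)
      moreover have "cmod (fourier_transform \<mu> \<xi>) * ?w \<xi> \<le> B" using B(2)[of "{0}" \<xi>] by (simp add: mult.commute)
      ultimately show ?thesis by (simp add: \<epsilon>_def)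
    qed
    then show "cmod (fourier_transform \<nu> \<xi>) * ?w \<xi> \<le> 2 * (B + 1)"
      unfolding fourier_transform_eexp by (intro lim_bound[OF cont, of 1 _ 0]) auto
  next
    let ?A = "\<lambda>i. {x. F (Ms i) x \<le> \<theta> (Ms i)}"
    have Fc: "continuous_on UNIV (\<lambda>x. F (Ms i) x)" for i
    proof -
      have "continuous_on UNIV (\<lambda>x. Re (complex_of_real (F (Ms i) x)))"
        by (intro continuous_intros trigpoly_continuous tF Ms1)
      then show ?thesis by simp
    qed
    have [measurable]: "F (Ms i) \<in> borel_measurable borel" for i by (rule borel_measurable_continuous_onI[OF Fc])
    have A: "?A i \<in> sets \<nu>" for i by measurable
    \<comment> \<open>Right after factor \<open>i\<close> is inserted the test function has integral
      at most \<open>4 * \<theta> (Ms i) * m i \<le> 6 * \<epsilon> i\<close>. Later factors add at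
      most \<open>2 * \<epsilon> (Suc i) = \<epsilon> i\<close>, and the passage to the normalised
      limit doubles the bound.\<close>
    have "measure \<nu> (?A i) \<le> 16 * \<epsilon> i" for i
    proof -
      let ?H = "\<lambda>x. complex_of_real (H (Ms i) x)"
      have tH: "trigpoly ?H" and H0: "\<And>x. 0 \<le> H (Ms i) x" and HF: "\<And>x. H (Ms i) x * F (Ms i) x \<le> 4 * \<theta> (Ms i)"
        and H1: "\<And>x. F (Ms i) x \<le> \<theta> (Ms i) \<Longrightarrow> 1 \<le> H (Ms i) x"
        using H[OF Ms1[of i]] by blast+
      obtain K where K: "\<And>x. cmod (?H x) \<le> K" using trigpoly_bounded[OF tH] by blast
      have Hc: "continuous_on UNIV ?H" by (rule trigpoly_continuous[OF tH])
      have \<theta>\<epsilon>: "0 < \<theta> (Ms i)" "\<theta> (Ms i) \<le> \<epsilon> i" using good[of i] \<theta>(2)[OF Ms1[of i]] by (auto simp: good_def len)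
      have tHP: "trigpoly (\<lambda>x. ?H x * complex_of_real (P (Suc i) x))" by (intro trigpoly_mult tH tP)
      have DH: "cmod (D ?H (Suc i)) \<le> 6 * \<epsilon> i"
      proof -
        have "D ?H (Suc i) = (LINT x|\<mu>. complex_of_real (H (Ms i) x * P (Suc i) x))" by (simp add: D_def)
        also have "\<dots> = complex_of_real (LINT x|\<mu>. H (Ms i) x * P (Suc i) x)" by (rule integral_complex_of_real)
        finally have "cmod (D ?H (Suc i)) = \<bar>LINT x|\<mu>. H (Ms i) x * P (Suc i) x\<bar>" by (simp only: norm_of_real)
        also have "\<dots> = (LINT x|\<mu>. H (Ms i) x * P (Suc i) x)" by (intro abs_of_nonneg integral_nonneg_AE AE_I2 mult_nonneg_nonneg H0 P0)
        also have "\<dots> \<le> (LINT x|\<mu>. (4 * \<theta> (Ms i)) * P i x)"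
        proof (rule integral_mono)
          have "integrable \<mu> (\<lambda>x. Re (?H x * complex_of_real (P (Suc i) x)))"
            by (intro integrable_Re integrable_trigpoly(2)[OF \<mu> tHP])
          then show "integrable \<mu> (\<lambda>x. H (Ms i) x * P (Suc i) x)" by simp
          show "integrable \<mu> (\<lambda>x. (4 * \<theta> (Ms i)) * P i x)" using intP by simp
          fix x
          have "(H (Ms i) x * F (Ms i) x) * P i x \<le> (4 * \<theta> (Ms i)) * P i x" by (intro mult_right_mono HF P0)
          then show "H (Ms i) x * P (Suc i) x \<le> (4 * \<theta> (Ms i)) * P i x" by (simp add: P_def mult_ac)
        qed
        also have "\<dots> = 4 * \<theta> (Ms i) * m i" by (simp add: m_def)
        also have "\<dots> \<le> 4 * \<epsilon> i * (3 / 2)" using \<theta>\<epsilon> m_bounds[of i] \<epsilon>0[of i] by (intro mult_mono) auto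
        finally show ?thesis by simp
      qed
      have DH': "cmod (D ?H j) * 1 \<le> cmod (D ?H (Suc i)) * 1 + 2 * \<epsilon> (Suc i)" if "j \<ge> Suc i" for j
      proof (rule tele[OF that Hc K])
        fix l assume l: "Suc i \<le> l"
        have "Ms i \<in> set (xs l)" using l by (auto simp: set_xs)
        then have "small (\<lambda>x. ?H x * PT (xs l) x) (\<epsilon> l) (Ms l)" using good[of l] by (simp add: good_def len)
        then have "cmod (LINT x|\<mu>. ?H x * PT (xs l) x * (complex_of_real (F (Ms l) x) - 1) * eexp (- (x \<bullet> 0))) * ?w 0 \<le> \<epsilon> l"
          unfolding small_def by blast
        then show "cmod (LINT x|\<mu>. ?H x * complex_of_real (P l x) * (complex_of_real (F (Ms l) x) - 1)) * 1 \<le> \<epsilon> l"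
          by (simp add: PPT infnorm_0)
      qed simp
      have "2 * \<epsilon> (Suc i) = \<epsilon> i" by (simp add: \<epsilon>_def)
      then have "cmod (D ?H j) * 1 \<le> 8 * \<epsilon> i" if "j \<ge> Suc i" for j
        using DH DH'[OF that] \<epsilon>0[of i] by linarith
      then have "cmod (LINT x|\<nu>. ?H x) * 1 \<le> 2 * (8 * \<epsilon> i)" by (intro lim_bound[OF Hc K, of 1 "Suc i"]) auto
      moreover have "(LINT x|\<nu>. ?H x) = complex_of_real (LINT x|\<nu>. H (Ms i) x)" by (rule integral_complex_of_real)
      ultimately have Hint: "(LINT x|\<nu>. H (Ms i) x) \<le> 16 * \<epsilon> i" by simp
      have "measure \<nu> (?A i) = (LINT x|\<nu>. indicator (?A i) x)" using A[of i] by simp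
      also have "\<dots> \<le> (LINT x|\<nu>. H (Ms i) x)"
      proof (rule integral_mono)
        show "integrable \<nu> (indicator (?A i) :: _ \<Rightarrow> real)" using A[of i] by (simp add: \<nu>.emeasure_eq_measure)
        have "integrable \<nu> (\<lambda>x. Re (?H x))" by (intro integrable_Re integrable_trigpoly(2)[OF \<nu> tH])
        then show "integrable \<nu> (H (Ms i))" by simp
        fix x show "indicator (?A i) x \<le> H (Ms i) x" using H0[of x] H1[of x] by (simp add: indicator_def)
      qed
      finally show ?thesis using Hint by simp
    qed
    then have "norm (measure \<nu> (?A i)) \<le> 16 * \<epsilon> i" for i by simp
    moreover have "summable (\<lambda>i. 16 * \<epsilon> i)" unfolding \<epsilon>_def by (intro summable_mult summable_geometric) auto
    ultimately have "summable (\<lambda>i. measure \<nu> (?A i))"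
      by (rule summable_comparison_test'[rotated])
    then have "AE x in \<nu>. \<forall>\<^sub>F i in sequentially. x \<in> space \<nu> - ?A i"
      by (intro borel_cantelli_AE1 A) (auto simp: \<nu>.emeasure_eq_measure)
    then show "AE x in \<nu>. \<forall>\<^sub>F j in sequentially. \<theta> (Ms j) < F (Ms j) x"
    proof eventually_elim
      case (elim x)
      then show ?case by eventually_elim auto
    qed
  qed
qed

section \<open>The Hausdorff measure of the approximation set\<close>

lemma hausdorff_null_iff:
  "hausdorff_outer_measure s E = 0 \<longleftrightarrow> (\<forall>\<delta>>0. \<forall>\<eta>>0. \<exists>U :: nat \<Rightarrow> 'a::metric_space set.
    (\<forall>i. bounded (U i) \<and> diameter (U i) \<le> \<delta>) \<and> E \<subseteq> (\<Union>i. U i) \<and> (\<Sum>i. diam_powr s (U i)) < \<eta>)"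
proof -
  have "hausdorff_outer_measure s E = 0 \<longleftrightarrow> (\<forall>\<delta>>0. hausdorff_premeasure s \<delta> E = 0)"
    unfolding hausdorff_outer_measure_def by (auto simp: bot_ennreal[symmetric] SUP_bot_conv)
  also have "\<dots> \<longleftrightarrow> (\<forall>\<delta>>0. \<forall>\<eta>>0. hausdorff_premeasure s \<delta> E < \<eta>)"
    using zero_less_iff_neq_zero by (metis less_irrefl)
  finally show ?thesis unfolding hausdorff_premeasure_def INF_less_iff by auto
qed

text \<open>Covers may be indexed by any countable type, such as pairs of integer vectors, and only
  finite partial sums have to be estimated. The sequence in the definition is filled up with empty
  sets, which contribute 0.\<close>

lemma hausdorff_nullI:
  fixes E :: "'a::metric_space set"
  assumes "\<And>\<delta> \<eta> :: real. \<delta> > 0 \<Longrightarrow> \<eta> > 0 \<Longrightarrow> \<exists>U :: 'i::countable \<Rightarrow> 'a set.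
    (\<forall>i. bounded (U i) \<and> diameter (U i) \<le> \<delta>) \<and> E \<subseteq> (\<Union>i. U i) \<and>
    (\<forall>S. finite S \<longrightarrow> (\<Sum>i\<in>S. diam_powr s (U i)) \<le> ennreal \<eta>)"
  shows "hausdorff_outer_measure s E = 0"
  unfolding hausdorff_null_iff
proof (intro allI impI)
  fix \<delta> :: real and \<eta> :: ennreal assume \<delta>: "\<delta> > 0" and \<eta>: "\<eta> > 0"
  obtain e :: real where e: "e > 0" "ennreal e < \<eta>"
  proof -
    obtain y where y: "0 < y" "y < \<eta>" using dense[OF \<eta>] by blast
    then have "y < \<top>" using less_top order_less_le_trans by (metis top_greatest)
    then have "ennreal (enn2real y) = y" by simp
    moreover have "enn2real y > 0" using y \<open>y < \<top>\<close> by (simp add: enn2real_positive_iff)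
    ultimately show thesis using that[of "enn2real y"] y by simp
  qed
  obtain U :: "'i \<Rightarrow> 'a set" where U: "\<forall>i. bounded (U i) \<and> diameter (U i) \<le> \<delta>" "E \<subseteq> (\<Union>i. U i)"
    "\<And>S. finite S \<Longrightarrow> (\<Sum>i\<in>S. diam_powr s (U i)) \<le> ennreal e" using assms[OF \<delta> e(1)] by blast
  define V where "V n = (if n \<in> range (to_nat :: 'i \<Rightarrow> nat) then U (from_nat n) else {})" for n
  have "\<forall>n. bounded (V n) \<and> diameter (V n) \<le> \<delta>" using U(1) \<delta> by (simp add: V_def)
  moreover have "E \<subseteq> (\<Union>n. V n)"
  proof
    fix x assume "x \<in> E"
    then obtain i where "x \<in> U i" using U(2) by blast
    then have "x \<in> V (to_nat i)" by (simp add: V_def)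
    then show "x \<in> (\<Union>n. V n)" by blast
  qed
  moreover have "(\<Sum>n. diam_powr s (V n)) \<le> ennreal e"
    unfolding suminf_eq_SUP
  proof (rule SUP_least)
    fix N
    let ?S = "{i :: 'i. to_nat i < N}"
    have fin: "finite ?S" using finite_vimageI[of "{..<N}" "to_nat :: 'i \<Rightarrow> nat"] by (simp add: vimage_def)
    have "(\<Sum>n<N. diam_powr s (V n)) = (\<Sum>n\<in>to_nat ` ?S. diam_powr s (V n))"
      by (rule sum.mono_neutral_right) (auto simp: V_def diam_powr_def)
    also have "\<dots> = (\<Sum>i\<in>?S. diam_powr s (U i))" by (subst sum.reindex) (auto simp: V_def)
    also have "\<dots> \<le> ennreal e" by (rule U(3)[OF fin])
    finally show "(\<Sum>n<N. diam_powr s (V n)) \<le> ennreal e" .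
  qed
  ultimately show "\<exists>U. (\<forall>i. bounded (U i) \<and> diameter (U i) \<le> \<delta>) \<and> E \<subseteq> (\<Union>i. U i) \<and> (\<Sum>i. diam_powr s (U i)) < \<eta>"
    using e(2) by (intro exI[of _ V]) auto
qed

lemma hausdorff_null_UN:
  fixes E :: "nat \<Rightarrow> 'a::metric_space set"
  assumes "\<And>R. hausdorff_outer_measure s (E R) = 0"
  shows "hausdorff_outer_measure s (\<Union>R. E R) = 0"
proof (rule hausdorff_nullI)
  fix \<delta> \<eta> :: real assume \<delta>: "\<delta> > 0" and \<eta>: "\<eta> > 0"
  define c where "c R = \<eta> * (1/2) ^ Suc R" for R :: nat
  have c0: "c R > 0" for R using \<eta> by (simp add: c_def)
  have "\<exists>U :: nat \<Rightarrow> 'a set. (\<forall>i. bounded (U i) \<and> diameter (U i) \<le> \<delta>) \<and> E R \<subseteq> (\<Union>i. U i) \<and> (\<Sum>i. diam_powr s (U i)) < ennreal (c R)" for R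
    using assms[of R] \<delta> c0[of R] unfolding hausdorff_null_iff by (simp add: ennreal_less_zero_iff)
  then obtain U :: "nat \<Rightarrow> nat \<Rightarrow> 'a set" where U: "\<And>R. (\<forall>i. bounded (U R i) \<and> diameter (U R i) \<le> \<delta>)"
    "\<And>R. E R \<subseteq> (\<Union>i. U R i)" "\<And>R. (\<Sum>i. diam_powr s (U R i)) < ennreal (c R)" by metis
  have "(\<Sum>p\<in>S. diam_powr s (U (fst p) (snd p))) \<le> ennreal \<eta>" if S: "finite S" for S
  proof -
    have "(\<Sum>p\<in>S. diam_powr s (U (fst p) (snd p))) \<le> (\<Sum>p\<in>fst ` S \<times> snd ` S. diam_powr s (U (fst p) (snd p)))"
      using S by (intro sum_mono2) (auto intro: rev_image_eqI)
    also have "\<dots> = (\<Sum>R\<in>fst ` S. \<Sum>i\<in>snd ` S. diam_powr s (U R i))"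
      by (simp add: sum.cartesian_product case_prod_unfold)
    also have "\<dots> \<le> (\<Sum>R\<in>fst ` S. ennreal (c R))"
    proof (rule sum_mono)
      fix R
      have "(\<Sum>i\<in>snd ` S. diam_powr s (U R i)) \<le> (\<Sum>i. diam_powr s (U R i))" using S by (intro sum_le_suminf) auto
      then show "(\<Sum>i\<in>snd ` S. diam_powr s (U R i)) \<le> ennreal (c R)" using U(3)[of R] by simp
    qed
    also have "\<dots> = ennreal (\<Sum>R\<in>fst ` S. c R)" using c0 by (intro sum_ennreal) (auto intro: less_imp_le)
    also have "(\<Sum>R\<in>fst ` S. c R) \<le> (\<Sum>R. c R)"
      using S c0 unfolding c_def by (intro sum_le_suminf summable_mult summable_geometric) (auto intro: less_imp_le)
    also have "(\<Sum>R. c R) = \<eta>" using sums_unique[OF sums_mult[OF power_half_series, of \<eta>]] by (simp add: c_def)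
    finally show ?thesis by (simp add: ennreal_leI)
  qed
  then show "\<exists>U :: nat \<times> nat \<Rightarrow> 'a set. (\<forall>i. bounded (U i) \<and> diameter (U i) \<le> \<delta>) \<and> (\<Union>R. E R) \<subseteq> (\<Union>i. U i) \<and>
    (\<forall>S. finite S \<longrightarrow> (\<Sum>i\<in>S. diam_powr s (U i)) \<le> ennreal \<eta>)"
    using U(1,2) by (intro exI[of _ "\<lambda>p. U (fst p) (snd p)"]) fastforce
qed

text \<open>The sum over the lattice is bounded by a product of one-dimensional sums, since
  \<open>|q| powr (- \<beta>) \<le> (\<Prod>i. max 1 |q i| powr (- \<beta> / n))\<close>.\<close>

lemma sum_infnorm_powr_bounded:
  fixes \<beta> :: real assumes \<beta>: "\<beta> > CARD('n)"
  obtains B where "B > 0" "\<And>S :: (int ^ 'n) set. finite S \<Longrightarrow> 0 \<notin> S \<Longrightarrow> (\<Sum>q\<in>S. infnorm (ivec q) powr (- \<beta>)) \<le> B"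
proof -
  define \<gamma> where "\<gamma> = \<beta> / CARD('n)"
  have \<gamma>: "\<gamma> > 1" using \<beta> by (simp add: \<gamma>_def)
  \<comment> \<open>The maximum with 1 matters at \<open>k = 0\<close>, where
    \<open>0 powr (- \<gamma>)\<close> is 0 and would make the product useless as an upper
    bound.\<close>
  define h where "h k = max 1 \<bar>real_of_int k\<bar> powr (- \<gamma>)" for k :: int
  have sm: "summable (\<lambda>k. real k powr (- \<gamma>))" using \<gamma> by (simp add: summable_real_powr_iff)
  define B1 where "B1 = 1 + 2 * (\<Sum>k. real k powr (- \<gamma>))"
  have B1: "B1 \<ge> 1" unfolding B1_def using suminf_nonneg[OF sm] by simp
  have hsum: "(\<Sum>k\<in>{- H..H}. h k) \<le> B1" for H
  proof -
    have h0: "h k \<ge> 0" for k by (simp add: h_def)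
    have "(\<Sum>k\<in>{- H..H}. h k) \<le> (\<Sum>k\<in>{0} \<union> {1..H} \<union> {- H..- 1}. h k)" by (rule sum_mono2) (auto simp: h0)
    also have "\<dots> = h 0 + (\<Sum>k\<in>{1..H}. h k) + (\<Sum>k\<in>{- H..- 1}. h k)"
      by (subst sum.union_disjoint; (subst sum.union_disjoint)?; auto)
    also have "(\<Sum>k\<in>{- H..- 1}. h k) = (\<Sum>k\<in>{1..H}. h k)"
      by (rule sum.reindex_bij_witness[of _ uminus uminus]) (auto simp: h_def)
    also have "(\<Sum>k\<in>{1..H}. h k) = (\<Sum>k\<in>nat ` {1..H}. real k powr (- \<gamma>))"
      by (subst sum.reindex) (auto simp: inj_on_def h_def max_def intro!: sum.cong)
    also have "\<dots> \<le> (\<Sum>k. real k powr (- \<gamma>))" by (rule sum_le_suminf[OF sm]) auto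
    finally show ?thesis by (simp add: B1_def h_def)
  qed
  show thesis
  proof (rule that[of "B1 ^ CARD('n)"])
    show "B1 ^ CARD('n) > 0" using B1 by simp
    fix S :: "(int ^ 'n) set" assume S: "finite S" "0 \<notin> S"
    have "(\<Sum>q\<in>S. infnorm (ivec q) powr (- \<beta>)) \<le> (\<Sum>q\<in>S. \<Prod>i\<in>UNIV. h (q $ i))"
    proof (rule sum_mono)
      fix q assume "q \<in> S"
      then have q: "infnorm (ivec q) \<ge> 1" using S by (intro infnorm_ivec_ge_1) auto
      have "infnorm (ivec q) powr (- \<beta>) = (infnorm (ivec q) powr (- \<gamma>)) ^ CARD('n)"
        using q by (simp add: powr_realpow[symmetric] powr_powr \<gamma>_def)
      also have "\<dots> = (\<Prod>i\<in>(UNIV :: 'n set). infnorm (ivec q) powr (- \<gamma>))" by simp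
      also have "\<dots> \<le> (\<Prod>i\<in>UNIV. h (q $ i))"
      proof (intro prod_mono conjI)
        fix i
        have "max 1 \<bar>real_of_int (q $ i)\<bar> \<le> infnorm (ivec q)"
          using q component_le_infnorm_cart[of "ivec q" i] by simp
        then show "infnorm (ivec q) powr (- \<gamma>) \<le> h (q $ i)"
          unfolding h_def using \<gamma> by (intro powr_mono2') auto
      qed simp
      finally show "infnorm (ivec q) powr (- \<beta>) \<le> (\<Prod>i\<in>UNIV. h (q $ i))" .
    qed
    also have "\<dots> \<le> B1 ^ CARD('n)"
    proof -
      define H where "H = (\<Sum>m\<in>S. \<Sum>i\<in>UNIV. \<bar>m $ i\<bar>)"
      have H0: "H \<ge> 0" unfolding H_def by (intro sum_nonneg) auto
      let ?P = "PiE (UNIV :: 'n set) (\<lambda>_. {- H..H})"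
      have "S \<subseteq> (\<lambda>g. \<chi> i. g i) ` ?P"
      proof
        fix q assume q: "q \<in> S"
        have "\<bar>q $ i\<bar> \<le> H" for i
        proof -
          have "\<bar>q $ i\<bar> \<le> (\<Sum>i\<in>UNIV. \<bar>q $ i\<bar>)" by (rule member_le_sum) auto
          also have "\<dots> \<le> H" unfolding H_def using q S by (intro member_le_sum sum_nonneg) auto
          finally show ?thesis .
        qed
        then have "(\<lambda>i. q $ i) \<in> ?P" by (auto simp: PiE_iff abs_le_iff minus_le_iff)
        then show "q \<in> (\<lambda>g. \<chi> i. g i) ` ?P" by (intro image_eqI[of _ _ "\<lambda>i. q $ i"]) auto
      qed
      moreover have finP: "finite ?P" by (intro finite_PiE) auto
      ultimately have "(\<Sum>q\<in>S. \<Prod>i\<in>UNIV. h (q $ i)) \<le> (\<Sum>q\<in>(\<lambda>g. \<chi> i. g i) ` ?P. \<Prod>i\<in>UNIV. h (q $ i))"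
        by (intro sum_mono2) (auto simp: h_def intro!: prod_nonneg)
      also have "\<dots> = (\<Sum>g\<in>?P. \<Prod>i\<in>UNIV. h (g i))" by (subst sum.reindex) (auto simp: inj_on_def vec_eq_iff)
      also have "\<dots> = (\<Prod>i\<in>(UNIV :: 'n set). \<Sum>k\<in>{- H..H}. h k)" by (rule prod_sum_PiE[symmetric]) auto
      also have "\<dots> \<le> (\<Prod>i\<in>(UNIV :: 'n set). B1)"
        using hsum by (intro prod_mono conjI sum_nonneg) (auto simp: h_def)
      finally show ?thesis by simp
    qed
    finally show "(\<Sum>q\<in>S. infnorm (ivec q) powr (- \<beta>)) \<le> B1 ^ CARD('n)" .
  qed
qed

lemma box_diameter:
  fixes c :: "real ^ 'n" and \<rho> :: real
  assumes "\<rho> \<ge> 0"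
  shows "bounded {x. infnorm (x - c) \<le> \<rho>}" "diameter {x. infnorm (x - c) \<le> \<rho>} \<le> 2 * sqrt CARD('n) * \<rho>"
proof -
  have n: "norm y \<le> sqrt CARD('n) * infnorm y" for y :: "real ^ 'n"
    using norm_le_infnorm[of y] by (simp add: DIM_cart)
  have d: "norm (x - y) \<le> 2 * sqrt CARD('n) * \<rho>" if "infnorm (x - c) \<le> \<rho>" "infnorm (y - c) \<le> \<rho>" for x y
  proof -
    have "infnorm (x - y) \<le> infnorm (x - c) + infnorm (c - y)" using infnorm_triangle[of "x - c" "c - y"] by simp
    also have "\<dots> \<le> 2 * \<rho>" using that infnorm_sub[of y c] by simp
    finally have "sqrt CARD('n) * infnorm (x - y) \<le> sqrt CARD('n) * (2 * \<rho>)" by (intro mult_left_mono) auto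
    then have "norm (x - y) \<le> sqrt CARD('n) * (2 * \<rho>)" by (rule order_trans[OF n])
    then show ?thesis by (simp add: mult_ac)
  qed
  show "diameter {x. infnorm (x - c) \<le> \<rho>} \<le> 2 * sqrt CARD('n) * \<rho>"
    by (rule diameter_le) (use d assms in auto)
  have "infnorm (c - c) \<le> \<rho>" using assms by (simp add: infnorm_0)
  then show "bounded {x. infnorm (x - c) \<le> \<rho>}"
    unfolding bounded_def dist_norm using d by (intro exI[of _ c] exI[of _ "2 * sqrt CARD('n) * \<rho>"]) auto
qed

context integral_basis_field
begin

lemma nf_approx_set_null:
  fixes s \<tau> :: real
  assumes \<tau>: "\<tau> > 0" and s: "s > 2 * CARD('n) / (1 + \<tau>)"
  shows "hausdorff_outer_measure s (nf_approx_set \<omega> \<tau>) = 0"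
proof -
  let ?n = "real CARD('n)"
  \<comment> \<open>In a bounded piece each denominator has only finitely many relevant numerators;
    the pieces are put together at the end.\<close>
  let ?E = "\<lambda>R::nat. nf_approx_set \<omega> \<tau> \<inter> {x. infnorm x \<le> real R}"
  have s0: "s > 0" by (rule less_trans[OF _ s]) (use \<tau> in simp)
  \<comment> \<open>\<open>- \<beta>\<close> is the exponent of \<open>|q|\<close> left after
    counting \<open>O(|q| ^ n)\<close> numerators. Half of the excess of \<open>\<beta>\<close> over
    \<open>n\<close> makes the lattice sum converge; the other half makes the part with
    \<open>|q| \<ge> Q0\<close> tend to 0.\<close>
  define \<beta> where "\<beta> = (\<tau> + 1) * s - ?n"
  define \<beta>' where "\<beta>' = (\<beta> + ?n) / 2"
  have \<beta>: "\<beta> > ?n"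
  proof -
    have "2 * ?n < s * (1 + \<tau>)" using s \<tau> by (simp add: divide_less_eq)
    then show ?thesis by (simp add: \<beta>_def algebra_simps)
  qed
  then have \<beta>': "\<beta>' > ?n" "\<beta> - \<beta>' > 0" by (auto simp: \<beta>'_def)
  obtain B where B: "B > 0" "\<And>S :: (int ^ 'n) set. finite S \<Longrightarrow> 0 \<notin> S \<Longrightarrow> (\<Sum>q\<in>S. infnorm (ivec q) powr (- \<beta>')) \<le> B"
    by (rule sum_infnorm_powr_bounded[OF \<beta>'(1)]) blast
  define D0 where "D0 = 2 * sqrt ?n"
  have D0: "D0 > 0" by (simp add: D0_def)
  have "hausdorff_outer_measure s (?E R) = 0" for R
  proof (rule hausdorff_nullI)
    fix \<delta> \<eta> :: real assume \<delta>: "\<delta> > 0" and \<eta>: "\<eta> > 0"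
    \<comment> \<open>From the count \<open>2 * t + 1\<close> of integers per coordinate, with
      \<open>t\<close> at most \<open>Cm * |q| * (R + 1)\<close> and the summand 1 bounded by
      \<open>|q|\<close>.\<close>
    define C2 where "C2 = 2 * Cm * (real R + 1) + 1"
    have C2: "C2 \<ge> 1" using Cm_ge_1 by (simp add: C2_def)
    define C3 where "C3 = C2 ^ CARD('n) * D0 powr s * B"
    have C3: "C3 > 0" using C2 D0 B(1) by (simp add: C3_def)
    have l1: "((\<lambda>Q. D0 * real Q powr (- (\<tau> + 1))) \<longlongrightarrow> 0) sequentially"
      using tendsto_mult_right_zero[OF tendsto_neg_powr[OF _ filterlim_real_sequentially]] \<tau> by simp
    have l2: "((\<lambda>Q. C3 * real Q powr (- (\<beta> - \<beta>'))) \<longlongrightarrow> 0) sequentially"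
      using tendsto_mult_right_zero[OF tendsto_neg_powr[OF _ filterlim_real_sequentially]] \<beta>'(2) by simp
    have "eventually (\<lambda>Q. D0 * real Q powr (- (\<tau> + 1)) < \<delta> \<and> C3 * real Q powr (- (\<beta> - \<beta>')) < \<eta> \<and> Q \<ge> 1) sequentially"
      using order_tendstoD(2)[OF l1 \<delta>] order_tendstoD(2)[OF l2 \<eta>] eventually_ge_at_top[of 1] by eventually_elim simp
    then obtain Q0 :: nat where Q0: "D0 * real Q0 powr (- (\<tau> + 1)) < \<delta>" "C3 * real Q0 powr (- (\<beta> - \<beta>')) < \<eta>" "Q0 \<ge> 1"
      by (auto simp: eventually_sequentially)
    \<comment> \<open>The radii are at most 1, so approximants of points with norm at most
      \<open>R\<close> have norm at most \<open>R + 1\<close>.\<close>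
    define ok where "ok q r \<longleftrightarrow> q \<noteq> 0 \<and> real Q0 \<le> infnorm (ivec q) \<and> infnorm (quot_vec \<omega> r q) \<le> real R + 1" for q r
    define U where "U p = (if ok (fst p) (snd p)
      then {x. infnorm (x - quot_vec \<omega> (snd p) (fst p)) \<le> infnorm (ivec (fst p)) powr (- (\<tau> + 1))} else {})" for p
    have bdd: "bounded (U p) \<and> diameter (U p) \<le> D0 * infnorm (ivec (fst p)) powr (- (\<tau> + 1))" for p
      using box_diameter[of "infnorm (ivec (fst p)) powr (- (\<tau> + 1))" "quot_vec \<omega> (snd p) (fst p)"] D0
      by (auto simp: U_def D0_def)
    have \<delta>bound: "bounded (U p) \<and> diameter (U p) \<le> \<delta>" for p
    proof (cases "ok (fst p) (snd p)")
      case True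
      then have "infnorm (ivec (fst p)) powr (- (\<tau> + 1)) \<le> real Q0 powr (- (\<tau> + 1))"
        using Q0(3) \<tau> unfolding ok_def by (intro powr_mono2') auto
      then have "D0 * infnorm (ivec (fst p)) powr (- (\<tau> + 1)) \<le> \<delta>"
        using Q0(1) D0 by (meson less_imp_le mult_left_mono order_trans)
      then show ?thesis using bdd[of p] by linarith
    qed (use \<delta> in \<open>simp add: U_def\<close>)
    have cover: "?E R \<subseteq> (\<Union>p. U p)"
    proof
      fix x assume x: "x \<in> ?E R"
      define T where "T = {(q :: int ^ 'n, r :: int ^ 'n). q \<noteq> 0 \<and>
        infnorm (x - quot_vec \<omega> r q) \<le> infnorm (ivec q) powr (- (\<tau> + 1))}"
      have inf: "infinite T" using x by (simp add: nf_approx_set_def T_def rat_to_real_int_to_rat)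
      define X where "X = Cm * real Q0 * (real R + 1) + real Q0"
      have bnd: "infnorm (quot_vec \<omega> r q) \<le> real R + 1" if "(q, r) \<in> T" for q r
      proof -
        have q1: "infnorm (ivec q) \<ge> 1" using that infnorm_ivec_ge_1 by (auto simp: T_def)
        have "infnorm (ivec q) powr (- (\<tau> + 1)) \<le> 1 powr (- (\<tau> + 1))" using q1 \<tau> by (intro powr_mono2') auto
        then have "infnorm (x - quot_vec \<omega> r q) \<le> 1" using that by (auto simp: T_def)
        moreover have "infnorm (quot_vec \<omega> r q) \<le> infnorm x + infnorm (quot_vec \<omega> r q - x)"
          using infnorm_triangle[of x "quot_vec \<omega> r q - x"] by simp
        moreover have "infnorm x \<le> real R" using x by simp
        ultimately show ?thesis using infnorm_sub[of x "quot_vec \<omega> r q"] by linarith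
      qed
      \<comment> \<open>Infinitely many pairs must include large denominators: bounded denominators
        bound the numerators as well and leave finitely many pairs.\<close>
      have "\<exists>q r. (q, r) \<in> T \<and> real Q0 \<le> infnorm (ivec q)"
      proof (rule ccontr)
        assume no: "\<not> ?thesis"
        have fin: "finite {z :: int ^ 'n. \<forall>i. \<bar>z $ i\<bar> \<le> \<lceil>X\<rceil>}"
        proof (rule card_int_box(2))
          have "X \<ge> 0" unfolding X_def using Cm_ge_1 by (intro add_nonneg_nonneg mult_nonneg_nonneg) auto
          then show "\<lceil>X\<rceil> \<ge> 0" by linarith
        qed
        have small: "z \<in> {z :: int ^ 'n. \<forall>i. \<bar>z $ i\<bar> \<le> \<lceil>X\<rceil>}" if "infnorm (ivec z) \<le> X" for z
        proof (clarify)
          fix i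
          have "\<bar>real_of_int (z $ i)\<bar> \<le> X" using component_le_infnorm_cart[of "ivec z" i] that by simp
          then have "real_of_int \<bar>z $ i\<bar> \<le> X" by simp
          then show "\<bar>z $ i\<bar> \<le> \<lceil>X\<rceil>" by linarith
        qed
        have "T \<subseteq> {z. \<forall>i. \<bar>z $ i\<bar> \<le> \<lceil>X\<rceil>} \<times> {z. \<forall>i. \<bar>z $ i\<bar> \<le> \<lceil>X\<rceil>}"
        proof (rule subrelI)
          fix q r assume qr: "(q, r) \<in> T"
          have q: "infnorm (ivec q) \<le> real Q0" using no qr by force
          have "infnorm (ivec r) \<le> Cm * infnorm (ivec q) * infnorm (quot_vec \<omega> r q)"
            using qr by (intro infnorm_numerator_le) (auto simp: T_def)
          also have "\<dots> \<le> Cm * real Q0 * (real R + 1)"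
            using q bnd[OF qr] Cm_ge_1 infnorm_pos_le by (intro mult_mono mult_left_mono) auto
          finally have "infnorm (ivec r) \<le> X" by (simp add: X_def)
          moreover have "infnorm (ivec q) \<le> X" using q Cm_ge_1 by (simp add: X_def add_increasing)
          ultimately show "(q, r) \<in> {z. \<forall>i. \<bar>z $ i\<bar> \<le> \<lceil>X\<rceil>} \<times> {z. \<forall>i. \<bar>z $ i\<bar> \<le> \<lceil>X\<rceil>}" using small by blast
        qed
        then show False using inf fin finite_subset by blast
      qed
      then obtain q r where qr: "(q, r) \<in> T" "real Q0 \<le> infnorm (ivec q)" by blast
      then have "ok q r" using bnd[OF qr(1)] by (auto simp: ok_def T_def)
      then have "x \<in> U (q, r)" using qr(1) by (simp add: U_def T_def)
      then show "x \<in> (\<Union>p. U p)" by blast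
    qed
    have "(\<Sum>p\<in>S. diam_powr s (U p)) \<le> ennreal \<eta>" if S: "finite S" for S
    proof -
      let ?S1 = "{q \<in> fst ` S. q \<noteq> 0 \<and> real Q0 \<le> infnorm (ivec q)}"
      have each: "(\<Sum>r\<in>snd ` S. diam_powr s (U (q, r))) \<le> (if q \<in> ?S1 then ennreal (C2 ^ CARD('n) * D0 powr s * infnorm (ivec q) powr (- \<beta>)) else 0)"
        if q: "q \<in> fst ` S" for q
      proof (cases "q \<in> ?S1")
        case False
        then have "U (q, r) = {}" for r using q by (auto simp: U_def ok_def)
        then show ?thesis using False by (simp add: diam_powr_def)
      next
        case True
        let ?q = "infnorm (ivec q)"
        have q1: "?q \<ge> 1" using True infnorm_ivec_ge_1 by auto
        define t where "t = \<lfloor>Cm * ?q * (real R + 1)\<rfloor>"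
        have t0: "t \<ge> 0" unfolding t_def using Cm_ge_1 q1 by simp
        let ?Z = "{z :: int ^ 'n. \<forall>i. \<bar>z $ i\<bar> \<le> t}"
        have Z: "finite ?Z" "real (card ?Z) \<le> (C2 * ?q) ^ CARD('n)"
        proof -
          show "finite ?Z" by (rule card_int_box(2)[OF t0])
          have "real (nat (2 * t + 1)) = 2 * real_of_int t + 1" using t0 by simp
          also have "\<dots> \<le> 2 * (Cm * ?q * (real R + 1)) + ?q" using q1 unfolding t_def by linarith
          also have "\<dots> = C2 * ?q" by (simp add: C2_def algebra_simps)
          finally have "real (nat (2 * t + 1)) ^ CARD('n) \<le> (C2 * ?q) ^ CARD('n)" by (intro power_mono) auto
          then show "real (card ?Z) \<le> (C2 * ?q) ^ CARD('n)" unfolding card_int_box(1)[OF t0] by simp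
        qed
        let ?d = "(D0 * ?q powr (- (\<tau> + 1))) powr s"
        have in_Z: "r \<in> ?Z" if "ok q r" for r
        proof (clarify)
          fix i
          have "\<bar>real_of_int (r $ i)\<bar> \<le> infnorm (ivec r)" using component_le_infnorm_cart[of "ivec r" i] by simp
          also have "\<dots> \<le> Cm * ?q * infnorm (quot_vec \<omega> r q)" using that by (intro infnorm_numerator_le) (auto simp: ok_def)
          also have "\<dots> \<le> Cm * ?q * (real R + 1)" using that Cm_ge_1 q1 by (intro mult_left_mono) (auto simp: ok_def)
          finally have "real_of_int \<bar>r $ i\<bar> \<le> Cm * ?q * (real R + 1)" by simp
          then show "\<bar>r $ i\<bar> \<le> t" unfolding t_def by (simp add: le_floor_iff)
        qed
        have dp: "diam_powr s (U (q, r)) \<le> (if r \<in> ?Z then ennreal ?d else 0)" for r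
        proof (cases "ok q r")
          case True
          have "diam_powr s (U (q, r)) \<le> ennreal (diameter (U (q, r)) powr s)" using s0 by (simp add: diam_powr_def)
          also have "\<dots> \<le> ennreal ?d"
            using bdd[of "(q, r)"] s0 diameter_ge_0[of "U (q, r)"] by (intro ennreal_leI powr_mono2) auto
          finally show ?thesis using in_Z[OF True] by simp
        next
          case False
          then have "U (q, r) = {}" by (simp add: U_def)
          then show ?thesis by (simp add: diam_powr_def)
        qed
        have "(\<Sum>r\<in>snd ` S. diam_powr s (U (q, r))) \<le> (\<Sum>r\<in>snd ` S. if r \<in> ?Z then ennreal ?d else 0)"
          by (rule sum_mono[OF dp])
        also have "\<dots> = (\<Sum>r\<in>snd ` S \<inter> ?Z. ennreal ?d)" by (rule sum.inter_restrict[symmetric]) (use S in simp)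
        also have "\<dots> \<le> (\<Sum>r\<in>?Z. ennreal ?d)" using Z(1) by (intro sum_mono2) auto
        also have "\<dots> = ennreal (real (card ?Z) * ?d)" by (simp add: ennreal_mult ennreal_of_nat_eq_real_of_nat)
        also have "\<dots> \<le> ennreal ((C2 * ?q) ^ CARD('n) * ?d)" using Z(2) by (intro ennreal_leI mult_right_mono) auto
        also have "(C2 * ?q) ^ CARD('n) * ?d = C2 ^ CARD('n) * D0 powr s * ?q powr (- \<beta>)"
        proof -
          have "(?q powr (- (\<tau> + 1))) powr s = ?q powr (- ((\<tau> + 1) * s))" by (simp only: powr_powr mult_minus_left)
          then have "?d = D0 powr s * ?q powr (- ((\<tau> + 1) * s))" using D0 by (simp only: powr_mult)
          moreover have "?q ^ CARD('n) = ?q powr ?n" using q1 by (simp add: powr_realpow)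
          moreover have "?q powr ?n * ?q powr (- ((\<tau> + 1) * s)) = ?q powr (- \<beta>)"
            by (simp add: powr_add[symmetric] \<beta>_def)
          ultimately show ?thesis by (simp add: power_mult_distrib mult_ac)
        qed
        finally show ?thesis using True by simp
      qed
      have finS1: "finite ?S1" using S by simp
      have "(\<Sum>p\<in>S. diam_powr s (U p)) \<le> (\<Sum>p\<in>fst ` S \<times> snd ` S. diam_powr s (U p))"
        using S by (intro sum_mono2) (auto intro: rev_image_eqI)
      also have "\<dots> = (\<Sum>q\<in>fst ` S. \<Sum>r\<in>snd ` S. diam_powr s (U (q, r)))"
        by (simp add: sum.cartesian_product)
      also have "\<dots> \<le> (\<Sum>q\<in>fst ` S. if q \<in> ?S1 then ennreal (C2 ^ CARD('n) * D0 powr s * infnorm (ivec q) powr (- \<beta>)) else 0)"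
        by (rule sum_mono[OF each])
      also have "\<dots> = (\<Sum>q\<in>?S1. ennreal (C2 ^ CARD('n) * D0 powr s * infnorm (ivec q) powr (- \<beta>)))"
        using S by (intro sum.mono_neutral_cong_right) auto
      also have "\<dots> = ennreal (\<Sum>q\<in>?S1. C2 ^ CARD('n) * D0 powr s * infnorm (ivec q) powr (- \<beta>))"
        using C2 by (intro sum_ennreal) auto
      also have "\<dots> \<le> ennreal \<eta>"
      proof (rule ennreal_leI)
        have "(\<Sum>q\<in>?S1. C2 ^ CARD('n) * D0 powr s * infnorm (ivec q) powr (- \<beta>))
          \<le> (\<Sum>q\<in>?S1. C2 ^ CARD('n) * D0 powr s * (real Q0 powr (- (\<beta> - \<beta>')) * infnorm (ivec q) powr (- \<beta>')))"
        proof (intro sum_mono mult_left_mono)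
          fix q assume q: "q \<in> ?S1"
          have "infnorm (ivec q) powr (- \<beta>) = infnorm (ivec q) powr (- (\<beta> - \<beta>')) * infnorm (ivec q) powr (- \<beta>')"
            by (simp add: powr_add[symmetric])
          also have "\<dots> \<le> real Q0 powr (- (\<beta> - \<beta>')) * infnorm (ivec q) powr (- \<beta>')"
            using q Q0(3) \<beta>'(2) by (intro mult_right_mono powr_mono2') auto
          finally show "infnorm (ivec q) powr (- \<beta>) \<le> real Q0 powr (- (\<beta> - \<beta>')) * infnorm (ivec q) powr (- \<beta>')" .
        qed (use C2 in auto)
        also have "\<dots> = C2 ^ CARD('n) * D0 powr s * (real Q0 powr (- (\<beta> - \<beta>')) * (\<Sum>q\<in>?S1. infnorm (ivec q) powr (- \<beta>')))"
          by (simp add: sum_distrib_left)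
        also have "\<dots> \<le> C2 ^ CARD('n) * D0 powr s * (real Q0 powr (- (\<beta> - \<beta>')) * B)"
          using C2 by (intro mult_left_mono B(2)[OF finS1]) auto
        also have "\<dots> = C3 * real Q0 powr (- (\<beta> - \<beta>'))" by (simp add: C3_def mult_ac)
        finally show "(\<Sum>q\<in>?S1. C2 ^ CARD('n) * D0 powr s * infnorm (ivec q) powr (- \<beta>)) \<le> \<eta>" using Q0(2) by linarith
      qed
      finally show ?thesis .
    qed
    then show "\<exists>U :: (int ^ 'n) \<times> (int ^ 'n) \<Rightarrow> (real ^ 'n) set. (\<forall>i. bounded (U i) \<and> diameter (U i) \<le> \<delta>) \<and> ?E R \<subseteq> (\<Union>i. U i) \<and>
      (\<forall>S. finite S \<longrightarrow> (\<Sum>i\<in>S. diam_powr s (U i)) \<le> ennreal \<eta>)"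
      using \<delta>bound cover by (intro exI[of _ U]) blast
  qed
  then have "hausdorff_outer_measure s (\<Union>R. ?E R) = 0" by (rule hausdorff_null_UN)
  moreover have "(\<Union>R. ?E R) = nf_approx_set \<omega> \<tau>" using real_arch_simple by auto
  ultimately show ?thesis by simp
qed

end

section \<open>Fourier decay and Hausdorff measure\<close>

abbreviation gauss :: "real measure" where
  "gauss \<equiv> density lborel std_normal_density"

lemma prob_gauss: "prob_space gauss"
  by (rule prob_space_normal_density) simp

lemma std_normal_density_le_1: "std_normal_density x \<le> 1"
proof -
  have "1 \<le> sqrt (2 * pi)" using pi_ge_two by (simp add: real_le_rsqrt)
  then have "1 / sqrt (2 * pi) * exp (- x\<^sup>2 / 2) \<le> 1 * 1" by (intro mult_mono) auto
  then show ?thesis by (simp add: std_normal_density_def)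
qed

text \<open>The value at \<open>0\<close> is separate because \<open>0 powr (- \<beta>) = 0\<close>.\<close>

definition rkernel :: "real \<Rightarrow> real \<Rightarrow> ennreal" where
  "rkernel \<beta> x = (if x = 0 then \<top> else ennreal (\<bar>x\<bar> powr (- \<beta>)))"

lemma rkernel_measurable [measurable]: "rkernel \<beta> \<in> borel_measurable borel"
  unfolding rkernel_def by measurable

text \<open>On \<open>[-1, 1]\<close> the density is at most 1 and
  \<open>|x| powr (- \<beta>)\<close> is integrable because \<open>\<beta> < 1\<close>; outside, the
  power is at most 1.\<close>

lemma gauss_moment_finite:
  assumes "0 \<le> \<beta>" "\<beta> < 1" shows "(\<integral>\<^sup>+x. rkernel \<beta> x \<partial>gauss) < \<top>"
proof -
  let ?f = "\<lambda>x::real. \<bar>x\<bar> powr (- \<beta>)"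
  have "((\<lambda>x. x powr (- \<beta>)) has_integral (1 powr (- \<beta> + 1) / (- \<beta> + 1))) {0..1}"
    using assms by (intro has_integral_powr_from_0) auto
  then have i1: "(?f has_integral (1 / (1 - \<beta>))) {0..1}"
    by (subst has_integral_cong[where g = "\<lambda>x. x powr (- \<beta>)"]) auto
  then have i2: "(?f has_integral (1 / (1 - \<beta>))) {-1..0}"
    using has_integral_reflect_real[of ?f "1 / (1 - \<beta>)" 1 0] by simp
  have "(?f has_integral (1 / (1 - \<beta>) + 1 / (1 - \<beta>))) {-1..1}"
    by (rule has_integral_combine[OF _ _ i2 i1]) auto
  then have "((\<lambda>x. if x \<in> {-1..1} then ?f x else 0) has_integral (1 / (1 - \<beta>) + 1 / (1 - \<beta>))) UNIV"
    by (simp only: has_integral_restrict_UNIV)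
  moreover have "(\<lambda>x. indicator {-1..1} x * ?f x) = (\<lambda>x. if x \<in> {-1..1} then ?f x else 0)" by auto
  ultimately have fin: "(\<integral>\<^sup>+x. ennreal (indicator {-1..1} x * ?f x) \<partial>lborel) = ennreal (1 / (1 - \<beta>) + 1 / (1 - \<beta>))"
    by (intro nn_integral_has_integral_lborel) auto
  have "(\<integral>\<^sup>+x. rkernel \<beta> x \<partial>gauss) = (\<integral>\<^sup>+x. ennreal (std_normal_density x) * rkernel \<beta> x \<partial>lborel)"
    by (subst nn_integral_density) auto
  also have "\<dots> \<le> (\<integral>\<^sup>+x. ennreal (indicator {-1..1} x * ?f x) + ennreal (std_normal_density x) \<partial>lborel)"
  proof (rule nn_integral_mono_AE)
    show "AE x in lborel. ennreal (std_normal_density x) * rkernel \<beta> x \<le> ennreal (indicator {-1..1} x * ?f x) + ennreal (std_normal_density x)"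
      using AE_lborel_singleton[of 0]
    proof eventually_elim
      case (elim x)
      have d: "0 \<le> std_normal_density x" "std_normal_density x \<le> 1" by (simp, rule std_normal_density_le_1)
      have "std_normal_density x * ?f x \<le> indicator {-1..1} x * ?f x + std_normal_density x"
      proof (cases "\<bar>x\<bar> \<le> 1")
        case True
        have "std_normal_density x * ?f x \<le> 1 * ?f x" using d by (intro mult_right_mono) auto
        then show ?thesis using True add_increasing2[OF d(1)] by (auto simp: indicator_def)
      next
        case False
        then have "?f x \<le> 1 powr (- \<beta>)" using assms by (intro powr_mono2') auto
        then have "std_normal_density x * ?f x \<le> std_normal_density x * 1" using d by (intro mult_left_mono) auto
        then show ?thesis using False by (auto simp: indicator_def)
      qed
      then show ?case using elim d by (simp add: rkernel_def ennreal_mult[symmetric] ennreal_plus[symmetric] del: ennreal_plus)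
    qed
  qed
  also have "\<dots> = ennreal (1 / (1 - \<beta>) + 1 / (1 - \<beta>)) + (\<integral>\<^sup>+x. ennreal (std_normal_density x) \<partial>lborel)"
    by (subst nn_integral_add) (auto simp: fin)
  also have "(\<integral>\<^sup>+x. ennreal (std_normal_density x) \<partial>lborel) = 1"
    using prob_space.emeasure_space_1[OF prob_gauss] by (simp add: emeasure_density)
  finally show ?thesis by (rule le_less_trans) simp
qed

lemma gauss_fourier: "(LINT x|gauss. eexp (- (t * x))) = of_real (exp (- (2 * pi * t)\<^sup>2 / 2))"
proof -
  have "(LINT x|gauss. eexp (- (t * x))) = char gauss (- (2 * pi * t))"
    unfolding char_def eexp_def cis_conv_exp by (simp add: mult_ac)
  also have "\<dots> = of_real (exp (- (2 * pi * t)\<^sup>2 / 2))" by (simp add: char_std_normal_distribution)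
  finally show ?thesis .
qed

text \<open>With \<open>w\<close> a standard normal vector, \<open>E e(- z \<bullet> w / r)\<close> is nonnegative and bounded below
  on \<open>|z| \<le> r\<close>; integrating it against \<open>\<mu> \<otimes> \<mu>\<close> bounds the measure of pairs at distance at most \<open>r\<close>
  by \<open>E |\<mu>^(w / r)|^2\<close>, and \<open>|w| powr (- s) \<le> (\<Prod>i. |w i| powr (- s / n))\<close>.\<close>

lemma pair_energy:
  fixes \<mu> :: "(real ^ 'n) measure" and s C :: real
  assumes \<mu>: "prob_space \<mu>" "sets \<mu> = sets borel" and s: "0 \<le> s" "s < CARD('n)"
    and C: "C > 0" "\<And>\<xi>. \<xi> \<noteq> 0 \<Longrightarrow> (cmod (fourier_transform \<mu> \<xi>))\<^sup>2 \<le> C * infnorm \<xi> powr (- s)"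
  obtains D where "D \<ge> 0"
    "\<And>r. r > 0 \<Longrightarrow> measure (\<mu> \<Otimes>\<^sub>M \<mu>) {p. infnorm (fst p - snd p) \<le> r} \<le> D * r powr s"
proof -
  interpret \<mu>: prob_space \<mu> by (rule \<mu>(1))
  interpret N: prob_space gauss by (rule prob_gauss)
  interpret GP: product_prob_space "\<lambda>_. gauss" "UNIV :: 'n set" ..
  interpret pp: pair_prob_space \<mu> \<mu> ..
  let ?\<pi> = "\<mu> \<Otimes>\<^sub>M \<mu>"
  let ?G = "PiM (UNIV :: 'n set) (\<lambda>_. gauss)"
  have G: "prob_space ?G" by (rule prob_space_PiM) (rule prob_gauss)
  interpret G: prob_space ?G by (rule G)
  interpret \<pi>: prob_space ?\<pi> by unfold_locales
  interpret GG: pair_prob_space ?\<pi> ?G ..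
  note [measurable_cong] = \<mu>(2)
  \<comment> \<open>Splitting the exponent evenly over the coordinates keeps each one-dimensional
    moment finite, since \<open>s < n\<close> means \<open>\<beta> < 1\<close>.\<close>
  define \<beta> where "\<beta> = s / CARD('n)"
  have \<beta>: "0 \<le> \<beta>" "\<beta> < 1" using s by (auto simp: \<beta>_def)
  define V :: "('n \<Rightarrow> real) \<Rightarrow> real ^ 'n" where "V w = (\<chi> i. w i)" for w
  have comp: "(\<lambda>w. w i) \<in> borel_measurable ?G" for i
  proof -
    have "(\<lambda>w. w i) \<in> measurable ?G gauss" by (rule measurable_component_singleton) simp
    then show ?thesis by (simp add: measurable_cong_sets[OF refl, of gauss borel])
  qed
  have [measurable]: "V \<in> measurable ?G borel"
    unfolding borel_measurable_euclidean_space[where f = V] V_def by (auto simp: Basis_vec_def inner_axis comp)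
  define Mo where "Mo = (\<integral>\<^sup>+w. (\<Prod>i\<in>UNIV. rkernel \<beta> (w i)) \<partial>?G)"
  have Mo: "Mo < \<top>"
  proof -
    have "Mo = (\<Prod>i\<in>(UNIV :: 'n set). \<integral>\<^sup>+x. rkernel \<beta> x \<partial>gauss)"
      unfolding Mo_def by (rule GP.product_nn_integral_prod) auto
    then show ?thesis using gauss_moment_finite[OF \<beta>] by (simp add: power_less_top_ennreal)
  qed
  define \<kappa> where "\<kappa> = exp (- (2 * pi)\<^sup>2 / 2) ^ CARD('n)"
  have \<kappa>: "\<kappa> > 0" by (simp add: \<kappa>_def)
  show thesis
  proof (rule that[of "C * enn2real Mo / \<kappa>"])
    show "C * enn2real Mo / \<kappa> \<ge> 0" using C(1) \<kappa> by simp
    fix r :: real assume r: "r > 0"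
    define K where "K z = (\<Prod>i\<in>UNIV. exp (- (2 * pi * (z $ i / r))\<^sup>2 / 2))" for z :: "real ^ 'n"
    have K0: "K z \<ge> 0" for z by (simp add: K_def prod_nonneg)
    have Keq: "complex_of_real (K z) = (LINT w|?G. eexp (- (z \<bullet> ((1 / r) *\<^sub>R V w))))" for z
    proof -
      have "(LINT w|?G. eexp (- (z \<bullet> ((1 / r) *\<^sub>R V w)))) = (LINT w|?G. (\<Prod>i\<in>UNIV. eexp (- (z $ i / r * w i))))"
        by (intro Bochner_Integration.integral_cong refl)
          (simp add: inner_vec_def V_def eexp_sum[symmetric] sum_negf sum_distrib_left mult_ac)
      also have "\<dots> = (\<Prod>i\<in>UNIV. LINT x|gauss. eexp (- (z $ i / r * x)))"
        by (intro GP.product_integral_prod N.integrable_eexp) auto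
      finally show ?thesis by (simp only: gauss_fourier K_def of_real_prod)
    qed
    have Klow: "\<kappa> \<le> K z" if z: "infnorm z \<le> r" for z
    proof -
      have "(\<Prod>i\<in>(UNIV :: 'n set). exp (- (2 * pi)\<^sup>2 / 2)) \<le> K z" unfolding K_def
      proof (intro prod_mono conjI)
        fix i
        have "\<bar>z $ i\<bar> \<le> r" using z infnorm_le_iff by blast
        then have "\<bar>2 * pi * (z $ i / r)\<bar> \<le> \<bar>2 * pi\<bar>" using r by (simp add: abs_mult divide_le_eq)
        then have "(2 * pi * (z $ i / r))\<^sup>2 \<le> (2 * pi)\<^sup>2" by (simp only: abs_le_square_iff)
        then show "exp (- (2 * pi)\<^sup>2 / 2) \<le> exp (- (2 * pi * (z $ i / r))\<^sup>2 / 2)" by simp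
      qed simp
      then show ?thesis by (simp add: \<kappa>_def)
    qed
    have Kcont: "continuous_on UNIV K" unfolding K_def using r by (intro continuous_intros) auto
    have Km [measurable]: "K \<in> borel_measurable borel" by (rule borel_measurable_continuous_onI[OF Kcont])
    have K1: "K z \<le> 1" for z unfolding K_def by (intro prod_le_1) auto
    let ?S = "{p :: (real ^ 'n) \<times> (real ^ 'n). infnorm (fst p - snd p) \<le> r}"
    have Sm: "?S \<in> sets ?\<pi>"
    proof -
      have "closed ?S" by (intro closed_Collect_le continuous_intros)
      then have "?S \<in> sets borel" by (rule borel_closed)
      then show ?thesis using sets_pair_measure_cong[OF \<mu>(2) \<mu>(2)] by (simp only: borel_prod)
    qed
    have Kint: "integrable ?\<pi> (\<lambda>p. K (fst p - snd p))"
      by (rule pp.P.integrable_const_bound[of _ 1]) (use K0 K1 in auto)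
    have "\<kappa> * measure ?\<pi> ?S = (LINT p|?\<pi>. \<kappa> * indicator ?S p)" using Sm by simp
    also have "\<dots> \<le> (LINT p|?\<pi>. K (fst p - snd p))"
    proof (rule integral_mono[OF _ Kint])
      show "integrable ?\<pi> (\<lambda>p. \<kappa> * indicator ?S p)" using Sm by (simp add: pp.P.emeasure_eq_measure)
      show "\<kappa> * indicator ?S p \<le> K (fst p - snd p)" for p using Klow K0 by (simp add: indicator_def)
    qed
    finally have low: "\<kappa> * measure ?\<pi> ?S \<le> (LINT p|?\<pi>. K (fst p - snd p))" .
    define ft where "ft w = (cmod (fourier_transform \<mu> ((1 / r) *\<^sub>R V w)))\<^sup>2" for w
    have "complex_of_real (LINT p|?\<pi>. K (fst p - snd p)) = (LINT p|?\<pi>. LINT w|?G. eexp (- ((fst p - snd p) \<bullet> ((1 / r) *\<^sub>R V w))))"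
      by (simp only: Keq[symmetric] integral_complex_of_real)
    also have "\<dots> = (LINT w|?G. LINT p|?\<pi>. eexp (- ((fst p - snd p) \<bullet> ((1 / r) *\<^sub>R V w))))"
      by (rule GG.Fubini_integral[symmetric]) (rule GG.P.integrable_const_bound[of _ 1], auto simp: case_prod_unfold)
    also have "\<dots> = (LINT w|?G. complex_of_real (ft w))"
    proof (rule Bochner_Integration.integral_cong[OF refl])
      fix w
      let ?\<zeta> = "(1 / r) *\<^sub>R V w"
      have "(LINT p|?\<pi>. eexp (- ((fst p - snd p) \<bullet> ?\<zeta>))) = (LINT x|\<mu>. LINT y|\<mu>. eexp (- (x \<bullet> ?\<zeta>)) * eexp (y \<bullet> ?\<zeta>))"
        by (subst pp.integral_fst'[symmetric])
          (auto intro!: pp.P.integrable_const_bound[of _ 1] Bochner_Integration.integral_cong simp: inner_diff_left eexp_add[symmetric] diff_divide_distrib)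
      also have "\<dots> = (LINT x|\<mu>. eexp (- (x \<bullet> ?\<zeta>))) * (LINT y|\<mu>. eexp (y \<bullet> ?\<zeta>))" by simp
      also have "(LINT y|\<mu>. eexp (y \<bullet> ?\<zeta>)) = cnj (LINT y|\<mu>. eexp (- (y \<bullet> ?\<zeta>)))"
        by (simp only: Bochner_Integration.integral_cnj[symmetric] cnj_eexp minus_minus)
      finally show "(LINT p|?\<pi>. eexp (- ((fst p - snd p) \<bullet> ?\<zeta>))) = complex_of_real (ft w)"
        unfolding ft_def fourier_transform_eexp by (simp only: complex_norm_square)
    qed
    also have "\<dots> = complex_of_real (LINT w|?G. ft w)" by (rule integral_complex_of_real)
    finally have eq: "(LINT p|?\<pi>. K (fst p - snd p)) = (LINT w|?G. ft w)" by (simp only: of_real_eq_iff)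
    have ft0: "ft w \<ge> 0" for w by (simp add: ft_def)
    have bound: "ennreal (ft w) \<le> ennreal (C * r powr s) * (\<Prod>i\<in>UNIV. rkernel \<beta> (w i))" for w
    proof (cases "V w = 0")
      \<comment> \<open>No decay is assumed at frequency 0; there the right-hand side is
        infinite.\<close>
      case True
      then have "w i = 0" for i by (simp add: V_def vec_eq_iff)
      then have "(\<Prod>i\<in>(UNIV::'n set). rkernel \<beta> (w i)) = \<top>" by (simp add: rkernel_def top_power_ennreal)
      moreover have "ennreal (C * r powr s) \<noteq> 0" using C(1) r by simp
      ultimately show ?thesis by (simp add: ennreal_mult_top)
    next
      case False
      let ?v = "infnorm (V w)"
      have v: "?v > 0" using False by (simp add: infnorm_pos_lt)
      have "ft w \<le> C * infnorm ((1 / r) *\<^sub>R V w) powr (- s)" unfolding ft_def using False r by (intro C(2)) auto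
      also have "infnorm ((1 / r) *\<^sub>R V w) powr (- s) = r powr s * ?v powr (- s)"
        using r v by (simp add: infnorm_mul powr_divide powr_minus field_simps)
      finally have "ennreal (ft w) \<le> ennreal (C * r powr s) * ennreal (?v powr (- s))"
        using C(1) by (simp add: ennreal_mult[symmetric] mult.assoc ennreal_leI)
      also have "ennreal (?v powr (- s)) = (\<Prod>i\<in>(UNIV :: 'n set). ennreal (?v powr (- \<beta>)))"
        using v by (simp add: ennreal_power powr_realpow[symmetric] powr_powr \<beta>_def)
      also have "\<dots> \<le> (\<Prod>i\<in>UNIV. rkernel \<beta> (w i))"
      proof (rule prod_mono_ennreal)
        fix i
        have "\<bar>w i\<bar> \<le> ?v" using component_le_infnorm_cart[of "V w" i] by (simp add: V_def)
        then show "ennreal (?v powr (- \<beta>)) \<le> rkernel \<beta> (w i)"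
          unfolding rkernel_def using \<beta>(1) by (auto intro!: ennreal_leI powr_mono2')
      qed
      finally show ?thesis by (simp add: mult_left_mono)
    qed
    have "ennreal (LINT w|?G. ft w) \<le> (\<integral>\<^sup>+w. ennreal (ft w) \<partial>?G)"
      by (cases "integrable ?G ft") (simp_all add: nn_integral_eq_integral ft0 not_integrable_integral_eq)
    also have "\<dots> \<le> (\<integral>\<^sup>+w. ennreal (C * r powr s) * (\<Prod>i\<in>UNIV. rkernel \<beta> (w i)) \<partial>?G)"
      by (rule nn_integral_mono[OF bound])
    also have "\<dots> = ennreal (C * r powr s) * Mo"
      unfolding Mo_def by (rule nn_integral_cmult) (intro borel_measurable_prod_ennreal measurable_compose[OF comp rkernel_measurable])
    also have "\<dots> = ennreal (C * r powr s * enn2real Mo)"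
      using Mo C(1) by (simp add: ennreal_mult)
    finally have "(LINT w|?G. ft w) \<le> C * r powr s * enn2real Mo"
      using C(1) by (subst (asm) ennreal_le_iff) auto
    then have "\<kappa> * measure ?\<pi> ?S \<le> C * r powr s * enn2real Mo" using low eq by simp
    then show "measure ?\<pi> ?S \<le> C * enn2real Mo / \<kappa> * r powr s"
      using \<kappa> by (simp add: field_simps)
  qed
qed

text \<open>The energy argument in dyadic form. The function \<open>T\<close>, which sums the masses
  of balls of radius \<open>r k\<close> weighted by \<open>r k powr (- s)\<close>, has finite
  integral because pairs at distance at most \<open>r\<close> have measure
  \<open>O(r powr t)\<close> with \<open>t > s\<close>. Where \<open>T \<le> m\<close>, small balls
  have mass \<open>O(r powr s)\<close>, so covers of \<open>E\<close> with small
  \<open>s\<close>-sum force that part of \<open>E\<close> to be null. Yet these parts exhaust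
  almost all of \<open>E\<close>.\<close>

lemma fourier_decay_hausdorff:
  fixes \<mu> :: "(real ^ 'n) measure" and s s0 :: real
  assumes \<mu>: "prob_space \<mu>" "sets \<mu> = sets borel" and E: "UNIV - E \<in> null_sets \<mu>"
    and s: "0 \<le> s" "s < s0" "s0 \<le> CARD('n)"
    and decay: "((\<lambda>\<xi>. (cmod (fourier_transform \<mu> \<xi>))\<^sup>2 * infnorm \<xi> powr s0) \<longlongrightarrow> 0) at_infinity"
  shows "hausdorff_outer_measure s E \<noteq> 0"
proof
  assume null: "hausdorff_outer_measure s E = 0"
  interpret \<mu>: prob_space \<mu> by (rule \<mu>(1))
  interpret pp: pair_prob_space \<mu> \<mu> ..
  note [measurable_cong] = \<mu>(2)
  \<comment> \<open>Above \<open>s\<close> so that the dyadic series converges, and below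
    \<open>s0\<close> so that \<open>t < n\<close> even when \<open>s0 = n\<close>.\<close>
  define t where "t = (s + s0) / 2"
  have t: "s < t" "t < s0" "t < CARD('n)" "0 \<le> t" using s by (auto simp: t_def)
  obtain b where b: "\<And>\<xi>. norm \<xi> \<ge> b \<Longrightarrow> (cmod (fourier_transform \<mu> \<xi>))\<^sup>2 * infnorm \<xi> powr s0 < 1"
    using order_tendstoD(2)[OF decay, of 1] by (auto simp: eventually_at_infinity)
  define R where "R = max 1 b"
  have "(cmod (fourier_transform \<mu> \<xi>))\<^sup>2 \<le> R powr t * infnorm \<xi> powr (- t)" if \<xi>: "\<xi> \<noteq> 0" for \<xi>
  proof (cases "infnorm \<xi> \<ge> R")
    case True
    let ?v = "infnorm \<xi>"
    have v: "?v \<ge> 1" using True by (simp add: R_def)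
    have "norm \<xi> \<ge> b" using True infnorm_le_norm[of \<xi>] by (simp add: R_def)
    then have "(cmod (fourier_transform \<mu> \<xi>))\<^sup>2 * ?v powr s0 \<le> 1" using b by (simp add: less_imp_le)
    then have "(cmod (fourier_transform \<mu> \<xi>))\<^sup>2 \<le> ?v powr (- s0)"
      using v by (simp add: powr_minus field_simps)
    also have "\<dots> \<le> 1 * ?v powr (- t)" using v t by (simp add: powr_mono)
    also have "\<dots> \<le> R powr t * ?v powr (- t)"
      using t by (intro mult_right_mono ge_one_powr_ge_zero) (auto simp: R_def)
    finally show ?thesis .
  next
    case False
    let ?v = "infnorm \<xi>"
    have v: "?v > 0" using \<xi> by (simp add: infnorm_pos_lt)
    have "(cmod (fourier_transform \<mu> \<xi>))\<^sup>2 \<le> 1" using norm_fourier_transform_le_1[OF \<mu>(1)] by (simp add: power_le_one)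
    also have "1 = ?v powr t * ?v powr (- t)" using v by (simp add: powr_add[symmetric])
    also have "\<dots> \<le> R powr t * ?v powr (- t)" using False v t by (intro mult_right_mono powr_mono2) auto
    finally show ?thesis .
  qed
  then obtain D where D: "D \<ge> 0" "\<And>r. r > 0 \<Longrightarrow> measure (\<mu> \<Otimes>\<^sub>M \<mu>) {p. infnorm (fst p - snd p) \<le> r} \<le> D * r powr t"
    by (rule pair_energy[OF \<mu> t(4,3), of "R powr t", rotated]) (auto simp: R_def)
  define r where "r k = (1/2 :: real) ^ k" for k :: nat
  have r: "r k > 0" for k by (simp add: r_def)
  define A where "A x k = {y. infnorm (x - y) \<le> r k}" for x :: "real ^ 'n" and k
  have Ac: "closed (A x k)" for x k unfolding A_def by (intro closed_Collect_le continuous_intros)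
  have Am: "A x k \<in> sets \<mu>" for x k using borel_closed[OF Ac] \<mu>(2) by simp
  define T where "T x = (\<Sum>k. ennreal (r k powr (- s)) * emeasure \<mu> (A x k))" for x
  let ?S = "\<lambda>k. {p :: (real ^ 'n) \<times> (real ^ 'n). infnorm (fst p - snd p) \<le> r k}"
  have Sm: "?S k \<in> sets (\<mu> \<Otimes>\<^sub>M \<mu>)" for k
  proof -
    have "closed (?S k)" by (intro closed_Collect_le continuous_intros)
    then have "?S k \<in> sets borel" by (rule borel_closed)
    then show ?thesis using sets_pair_measure_cong[OF \<mu>(2) \<mu>(2)] by (simp only: borel_prod)
  qed
  have slice: "Pair x -` ?S k = A x k" for x k by (auto simp: A_def)
  have Aemm: "(\<lambda>x. emeasure \<mu> (A x k)) \<in> borel_measurable \<mu>" for k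
    using \<mu>.measurable_emeasure_Pair[OF Sm[of k]] by (simp only: slice)
  have Aint: "(\<integral>\<^sup>+x. emeasure \<mu> (A x k) \<partial>\<mu>) \<le> ennreal (D * r k powr t)" for k
  proof -
    have "(\<integral>\<^sup>+x. emeasure \<mu> (A x k) \<partial>\<mu>) = emeasure (\<mu> \<Otimes>\<^sub>M \<mu>) (?S k)"
      by (simp only: \<mu>.emeasure_pair_measure_alt[OF Sm] slice)
    also have "\<dots> \<le> ennreal (D * r k powr t)" using D(2)[OF r[of k]] by (simp add: pp.P.emeasure_eq_measure ennreal_leI)
    finally show ?thesis .
  qed
  have Tm: "T \<in> borel_measurable \<mu>" unfolding T_def using Aemm by measurable
  have "(\<integral>\<^sup>+x. T x \<partial>\<mu>) = (\<Sum>k. \<integral>\<^sup>+x. ennreal (r k powr (- s)) * emeasure \<mu> (A x k) \<partial>\<mu>)"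
    unfolding T_def by (rule nn_integral_suminf) (use Aemm in measurable)
  also have "\<dots> \<le> (\<Sum>k. ennreal (D * ((1/2) powr (t - s)) ^ k))"
  proof (rule suminf_le)
    fix k
    have "(\<integral>\<^sup>+x. ennreal (r k powr (- s)) * emeasure \<mu> (A x k) \<partial>\<mu>) = ennreal (r k powr (- s)) * (\<integral>\<^sup>+x. emeasure \<mu> (A x k) \<partial>\<mu>)"
      by (rule nn_integral_cmult[OF Aemm])
    also have "\<dots> \<le> ennreal (r k powr (- s)) * ennreal (D * r k powr t)" by (intro mult_left_mono Aint) auto
    also have "\<dots> = ennreal (D * ((1/2) powr (t - s)) ^ k)"
    proof -
      have "r k powr (- s) * r k powr t = r k powr (t - s)" by (simp add: powr_add[symmetric])
      also have "\<dots> = ((1/2) powr (t - s)) ^ k"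
        by (simp add: r_def powr_realpow[symmetric] powr_powr mult.commute)
      finally show ?thesis using D(1) by (simp add: ennreal_mult[symmetric] mult.left_commute)
    qed
    finally show "(\<integral>\<^sup>+x. ennreal (r k powr (- s)) * emeasure \<mu> (A x k) \<partial>\<mu>) \<le> ennreal (D * ((1/2) powr (t - s)) ^ k)" .
  qed auto
  also have "\<dots> < \<top>"
  proof -
    have "(1/2 :: real) powr (t - s) < 1" using t(1) by (simp add: powr01_less_one)
    then have "summable (\<lambda>k. D * ((1/2) powr (t - s)) ^ k)" by (intro summable_mult summable_geometric) auto
    then show ?thesis using D(1) by (subst suminf_ennreal2) auto
  qed
  finally have "(\<integral>\<^sup>+x. T x \<partial>\<mu>) \<noteq> \<infinity>" by simp
  then have AET: "AE x in \<mu>. T x \<noteq> \<infinity>" by (rule nn_integral_noteq_infinite[OF Tm])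
  have EM: "E \<in> sets \<mu>"
  proof -
    have "UNIV - E \<in> sets \<mu>" using E by (rule null_setsD2)
    then have "space \<mu> - (UNIV - E) \<in> sets \<mu>" by (rule sets.compl_sets)
    moreover have "space \<mu> = UNIV" using sets_eq_imp_space_eq[OF \<mu>(2)] by simp
    ultimately show ?thesis by (simp add: double_diff)
  qed
  define Z where "Z m = {x \<in> space \<mu>. T x \<le> of_nat m} \<inter> E" for m
  have Zm: "Z m \<in> sets \<mu>" for m unfolding Z_def using Tm EM by measurable
  have Zball: "emeasure \<mu> {y. infnorm (x - y) \<le> diameter U} \<le> of_nat m * ennreal (2 powr s) * diam_powr s U"
    if x: "x \<in> Z m" and U: "U \<noteq> {}" "bounded U" "diameter U \<le> 1" for x m U
  proof -
    let ?d = "diameter U"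
    have Tk: "emeasure \<mu> (A x k) \<le> of_nat m * ennreal (r k powr s)" for k
    proof -
      have "(\<Sum>k\<in>{k}. ennreal (r k powr (- s)) * emeasure \<mu> (A x k)) \<le> T x"
        unfolding T_def by (rule sum_le_suminf) auto
      then have "ennreal (r k powr (- s)) * emeasure \<mu> (A x k) \<le> of_nat m" using x by (auto simp: Z_def intro: order_trans)
      then have "ennreal (r k powr s) * (ennreal (r k powr (- s)) * emeasure \<mu> (A x k)) \<le> ennreal (r k powr s) * of_nat m"
        by (rule mult_left_mono) simp
      moreover have "ennreal (r k powr s) * (ennreal (r k powr (- s)) * emeasure \<mu> (A x k)) = emeasure \<mu> (A x k)"
        using r[of k] by (simp add: mult.assoc[symmetric] ennreal_mult[symmetric] powr_add[symmetric])
      ultimately show ?thesis by (simp add: mult.commute)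
    qed
    have d0: "?d \<ge> 0" by (rule diameter_ge_0[OF U(2)])
    show ?thesis
    proof (cases "?d = 0")
      case False
      then have d: "?d > 0" using d0 by simp
      obtain k where k: "?d \<le> r k" "r k \<le> 2 * ?d"
      proof -
        have ex: "\<exists>k. r k < ?d" unfolding r_def using real_arch_pow_inv[OF d, of "1/2"] by auto
        define k1 where "k1 = (LEAST k. r k < ?d)"
        have k1: "r k1 < ?d" unfolding k1_def by (rule LeastI_ex[OF ex])
        have "k1 \<noteq> 0" using k1 U(3) by (cases k1) (auto simp: r_def)
        then obtain k where k: "k1 = Suc k" by (cases k1) auto
        have "\<not> r k < ?d" using not_less_Least[of k "\<lambda>k. r k < ?d"] k unfolding k1_def by simp
        then show thesis using that[of k] k1 k by (simp add: r_def)
      qed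
      have "emeasure \<mu> {y. infnorm (x - y) \<le> ?d} \<le> emeasure \<mu> (A x k)"
        by (rule emeasure_mono[OF _ Am]) (use k in \<open>auto simp: A_def\<close>)
      also have "\<dots> \<le> of_nat m * ennreal (r k powr s)" by (rule Tk)
      also have "\<dots> \<le> of_nat m * ennreal (2 powr s * ?d powr s)"
        using k(2) s(1) d r[of k] by (intro mult_left_mono ennreal_leI) (auto simp: powr_mult[symmetric] intro!: powr_mono2)
      also have "\<dots> \<le> of_nat m * (ennreal (2 powr s) * diam_powr s U)"
        using U(1) d by (intro mult_left_mono) (auto simp: diam_powr_def ennreal_mult)
      finally show ?thesis by (simp add: mult.assoc)
    next
      case True
      \<comment> \<open>Sets of diameter 0 need care: for \<open>s = 0\<close> they count as 1 and
        the bound for the unit ball suffices, while for \<open>s > 0\<close> they count as 0 and the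
        ball of radius 0 must be shown to be null by letting \<open>k\<close> grow.\<close>
      show ?thesis
      proof (cases "s = 0")
        case s0: True
        have "emeasure \<mu> {y. infnorm (x - y) \<le> ?d} \<le> emeasure \<mu> (A x 0)"
          by (rule emeasure_mono[OF _ Am]) (use True in \<open>auto simp: A_def r_def\<close>)
        also have "\<dots> \<le> of_nat m * ennreal (r 0 powr s)" by (rule Tk)
        finally show ?thesis using s0 U(1) by (simp add: diam_powr_def r_def)
      next
        case False
        have lim: "(\<lambda>k. real m * r k powr s) \<longlonglongrightarrow> 0"
        proof -
          have "r k powr s = ((1/2) powr s) ^ k" for k by (simp add: r_def powr_realpow[symmetric] powr_powr mult.commute)
          moreover have "(1/2 :: real) powr s < 1" using False s(1) by (simp add: powr01_less_one)
          ultimately show ?thesis using tendsto_mult_right_zero[OF LIMSEQ_realpow_zero] by simp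
        qed
        have "measure \<mu> {y. infnorm (x - y) \<le> ?d} \<le> real m * r k powr s" for k
        proof -
          have "emeasure \<mu> {y. infnorm (x - y) \<le> ?d} \<le> emeasure \<mu> (A x k)"
            by (rule emeasure_mono[OF _ Am]) (use True r[of k] in \<open>auto simp: A_def\<close>)
          also have "\<dots> \<le> ennreal (real m * r k powr s)" using Tk[of k] by (simp add: ennreal_mult ennreal_of_nat_eq_real_of_nat)
          finally show ?thesis by (simp add: \<mu>.emeasure_eq_measure)
        qed
        then have "measure \<mu> {y. infnorm (x - y) \<le> ?d} \<le> 0" using LIMSEQ_le_const[OF lim] by blast
        then show ?thesis by (simp add: \<mu>.emeasure_eq_measure measure_le_0_iff)
      qed
    qed
  qed
  have Z0: "emeasure \<mu> (Z m) = 0" for m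
  proof -
    have bnd: "measure \<mu> (Z m) \<le> real m * 2 powr s * \<eta>" if \<eta>: "\<eta> > 0" for \<eta> :: real
    proof -
      obtain U :: "nat \<Rightarrow> (real ^ 'n) set" where U: "\<forall>i. bounded (U i) \<and> diameter (U i) \<le> 1" "E \<subseteq> (\<Union>i. U i)"
        "(\<Sum>i. diam_powr s (U i)) < ennreal \<eta>"
        using null[unfolded hausdorff_null_iff, rule_format, of 1 "ennreal \<eta>"] \<eta> by auto
      \<comment> \<open>The balls are centred at points of \<open>Z m\<close>, the only places where
        the mass bound is known; covering sets that miss \<open>Z m\<close> are dropped.\<close>
      define V where "V i = (if U i \<inter> Z m = {} then {} else {y. infnorm ((SOME x. x \<in> U i \<inter> Z m) - y) \<le> diameter (U i)})" for i
      have Vm: "V i \<in> sets \<mu>" for i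
      proof -
        have "closed (V i)" unfolding V_def by (auto intro!: closed_Collect_le continuous_intros)
        then show ?thesis using borel_closed \<mu>(2) by simp
      qed
      have Vb: "emeasure \<mu> (V i) \<le> of_nat m * ennreal (2 powr s) * diam_powr s (U i)" for i
      proof (cases "U i \<inter> Z m = {}")
        case False
        then have "(SOME x. x \<in> U i \<inter> Z m) \<in> U i \<inter> Z m" by (simp only: some_in_eq not_False_eq_True)
        then show ?thesis using Zball[of "SOME x. x \<in> U i \<inter> Z m" m "U i"] U(1) False by (auto simp: V_def)
      qed (simp add: V_def)
      have "Z m \<subseteq> (\<Union>i. V i)"
      proof
        fix y assume y: "y \<in> Z m"
        then obtain i where i: "y \<in> U i" using U(2) by (auto simp: Z_def)
        then have ne: "U i \<inter> Z m \<noteq> {}" using y by blast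
        then have x: "(SOME x. x \<in> U i \<inter> Z m) \<in> U i \<inter> Z m" by (simp only: some_in_eq not_False_eq_True)
        let ?x = "SOME x. x \<in> U i \<inter> Z m"
        have "infnorm (?x - y) \<le> dist ?x y" by (simp add: dist_norm infnorm_le_norm)
        also have "\<dots> \<le> diameter (U i)" using x i U(1) by (intro diameter_bounded_bound) auto
        finally have "y \<in> V i" using ne by (simp add: V_def)
        then show "y \<in> (\<Union>i. V i)" by blast
      qed
      then have "emeasure \<mu> (Z m) \<le> emeasure \<mu> (\<Union>i. V i)" using Vm by (intro emeasure_mono) auto
      also have "\<dots> \<le> (\<Sum>i. emeasure \<mu> (V i))" using Vm by (intro emeasure_subadditive_countably) auto
      also have "\<dots> \<le> (\<Sum>i. of_nat m * ennreal (2 powr s) * diam_powr s (U i))" by (intro suminf_le Vb) auto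
      also have "\<dots> = of_nat m * ennreal (2 powr s) * (\<Sum>i. diam_powr s (U i))" by (rule ennreal_suminf_cmult)
      also have "\<dots> \<le> of_nat m * ennreal (2 powr s) * ennreal \<eta>" using U(3) by (intro mult_left_mono) auto
      also have "\<dots> = ennreal (real m * 2 powr s * \<eta>)" using \<eta> by (simp add: ennreal_mult ennreal_of_nat_eq_real_of_nat)
      finally show ?thesis using \<eta> by (simp add: \<mu>.emeasure_eq_measure)
    qed
    have "measure \<mu> (Z m) \<le> 0 + e" if "e > 0" for e :: real
    proof -
      \<comment> \<open>The summand 1 avoids a division by 0 when \<open>m = 0\<close>.\<close>
      have pos: "real m * 2 powr s + 1 > 0" by (simp add: add_nonneg_pos)
      have "measure \<mu> (Z m) \<le> real m * 2 powr s * (e / (real m * 2 powr s + 1))"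
        by (rule bnd[OF divide_pos_pos[OF that pos]])
      also have "\<dots> \<le> (real m * 2 powr s + 1) * (e / (real m * 2 powr s + 1))"
        using that pos by (intro mult_right_mono) auto
      also have "\<dots> = e" using pos by simp
      finally show ?thesis by simp
    qed
    then have "measure \<mu> (Z m) \<le> 0" by (rule field_le_epsilon)
    then show ?thesis by (simp add: \<mu>.emeasure_eq_measure measure_le_0_iff)
  qed
  have "AE x in \<mu>. \<forall>m. x \<notin> Z m" unfolding AE_all_countable
    using Z0 Zm by (intro allI AE_not_in) (auto simp: null_sets_def)
  moreover have "AE x in \<mu>. x \<notin> UNIV - E" by (rule AE_not_in[OF E])
  moreover have "AE x in \<mu>. x \<in> space \<mu>" by (rule AE_space)
  ultimately have "AE x in \<mu>. False" using AET
  proof eventually_elim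
    case (elim x)
    then obtain u where u: "T x = ennreal u" "u \<ge> 0" by (cases "T x") auto
    obtain m :: nat where "u \<le> real m" using real_arch_simple by blast
    then have "T x \<le> of_nat m" using u by (simp add: ennreal_leI ennreal_of_nat_eq_real_of_nat)
    then have "x \<in> Z m" using elim by (auto simp: Z_def)
    then show ?case using elim by blast
  qed
  then show False using \<mu>.prob_space \<mu>.AE_False by simp
qed

section \<open>The dimension of the approximation set\<close>

lemma filterlim_infnorm_at_top: "filterlim (infnorm :: real ^ 'n \<Rightarrow> real) at_top at_infinity"
proof (rule filterlim_at_top_mono)
  let ?c = "inverse (sqrt DIM(real ^ 'n))"
  have "0 < sqrt DIM(real ^ 'n)" by (simp only: real_sqrt_gt_0_iff of_nat_0_less_iff DIM_positive)
  then have c: "0 < ?c" by simp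
  show "filterlim (\<lambda>x :: real ^ 'n. ?c * norm x) at_top at_infinity"
    by (rule filterlim_tendsto_pos_mult_at_top[OF tendsto_const c filterlim_norm_at_top])
  show "\<forall>\<^sub>F x in at_infinity. ?c * norm x \<le> infnorm (x :: real ^ 'n)"
  proof (rule always_eventually, rule allI)
    fix x :: "real ^ 'n"
    have "?c * norm x \<le> ?c * (sqrt DIM(real ^ 'n) * infnorm x)"
      using c by (intro mult_left_mono norm_le_infnorm) simp
    also have "\<dots> = infnorm x" using c by simp
    finally show "?c * norm x \<le> infnorm x" .
  qed
qed

text \<open>A limit superior of countably many closed sets, written as an intersection of unions
  along an enumeration of the pairs. Measurability of the complement is part of membership in
  \<open>null_sets\<close>.\<close>

lemma nf_approx_set_borel: "nf_approx_set \<omega> \<tau> \<in> sets borel"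
proof -
  define B where "B p = {x. fst p \<noteq> 0 \<and>
    infnorm (x - quot_vec \<omega> (snd p) (fst p)) \<le> infnorm (rat_to_real_vec (int_to_rat_vec (fst p))) powr (- (\<tau> + 1))}"
    for p :: "(int ^ 'a) \<times> (int ^ 'a)"
  have B: "B p \<in> sets borel" for p
  proof (cases "fst p = 0")
    case False
    have "closed (B p)" unfolding B_def using False by (simp, intro closed_Collect_le continuous_intros)
    then show ?thesis by (rule borel_closed)
  qed (simp add: B_def)
  have "x \<in> nf_approx_set \<omega> \<tau> \<longleftrightarrow> (\<forall>N. \<exists>p. N \<le> to_nat p \<and> x \<in> B p)" for x
  proof -
    have "x \<in> nf_approx_set \<omega> \<tau> \<longleftrightarrow> infinite {p. x \<in> B p}"
      by (simp add: nf_approx_set_def B_def case_prod_unfold)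
    also have "\<dots> \<longleftrightarrow> infinite (to_nat ` {p. x \<in> B p})"
      by (simp add: finite_image_iff inj_on_subset[OF inj_to_nat])
    also have "\<dots> \<longleftrightarrow> (\<forall>N. \<exists>p. N \<le> to_nat p \<and> x \<in> B p)"
      by (simp only: infinite_nat_iff_unbounded_le image_iff mem_Collect_eq Bex_def) blast
    finally show ?thesis .
  qed
  then have "nf_approx_set \<omega> \<tau> = (\<Inter>N. \<Union>p\<in>{p. N \<le> to_nat p}. B p)"
    by (simp add: set_eq_iff Bex_def del: split_paired_Ex split_paired_All)
  moreover have "(\<Union>p\<in>{p. N \<le> to_nat p}. B p) \<in> sets borel" for N
    using B by (intro sets.countable_UN') (auto intro: countableI_type countable_subset[OF subset_UNIV])
  ultimately show ?thesis by (simp add: sets.countable_INT'')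
qed

context integral_basis_field
begin

lemma mem_nf_approx_set:
  assumes "\<And>b. \<exists>q r. b < infnorm (ivec q) \<and> q \<noteq> 0 \<and>
    infnorm (x - quot_vec \<omega> r q) \<le> infnorm (ivec q) powr (- (\<tau> + 1))"
  shows "x \<in> nf_approx_set \<omega> \<tau>"
proof -
  let ?A = "{p. fst p \<noteq> 0 \<and> infnorm (x - quot_vec \<omega> (snd p) (fst p)) \<le> infnorm (ivec (fst p)) powr (- (\<tau> + 1))}"
  have "infinite ?A"
  proof
    assume fin: "finite ?A"
    define b where "b = Max (insert 0 ((\<lambda>p. infnorm (ivec (fst p))) ` ?A))"
    obtain q r where qr: "b < infnorm (ivec q)" "q \<noteq> 0"
      "infnorm (x - quot_vec \<omega> r q) \<le> infnorm (ivec q) powr (- (\<tau> + 1))" using assms by blast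
    have "(q, r) \<in> ?A" using qr by simp
    then have "infnorm (ivec (fst (q, r))) \<le> b" unfolding b_def using fin by (intro Max_ge finite.insertI finite_imageI insertI2 imageI)
    then show False using qr by simp
  qed
  then show ?thesis by (simp add: nf_approx_set_def case_prod_unfold rat_to_real_int_to_rat)
qed

lemma salem_measure:
  fixes s \<tau> :: real
  assumes \<tau>: "\<tau> > 0" and s: "0 \<le> s" "s < 2 * real CARD('n) / (1 + \<tau>)"
  obtains \<nu> :: "(real ^ 'n) measure" where "prob_space \<nu>" "sets \<nu> = sets borel"
    "UNIV - nf_approx_set \<omega> \<tau> \<in> null_sets \<nu>"
    "((\<lambda>\<xi>. (cmod (fourier_transform \<nu> \<xi>))\<^sup>2 * infnorm \<xi> powr s) \<longlongrightarrow> 0) at_infinity"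
proof -
  \<comment> \<open>The midpoint between \<open>s / 2\<close> and \<open>n / (1 + \<tau>)\<close>:
    the squared transform decays with order \<open>2 * a > s\<close>, so the weighted product tends
    to 0 and is not merely bounded.\<close>
  define a where "a = (s / 2 + CARD('n) / (1 + \<tau>)) / 2"
  have a: "0 \<le> a" "a < CARD('n) / (1 + \<tau>)" "s - 2 * a < 0" using s \<tau> by (auto simp: a_def)
  obtain F \<theta> \<eta> S f where
    F: "\<And>M x. 0 \<le> F M x"
      "\<And>M x. M \<ge> 1 \<Longrightarrow> complex_of_real (F M x) = 1 + (\<Sum>m\<in>S M. of_real (f M m) * eexp (ivec m \<bullet> x))"
      "\<And>M. finite (S M)"
      "\<And>M m. M \<ge> 1 \<Longrightarrow> m \<in> S M \<Longrightarrow> \<bar>f M m\<bar> * (1 + infnorm (ivec m)) powr a \<le> \<eta> M"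
      "\<eta> \<longlonglongrightarrow> 0" "\<theta> \<longlonglongrightarrow> 0" "\<And>M. M \<ge> 1 \<Longrightarrow> \<theta> M > 0"
    and approx: "\<And>M x. M \<ge> 1 \<Longrightarrow> F M x > \<theta> M \<Longrightarrow> \<exists>q r. real M / 2 \<le> infnorm (ivec q) \<and>
        infnorm (x - quot_vec \<omega> r q) \<le> infnorm (ivec q) powr (- (\<tau> + 1))"
    by (rule approximating_trigpolys[OF \<tau> a(1,2)]) blast
  obtain \<nu> C Ms where Ms: "strict_mono Ms" "Ms 0 \<ge> 1"
    and \<nu>: "prob_space \<nu>" "sets \<nu> = sets borel"
    and C: "\<And>\<xi>. cmod (fourier_transform \<nu> \<xi>) * (1 + infnorm \<xi>) powr a \<le> C"
    and AE: "AE x in \<nu>. \<forall>\<^sub>F j in sequentially. \<theta> (Ms j) < F (Ms j) x"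
    by (rule measure_construction[OF a(1) F]) blast+
  have in_E: "x \<in> nf_approx_set \<omega> \<tau>" if x: "\<forall>\<^sub>F j in sequentially. \<theta> (Ms j) < F (Ms j) x" for x
  proof (rule mem_nf_approx_set)
    fix b :: real
    obtain J where J: "\<And>j. j \<ge> J \<Longrightarrow> \<theta> (Ms j) < F (Ms j) x" using x by (auto simp: eventually_sequentially)
    obtain k :: nat where k: "2 * \<bar>b\<bar> < real k" using reals_Archimedean2 by blast
    define j where "j = max J k"
    have j: "k \<le> Ms j" "Ms j \<ge> 1"
      using strict_mono_imp_increasing[OF Ms(1), of j] strict_mono_leD[OF Ms(1), of 0 j] Ms(2) by (auto simp: j_def)
    obtain q r where qr: "real (Ms j) / 2 \<le> infnorm (ivec q)"
      "infnorm (x - quot_vec \<omega> r q) \<le> infnorm (ivec q) powr (- (\<tau> + 1))"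
      using approx[OF j(2) J[of j]] by (auto simp: j_def)
    have "real k \<le> real (Ms j)" using j(1) by simp
    then have b: "\<bar>b\<bar> < infnorm (ivec q)" using qr(1) k by linarith
    have "ivec q \<noteq> 0" using b by (auto simp: infnorm_0)
    then have "q \<noteq> 0" by (auto simp: vec_eq_iff ivec_nth)
    then show "\<exists>q r. b < infnorm (ivec q) \<and> q \<noteq> 0 \<and>
        infnorm (x - quot_vec \<omega> r q) \<le> infnorm (ivec q) powr (- (\<tau> + 1))" using b qr(2) by force
  qed
  have "AE x in \<nu>. x \<in> nf_approx_set \<omega> \<tau>" using AE by (rule AE_mp) (use in_E in auto)
  then have "UNIV - nf_approx_set \<omega> \<tau> \<in> null_sets \<nu>"
    using nf_approx_set_borel[of \<omega> \<tau>] sets_eq_imp_space_eq[OF \<nu>(2)] \<nu>(2)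
    by (subst AE_iff_null_sets) auto
  moreover have "((\<lambda>\<xi>. (cmod (fourier_transform \<nu> \<xi>))\<^sup>2 * infnorm \<xi> powr s) \<longlongrightarrow> 0) at_infinity"
  proof (rule Lim_null_comparison)
    have "filterlim (\<lambda>\<xi> :: real ^ 'n. 1 + infnorm \<xi>) at_top at_infinity"
      by (rule filterlim_tendsto_add_at_top[OF tendsto_const filterlim_infnorm_at_top])
    then have "((\<lambda>\<xi> :: real ^ 'n. C\<^sup>2 * (1 + infnorm \<xi>) powr (s - 2 * a)) \<longlongrightarrow> C\<^sup>2 * 0) at_infinity"
      by (intro tendsto_mult tendsto_const tendsto_neg_powr a(3))
    then show "((\<lambda>\<xi> :: real ^ 'n. C\<^sup>2 * (1 + infnorm \<xi>) powr (s - 2 * a)) \<longlongrightarrow> 0) at_infinity" by simp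
    have "(cmod (fourier_transform \<nu> \<xi>))\<^sup>2 * infnorm \<xi> powr s \<le> C\<^sup>2 * (1 + infnorm \<xi>) powr (s - 2 * a)" for \<xi>
    proof -
      let ?w = "1 + infnorm \<xi>"
      have w: "?w > 0" using infnorm_pos_le[of \<xi>] by simp
      have "(cmod (fourier_transform \<nu> \<xi>) * ?w powr a)\<^sup>2 \<le> C\<^sup>2" by (intro power_mono C) simp
      then have "(cmod (fourier_transform \<nu> \<xi>) * ?w powr a)\<^sup>2 * ?w powr (s - 2 * a) \<le> C\<^sup>2 * ?w powr (s - 2 * a)"
        by (rule mult_right_mono) simp
      moreover have "(cmod (fourier_transform \<nu> \<xi>) * ?w powr a)\<^sup>2 * ?w powr (s - 2 * a) = (cmod (fourier_transform \<nu> \<xi>))\<^sup>2 * ?w powr s"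
        using w by (simp add: power2_eq_square powr_add[symmetric] mult.assoc)
      moreover have "(cmod (fourier_transform \<nu> \<xi>))\<^sup>2 * infnorm \<xi> powr s \<le> (cmod (fourier_transform \<nu> \<xi>))\<^sup>2 * ?w powr s"
        using s(1) infnorm_pos_le[of \<xi>] by (intro mult_left_mono powr_mono2) auto
      ultimately show ?thesis by linarith
    qed
    then show "\<forall>\<^sub>F \<xi> in at_infinity. norm ((cmod (fourier_transform \<nu> \<xi>))\<^sup>2 * infnorm \<xi> powr s) \<le> C\<^sup>2 * (1 + infnorm \<xi>) powr (s - 2 * a)"
      by (intro always_eventually allI) simp
  qed
  ultimately show thesis using that \<nu> by blast
qed

end

lemma fourier_dim_le_hausdorff_dim: "fourier_dim E \<le> hausdorff_dim E"
  unfolding fourier_dim_def hausdorff_dim_def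
proof (intro SUP_least INF_greatest)
  fix s t assume s: "s \<in> {s. 0 \<le> s \<and> s \<le> real CARD('a) \<and> (\<exists>\<mu>. prob_space \<mu> \<and> sets \<mu> = sets borel \<and> UNIV - E \<in> null_sets \<mu> \<and>
      ((\<lambda>\<xi>. (cmod (fourier_transform \<mu> \<xi>))\<^sup>2 * infnorm \<xi> powr s) \<longlongrightarrow> 0) at_infinity)}"
    and t: "t \<in> {t. 0 \<le> t \<and> hausdorff_outer_measure t E = 0}"
  show "ennreal s \<le> ennreal t"
  proof (rule ccontr)
    assume "\<not> ennreal s \<le> ennreal t"
    then have "t < s" using t by (metis ennreal_leI not_le)
    then show False using s t fourier_decay_hausdorff[of _ E t s] by auto
  qed
qed

theorem theorem1p1:
  fixes K :: "'k::field_char_0 set" and \<omega> :: "'n::finite \<Rightarrow> 'k" and \<tau> :: real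
  assumes "number_field K" and "degree_over_rat K = CARD('n)"
    and "integral_basis K \<omega>" and "\<tau> > 1"
  shows "salem_set (nf_approx_set \<omega> \<tau>) \<and>
    fourier_dim (nf_approx_set \<omega> \<tau>) = ennreal (2 * real CARD('n) / (1 + \<tau>)) \<and>
    hausdorff_dim (nf_approx_set \<omega> \<tau>) = ennreal (2 * real CARD('n) / (1 + \<tau>))"
proof -
  interpret integral_basis_field K \<omega> using assms(1,3) by unfold_locales
  let ?E = "nf_approx_set \<omega> \<tau>" and ?d = "2 * real CARD('n) / (1 + \<tau>)"
  have \<tau>: "\<tau> > 0" using assms(4) by simp
  have d: "0 < ?d" using \<tau> by simp
  have upper: "hausdorff_dim ?E \<le> ennreal ?d"
  proof (rule ennreal_le_epsilon)
    fix e :: real assume e: "e > 0"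
    have "hausdorff_outer_measure (?d + e) ?E = 0" by (rule nf_approx_set_null[OF \<tau>]) (use e in simp)
    then have "hausdorff_dim ?E \<le> ennreal (?d + e)" unfolding hausdorff_dim_def using d e by (intro INF_lower) simp
    then show "hausdorff_dim ?E \<le> ennreal ?d + ennreal e" using d e by simp
  qed
  have lower: "ennreal ?d \<le> fourier_dim ?E"
  proof (rule ccontr)
    assume "\<not> ennreal ?d \<le> fourier_dim ?E"
    then have lt: "fourier_dim ?E < ennreal ?d" by simp
    then obtain u where u: "fourier_dim ?E = ennreal u" "0 \<le> u" by (cases "fourier_dim ?E") auto
    define s where "s = (u + ?d) / 2"
    have "u < ?d" using lt u by (simp add: ennreal_less_iff)
    then have s: "u < s" "s < ?d" by (simp_all add: s_def)
    \<comment> \<open>The size of \<open>\<tau>\<close> enters here: \<open>fourier_dim\<close>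
      admits only exponents up to \<open>n\<close>.\<close>
    have "?d \<le> CARD('n)" using assms(4) by (simp add: divide_le_eq)
    moreover obtain \<nu> :: "(real ^ 'n) measure" where "prob_space \<nu>" "sets \<nu> = sets borel"
      "UNIV - nf_approx_set \<omega> \<tau> \<in> null_sets \<nu>"
      "((\<lambda>\<xi>. (cmod (fourier_transform \<nu> \<xi>))\<^sup>2 * infnorm \<xi> powr s) \<longlongrightarrow> 0) at_infinity"
      by (rule salem_measure[OF \<tau> _ s(2)]) (use u(2) s(1) in auto)
    ultimately have "ennreal s \<le> fourier_dim ?E"
      unfolding fourier_dim_def using u(2) s by (intro SUP_upper) auto
    then show False using u s by (simp add: ennreal_le_iff2)
  qed
  have "fourier_dim ?E = ennreal ?d" "hausdorff_dim ?E = ennreal ?d"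
    using upper lower fourier_dim_le_hausdorff_dim[of ?E] by auto
  then show ?thesis by (simp add: salem_set_def)
qed

end
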